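(* Let $G$ be a locally finite graph and let $H\subseteq G$ be a set of vertices. Let $(\xi_0,S,h)$ and $(\xi_0',S',h')$ be two regular systems on $G$ with $S\overset{d}{=}S'$ and $h\overset{d}{=}h'$. Assume that, for each of the two systems, almost surely either $H$ is finite or the total number of initial $A$-particles is finite, i.e. $\min\{|H|,\sum_{x\in G}\xi_0^+(x)\}<\infty$ a.s. and $\min\{|H|,\sum_{x\in G}(\xi_0')^+(x)\}<\infty$ a.s. Let $V_T$ and $V_T'$ be the occupation times of $H$ by $A$-particles up to time $T$ for the two systems, respectively. If $\xi_0(x)\preceq_{icx}\xi_0'(x)$ for all $x\in G$, then $V_T\preceq_{icx}V_T'$ for all $T\ge 0$.
   Context: Increasing convex order: for real-valued random variables $X,Y$, $X\preceq_{icx}Y$ means $\mathbf E\varphi(X)\le\mathbf E\varphi(Y)$ for all increasing (i.e. nondecreasing) convex $\varphi:\mathbb R\to\mathbb R$ for which the expectations exist. Diffusion-limited annihilating system (DLAS): $x\in G$ and $H\subseteq G$ refer to the vertex set of $G$. The initial conditions are $\xi_0=(\xi_0(x))_{x\in G}$, integer-valued: if $\xi_0(x)>0$ there are $\xi_0(x)$ many $A$-particles at $x$, and if $\xi_0(x)<0$ there are $|\xi_0(x)|$ many $B$-particles at $x$. The instructions are $(S,h)$, where for $x\in G$, $j\in\mathbb Z\setminus\{0\}$, $S^{x,j}=(S^{x,j}_t)_{t\ge0}$ is a right-continuous path in $G$ with left limits started at $x$, and $h^{x,j}\in[0,1]$ are distinct numbers (bravenesses). For $j\geq 1$ the $j$th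 $A$-particle initially at $x$ has path $S^{x,j}$ and braveness $h^{x,j}$; the $j$th $B$-particle initially at $x$ has path $S^{x,-j}$ and braveness $h^{x,-j}$. Particles follow their paths until annihilated. When one or more $A$-particles arrive at a site containing $B$-particles, the bravest (largest braveness) $A$-particles mutually annihilate one-for-one with (the bravest) $B$-particles until there are no remaining pairs of opposite type at the site. $\xi_t(x)$ denotes the number of $A$-particles at $x$ at time $t$ if positive, and minus the number of $B$-particles at $x$ at time $t$ if negative. $(\xi_0,S,h)$ is regular if: (1) the $\xi_0(x)$ are independent over $x$; the $S^{x,j}$ and the $h^{x,j}$ are each independent over $x\in G$ and $j\in\mathbb Z\setminus\{0\}$; and the three collections $\xi_0$, $S$, $h$ are independent of each other; (2) for $j>0$ the $S^{x,j}$ are random walk paths (Markov chain trajectories on $G$) started at $x$ all with the same transition kernel, either all in continuous time (jumping at the times of a unit intensity Poisson process) or all in discrete time (jumping at positive integer times); (3) for $j<0$, $S^{x,j}_t\equiv x$ ($B$-particles are stationary); (4) each $h^{x,j}$ is uniform on $[0,1]$; (5) the system is well defined and locally approximated by finite systems: for any finite subgraphs $G_1\subseteq G_2\subseteq\cdots$ with union $G$, any finite vertex set $K$ and any $T\geq 0$, if $\xi^{(n)}$ is the DLAS with instructions $(S,h)$ and initial conditions $\xi_0(x)\mathbf 1\{x\in G_n\}$, then the sequence $(\xi^{(n)}_t(x))_{0\le t\le T,x\in K}$ is almost surely eventually constant in $n$, with limit (namely $(\xi_t(x))_{0\le t\le T,x\in K}$) not depending on the choice of $(G_n)$. Occupation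 time: $V_T=V_T(H,\xi_0,S,h)=\sum_{x\in H}\int_0^T\mathbf 1\{\xi_t(x)>0\}\,\xi_t(x)\,dt$; $V_T'$ is the same quantity for $(\xi_0',S',h')$. Here $a^+=\max(a,0)$. *)

theory Defs
  imports "HOL-Probability.Probability" "Graph_Theory.Digraph_Component"
begin

section \<open>Increasing convex order\<close>

text \<open>
  Expectations are taken in the extended sense, with values in \<open>[-\<infinity>, \<infinity>]\<close>: the expectation of
  \<open>f\<close> exists unless both its positive and its negative part have infinite integral.
  The Bochner integral would not do here, as it is \<open>0\<close> on non-integrable functions.
\<close>

definition expectation_exists :: "'w measure \<Rightarrow> ('w \<Rightarrow> real) \<Rightarrow> bool" where
  "expectation_exists M f \<longleftrightarrow>
     (\<integral>\<^sup>+ \<omega>. ennreal (f \<omega>) \<partial>M) < \<infinity> \<or> (\<integral>\<^sup>+ \<omega>. ennreal (- f \<omega>) \<partial>M) < \<infinity>"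

definition ext_expectation :: "'w measure \<Rightarrow> ('w \<Rightarrow> real) \<Rightarrow> ereal" where
  "ext_expectation M f =
     enn2ereal (\<integral>\<^sup>+ \<omega>. ennreal (f \<omega>) \<partial>M) - enn2ereal (\<integral>\<^sup>+ \<omega>. ennreal (- f \<omega>) \<partial>M)"

definition icx_le :: "'w measure \<Rightarrow> ('w \<Rightarrow> real) \<Rightarrow> 'u measure \<Rightarrow> ('u \<Rightarrow> real) \<Rightarrow> bool" where
  "icx_le M X N Y \<longleftrightarrow>
     (\<forall>\<phi>::real \<Rightarrow> real. mono \<phi> \<longrightarrow> convex_on UNIV \<phi> \<longrightarrow>
        expectation_exists M (\<lambda>\<omega>. \<phi> (X \<omega>)) \<longrightarrow> expectation_exists N (\<lambda>\<omega>. \<phi> (Y \<omega>)) \<longrightarrow>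
        ext_expectation M (\<lambda>\<omega>. \<phi> (X \<omega>)) \<le> ext_expectation N (\<lambda>\<omega>. \<phi> (Y \<omega>)))"

section \<open>Locally finite graphs\<close>

text \<open>
  An undirected graph is a symmetric digraph. Countability is necessary for the existence of
  an exhaustion by finite subgraphs, and is automatic for connected locally finite graphs.
\<close>

locale locally_finite_graph = sym_digraph G for G :: "('v, 'e) pre_digraph" +
  assumes locally_finite: "v \<in> verts G \<Longrightarrow> finite (out_arcs G v)"
    and countable_verts: "countable (verts G)"

definition finite_exhaustion ::
  "('v, 'e) pre_digraph \<Rightarrow> (nat \<Rightarrow> ('v, 'e) pre_digraph) \<Rightarrow> bool" where
  "finite_exhaustion G Gs \<longleftrightarrow>
     (\<forall>n. fin_digraph (Gs n) \<and> sym_digraph (Gs n) \<and> subgraph (Gs n) G \<and>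
          subgraph (Gs n) (Gs (Suc n))) \<and>
     (\<Union>n. verts (Gs n)) = verts G \<and> (\<Union>n. arcs (Gs n)) = arcs G"

section \<open>Diffusion-limited annihilating systems\<close>

text \<open>
  The label \<open>(x, j)\<close> stands for the \<open>j\<close>th A-particle initially at \<open>x\<close> if \<open>j > 0\<close>, and for the
  \<open>\<bar>j\<bar>\<close>th B-particle initially at \<open>x\<close> if \<open>j < 0\<close>.
\<close>

type_synonym 'v particle = "'v \<times> int"

abbreviation type_A :: "'v particle \<Rightarrow> bool" where "type_A p \<equiv> 0 < snd p"
abbreviation type_B :: "'v particle \<Rightarrow> bool" where "type_B p \<equiv> snd p < 0"

definition labels :: "'v set \<Rightarrow> 'v particle set" where
  "labels V = V \<times> (UNIV - {0})"

definition initial_particles :: "'v set \<Rightarrow> ('v \<Rightarrow> int) \<Rightarrow> 'v particle set" where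
  "initial_particles V \<zeta> =
     {(x, j). x \<in> V \<and> (1 \<le> j \<and> j \<le> \<zeta> x \<or> \<zeta> x \<le> j \<and> j \<le> - 1)}"

definition cadlag_path :: "'v set \<Rightarrow> (real \<Rightarrow> 'v) \<Rightarrow> bool" where
  \<comment> \<open>right-continuous with left limits, for the discrete topology on \<open>V\<close>\<close>
  "cadlag_path V s \<longleftrightarrow>
     (\<forall>t\<ge>0. s t \<in> V) \<and>
     (\<forall>t\<ge>0. \<forall>\<^sub>F r in at_right t. s r = s t) \<and>
     (\<forall>t>0. \<exists>y\<in>V. \<forall>\<^sub>F r in at_left t. s r = y)"

definition instructions ::
  "'v set \<Rightarrow> ('v particle \<Rightarrow> real \<Rightarrow> 'v) \<Rightarrow> ('v particle \<Rightarrow> real) \<Rightarrow> bool" where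
  "instructions V s h \<longleftrightarrow>
     (\<forall>p\<in>labels V. cadlag_path V (s p) \<and> s p 0 = fst p \<and> h p \<in> {0..1}) \<and> inj_on h (labels V)"

text \<open>
  If \<open>P\<close> is the set of particles present at time \<open>t\<close> just before annihilation, and a site
  contains \<open>a\<close> A-particles and \<open>b\<close> B-particles of \<open>P\<close>, then the \<open>min a b\<close> bravest ones of each
  type are removed. A particle is among them iff the number of braver particles
  of its own type at its site is smaller than the number of particles of the opposite type there.
\<close>

definition annihilated ::
  "('v particle \<Rightarrow> real \<Rightarrow> 'v) \<Rightarrow> ('v particle \<Rightarrow> real) \<Rightarrow> 'v particle set \<Rightarrow> real
     \<Rightarrow> 'v particle set" where
  "annihilated s h P t =
     {p \<in> P.
        card {q \<in> P. s q t = s p t \<and> (type_A q \<longleftrightarrow> type_A p) \<and> h p < h q}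
        < card {q \<in> P. s q t = s p t \<and> (type_A q \<longleftrightarrow> type_B p)}}"

text \<open>
  \<open>\<tau> p\<close> is the time at which \<open>p\<close> is annihilated (\<open>\<infinity>\<close> if it never is); the particles
  \<open>q\<close> with \<open>t \<le> \<tau> q\<close> are the ones that have survived all annihilations before time \<open>t\<close>.
  For finitely many particles this specification determines \<open>\<tau>\<close> on \<open>P\<close>,
  see \<open>annihilation_times_exists\<close> and \<open>annihilation_times_unique\<close> below.
\<close>

definition annihilation_times ::
  "('v particle \<Rightarrow> real \<Rightarrow> 'v) \<Rightarrow> ('v particle \<Rightarrow> real) \<Rightarrow> 'v particle set
     \<Rightarrow> ('v particle \<Rightarrow> ereal) \<Rightarrow> bool" where
  "annihilation_times s h P \<tau> \<longleftrightarrow>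
     (\<forall>p\<in>P. 0 \<le> \<tau> p \<and>
        (\<forall>t\<ge>0. \<tau> p = ereal t \<longleftrightarrow> p \<in> annihilated s h {q \<in> P. ereal t \<le> \<tau> q} t))"

text \<open>
  The process \<open>\<xi>\<close> of a system with finitely many particles. At most one of the two
  cardinalities is nonzero, as no site contains particles of both types after annihilation.
\<close>

definition finite_dlas ::
  "'v set \<Rightarrow> ('v \<Rightarrow> int) \<Rightarrow> ('v particle \<Rightarrow> real \<Rightarrow> 'v) \<Rightarrow> ('v particle \<Rightarrow> real)
     \<Rightarrow> real \<Rightarrow> 'v \<Rightarrow> int" where
  "finite_dlas V \<zeta> s h t x =
     (let P = initial_particles V \<zeta>;
          \<tau> = (SOME \<tau>. annihilation_times s h P \<tau>)
      in int (card {p \<in> P. type_A p \<and> ereal t < \<tau> p \<and> s p t = x})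
       - int (card {p \<in> P. type_B p \<and> ereal t < \<tau> p \<and> s p t = x}))"

lemma annihilated_subset: "annihilated s h P t \<subseteq> P"
  by (auto simp: annihilated_def)

lemma annihilated_imp_pair:
  assumes "p \<in> annihilated s h P t"
  shows "\<exists>q\<in>P. s q t = s p t \<and> (type_A q \<longleftrightarrow> type_B p)"
proof -
  from assms have "card {q \<in> P. s q t = s p t \<and> (type_A q \<longleftrightarrow> type_B p)} \<noteq> 0"
    by (auto simp: annihilated_def)
  then have "{q \<in> P. s q t = s p t \<and> (type_A q \<longleftrightarrow> type_B p)} \<noteq> {}"
    by (metis card.empty)
  then show ?thesis by blast
qed

lemma no_pair_after_annihilation:
  assumes fin: "finite P" and typd: "\<forall>p\<in>P. snd p \<noteq> 0"
    and p: "p \<in> P - annihilated s h P t" and q: "q \<in> P - annihilated s h P t"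
    and site: "s q t = s p t"
  shows "\<not> (type_A q \<longleftrightarrow> type_B p)"
proof
  assume opp: "type_A q \<longleftrightarrow> type_B p"
  let ?S = "{r \<in> P. s r t = s p t \<and> (type_A r \<longleftrightarrow> type_A p)}"
  let ?O = "{r \<in> P. s r t = s p t \<and> (type_A r \<longleftrightarrow> type_B p)}"
  have tp: "snd p \<noteq> 0" "snd q \<noteq> 0" using p q typd by auto
  have 1: "card ?O \<le> card {r \<in> P. s r t = s p t \<and> (type_A r \<longleftrightarrow> type_A p) \<and> h p < h r}"
    using p by (auto simp: annihilated_def)
  have "card {r \<in> P. s r t = s p t \<and> (type_A r \<longleftrightarrow> type_A p) \<and> h p < h r} < card ?S"
    by (rule psubset_card_mono) (use fin p in auto)
  with 1 have less1: "card ?O < card ?S" by simp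
  have sets: "{r \<in> P. s r t = s q t \<and> (type_A r \<longleftrightarrow> type_B q)} = ?S"
    "{r \<in> P. s r t = s q t \<and> (type_A r \<longleftrightarrow> type_A q)} = ?O"
    using opp tp site by auto
  have 2: "card ?S \<le> card {r \<in> P. s r t = s q t \<and> (type_A r \<longleftrightarrow> type_A q) \<and> h q < h r}"
    using q sets(1) by (auto simp: annihilated_def)
  have "card {r \<in> P. s r t = s q t \<and> (type_A r \<longleftrightarrow> type_A q) \<and> h q < h r}
      < card {r \<in> P. s r t = s q t \<and> (type_A r \<longleftrightarrow> type_A q)}"
    by (rule psubset_card_mono) (use fin q in auto)
  with 2 sets(2) have "card ?S < card ?O" by simp
  with less1 show False by simp
qed

lemma annihilation_times_exists:
  assumes "finite P" and "\<forall>p\<in>P. snd p \<noteq> 0"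
    and "\<forall>p\<in>P. \<forall>t\<ge>0. \<forall>\<^sub>F r in at_right t. s p r = s p t"
  shows "\<exists>\<tau>. annihilation_times s h P \<tau>"
  using assms
proof (induction "card P" arbitrary: P rule: less_induct)
  case less
  note fin = less.prems(1) and typd = less.prems(2) and rc = less.prems(3)
  define C where "C = {t. 0 \<le> t \<and> annihilated s h P t \<noteq> {}}"
  show ?case
  proof (cases "C = {}")
    case True
    then have "\<forall>t\<ge>0. annihilated s h P t = {}" by (auto simp: C_def)
    then have "annihilation_times s h P (\<lambda>_. \<infinity>)"
      by (auto simp: annihilation_times_def)
    then show ?thesis by blast
  next
    case False
    define t0 where "t0 = Inf C"
    have bdd: "bdd_below C" by (auto simp: C_def intro!: bdd_belowI[of _ 0])
    have t0_nonneg: "0 \<le> t0" unfolding t0_def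
      by (rule cInf_greatest) (use False in \<open>auto simp: C_def\<close>)
    have before: "annihilated s h P t = {}" if "0 \<le> t" "t < t0" for t
      using cInf_lower[OF _ bdd, of t] that by (auto simp: t0_def C_def)
    have at0: "annihilated s h P t0 \<noteq> {}"
    proof
      assume empty: "annihilated s h P t0 = {}"
      have "\<forall>\<^sub>F r in at_right t0. \<forall>p\<in>P. s p r = s p t0"
        using fin rc t0_nonneg by (auto simp: eventually_ball_finite_distrib)
      then obtain b where b: "b > t0" "\<And>r p. t0 < r \<Longrightarrow> r < b \<Longrightarrow> p \<in> P \<Longrightarrow> s p r = s p t0"
        by (auto simp: eventually_at_right_field)
      obtain c where c: "c \<in> C" "c < b"
        using cInf_lessD[OF False, of b] b(1) by (auto simp: t0_def)
      have "t0 \<le> c" using cInf_lower[OF c(1) bdd] by (simp add: t0_def)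
      moreover have "c \<noteq> t0" using c(1) empty by (auto simp: C_def)
      ultimately have eq: "s p c = s p t0" if "p \<in> P" for p using b(2)[of c p] c(2) that by simp
      have "annihilated s h P c = annihilated s h P t0"
        unfolding annihilated_def by (intro Collect_cong conj_cong refl) (simp add: eq cong: conj_cong)
      with empty c(1) show False by (simp add: C_def)
    qed
    define D where "D = annihilated s h P t0"
    define Q where "Q = P - D"
    have DP: "D \<subseteq> P" by (auto simp: D_def annihilated_def)
    have "Q \<subset> P" using at0 DP by (auto simp: Q_def D_def)
    then have "card Q < card P" using fin by (rule psubset_card_mono[rotated])
    from less.hyps[OF this] obtain \<tau>' where \<tau>': "annihilation_times s h Q \<tau>'"
      using fin typd rc by (auto simp: Q_def)
    have no_pair: "annihilated s h R t = {}" if R: "R \<subseteq> Q" and t: "0 \<le> t" "t \<le> t0" for R t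
    proof (rule ccontr)
      assume "annihilated s h R t \<noteq> {}"
      then obtain p where p: "p \<in> annihilated s h R t" by auto
      obtain q where q: "q \<in> R" "s q t = s p t" "type_A q \<longleftrightarrow> type_B p"
        using annihilated_imp_pair[OF p] by auto
      have pR: "p \<in> R" using p by (auto simp: annihilated_def)
      have "R \<inter> annihilated s h P t = {}"
        using R t before[of t] by (cases "t = t0") (auto simp: Q_def D_def)
      then have "p \<in> P - annihilated s h P t" "q \<in> P - annihilated s h P t"
        using pR q(1) R by (auto simp: Q_def)
      from no_pair_after_annihilation[OF fin typd this q(2)] q(3) show False by simp
    qed
    have late: "ereal t0 < \<tau>' q" if "q \<in> Q" for q
    proof (rule ccontr)
      assume neg: "\<not> ereal t0 < \<tau>' q"
      moreover have "0 \<le> \<tau>' q" using \<tau>' that by (auto simp: annihilation_times_def)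
      ultimately obtain t where t: "\<tau>' q = ereal t" "0 \<le> t" "t \<le> t0"
        by (cases "\<tau>' q") auto
      then have "q \<in> annihilated s h {r \<in> Q. ereal t \<le> \<tau>' r} t"
        using \<tau>' that by (auto simp: annihilation_times_def)
      then show False using no_pair[of "{r \<in> Q. ereal t \<le> \<tau>' r}" t] t by auto
    qed
    define \<tau> where "\<tau> = (\<lambda>p. if p \<in> D then ereal t0 else \<tau>' p)"
    have ge: "ereal t0 \<le> \<tau> p" if "p \<in> P" for p
      using late[of p] that by (auto simp: \<tau>_def Q_def)
    have "\<tau> p = ereal t \<longleftrightarrow> p \<in> annihilated s h {q \<in> P. ereal t \<le> \<tau> q} t"
      if p: "p \<in> P" and t: "0 \<le> t" for p t
    proof -
      consider "t < t0" | "t = t0" | "t0 < t" by linarith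
      then show ?thesis
      proof cases
        case 1
        have "\<tau> p \<noteq> ereal t" using ge[OF p] 1 by auto
        moreover have "{q \<in> P. ereal t \<le> \<tau> q} = P"
          using ge 1 by (auto intro: order_trans[of "ereal t" "ereal t0"])
        ultimately show ?thesis using before[OF t 1] by simp
      next
        case 2
        have "{q \<in> P. ereal t \<le> \<tau> q} = P" using ge 2 by auto
        moreover have "\<tau> p = ereal t0 \<longleftrightarrow> p \<in> D"
          using late[of p] p by (auto simp: \<tau>_def Q_def)
        ultimately show ?thesis using 2 by (simp add: D_def)
      next
        case 3
        have eq: "{q \<in> P. ereal t \<le> \<tau> q} = {q \<in> Q. ereal t \<le> \<tau>' q}"
          using 3 by (auto simp: \<tau>_def Q_def)
        show ?thesis
        proof (cases "p \<in> D")
          case True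
          then show ?thesis
            using 3 annihilated_subset[of s h "{q \<in> Q. ereal t \<le> \<tau>' q}" t]
            unfolding eq by (auto simp: \<tau>_def Q_def)
        next
          case False
          then show ?thesis unfolding eq using \<tau>' p t
            by (auto simp: \<tau>_def Q_def annihilation_times_def)
        qed
      qed
    qed
    moreover have "0 \<le> \<tau> p" if "p \<in> P" for p
      using ge[OF that] t0_nonneg by (auto intro: order_trans[of 0 "ereal t0"])
    ultimately have "annihilation_times s h P \<tau>" by (auto simp: annihilation_times_def)
    then show ?thesis by blast
  qed
qed

lemma annihilation_times_unique:
  assumes fin: "finite P" and \<tau>: "annihilation_times s h P \<tau>" and \<sigma>: "annihilation_times s h P \<sigma>"
    and p: "p \<in> P"
  shows "\<tau> p = \<sigma> p"
proof (rule ccontr)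
  assume neq: "\<tau> p \<noteq> \<sigma> p"
  define N where "N = {q \<in> P. \<tau> q \<noteq> \<sigma> q}"
  define m where "m = (\<lambda>q. min (\<tau> q) (\<sigma> q))"
  have N: "finite N" "N \<noteq> {}" unfolding N_def using fin p neq by (simp, blast)
  obtain q where q: "q \<in> N" "\<And>r. r \<in> N \<Longrightarrow> m q \<le> m r"
    using arg_min_if_finite[OF N, of m] by (meson not_le)
  have qP: "q \<in> P" "\<tau> q \<noteq> \<sigma> q" using q(1) by (auto simp: N_def)
  have "0 \<le> \<tau> q" "0 \<le> \<sigma> q" using \<tau> \<sigma> qP by (auto simp: annihilation_times_def)
  then have "0 \<le> m q" by (simp add: m_def)
  moreover have "m q \<noteq> \<infinity>" using qP(2) by (auto simp: m_def min_def split: if_splits)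
  ultimately obtain t where t: "m q = ereal t" "0 \<le> t"
    by (cases "m q") auto
  have "ereal t \<le> \<tau> r \<longleftrightarrow> ereal t \<le> \<sigma> r" if "r \<in> P" for r
    using q(2)[of r] that t(1) by (cases "\<tau> r = \<sigma> r") (auto simp: N_def m_def)
  then have "{r \<in> P. ereal t \<le> \<tau> r} = {r \<in> P. ereal t \<le> \<sigma> r}" by auto
  then have "\<tau> q = ereal t \<longleftrightarrow> \<sigma> q = ereal t"
    using \<tau> \<sigma> qP(1) t(2) by (auto simp: annihilation_times_def)
  with t(1) qP(2) show False by (auto simp: m_def min_def split: if_splits)
qed

section \<open>Random walks\<close>

definition markov_chain ::
  "'w measure \<Rightarrow> 'v set \<Rightarrow> ('v \<Rightarrow> 'v pmf) \<Rightarrow> 'v \<Rightarrow> (nat \<Rightarrow> 'w \<Rightarrow> 'v) \<Rightarrow> bool" where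
  "markov_chain M V K x Y \<longleftrightarrow>
     (\<forall>n. Y n \<in> measurable M (count_space V)) \<and>
     (\<forall>n y. measure M {\<omega> \<in> space M. \<forall>i\<le>n. Y i \<omega> = y i} =
        (if y 0 = x then \<Prod>i<n. pmf (K (y i)) (y (Suc i)) else 0))"

definition discrete_time_walk ::
  "'w measure \<Rightarrow> 'v set \<Rightarrow> ('v \<Rightarrow> 'v pmf) \<Rightarrow> 'v \<Rightarrow> ('w \<Rightarrow> real \<Rightarrow> 'v) \<Rightarrow> bool" where
  "discrete_time_walk M V K x X \<longleftrightarrow>
     (\<exists>Y. markov_chain M V K x Y \<and>
        (AE \<omega> in M. \<forall>n t. real n \<le> t \<and> t < real (Suc n) \<longrightarrow> X \<omega> t = Y n \<omega>))"

text \<open>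
  The \<open>n\<close>th point of the unit intensity Poisson process is \<open>\<Sum>i<n. W i\<close>, for independent
  exponential waiting times \<open>W i\<close> of rate \<open>1\<close>.
\<close>

definition continuous_time_walk ::
  "'w measure \<Rightarrow> 'v set \<Rightarrow> ('v \<Rightarrow> 'v pmf) \<Rightarrow> 'v \<Rightarrow> ('w \<Rightarrow> real \<Rightarrow> 'v) \<Rightarrow> bool" where
  "continuous_time_walk M V K x X \<longleftrightarrow>
     (\<exists>Y (W :: nat \<Rightarrow> 'w \<Rightarrow> real). markov_chain M V K x Y \<and>
        prob_space.indep_vars M (\<lambda>_. borel) W UNIV \<and>
        (\<forall>i. distributed M lborel (W i) (exponential_density 1)) \<and>
        prob_space.indep_set M
          (sets (vimage_algebra (space M) (\<lambda>\<omega> n. Y n \<omega>) (PiM UNIV (\<lambda>_. count_space V))))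
          (sets (vimage_algebra (space M) (\<lambda>\<omega> i. W i \<omega>) (PiM UNIV (\<lambda>_. borel)))) \<and>
        (AE \<omega> in M. \<forall>n t. (\<Sum>i<n. W i \<omega>) \<le> t \<and> t < (\<Sum>i<Suc n. W i \<omega>) \<longrightarrow> X \<omega> t = Y n \<omega>))"

section \<open>Regular systems\<close>

definition initial_space :: "'v set \<Rightarrow> ('v \<Rightarrow> int) measure" where
  "initial_space V = PiM V (\<lambda>_. count_space UNIV)"

definition path_space :: "'v set \<Rightarrow> (real \<Rightarrow> 'v) measure" where
  "path_space V = PiM {0..} (\<lambda>_. count_space V)"

definition paths_space :: "'v set \<Rightarrow> ('v particle \<Rightarrow> real \<Rightarrow> 'v) measure" where
  "paths_space V = PiM (labels V) (\<lambda>_. path_space V)"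

definition bravery_space :: "'v set \<Rightarrow> ('v particle \<Rightarrow> real) measure" where
  "bravery_space V = PiM (labels V) (\<lambda>_. borel)"

text \<open>
  The families \<open>\<xi>\<^sub>0\<close>, \<open>S\<close> and \<open>h\<close> as single random elements of the above product spaces; the
  restrictions are needed because elements of a product space are extensional functions.
\<close>

definition initial_element :: "'v set \<Rightarrow> ('v \<Rightarrow> 'w \<Rightarrow> int) \<Rightarrow> 'w \<Rightarrow> 'v \<Rightarrow> int" where
  "initial_element V \<xi>0 \<omega> = (\<lambda>x\<in>V. \<xi>0 x \<omega>)"

definition path_element :: "('w \<Rightarrow> real \<Rightarrow> 'v) \<Rightarrow> 'w \<Rightarrow> real \<Rightarrow> 'v" where
  "path_element X \<omega> = (\<lambda>t\<in>{0..}. X \<omega> t)"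

definition paths_element ::
  "'v set \<Rightarrow> ('v particle \<Rightarrow> 'w \<Rightarrow> real \<Rightarrow> 'v) \<Rightarrow> 'w \<Rightarrow> 'v particle \<Rightarrow> real \<Rightarrow> 'v" where
  "paths_element V S \<omega> = (\<lambda>p\<in>labels V. path_element (S p) \<omega>)"

definition bravery_element ::
  "'v set \<Rightarrow> ('v particle \<Rightarrow> 'w \<Rightarrow> real) \<Rightarrow> 'w \<Rightarrow> 'v particle \<Rightarrow> real" where
  "bravery_element V h \<omega> = (\<lambda>p\<in>labels V. h p \<omega>)"

text \<open>
  \<open>\<xi> \<omega> t x\<close> is the process of the system. It is not assumed to be constructed in any particular
  way: \<open>finite_approximation\<close> determines it up to null sets. The transition kernel \<open>K\<close> of the
  A-particles is an arbitrary one on the vertex set, not necessarily nearest-neighbour.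
\<close>

locale regular_dlas = prob_space M + locally_finite_graph G
  for M :: "'w measure" and G :: "('v, 'e) pre_digraph" +
  fixes \<xi>0 :: "'v \<Rightarrow> 'w \<Rightarrow> int"
    and S :: "'v particle \<Rightarrow> 'w \<Rightarrow> real \<Rightarrow> 'v"
    and h :: "'v particle \<Rightarrow> 'w \<Rightarrow> real"
    and \<xi> :: "'w \<Rightarrow> real \<Rightarrow> 'v \<Rightarrow> int"
  assumes valid_instructions: "AE \<omega> in M. instructions (verts G) (\<lambda>p. S p \<omega>) (\<lambda>p. h p \<omega>)"
    and indep_initial: "indep_vars (\<lambda>_. count_space UNIV) \<xi>0 (verts G)"
    and indep_paths:
      "indep_vars (\<lambda>_. path_space (verts G)) (\<lambda>p. path_element (S p)) (labels (verts G))"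
    and indep_bravery: "indep_vars (\<lambda>_. borel) h (labels (verts G))"
    and indep_collections:
      "indep_sets (\<lambda>k. sets
         ([vimage_algebra (space M) (initial_element (verts G) \<xi>0) (initial_space (verts G)),
           vimage_algebra (space M) (paths_element (verts G) S) (paths_space (verts G)),
           vimage_algebra (space M) (bravery_element (verts G) h) (bravery_space (verts G))] ! k))
         {..<3}"
    and A_walks:
      "\<exists>K :: 'v \<Rightarrow> 'v pmf. (\<forall>x\<in>verts G. set_pmf (K x) \<subseteq> verts G) \<and>
         ((\<forall>x\<in>verts G. \<forall>j>0. continuous_time_walk M (verts G) K x (S (x, j))) \<or>
          (\<forall>x\<in>verts G. \<forall>j>0. discrete_time_walk M (verts G) K x (S (x, j))))"
    and B_stationary: "\<forall>x\<in>verts G. \<forall>j<0. AE \<omega> in M. \<forall>t\<ge>0. S (x, j) \<omega> t = x"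
    and bravery_uniform:
      "\<forall>p\<in>labels (verts G). distr M borel (h p) = uniform_measure lborel {0..1}"
    and finite_approximation:
      "\<forall>Gs F T. finite_exhaustion G Gs \<longrightarrow> finite F \<longrightarrow> F \<subseteq> verts G \<longrightarrow> 0 \<le> T \<longrightarrow>
         (AE \<omega> in M. \<forall>\<^sub>F n in sequentially. \<forall>t\<in>{0..T}. \<forall>x\<in>F.
            finite_dlas (verts G) (\<lambda>y. if y \<in> verts (Gs n) then \<xi>0 y \<omega> else 0)
              (\<lambda>p. S p \<omega>) (\<lambda>p. h p \<omega>) t x = \<xi> \<omega> t x)"

text \<open>
  The total number of initial A-particles, and the occupation time of \<open>H\<close> by A-particles up to
  time \<open>T\<close>, for a fixed realization. Both take values in \<open>[0, \<infinity>]\<close>; if \<open>H\<close> or the number of initial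
  A-particles is almost surely finite, then so is the occupation time of a regular system.
\<close>

definition total_A :: "'v set \<Rightarrow> ('v \<Rightarrow> int) \<Rightarrow> ennreal" where
  "total_A V \<zeta> = (\<Sum>\<^sub>\<infinity>x\<in>V. ennreal (real_of_int (max (\<zeta> x) 0)))"

definition occupation_time :: "'v set \<Rightarrow> (real \<Rightarrow> 'v \<Rightarrow> int) \<Rightarrow> real \<Rightarrow> ennreal" where
  "occupation_time H \<xi> T =
     (\<Sum>\<^sub>\<infinity>x\<in>H. \<integral>\<^sup>+t\<in>{0..T}. ennreal (if 0 < \<xi> t x then real_of_int (\<xi> t x) else 0) \<partial>lborel)"

end

(*
  Annihilation is abelian: on a finite system sampled at discrete times, the total occupation time
  of the A-particles can be computed by running the A-particles one after the other, each waiting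
  at every B-particle it meets until that B-particle is released. In this sequential form one more
  particle contributes a nonnegative amount that decreases in the number of B-particles and has
  increasing marginal effect, so the expected value of an increasing convex function of the occupation
  time is increasing and convex in each initial coordinate (an A-B pair at the same site cancels, so
  that negative coordinates are covered). The icx comparison of the initial coordinates therefore
  passes to the occupation times. For infinite systems, distant particles are removed by killing
  everything outside a finite set; that this is harmless is a consequence of the local finite
  approximability, which forces the arrival probabilities of the A-particles to be summable.
*)
theory Submission imports Defs
begin

text \<open>The obstacle is that truncation has to be uniform in the grid, although kernel,
  B-configuration and moments are arbitrary. Local approximability keeps the expectation of exp (- r
  V) above some \<theta> in all large finite systems, V being the occupation time. Every token
  multiplies this expectation by a factor below 1, so a large sum of arrival probabilities would
  push it below \<theta>. B-particles may block a token, so only hitting probabilities that avoid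
  the other starting sites are available; averaging over random subsets of sites recovers the
  unobstructed ones at the cost of a factor 2 per position. This controls paths with boundedly many
  jumps. In continuous time, paths with many jumps up to T are compared with the occupation in more
  than twice the time, where J jumps have about 2^J times as many opportunities; they contribute a
  small multiple of a quantity that is tight. Limits of killed systems along the grids are replaced
  by a limsup, which keeps monotonicity and midpoint convexity in each coordinate.\<close>

abbreviation (input) converges_to (infix "~~>" 60) where
 "X ~~> L == X \<longlonglongrightarrow> L"

section \<open>Environments of B-particles met by successive tokens\<close>

type_synonym 'v env = "'v => nat => enat"

text \<open>\<open>b y j\<close> is the number of B-particles that a token present at
  \<open>y\<close> at time \<open>j\<close> still finds there; the value \<open>\<infinity>\<close>
  turns a site into one that kills every token. The number can only fall with time. It is
  \<open>0\<close> from the horizon \<open>N\<close> on so that \<open>clear_time\<close> always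
  exists; a token whose leaving time is \<open>N\<close> or later is dead.\<close>

definition admissible :: "nat => 'v env => bool" where
 "admissible N b \<longleftrightarrow> (ALL y. antimono (b y) & (ALL j>=N. b y j = 0))"

definition clear_time :: "'v env => 'v => nat" where
 "clear_time b y = (LEAST j. b y j = 0)"

text \<open>A token waiting at a B-particle leaves it when a token that was handled before, but
  arrived later, has been charged with the annihilation: the two exchange their roles, and their
  futures have the same law. So one B-particle is missing from the arrival time \<open>t\<close> on,
  whatever the token does next, and it is still visible before \<open>t\<close>.\<close>

definition take_B :: "'v env => 'v => nat => 'v env" where
 "take_B b y t = b(y := %j. if t <= j then b y j - 1 else b y j)"

lemma enat_diff_1_eq_0: "(n::enat) - 1 = 0 \<longleftrightarrow> n <= 1"
 by (cases n) (auto simp: one_enat_def zero_enat_def)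

lemma enat_diff_1_mono: "(m::enat) <= n ==> m - 1 <= n - 1"
 by (cases m; cases n) (auto simp: one_enat_def)

lemma enat_diff_1_le: "(n::enat) - 1 <= n"
 by (cases n) (auto simp: one_enat_def)

lemma clear_time_iff:
 assumes "admissible N b"
 shows "b y j = 0 \<longleftrightarrow> clear_time b y <= j"
proof -
 have anti: "antimono (b y)" and z: "b y N = 0" using assms by (auto simp: admissible_def)
 have "b y (clear_time b y) = 0"
  unfolding clear_time_def using z by (rule LeastI)
 hence "b y j = 0" if "clear_time b y <= j"
  using antimonoD[OF anti that] by simp
 moreover have "clear_time b y <= j" if "b y j = 0"
  unfolding clear_time_def using that by (rule Least_le)
 ultimately show ?thesis by blast
qed

lemma clear_time_eqI:
 assumes "!!j. b y j = 0 \<longleftrightarrow> m <= j"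
 shows "clear_time b y = m"
 unfolding clear_time_def by (rule Least_equality) (use assms in auto)

lemma admissible_take_B:
 assumes "admissible N b"
 shows "admissible N (take_B b y t)"
proof -
 have "take_B b y t z j <= take_B b y t z i" if "i <= j" for z i j
 proof -
  have le: "b z j <= b z i" using assms that by (auto simp: admissible_def antimono_def)
  show ?thesis
  proof (cases "t <= i \<or> \<not> t <= j \<or> z ~= y")
   case True
   thus ?thesis
    using that le enat_diff_1_mono[OF le] by (auto simp: take_B_def)
  next
   case False
   thus ?thesis
    using order_trans[OF enat_diff_1_le le] by (auto simp: take_B_def)
  qed
 qed
 moreover have "take_B b y t z j = 0" if "N <= j" for z j
  using assms that by (auto simp: admissible_def take_B_def)
 ultimately show ?thesis by (auto simp: admissible_def antimono_def)
qed

lemma take_B_le: "take_B b y t z j <= b z j"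
 by (auto simp: take_B_def enat_diff_1_le)

lemma take_B_commute: "take_B (take_B b y t) z s = take_B (take_B b z s) y t"
 by (auto simp: take_B_def fun_eq_iff)

lemma clear_time_take_B_other: "y ~= z ==> clear_time (take_B b y t) z = clear_time b z"
 by (simp add: clear_time_def take_B_def)

definition second_clear :: "'v env => 'v => nat" where
 "second_clear b y = (LEAST j. b y j <= 1)"

lemma second_clear_iff:
 assumes "admissible N b"
 shows "b y j <= 1 \<longleftrightarrow> second_clear b y <= j"
proof -
 have anti: "antimono (b y)" and z: "b y N <= 1" using assms by (auto simp: admissible_def)
 have "b y (second_clear b y) <= 1"
  unfolding second_clear_def using z by (rule LeastI)
 hence "b y j <= 1" if "second_clear b y <= j"
  using antimonoD[OF anti that] by simp
 moreover have "second_clear b y <= j" if "b y j <= 1"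
  unfolding second_clear_def using that by (rule Least_le)
 ultimately show ?thesis by blast
qed

text \<open>Zeros that are present at time \<open>t\<close> stay where they are. Otherwise the site
  becomes clear as soon as the arrival has taken place and at most one B-particle was left.\<close>

lemma clear_time_take_B:
 assumes "admissible N b"
 shows "clear_time (take_B b y t) y =
  (if clear_time b y <= t then clear_time b y else max t (second_clear b y))"
proof (rule clear_time_eqI)
 fix j
 show "take_B b y t y j = 0 \<longleftrightarrow>
   (if clear_time b y <= t then clear_time b y else max t (second_clear b y)) <= j"
  using clear_time_iff[OF assms, of y j] second_clear_iff[OF assms, of y j]
  by (auto simp: take_B_def enat_diff_1_eq_0)
qed

lemma second_clear_le_clear_time: "admissible N b ==> second_clear b y <= clear_time b y"
 using second_clear_iff[of N b y "clear_time b y"] clear_time_iff[of N b y "clear_time b y"] by auto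

text \<open>
 Two tokens arriving at the same site leave it at the same two times, whichever is handled first;
 only which token leaves when may depend on the order.
\<close>

lemma leave_times_swap:
 fixes b :: "'v env" and y :: 'v
 assumes b: "admissible N b"
 defines "l \<equiv> %b t. max t (clear_time b y)"
 shows "(l b s = l (take_B b y t) s & l (take_B b y s) t = l b t) \<or>
     (l b s = l b t & l (take_B b y s) t = l (take_B b y t) s)"
 using second_clear_le_clear_time[OF b, of y]
 by (auto simp: l_def clear_time_take_B[OF b] max_def)

section \<open>The token process\<close>

text \<open>With the rest of the run as a continuation \<open>R\<close>, commuting two moves becomes
  an identity between nested applications.\<close>

definition emit ::
 "('v => 'v pmf) => nat => ('v => nat => 'a::comm_monoid_add) => 'v => nat
  => ('a => ('v \<times> nat) multiset => 'r pmf) => 'a => ('v \<times> nat) multiset => 'r pmf" where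
 "emit Q N c y l R v M =
   (if N <= l then R v M else bind_pmf (Q y) (%y'. R (v + c y l) (add_mset (y', Suc l) M)))"

text \<open>The value lives in an arbitrary commutative monoid, so that two occupation functionals
  can be carried along as a pair. \<open>SOME\<close> fixes one order of handling the tokens;
  \<open>run_advance\<close> shows that the law is the same for all orders.\<close>

function run ::
 "('v => 'v pmf) => nat => ('v => nat => 'a::comm_monoid_add) => 'v env => 'a
  => ('v \<times> nat) multiset => ('v env \<times> 'a) pmf" where
 "run Q N c b v M =
   (if M = {#} then return_pmf (b, v)
   else let x = (SOME x. x \<in># M); y = fst x; t = snd x; l = max t (clear_time b y) in
    if N <= l then run Q N c (take_B b y t) v (M - {#x#})
    else bind_pmf (Q y) (%y'. run Q N c (take_B b y t) (v + c y l) (add_mset (y', Suc l) (M - {#x#}))))"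
 by pat_completeness auto

definition work :: "nat => ('v \<times> nat) multiset => nat" where
 "work N M = (\<Sum>x\<in>#M. Suc (Suc N - snd x))"

lemma work_simps [simp]:
 "work N {#} = 0" "work N (add_mset x M) = Suc (Suc N - snd x) + work N M"
 "work N (M + M') = work N M + work N M'"
 by (auto simp: work_def)

lemma work_remove: "x \<in># M ==> work N M = Suc (Suc N - snd x) + work N (M - {#x#})"
 by (metis insert_DiffM work_simps(2))

termination
proof (relation "Wellfounded.measure (%(Q, N, c, b, v, M). work N M)", goal_cases)
 case 1
 show ?case by simp
next
 case (2 Q N c b v M x y t l)
 hence "x \<in># M" by (metis multiset_nonemptyE someI)
 from work_remove[OF this, of N] show ?case by simp
next
 case (3 Q N c b v M x y t l y')
 hence "x \<in># M" by (metis multiset_nonemptyE someI)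
 from work_remove[OF this, of N] show ?case using 3 by simp
qed

declare run.simps [simp del]

definition advance where
 "advance Q N c b y t v M =
   emit Q N c y (max t (clear_time b y)) (run Q N c (take_B b y t)) v M"

lemma run_empty [simp]: "run Q N c b v {#} = return_pmf (b, v)"
 by (simp add: run.simps)

lemma run_some:
 assumes "M ~= {#}"
 obtains y t where "(y, t) \<in># M" "!!b v. run Q N c b v M = advance Q N c b y t v (M - {#(y, t)#})"
proof -
 define x where "x = (SOME x. x \<in># M)"
 have "x \<in># M" unfolding x_def using assms by (metis multiset_nonemptyE someI)
 moreover have "run Q N c b v M = advance Q N c b (fst x) (snd x) v (M - {#x#})" for b v
  using assms by (subst run.simps) (simp add: advance_def emit_def x_def Let_def)
 ultimately show ?thesis using that[of "fst x" "snd x"] by simp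
qed

lemma emit_commute:
 "emit Q N c y l (emit Q N c z k R) v M = emit Q N c z k (emit Q N c y l R) v M"
proof -
 have "bind_pmf (Q y) (%y'. bind_pmf (Q z) (%z'. R (v + c y l + c z k) (add_mset (z', Suc k) (add_mset (y', Suc l) M))))
   = bind_pmf (Q z) (%z'. bind_pmf (Q y) (%y'. R (v + c z k + c y l) (add_mset (y', Suc l) (add_mset (z', Suc k) M))))"
  by (subst bind_commute_pmf) (simp add: add.assoc add.commute[of "c y l"] add_mset_commute)
 thus ?thesis by (auto simp: emit_def)
qed

text \<open>Induction on the remaining work. If the run picks another token first, the induction
  hypothesis handles \<open>(y, t)\<close> directly after it, so both orders become two nested
  \<open>emit\<close>s with the same final environment. At different sites these commute; at a
  common site \<open>leave_times_swap\<close> makes them commute or coincide.\<close>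

theorem run_advance:
 assumes "admissible N b" "(y, t) \<in># M"
 shows "run Q N c b v M = advance Q N c b y t v (M - {#(y, t)#})"
 using assms
proof (induction "work N M" arbitrary: b v M y t rule: less_induct)
 case less
 have "M ~= {#}" using less.prems by auto
 then obtain z s where zs: "(z, s) \<in># M"
  and run: "!!b v. run Q N c b v M = advance Q N c b z s v (M - {#(z, s)#})"
  using run_some[of M Q N c] by metis
 show ?case
 proof (cases "(z, s) = (y, t)")
  case True
  thus ?thesis using run by simp
 next
  case False
  define M0 where "M0 = M - {#(y, t)#} - {#(z, s)#}"
  have "(z, s) \<in># M - {#(y, t)#}"
   using zs False by (auto simp: in_diff_count not_in_iff count_greater_zero_iff)
  hence M: "M = add_mset (y, t) (add_mset (z, s) M0)"
   using insert_DiffM[OF less.prems(2)] insert_DiffM[of "(z, s)" "M - {#(y, t)#}"]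
   unfolding M0_def by presburger
  have adv: "run Q N c b' v' (add_mset (y', t') M') = advance Q N c b' y' t' v' M'"
   if "work N (add_mset (y', t') M') < work N M" "admissible N b'" for b' v' y' t' M'
   using less.hyps[OF that(1) that(2), of y' t' v'] by simp
  note adm = admissible_take_B[OF less.prems(1)]
  have l: "advance Q N c b z s v (add_mset (y, t) M0) =
    emit Q N c z (max s (clear_time b z))
     (emit Q N c y (max t (clear_time (take_B b z s) y)) (run Q N c (take_B (take_B b z s) y t))) v M0"
  proof -
   have 1: "run Q N c (take_B b z s) v' (add_mset (y, t) M') =
     emit Q N c y (max t (clear_time (take_B b z s) y)) (run Q N c (take_B (take_B b z s) y t)) v' M'"
    if "work N M' < Suc (Suc N - s) + work N M0" for v' M'
    using adv[of y t M' "take_B b z s" v', OF _ adm] that unfolding advance_def by (simp add: M)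
   show ?thesis unfolding advance_def emit_def[of Q N c z]
    by (simp add: add_mset_commute[of _ "(y, t)"] 1)
  qed
  have r: "advance Q N c b y t v (add_mset (z, s) M0) =
    emit Q N c y (max t (clear_time b y))
     (emit Q N c z (max s (clear_time (take_B b y t) z)) (run Q N c (take_B (take_B b y t) z s))) v M0"
  proof -
   have 1: "run Q N c (take_B b y t) v' (add_mset (z, s) M') =
     emit Q N c z (max s (clear_time (take_B b y t) z)) (run Q N c (take_B (take_B b y t) z s)) v' M'"
    if "work N M' < Suc (Suc N - t) + work N M0" for v' M'
    using adv[of z s M' "take_B b y t" v', OF _ adm] that unfolding advance_def by (simp add: M)
   show ?thesis unfolding advance_def emit_def[of Q N c y]
    by (simp add: add_mset_commute[of _ "(z, s)"] 1)
  qed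
  have env: "take_B (take_B b y t) z s = take_B (take_B b z s) y t" by (rule take_B_commute)
  have "advance Q N c b z s v (add_mset (y, t) M0) = advance Q N c b y t v (add_mset (z, s) M0)"
  proof (cases "y = z")
   case True
   show ?thesis unfolding l r env
    using leave_times_swap[OF less.prems(1), of s y t]
   proof (elim disjE conjE)
    assume "max s (clear_time b y) = max s (clear_time (take_B b y t) y)"
     "max t (clear_time (take_B b y s) y) = max t (clear_time b y)"
    thus "emit Q N c z (max s (clear_time b z))
      (emit Q N c y (max t (clear_time (take_B b z s) y)) (run Q N c (take_B (take_B b z s) y t))) v M0 =
     emit Q N c y (max t (clear_time b y))
      (emit Q N c z (max s (clear_time (take_B b y t) z)) (run Q N c (take_B (take_B b z s) y t))) v M0"
     using True by (simp add: emit_commute)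
   next
    assume "max s (clear_time b y) = max t (clear_time b y)"
     "max t (clear_time (take_B b y s) y) = max s (clear_time (take_B b y t) y)"
    thus "emit Q N c z (max s (clear_time b z))
      (emit Q N c y (max t (clear_time (take_B b z s) y)) (run Q N c (take_B (take_B b z s) y t))) v M0 =
     emit Q N c y (max t (clear_time b y))
      (emit Q N c z (max s (clear_time (take_B b y t) z)) (run Q N c (take_B (take_B b z s) y t))) v M0"
     using True by simp
   qed
  next
   case False
   thus ?thesis unfolding l r env
    by (simp add: clear_time_take_B_other emit_commute)
  qed
  thus ?thesis using run by (simp add: M False add_mset_commute)
 qed
qed

lemma run_add_mset:
 "admissible N b ==> run Q N c b v (add_mset (y, t) M) = advance Q N c b y t v M"
 by (simp add: run_advance[of N b y t])

lemma run_die: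
 "admissible N b ==> N <= max t (clear_time b y) ==>
  run Q N c b v (add_mset (y, t) M) = run Q N c (take_B b y t) v M"
 by (simp add: run_add_mset advance_def emit_def)

lemma run_move:
 "admissible N b ==> l = max t (clear_time b y) ==> l < N ==>
  run Q N c b v (add_mset (y, t) M) =
  bind_pmf (Q y) (%y'. run Q N c (take_B b y t) (v + c y l) (add_mset (y', Suc l) M))"
 by (simp only: run_add_mset advance_def emit_def not_le[symmetric] if_False)

lemma run_induct [consumes 1, case_names empty die move]:
 fixes c :: "'v => nat => 'a::comm_monoid_add"
 assumes "admissible N b"
  and "!!b v. admissible N b ==> P b v {#}"
  and "!!b v y t M. admissible N b ==> N <= max t (clear_time b y) ==> P (take_B b y t) v M ==>
   P b v (add_mset (y, t) M)"
  and "!!b v y t M l. admissible N b ==> l = max t (clear_time b y) ==> l < N ==>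
   (!!y'. P (take_B b y t) (v + c y l) (add_mset (y', Suc l) M)) ==>
   P b v (add_mset (y, t) M)"
 shows "P b v M"
 using assms(1)
proof (induction "work N M" arbitrary: b v M rule: less_induct)
 case less
 show ?case
 proof (cases M)
  case empty
  thus ?thesis using assms(2) less.prems by simp
 next
  case (add x M0)
  obtain y t where x: "x = (y, t)" by fastforce
  note adm = admissible_take_B[OF less.prems]
  have "P b v (add_mset (y, t) M0)"
  proof (cases "N <= max t (clear_time b y)")
   case True
   show ?thesis
    by (rule assms(3)[OF less.prems True]; rule less.hyps[OF _ adm]) (auto simp: add x)
  next
   case False
   show ?thesis
    by (rule assms(4)[OF less.prems refl]; (rule less.hyps[OF _ adm])?) (use False in \<open>auto simp: add x\<close>)
  qed
  thus ?thesis by (simp add: add x)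
 qed
qed

text \<open>This allows one group of tokens to be studied in the environment that another group has
  left behind.\<close>

lemma run_union:
 assumes "admissible N b"
 shows "run Q N c b v (M + E) = bind_pmf (run Q N c b v M) (%(b', v'). run Q N c b' v' E)"
 using assms
proof (induction b v M rule: run_induct[where c = c])
 case (die b v y t M)
 thus ?case by (simp only: union_mset_add_mset_left run_die)
next
 case (move b v y t M l)
 thus ?case
  by (simp only: union_mset_add_mset_left run_move bind_assoc_pmf)
qed (simp add: bind_return_pmf)

lemma run_decreasing:
 assumes "admissible N b"
 shows "z : set_pmf (run Q N c b v M) ==> admissible N (fst z) & (ALL y j. fst z y j <= b y j)"
 using assms
proof (induction b v M rule: run_induct[where c = c])
 case (die b v y t M)
 have "z : set_pmf (run Q N c (take_B b y t) v M)"
  using die(4) by (simp only: run_die[OF die(1,2)])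
 from die(3)[OF this] show ?case using take_B_le[of b y t] order_trans by blast
next
 case (move b v y t M l)
 obtain y' where "z : set_pmf (run Q N c (take_B b y t) (v + c y l) (add_mset (y', Suc l) M))"
  using move(5) by (auto simp only: run_move[OF move(1-3)] set_bind_pmf)
 from move(4)[OF this] show ?case using take_B_le[of b y t] order_trans by blast
qed simp

lemma run_increasing:
 fixes c :: "'v => nat => 'a::ordered_comm_monoid_add"
 assumes "admissible N b" "!!y j. 0 <= c y j"
 shows "z : set_pmf (run Q N c b v M) ==> v <= snd z"
 using assms(1)
proof (induction b v M rule: run_induct[where c = c])
 case (die b v y t M)
 thus ?case by (simp only: run_die)
next
 case (move b v y t M l)
 obtain y' where "z : set_pmf (run Q N c (take_B b y t) (v + c y l) (add_mset (y', Suc l) M))"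
  using move(5) by (auto simp only: run_move[OF move(1-3)] set_bind_pmf)
 from move(4)[OF this] have "v + c y l <= snd z" .
 moreover have "v + 0 <= v + c y l" by (rule add_left_mono) (rule assms(2))
 ultimately show ?case by simp
qed simp

lemma run_translate:
 assumes "admissible N b"
 shows "run Q N c b (u + v) M = map_pmf (map_prod id ((+) u)) (run Q N c b v M)"
 using assms
proof (induction b v M rule: run_induct[where c = c])
 case (die b v y t M)
 thus ?case by (simp only: run_die)
next
 case (move b v y t M l)
 thus ?case
  by (simp only: run_move map_bind_pmf add.assoc)
qed simp

text \<open>Applied to the projections \<open>fst\<close> and \<open>snd\<close>, this recovers the
  two separate runs from a run that carries a pair of values.\<close>

lemma run_hom:
 assumes "admissible N b" and f: "!!x y. f (x + y) = f x + f y"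
 shows "map_pmf (map_prod id f) (run Q N c b v M) = run Q N (%y j. f (c y j)) b (f v) M"
 using assms(1)
proof (induction b v M rule: run_induct[where c = c])
 case (die b v y t M)
 thus ?case by (simp only: run_die)
next
 case (move b v y t M l)
 thus ?case
  by (simp only: run_move map_bind_pmf f)
qed simp

definition expect ::
 "('v => 'v pmf) => nat => ('v => nat => 'a::comm_monoid_add) => ('a => ennreal) => 'v env => 'a
  => ('v \<times> nat) multiset => ennreal" where
 "expect Q N c g b v M = (\<integral>\<^sup>+ x. g (snd x) \<partial>measure_pmf (run Q N c b v M))"

lemma expect_empty [simp]: "expect Q N c g b v {#} = g v"
 by (simp add: expect_def)

lemma expect_add_mset:
 assumes "admissible N b"
 shows "expect Q N c g b v (add_mset (y, t) M) =
  (let l = max t (clear_time b y) in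
   if N <= l then expect Q N c g (take_B b y t) v M
   else \<integral>\<^sup>+ y'. expect Q N c g (take_B b y t) (v + c y l) (add_mset (y', Suc l) M) \<partial>measure_pmf (Q y))"
 by (simp add: expect_def run_add_mset[OF assms] advance_def emit_def Let_def nn_integral_bind_pmf)

lemma expect_union:
 assumes "admissible N b"
 shows "expect Q N c g b v (M + E) =
  (\<integral>\<^sup>+ x. expect Q N c g (fst x) (snd x) E \<partial>measure_pmf (run Q N c b v M))"
 by (simp add: expect_def run_union[OF assms] nn_integral_bind_pmf case_prod_beta)

lemma expect_translate:
 assumes "admissible N b"
 shows "expect Q N c g b (u + v) M = expect Q N c (%x. g (u + x)) b v M"
 by (simp add: expect_def run_translate[OF assms])

definition no_later :: "'v \<times> nat => 'v \<times> nat => bool" where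
 "no_later x x' \<longleftrightarrow> fst x = fst x' & snd x' <= snd x"

text \<open>
 The times at which a token moves only decrease if there are fewer B-particles or other tokens are
 added, so along a fixed sequence of sites everything happens earlier.
\<close>

theorem expect_mono:
 fixes c :: "'v => nat => real"
 assumes c: "!!y j. 0 <= c y j" "!!y i j. i <= j ==> c y j <= c y i" and g: "mono g"
  and "admissible N b" "admissible N b'" "!!y j. b' y j <= b y j" "v <= v'"
  and "rel_mset no_later M M'"
 shows "expect Q N c g b v M <= expect Q N c g b' v' (M' + E)"
 using assms(4-)
proof (induction "work N M + work N (M' + E)" arbitrary: b b' v v' M M' E rule: less_induct)
 case less
 note adm = admissible_take_B[OF less.prems(1)] admissible_take_B[OF less.prems(2)]
 show ?case
 proof (cases M)
  case empty
  hence M': "M' = {#}" using less.prems(5) by simp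
  show ?thesis
  proof (cases E)
   case empty
   thus ?thesis using \<open>M = {#}\<close> M' less.prems(4) g by (simp add: monoD)
  next
   case (add x E0)
   obtain y t where x: "x = (y, t)" by fastforce
   define l where "l = max t (clear_time b' y)"
   have le: "take_B b' y t z j <= b z j" for z j
    using take_B_le[of b' y t z j] less.prems(3)[of z j] by (rule order_trans)
   show ?thesis
   proof (cases "N <= l")
    case True
    have "expect Q N c g b v M <= expect Q N c g (take_B b' y t) v' (M' + E0)"
     by (rule less.hyps) (use less.prems adm le in \<open>auto simp: add x\<close>)
    thus ?thesis using True less.prems(2) M' by (simp add: add x expect_add_mset l_def)
   next
    case False
    have step: "expect Q N c g b v M
      <= expect Q N c g (take_B b' y t) (v' + c y l) (M' + add_mset (y', Suc l) E0)" for y'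
     by (rule less.hyps) (use less.prems adm le c(1)[of y l] False in \<open>auto simp: add x l_def\<close>)
    hence "(\<integral>\<^sup>+ y'. expect Q N c g b v M \<partial>measure_pmf (Q y)) \<le>
      (\<integral>\<^sup>+ y'. expect Q N c g (take_B b' y t) (v' + c y l) (M' + add_mset (y', Suc l) E0) \<partial>measure_pmf (Q y))"
     by (intro nn_integral_mono)
    thus ?thesis using False less.prems(2) M' by (simp add: add x expect_add_mset l_def Let_def)
   qed
  qed
 next
  case (add x M1)
  obtain x' M1' where M': "M' = add_mset x' M1'" "no_later x x'" "rel_mset no_later M1 M1'"
   using msed_rel_invL less.prems(5) unfolding add by metis
  obtain y t t' where x: "x = (y, t)" "x' = (y, t')" "t' <= t"
   using M'(2) by (cases x; cases x') (auto simp: no_later_def)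
  define l l' where "l = max t (clear_time b y)" and "l' = max t' (clear_time b' y)"
  have "clear_time b' y <= clear_time b y"
   using clear_time_iff[OF less.prems(1), of y "clear_time b y"]
    clear_time_iff[OF less.prems(2), of y "clear_time b y"] less.prems(3)[of y "clear_time b y"] by simp
  hence ll: "l' <= l" using x(3) by (auto simp: l_def l'_def)
  have le: "take_B b' y t' z j <= take_B b y t z j" for z j
  proof (cases "z = y & t <= j")
   case True
   thus ?thesis using x(3) less.prems(3)[of y j] by (auto simp: take_B_def enat_diff_1_mono)
  next
   case False
   hence "take_B b y t z j = b z j" by (auto simp: take_B_def)
   thus ?thesis using take_B_le[of b' y t' z j] less.prems(3)[of z j] by simp
  qed
  have LHS: "expect Q N c g b v M = (if N <= l then expect Q N c g (take_B b y t) v M1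
   else \<integral>\<^sup>+ y'. expect Q N c g (take_B b y t) (v + c y l) (add_mset (y', Suc l) M1) \<partial>measure_pmf (Q y))"
   using less.prems(1) by (simp add: add x expect_add_mset l_def Let_def)
  have RHS: "expect Q N c g b' v' (M' + E) = (if N <= l' then expect Q N c g (take_B b' y t') v' (M1' + E)
   else \<integral>\<^sup>+ y'. expect Q N c g (take_B b' y t') (v' + c y l') (add_mset (y', Suc l') (M1' + E)) \<partial>measure_pmf (Q y))"
   using less.prems(2) by (simp add: M' x expect_add_mset l'_def Let_def)
  consider "N <= l'" | "l' < N" "N <= l" | "l < N" by linarith
  thus ?thesis
  proof cases
   case 1
   have "expect Q N c g (take_B b y t) v M1 <= expect Q N c g (take_B b' y t') v' (M1' + E)"
    by (rule less.hyps) (use less.prems adm le M' in \<open>auto simp: add x\<close>)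
   thus ?thesis using 1 ll unfolding LHS RHS by simp
  next
   case 2
   have "expect Q N c g (take_B b y t) v M1
     <= expect Q N c g (take_B b' y t') (v' + c y l') (M1' + add_mset (y', Suc l') E)" for y'
    by (rule less.hyps) (use less.prems adm le M' c(1)[of y l'] 2 in \<open>auto simp: add x l'_def\<close>)
   hence "(\<integral>\<^sup>+ y'. expect Q N c g (take_B b y t) v M1 \<partial>measure_pmf (Q y)) \<le>
    (\<integral>\<^sup>+ y'. expect Q N c g (take_B b' y t') (v' + c y l') (M1' + add_mset (y', Suc l') E) \<partial>measure_pmf (Q y))"
    by (intro nn_integral_mono)
   thus ?thesis using 2 unfolding LHS RHS by simp
  next
   case 3
   have "expect Q N c g (take_B b y t) (v + c y l) (add_mset (y', Suc l) M1)
     <= expect Q N c g (take_B b' y t') (v' + c y l') (add_mset (y', Suc l') M1' + E)" for y'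
    by (rule less.hyps)
     (use less.prems adm le M' c(2)[OF ll, of y] 3 ll in
      \<open>auto simp: add x l'_def l_def no_later_def intro!: rel_mset_Plus add_mono\<close>)
   thus ?thesis using 3 ll unfolding LHS RHS by (auto intro!: nn_integral_mono)
  qed
 qed
qed

lemma rel_mset_no_later_refl: "rel_mset no_later M M"
 by (rule multiset.rel_refl_strong) (simp add: no_later_def)

text \<open>After \<open>M\<close> has run, let \<open>D\<close> be the law of the increment due to
  one copy of \<open>x\<close>. A second copy meets at most as many B-particles, so by
  \<open>expect_mono\<close> it does at least as well as an independent increment with law
  \<open>D\<close>, and \<open>conv\<close> applies to two such increments.\<close>

theorem expect_convex:
 fixes c :: "'v => nat => real"
 assumes c: "!!y j. 0 <= c y j" "!!y i j. i <= j ==> c y j <= c y i" and g: "mono g"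
  and conv: "!!v d d'. 0 <= d ==> 0 <= d' ==> g (v + d) + g (v + d') <= g (v + d + d') + g v"
  and b: "admissible N b"
 shows "2 * expect Q N c g b v (add_mset x M)
  <= expect Q N c g b v (add_mset x (add_mset x M)) + expect Q N c g b v M"
proof -
 have one: "2 * expect Q N c g b v {#x#} <= expect Q N c g b v {#x, x#} + g v"
  if b: "admissible N b" for b v
 proof -
  define D where "D = map_pmf snd (run Q N c b 0 {#x#})"
  have D0: "0 <= d" if "d : set_pmf D" for d
   using that run_increasing[OF b c(1)] by (auto simp: D_def)
  have ex: "expect Q N c f b u {#x#} = (\<integral>\<^sup>+ d. f (u + d) \<partial>measure_pmf D)" for f u
   using expect_translate[OF b, of Q c f u 0 "{#x#}"] by (simp add: expect_def D_def)
  have "(\<integral>\<^sup>+ d. \<integral>\<^sup>+ d'. g (v + d) + g (v + d') \<partial>measure_pmf D \<partial>measure_pmf D)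
    <= (\<integral>\<^sup>+ d. \<integral>\<^sup>+ d'. g (v + d + d') + g v \<partial>measure_pmf D \<partial>measure_pmf D)"
   by (intro nn_integral_mono_AE AE_pmfI nn_integral_mono_AE conv D0)
  moreover have "(\<integral>\<^sup>+ d. \<integral>\<^sup>+ d'. g (v + d) + g (v + d') \<partial>measure_pmf D \<partial>measure_pmf D) = 2 * expect Q N c g b v {#x#}"
   by (simp add: nn_integral_add ex mult_2)
  moreover have "(\<integral>\<^sup>+ d. \<integral>\<^sup>+ d'. g (v + d + d') + g v \<partial>measure_pmf D \<partial>measure_pmf D) =
    (\<integral>\<^sup>+ d. \<integral>\<^sup>+ d'. g (v + d + d') \<partial>measure_pmf D \<partial>measure_pmf D) + g v"
   by (simp add: nn_integral_add)
  moreover have "(\<integral>\<^sup>+ d. \<integral>\<^sup>+ d'. g (v + d + d') \<partial>measure_pmf D \<partial>measure_pmf D) = expect Q N c (%u. expect Q N c g b u {#x#}) b v {#x#}"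
   by (simp add: ex)
  moreover have "... <= expect Q N c g b v {#x, x#}"
  proof -
   have "expect Q N c g b v {#x, x#} = (\<integral>\<^sup>+ z. expect Q N c g (fst z) (snd z) {#x#} \<partial>measure_pmf (run Q N c b v {#x#}))"
    using expect_union[OF b, of Q c g v "{#x#}" "{#x#}"] by simp
   moreover have "expect Q N c (%u. expect Q N c g b u {#x#}) b v {#x#} <= ..."
    unfolding expect_def[of Q N c "%u. expect Q N c g b u {#x#}"]
   proof (intro nn_integral_mono_AE AE_pmfI)
    fix z assume "z : set_pmf (run Q N c b v {#x#})"
    hence "admissible N (fst z) & (ALL y j. fst z y j <= b y j)"
     by (rule run_decreasing[OF b])
    thus "expect Q N c g b (snd z) {#x#} <= expect Q N c g (fst z) (snd z) {#x#}"
     using expect_mono[OF c g b, where b' = "fst z" and v = "snd z" and v' = "snd z" and M = "{#x#}"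
      and M' = "{#x#}" and E = "{#}" and Q = Q]
     by (simp add: rel_mset_no_later_refl)
   qed
   ultimately show ?thesis by simp
  qed
  ultimately show ?thesis by (auto intro: order_trans[OF _ add_right_mono])
 qed
 have "2 * expect Q N c g b v (M + {#x#}) = (\<integral>\<^sup>+ z. 2 * expect Q N c g (fst z) (snd z) {#x#} \<partial>measure_pmf (run Q N c b v M))"
  by (simp only: expect_union[OF b]) (simp add: nn_integral_cmult)
 also have "... <= (\<integral>\<^sup>+ z. expect Q N c g (fst z) (snd z) {#x, x#} + g (snd z) \<partial>measure_pmf (run Q N c b v M))"
 proof (intro nn_integral_mono_AE AE_pmfI one)
  fix z assume "z : set_pmf (run Q N c b v M)"
  thus "admissible N (fst z)" by (rule conjunct1[OF run_decreasing[OF b]])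
 qed
 also have "... = expect Q N c g b v (M + {#x, x#}) + expect Q N c g b v M"
  by (simp only: expect_union[OF b]) (simp add: nn_integral_add expect_def[of Q N c g b v M])
 finally show ?thesis by simp
qed

section \<open>Annihilation on a grid of times\<close>

text \<open>The number of braver elements is a bijection from \<open>S\<close> onto
  \<open>{..<card S}\<close>.\<close>

lemma card_bravest:
 fixes h :: "'b => real"
 assumes S: "finite S" "inj_on h S"
 shows "card {p : S. card {q : S. h p < h q} < k} = min (card S) k"
proof -
 define r where "r p = card {q : S. h p < h q}" for p
 have less: "r p' < r p" if "p : S" "p' : S" "h p < h p'" for p p'
  unfolding r_def by (rule psubset_card_mono) (use that S in auto)
 have inj: "inj_on r S"
 proof (rule inj_onI, rule ccontr)
  fix p p' assume p: "p : S" "p' : S" "r p = r p'" "p ~= p'"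
  hence "h p ~= h p'" using S(2) by (auto dest: inj_onD)
  thus False using less[OF p(1,2)] less[OF p(2,1)] p(3) by linarith
 qed
 have "r p < card S" if "p : S" for p
  unfolding r_def by (rule psubset_card_mono) (use that S in auto)
 hence "r ` S <= {..<card S}" by auto
 hence img: "r ` S = {..<card S}"
  by (rule card_subset_eq[rotated]) (simp_all add: card_image[OF inj])
 have "card {p : S. r p < k} = card (r ` {p : S. r p < k})"
  by (rule card_image[symmetric]) (rule inj_on_subset[OF inj], auto)
 also have "r ` {p : S. r p < k} = {..<min (card S) k}"
 proof (intro equalityI subsetI)
  fix i assume i: "i : {..<min (card S) k}"
  hence "i : r ` S" by (simp add: img)
  with i show "i : r ` {p : S. r p < k}" by auto
 qed (use img in auto)
 finally show ?thesis by (simp add: r_def)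
qed

text \<open>Positions replace paths here, so the time argument of \<open>annihilated\<close> is a
  dummy.\<close>

definition survivors :: "('v particle => real) => 'v particle set => ('v particle => 'v) => 'v particle set" where
 "survivors h P pos = P - annihilated (%p _. pos p) h P 0"

lemma survivors_subset: "survivors h P pos <= P"
 by (auto simp: survivors_def)

definition A_at :: "('v particle => 'v) => 'v particle set => 'v => 'v particle set" where
 "A_at pos P y = {p : P. type_A p & pos p = y}"

definition B_at :: "('v particle => 'v) => 'v particle set => 'v => 'v particle set" where
 "B_at pos P y = {p : P. type_B p & pos p = y}"

lemma card_annihilated:
 fixes pos :: "'v particle => 'v" and h :: "'v particle => real" and P :: "'v particle set"
 assumes P: "finite P" "inj_on h P" "ALL p:P. snd p ~= 0"
 defines "D \<equiv> annihilated (%p _. pos p) h P 0"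
 shows "card (A_at pos P y Int D) = min (card (A_at pos P y)) (card (B_at pos P y))" (is ?A)
  and "card (B_at pos P y Int D) = min (card (A_at pos P y)) (card (B_at pos P y))" (is ?B)
proof -
 have opp: "type_A q \<longleftrightarrow> \<not> type_B q" if "q : P" for q
  using P(3) that by (cases "snd q" "0::int" rule: linorder_cases) auto
 have a: "p : D \<longleftrightarrow> card {q : A_at pos P y. h p < h q} < card (B_at pos P y)" if "p : A_at pos P y" for p
 proof -
  have "{q : P. pos q = pos p & (type_A q \<longleftrightarrow> type_A p) & h p < h q} = {q : A_at pos P y. h p < h q}"
   "{q : P. pos q = pos p & (type_A q \<longleftrightarrow> type_B p)} = B_at pos P y" "p : P"
   using that opp by (auto simp: A_at_def B_at_def)
  thus ?thesis unfolding D_def annihilated_def mem_Collect_eq by (simp only: simp_thms)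
 qed
 have b: "p : D \<longleftrightarrow> card {q : B_at pos P y. h p < h q} < card (A_at pos P y)" if "p : B_at pos P y" for p
 proof -
  have "{q : P. pos q = pos p & (type_A q \<longleftrightarrow> type_A p) & h p < h q} = {q : B_at pos P y. h p < h q}"
   "{q : P. pos q = pos p & (type_A q \<longleftrightarrow> type_B p)} = A_at pos P y" "p : P"
   using that opp by (auto simp: A_at_def B_at_def)
  thus ?thesis unfolding D_def annihilated_def mem_Collect_eq by (simp only: simp_thms)
 qed
 have a': "A_at pos P y Int D = {p : A_at pos P y. card {q : A_at pos P y. h p < h q} < card (B_at pos P y)}"
  using a by blast
 have b': "B_at pos P y Int D = {p : B_at pos P y. card {q : B_at pos P y. h p < h q} < card (A_at pos P y)}"
  using b by blast
 have "finite (A_at pos P y)" "finite (B_at pos P y)" "inj_on h (A_at pos P y)" "inj_on h (B_at pos P y)"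
  using P by (auto simp: A_at_def B_at_def intro: inj_on_subset)
 thus ?A ?B unfolding a' b' by (simp_all add: card_bravest min.commute)
qed

lemma A_survivors_sites_clear:
 assumes "finite P" "inj_on h P" "ALL p:P. snd p ~= 0" "p : survivors h P pos" "type_A p"
 shows "B_at pos (survivors h P pos) (pos p) = {}"
proof -
 have "\<not> (type_A q \<longleftrightarrow> type_B p)" if "q : survivors h P pos" "pos q = pos p" for q
  using no_pair_after_annihilation[of P p "%p _. pos p" h 0 q] assms that
  by (auto simp: survivors_def)
 thus ?thesis using assms(5) by (force simp: B_at_def)
qed

fun grid_occupation ::
 "('v => nat => real) => ('v particle => real) => nat => 'v particle set => ('v particle => 'v) list => real" where
 "grid_occupation c h j P [] = 0"
| "grid_occupation c h j P (pos # xs) =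
   (\<Sum>p | p \<in> survivors h P pos & type_A p. c (pos p) j)
   + grid_occupation c h (Suc j) (survivors h P pos) xs"

text \<open>All of \<open>A\<close> jumps, dead particles included. With a fixed index set the law
  of the whole trajectory is a product over particles, as for the paths of a regular system.\<close>

definition jump :: "('v => 'v pmf) => 'v particle set => ('v particle => 'v) => ('v particle => 'v) pmf" where
 "jump Q A pos = map_pmf (%f p. if p : A then f p else pos p) (Pi_pmf A undefined (%p. Q (pos p)))"

fun trajectory :: "('v => 'v pmf) => 'v particle set => nat => ('v particle => 'v) => ('v particle => 'v) list pmf" where
 "trajectory Q A 0 pos = return_pmf []"
| "trajectory Q A (Suc n) pos = map_pmf ((#) pos) (bind_pmf (jump Q A pos) (trajectory Q A n))"

abbreviation tokens :: "('v particle => 'v) => nat => 'v particle set => ('v \<times> nat) multiset" where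
 "tokens pos j A \<equiv> image_mset (%p. (pos p, j)) (mset_set A)"

lemma run_all_late:
 assumes "admissible N b" "!!x. x \<in># M ==> N <= snd x"
 shows "map_pmf snd (run Q N c b v M) = return_pmf v"
 using assms
proof (induction b v M rule: run_induct[where c = c])
 case (die b v y t M)
 thus ?case by (simp only: run_die) simp
next
 case (move b v y t M l)
 from move(5)[of "(y, t)"] move(2,3) show ?case by simp
qed simp

text \<open>If a site holds at least as many B-particles as tokens of \<open>D\<close> up to the
  horizon, each of these tokens finds it occupied until \<open>N\<close>; it dies and takes one
  B-particle with it. The new environment is described from time \<open>j\<close> on, since all
  remaining tokens move at \<open>j\<close> or later.\<close>

lemma run_remove_dying:
 assumes "finite D" "admissible N b" "!!y i. j <= i ==> i < N ==> enat (card (A_at pos D y)) <= b y i"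
  "ALL p:D. type_A p" "j < N"
 shows "EX b'. admissible N b' & (ALL y i. j <= i --> b' y i = b y i - enat (card (A_at pos D y))) &
  run Q N c b v (tokens pos j D + M) = run Q N c b' v M"
 using assms
proof (induction D arbitrary: b rule: finite_induct)
 case empty
 thus ?case by (intro exI[of _ b]) (auto simp: A_at_def zero_enat_def[symmetric])
next
 case (insert p D)
 have card: "card (A_at pos (insert p D) y) = (if y = pos p then Suc (card (A_at pos D y)) else card (A_at pos D y))" for y
 proof -
  have "A_at pos (insert p D) y = (if y = pos p then insert p (A_at pos D y) else A_at pos D y)"
   using insert.prems(3) by (auto simp: A_at_def)
  moreover have "p ~: A_at pos D y" "finite (A_at pos D y)" using insert.hyps by (auto simp: A_at_def)
  ultimately show ?thesis by (cases "y = pos p") simp_all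
 qed
 let ?b = "take_B b (pos p) j"
 \<comment> \<open>As \<open>b\<close> decreases in time, it is enough that the site is still
   occupied at the last time before the horizon.\<close>
 have "j <= N - 1" "N - 1 < N" using insert.prems(4) by auto
 from insert.prems(2)[OF this, of "pos p"] have "enat 1 <= b (pos p) (N - 1)"
  using card[of "pos p"] by (cases "b (pos p) (N - 1)") auto
 hence "b (pos p) (N - 1) ~= 0" by (auto simp: zero_enat_def)
 hence late: "N <= max j (clear_time b (pos p))"
  using clear_time_iff[OF insert.prems(1), of "pos p" "N - 1"] by auto
 have "EX b'. admissible N b' & (ALL y i. j <= i --> b' y i = ?b y i - enat (card (A_at pos D y))) &
  run Q N c ?b v (tokens pos j D + M) = run Q N c b' v M"
 proof (rule insert.IH)
  show "admissible N ?b" using admissible_take_B insert.prems(1) .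
  show "enat (card (A_at pos D y)) <= ?b y i" if "j <= i" "i < N" for y i
   using insert.prems(2)[OF that, of y] that(1)
   by (cases "b y i") (auto simp: card take_B_def one_enat_def split: if_splits)
 qed (use insert.prems in auto)
 then obtain b' where b': "admissible N b'" "ALL y i. j <= i --> b' y i = ?b y i - enat (card (A_at pos D y))"
  "run Q N c ?b v (tokens pos j D + M) = run Q N c b' v M" by blast
 have "b' y i = b y i - enat (card (A_at pos (insert p D) y))" if "j <= i" for y i
  using b'(2) that by (cases "b y i") (auto simp: card take_B_def one_enat_def)
 moreover have "run Q N c b v (tokens pos j (insert p D) + M) = run Q N c b' v M"
  using insert.hyps b'(3) run_die[OF insert.prems(1) late, where Q = Q and c = c and v = v and M = "tokens pos j D + M"] by simp
 ultimately show ?case using b'(1) by blast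
qed

lemma run_move_survivors:
 assumes "finite A" "admissible N b" "!!p i. p : A ==> j <= i ==> b (pos p) i = 0" "j < N"
 shows "run Q N c b v (tokens pos j A + M) =
  bind_pmf (Pi_pmf A d (%p. Q (pos p)))
   (%f. run Q N c b (v + (SUM p:A. c (pos p) j)) (tokens f (Suc j) A + M))"
 using assms
proof (induction A arbitrary: v M rule: finite_induct)
 case empty
 thus ?case by (simp add: bind_return_pmf)
next
 case (insert p A)
 have ct: "clear_time b (pos p) <= j"
  using clear_time_iff[OF insert.prems(1), of "pos p" j] insert.prems(2)[of p j] by simp
 have tb: "take_B b (pos p) j = b"
  using insert.prems(2)[of p] by (auto simp: take_B_def fun_eq_iff)
 have fcong: "image_mset (%q. (if q = p then y else f q, Suc j)) (mset_set A) = tokens f (Suc j) A" for f y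
  using insert.hyps by (intro image_mset_cong) auto
 have "run Q N c b v (tokens pos j (insert p A) + M) =
   bind_pmf (Q (pos p)) (%y. run Q N c b (v + c (pos p) j) (tokens pos j A + add_mset (y, Suc j) M))"
  using run_move[OF insert.prems(1), of j j "pos p" Q c v "tokens pos j A + M"] ct insert.hyps insert.prems(3) tb
  by (simp add: max_absorb1)
 also have "... = bind_pmf (Q (pos p)) (%y. bind_pmf (Pi_pmf A d (%p. Q (pos p)))
   (%f. run Q N c b (v + (SUM p:insert p A. c (pos p) j)) (tokens (f(p := y)) (Suc j) (insert p A) + M)))"
  using insert.hyps insert.prems by (subst insert.IH) (auto simp: fcong add.assoc)
 also have "... = bind_pmf (Pi_pmf (insert p A) d (%p. Q (pos p)))
   (%f. run Q N c b (v + (SUM p:insert p A. c (pos p) j)) (tokens f (Suc j) (insert p A) + M))"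
  using insert.hyps by (simp add: Pi_pmf_insert pair_pmf_def bind_map_pmf bind_assoc_pmf bind_return_pmf)
 finally show ?case .
qed

text \<open>At each grid time the doomed tokens \<open>D\<close> are handled first and remove the
  B-particles they annihilate with. A site with surviving A-particles is then clear, so the
  survivors leave at once. Thus the simultaneous dynamics is the run in order of time, which is one
  of its possible orders. Braveness decides who dies at a site, but only the numbers at the site
  enter the law.\<close>

theorem grid_occupation_law:
 fixes c :: "'v => nat => real"
 assumes "finite P" "inj_on h P" "ALL p:P. snd p ~= 0"
  and A: "finite A" "{p : P. type_A p} <= A" "ALL p:A. type_A p"
  and "admissible N b" "!!y i. j <= i ==> i < N ==> b y i = enat (card (B_at pos P y))" "j + n = N"
 shows "map_pmf (%xs. v + grid_occupation c h j P xs) (trajectory Q A n pos) =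
  map_pmf snd (run Q N c b v (tokens pos j {p : P. type_A p}))"
 using assms(1,2,3,5,7-)
proof (induction n arbitrary: P b j pos v)
 case 0
 thus ?case by (subst run_all_late) (auto simp: map_pmf_const)
next
 case (Suc n)
 define P' where "P' = survivors h P pos"
 define D where "D = {p : P. type_A p} - P'"
 define A' where "A' = {p : P'. type_A p}"
 define w where "w = v + (SUM p:A'. c (pos p) j)"
 have P': "finite P'" "inj_on h P'" "ALL p:P'. snd p ~= 0" "A' <= A" "finite A'"
  using Suc.prems survivors_subset[of h P pos] A(1) unfolding P'_def A'_def
  by (auto intro: finite_subset inj_on_subset)
 have split: "{p : P. type_A p} = D Un A'" "D Int A' = {}" "finite D"
  using survivors_subset[of h P pos] Suc.prems(1) by (auto simp: D_def A'_def P'_def)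
 have "A_at pos D y = A_at pos P y Int annihilated (%p _. pos p) h P 0" for y
  by (auto simp: A_at_def D_def P'_def survivors_def annihilated_def)
 hence cardD: "card (A_at pos D y) = min (card (A_at pos P y)) (card (B_at pos P y))" for y
  using card_annihilated(1)[OF Suc.prems(1-3)] by simp
 have "B_at pos P' y = B_at pos P y - (B_at pos P y Int annihilated (%p _. pos p) h P 0)" for y
  by (auto simp: B_at_def P'_def survivors_def)
 hence cardB: "card (B_at pos P' y) = card (B_at pos P y) - card (A_at pos D y)" for y
  using card_annihilated(2)[OF Suc.prems(1-3), of pos y] Suc.prems(1) cardD[of y]
  by (simp add: card_Diff_subset B_at_def)
 have jN: "j < N" using Suc.prems(7) by simp
 have "EX b'. admissible N b' & (ALL y i. j <= i --> b' y i = b y i - enat (card (A_at pos D y))) &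
  run Q N c b v (tokens pos j D + tokens pos j A') = run Q N c b' v (tokens pos j A')"
 proof (rule run_remove_dying[OF split(3) Suc.prems(5) _ _ jN])
  show "enat (card (A_at pos D y)) <= b y i" if "j <= i" "i < N" for y i
   by (simp add: Suc.prems(6)[OF that] cardD)
 qed (simp add: D_def)
 then obtain b' where b': "admissible N b'" "!!y i. j <= i ==> b' y i = b y i - enat (card (A_at pos D y))"
  "run Q N c b v (tokens pos j D + tokens pos j A') = run Q N c b' v (tokens pos j A')"
  by blast
 have b'P: "b' y i = enat (card (B_at pos P' y))" if "j <= i" "i < N" for y i
  using b'(2) Suc.prems(6) cardB that by simp
 have clear: "b' (pos p) i = 0" if "p : A'" "j <= i" for p i
 proof (cases "i < N")
  case True
  thus ?thesis
   using b'P[OF that(2) True, of "pos p"] A_survivors_sites_clear[OF Suc.prems(1-3), of p pos] that(1)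
   by (simp add: A'_def P'_def zero_enat_def)
 next
  case False
  thus ?thesis using b'(1) by (simp add: admissible_def)
 qed
 have "map_pmf snd (run Q N c b v (tokens pos j {p : P. type_A p})) =
   map_pmf snd (run Q N c b' v (tokens pos j A'))"
  using b'(3) split P'(5) by (simp add: mset_set_Union)
 also have "... = bind_pmf (Pi_pmf A' undefined (%p. Q (pos p))) (%f. map_pmf snd (run Q N c b' w (tokens f (Suc j) A')))"
  using run_move_survivors[OF P'(5) b'(1) clear jN, where M = "{#}" and d = undefined and Q = Q and c = c and v = v]
  by (simp add: map_bind_pmf w_def)
 \<comment> \<open>Dead particles keep jumping in \<open>trajectory\<close> but are absent from the
   run; the product law on \<open>A\<close> is an extension of the one on the survivors
   \<open>A'\<close>.\<close>
 also have "... = bind_pmf (Pi_pmf A undefined (%p. Q (pos p)))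
   (%f. map_pmf snd (run Q N c b' w (tokens (%p. if p : A' then f p else undefined) (Suc j) A')))"
  by (subst Pi_pmf_subset[OF A(1) P'(4)]) (simp add: bind_map_pmf)
 also have "... = bind_pmf (jump Q A pos) (%pos'. map_pmf snd (run Q N c b' w (tokens pos' (Suc j) A')))"
 proof -
  have "tokens (%p. if p : A' then f p else undefined) (Suc j) A' =
    tokens (%p. if p : A then f p else pos p) (Suc j) A'" for f
   using P'(4,5) by (intro image_mset_cong) auto
  thus ?thesis by (simp add: jump_def bind_map_pmf)
 qed
 also have "... = bind_pmf (jump Q A pos) (%pos'. map_pmf (%xs. w + grid_occupation c h (Suc j) P' xs) (trajectory Q A n pos'))"
 proof (intro bind_pmf_cong refl)
  fix pos' assume "pos' : set_pmf (jump Q A pos)"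
  hence "pos' p = pos p" if "p ~: A" for p using that by (auto simp: jump_def)
  moreover have "p ~: A" if "type_B p" for p using A(3) that by fastforce
  ultimately have "B_at pos' P' y = B_at pos P' y" for y by (auto simp: B_at_def)
  thus "map_pmf snd (run Q N c b' w (tokens pos' (Suc j) A')) =
    map_pmf (%xs. w + grid_occupation c h (Suc j) P' xs) (trajectory Q A n pos')"
   unfolding A'_def using P' b'(1) b'P Suc.prems(7)
   by (intro Suc.IH[symmetric]) (auto simp: A'_def)
 qed
 also have "... = map_pmf (%xs. v + grid_occupation c h j P xs) (trajectory Q A (Suc n) pos)"
  by (simp add: map_bind_pmf pmf.map_comp o_def P'_def A'_def w_def add.assoc)
 finally show ?case ..
qed

section \<open>From real time to a grid\<close>

definition alive :: "'v particle set => ('v particle => ereal) => real => 'v particle set" where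
 "alive P ta t = {p : P. ereal t < ta p}"

definition frozen :: "('v particle => real => 'v) => 'v particle set => real set => bool" where
 "frozen s P I \<longleftrightarrow> (ALL p:P. ALL t:I. ALL t':I. s p t = s p t')"

lemma annihilated_positions:
 assumes "!!p. p : Q ==> s p t = pos p"
 shows "annihilated s h Q t = annihilated (%p _. pos p) h Q 0"
 unfolding annihilated_def by (intro Collect_cong conj_cong refl) (simp add: assms cong: conj_cong)

context
 fixes s :: "'v particle => real => 'v" and h :: "'v particle => real" and P :: "'v particle set"
  and ta :: "'v particle => ereal"
 assumes P: "finite P" "ALL p:P. snd p ~= 0" and ta: "annihilation_times s h P ta"
begin

lemma alive_after:
 assumes "0 <= t"
 shows "alive P ta t = {q : P. ereal t <= ta q} - annihilated s h {q : P. ereal t <= ta q} t"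
proof -
 have "ta p = ereal t \<longleftrightarrow> p : annihilated s h {q : P. ereal t <= ta q} t" if "p : P" for p
  using ta assms that by (auto simp: annihilation_times_def)
 note iff = this
 show ?thesis
 proof (rule set_eqI)
  fix p
  show "p : alive P ta t \<longleftrightarrow> p : {q : P. ereal t <= ta q} - annihilated s h {q : P. ereal t <= ta q} t"
  proof (cases "p : P")
   case True
   have "ereal t < ta p \<longleftrightarrow> ereal t <= ta p & ta p ~= ereal t" by auto
   thus ?thesis using iff[OF True] True by (simp add: alive_def)
  qed (simp add: alive_def)
 qed
qed

lemma alive_no_pair:
 assumes "0 <= t" "p : alive P ta t" "q : alive P ta t" "s q t = s p t"
 shows "\<not> (type_A q \<longleftrightarrow> type_B p)"
 using no_pair_after_annihilation[of "{q : P. ereal t <= ta q}" p s h t q] P assms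
 by (auto simp: alive_after)

text \<open>A death at \<open>r\<close> requires a particle of the opposite type at the same site.
  As the paths are constant since \<open>a\<close>, the same pair would have shared a site at time
  \<open>a\<close>, after the annihilations at \<open>a\<close> had left no such pair.\<close>

lemma frozen_no_death:
 assumes "0 <= a" "a < r" "frozen s P {a..r}" "p : alive P ta a"
 shows "ta p ~= ereal r"
proof
 assume "ta p = ereal r"
 hence "p : annihilated s h {q : P. ereal r <= ta q} r"
  using ta assms(1,2,4) by (auto simp: annihilation_times_def alive_def)
 from annihilated_imp_pair[OF this] obtain q
  where q: "q : P" "ereal r <= ta q" "s q r = s p r" "type_A q \<longleftrightarrow> type_B p" by auto
 have "s q a = s q r" "s p a = s p r"
  using assms q(1) by (auto simp: frozen_def alive_def)
 moreover have "q : alive P ta a"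
  using q(1,2) assms(2) by (auto simp: alive_def intro: less_le_trans[of "ereal a" "ereal r"])
 ultimately show False using alive_no_pair[OF assms(1,4)] q(3,4) by simp
qed

lemma alive_mono: "t <= t' ==> alive P ta t' <= alive P ta t"
 by (auto simp: alive_def intro: le_less_trans[of "ereal t" "ereal t'"])

lemma alive_frozen:
 assumes "0 <= a" "a <= b" "frozen s P {a..b}"
 shows "alive P ta b = alive P ta a"
proof
 show "alive P ta a <= alive P ta b"
 proof
  fix p assume p: "p : alive P ta a"
  show "p : alive P ta b"
  proof (rule ccontr)
   assume "p ~: alive P ta b"
   with p have "ereal a < ta p" "ta p <= ereal b" by (auto simp: alive_def)
   then obtain r where r: "ta p = ereal r" "a < r" "r <= b" by (cases "ta p") auto
   have "frozen s P {a..r}" using assms(3) r(3) by (auto simp: frozen_def)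
   from frozen_no_death[OF assms(1) r(2) this p] r(1) show False by simp
  qed
 qed
qed (rule alive_mono[OF assms(2)])

text \<open>With \<open>u\<close> as the only possible jump time in the cell nobody dies strictly
  between \<open>a\<close> and \<open>u\<close> or after \<open>u\<close>, so one annihilation with
  the positions at \<open>b\<close> has the same effect as the dynamics in real time.\<close>

lemma survivors_step:
 assumes "0 <= a" "a < u" "u <= b" "frozen s P {a..<u}" "frozen s P {u..b}"
 shows "survivors h (alive P ta a) (%p. s p b) = alive P ta b"
proof -
 have eq: "{q : P. ereal u <= ta q} = alive P ta a"
 proof
  show "alive P ta a <= {q : P. ereal u <= ta q}"
  proof
   fix p assume p: "p : alive P ta a"
   show "p : {q : P. ereal u <= ta q}"
   proof (rule ccontr)
    assume "p ~: {q : P. ereal u <= ta q}"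
    with p have "ereal a < ta p" "ta p < ereal u" by (auto simp: alive_def)
    then obtain r where r: "ta p = ereal r" "a < r" "r < u" by (cases "ta p") auto
    have "frozen s P {a..r}" using assms(4) r(3) by (auto simp: frozen_def)
    from frozen_no_death[OF assms(1) r(2) this p] r(1) show False by simp
   qed
  qed
 qed (use assms(2) in \<open>auto simp: alive_def intro: less_le_trans[of "ereal a" "ereal u"]\<close>)
 have "alive P ta b = alive P ta u" using assms by (intro alive_frozen) auto
 also have "... = alive P ta a - annihilated s h (alive P ta a) u"
  using alive_after[of u] assms(1,2) by (simp add: eq)
 also have "annihilated s h (alive P ta a) u = annihilated (%p _. s p b) h (alive P ta a) 0"
  by (rule annihilated_positions) (use assms(3,5) in \<open>auto simp: frozen_def alive_def\<close>)
 finally show ?thesis by (simp add: survivors_def)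
qed

lemma survivors_start: "survivors h P (%p. s p 0) = alive P ta 0"
proof -
 have "{q : P. ereal 0 <= ta q} = P" using ta by (auto simp: annihilation_times_def zero_ereal_def)
 thus ?thesis
  using alive_after[of 0] annihilated_positions[of P s 0 "%p. s p 0" h] by (simp add: survivors_def)
qed

text \<open>For \<open>j = 0\<close> there is no previous grid time, so the list starts from all
  initial particles, before the annihilations at time \<open>0\<close>.\<close>

lemma grid_occupation_alive:
 assumes dt: "0 < dt" and n: "j <= n"
  and step: "!!i. Suc i < n ==> EX u. real i * dt < u & u <= real (Suc i) * dt &
   frozen s P {real i * dt..<u} & frozen s P {u..real (Suc i) * dt}"
 shows "grid_occupation c h j (if j = 0 then P else alive P ta (real (j - 1) * dt))
   (map (%i p. s p (real i * dt)) [j..<n]) =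
  (\<Sum>i=j..<n. \<Sum>p | p \<in> alive P ta (real i * dt) & type_A p. c (s p (real i * dt)) i)"
 using n
proof (induction "n - j" arbitrary: j)
 case 0
 thus ?case by simp
next
 case (Suc k)
 hence jn: "j < n" by simp
 have surv: "survivors h (if j = 0 then P else alive P ta (real (j - 1) * dt)) (%p. s p (real j * dt))
   = alive P ta (real j * dt)"
 proof (cases j)
  case 0
  thus ?thesis using survivors_start by simp
 next
  case (Suc i)
  obtain u where "real i * dt < u" "u <= real (Suc i) * dt"
   "frozen s P {real i * dt..<u}" "frozen s P {u..real (Suc i) * dt}"
   using step[of i] jn Suc by auto
  from survivors_step[OF _ this] dt Suc show ?thesis by simp
 qed
 have "grid_occupation c h (Suc j) (alive P ta (real j * dt)) (map (%i p. s p (real i * dt)) [Suc j..<n]) =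
  (\<Sum>i=Suc j..<n. \<Sum>p | p \<in> alive P ta (real i * dt) & type_A p. c (s p (real i * dt)) i)"
  using Suc.hyps(1)[of "Suc j"] Suc.hyps(2) Suc.prems jn by simp
 thus ?case using jn surv
  by (simp add: upt_conv_Cons sum.atLeast_Suc_lessThan)
qed

end

definition cell_weight :: "real => real => nat => real" where
 "cell_weight T dt j = measure lborel ({real j * dt..<real (Suc j) * dt} Int {0..T})"

definition occ_weight :: "'v set => real => real => 'v => nat => real" where
 "occ_weight H T dt y j = (if y : H then cell_weight T dt j else 0)"

text \<open>After annihilation no site carries both types, so the positive part of the signed count
  is the number of surviving A-particles.\<close>

lemma finite_dlas_occupation:
 assumes P: "finite (initial_particles V ze)"
  and rc: "!!p t. p : initial_particles V ze ==> 0 <= t ==> \<forall>\<^sub>F r in at_right t. s p r = s p t"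
  and meas: "!!p x. p : initial_particles V ze ==> {t : {0..T}. s p t = x} : sets borel"
  and H: "finite H"
 obtains ta where "annihilation_times s h (initial_particles V ze) ta"
  "occupation_time H (finite_dlas V ze s h) T =
   (\<integral>\<^sup>+t\<in>{0..T}. ennreal (real (card {p : alive (initial_particles V ze) ta t. type_A p & s p t : H})) \<partial>lborel)"
proof -
 let ?P = "initial_particles V ze"
 define ta where "ta = (SOME ta. annihilation_times s h ?P ta)"
 have snd: "ALL p:?P. snd p ~= 0" by (auto simp: initial_particles_def)
 have "\<exists>ta. annihilation_times s h ?P ta"
  by (rule annihilation_times_exists[OF P snd]) (use rc in blast)
 hence ta: "annihilation_times s h ?P ta"
  unfolding ta_def by (rule someI_ex)
 define A where "A t x = {p : alive ?P ta t. type_A p & s p t = x}" for t x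
 have finA: "finite (A t x)" for t x using P by (simp add: A_def alive_def)
 have val: "(if 0 < finite_dlas V ze s h t x then real_of_int (finite_dlas V ze s h t x) else 0)
   = real (card (A t x))" if t: "0 <= t" for t x
 proof -
  define B where "B = {p : alive ?P ta t. type_B p & s p t = x}"
  have "A t x = {p : ?P. type_A p & ereal t < ta p & s p t = x}"
   "B = {p : ?P. type_B p & ereal t < ta p & s p t = x}"
   by (auto simp: A_def B_def alive_def)
  hence "finite_dlas V ze s h t x = int (card (A t x)) - int (card B)"
   by (simp add: finite_dlas_def Let_def ta_def[symmetric])
  moreover have "A t x = {} \<or> B = {}"
  proof (rule ccontr)
   assume "\<not> (A t x = {} \<or> B = {})"
   then obtain p q where "p : A t x" "q : B" by blast
   thus False using alive_no_pair[OF P snd ta t, of q p] by (simp add: A_def B_def)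
  qed
  ultimately show ?thesis using finA[of t x] by (auto simp: card_gt_0_iff)
 qed
 have sum: "(SUM x:H. ennreal (real (card (A t x)))) = ennreal (real (card {p : alive ?P ta t. type_A p & s p t : H}))" for t
 proof -
  have "{p : alive ?P ta t. type_A p & s p t : H} = (UN x:H. A t x)" by (auto simp: A_def)
  moreover have "card (UN x:H. A t x) = (SUM x:H. card (A t x))"
   using H finA by (intro card_UN_disjoint) (auto simp: A_def)
  ultimately show ?thesis by (simp add: sum_ennreal)
 qed
 have mA: "(%t. ennreal (real (card (A t x))) * indicator {0..T} t) : borel_measurable lborel" for x
 proof -
  have "ennreal (real (card (A t x))) * indicator {0..T} t =
    (\<Sum>p | p \<in> ?P & type_A p. indicator ({t. ereal t < ta p} Int {t : {0..T}. s p t = x}) t)" for t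
  proof (cases "t : {0..T}")
   case True
   have "A t x = {p : {p : ?P. type_A p}. t : {t. ereal t < ta p} Int {t : {0..T}. s p t = x}}"
    using True by (auto simp: A_def alive_def)
   hence "ennreal (real (card (A t x))) = (\<Sum>p | p \<in> ?P & type_A p. indicator ({t. ereal t < ta p} Int {t : {0..T}. s p t = x}) t)"
    using P by (simp add: indicator_def sum.If_cases Int_def ennreal_of_nat_eq_real_of_nat conj_ac)
   thus ?thesis using True by simp
  next
   case False
   hence "indicator {0..T} t = (0::ennreal)"
    "indicator ({t. ereal t < ta p} Int {t : {0..T}. s p t = x}) t = (0::ennreal)" for p
    by (auto simp: indicator_def)
   thus ?thesis by simp
  qed
  moreover have "(%t. \<Sum>p | p \<in> ?P & type_A p. indicator ({t. ereal t < ta p} Int {t : {0..T}. s p t = x}) t :: ennreal)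
    : borel_measurable lborel"
   using meas by (intro borel_measurable_sum borel_measurable_indicator sets.Int) auto
  ultimately show ?thesis by presburger
 qed
 have "occupation_time H (finite_dlas V ze s h) T =
   (SUM x:H. \<integral>\<^sup>+t. ennreal (real (card (A t x))) * indicator {0..T} t \<partial>lborel)"
  unfolding occupation_time_def infsum_finite[OF H]
 proof (intro sum.cong refl nn_integral_cong)
  show "ennreal (if 0 < finite_dlas V ze s h t x then real_of_int (finite_dlas V ze s h t x) else 0) * indicator {0..T} t
    = ennreal (real (card (A t x))) * indicator {0..T} t" for t x
   by (cases "t : {0..T}") (simp_all only: val atLeastAtMost_iff indicator_simps mult_zero_right not_False_eq_True)
 qed
 also have "... = (\<integral>\<^sup>+t. (SUM x:H. ennreal (real (card (A t x))) * indicator {0..T} t) \<partial>lborel)"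
  by (rule nn_integral_sum[symmetric]) (rule mA)
 also have "... = (\<integral>\<^sup>+t\<in>{0..T}. ennreal (real (card {p : alive ?P ta t. type_A p & s p t : H})) \<partial>lborel)"
  by (simp only: sum_distrib_right[symmetric] sum)
 finally show ?thesis using that ta by blast
qed

definition well_sampled :: "('v particle => real => 'v) => 'v particle set => real => real => bool" where
 "well_sampled s P T dt \<longleftrightarrow> 0 < dt & (ALL i. real i * dt <= T --> (EX u. real i * dt < u & u <= real (Suc i) * dt &
   frozen s P {real i * dt..<u} & frozen s P {u..real (Suc i) * dt}))"

lemma floor_cell:
 assumes "0 < dt" "0 <= t"
 shows "t : {real j * dt..<real (Suc j) * dt} \<longleftrightarrow> j = nat \<lfloor>t / dt\<rfloor>"
proof -
 have "t : {real j * dt..<real (Suc j) * dt} \<longleftrightarrow> real j <= t / dt & t / dt < real j + 1"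
  using assms(1) by (auto simp: field_simps)
 also have "... \<longleftrightarrow> \<lfloor>t / dt\<rfloor> = int j" by (auto simp: floor_eq_iff)
 also have "... \<longleftrightarrow> j = nat \<lfloor>t / dt\<rfloor>" using assms by (auto simp: zero_le_floor)
 finally show ?thesis .
qed

lemma well_sampled_measurable:
 assumes "well_sampled s P T dt" "p : P"
 shows "{t : {0..T}. s p t = x} : sets borel"
proof -
 define E where "E = {t : {0..T}. s p t = x}"
 have dt: "0 < dt" using assms(1) by (simp add: well_sampled_def)
 have "E Int {real i * dt..<real (Suc i) * dt} : sets borel" for i
 proof (cases "real i * dt <= T")
  case True
  then obtain u where u: "real i * dt < u" "u <= real (Suc i) * dt"
   "frozen s P {real i * dt..<u}" "frozen s P {u..real (Suc i) * dt}"
   using assms(1) unfolding well_sampled_def by blast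
  have *: "E Int I : sets borel" if I: "frozen s P I" "I : sets borel" for I :: "real set"
  proof (cases "E Int I = {}")
   case False
   then obtain t where t: "t : I" "s p t = x" by (auto simp: E_def)
   have "s p t' = x" if t': "t' : I" for t'
   proof -
    have "s p t' = s p t" using I(1) assms(2) t' t(1) unfolding frozen_def by blast
    thus ?thesis using t(2) by simp
   qed
   hence "E Int I = {0..T} Int I" unfolding E_def by blast
   thus ?thesis using that(2) by simp
  qed (use that(2) in simp)
  have "frozen s P {u..<real (Suc i) * dt}"
   using u(4) unfolding frozen_def by (meson atLeastAtMost_iff atLeastLessThan_iff less_imp_le)
  hence "E Int {real i * dt..<u} Un E Int {u..<real (Suc i) * dt} : sets borel"
   using u(3) by (intro sets.Un *) auto
  moreover have "E Int {real i * dt..<real (Suc i) * dt} = E Int {real i * dt..<u} Un E Int {u..<real (Suc i) * dt}"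
   by (simp only: Int_Un_distrib[symmetric] ivl_disj_un_two(3)[OF less_imp_le[OF u(1)] u(2)])
  ultimately show ?thesis by simp
 next
  case False
  hence "E Int {real i * dt..<real (Suc i) * dt} = {}"
   unfolding E_def by fastforce
  thus ?thesis by simp
 qed
 note cell = this
 have "(\<Union>i. E Int {real i * dt..<real (Suc i) * dt}) : sets borel"
  by (rule sets.countable_UN) (use cell in blast)
 also have "(\<Union>i. E Int {real i * dt..<real (Suc i) * dt}) = E"
 proof (rule set_eqI)
  fix t
  have "EX i. t : {real i * dt..<real (Suc i) * dt}" if "t : E"
  proof -
   have "0 <= t" using that by (simp add: E_def)
   from floor_cell[OF dt this] show ?thesis by blast
  qed
  thus "t : (\<Union>i. E Int {real i * dt..<real (Suc i) * dt}) \<longleftrightarrow> t : E"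
   unfolding UN_iff Int_iff by blast
 qed
 finally show ?thesis by (simp add: E_def)
qed

text \<open>The grid sum is the integral of the step function \<open>G k\<close>, which evaluates
  the occupation number \<open>f\<close> at the grid point to the left. By \<open>fr\<close> the two
  eventually agree at almost every time, and the number of particles dominates both.\<close>

theorem grid_occupation_limit:
 fixes dt :: "nat => real" and s :: "'v particle => real => 'v" and ze :: "'v => int"
 assumes P: "finite (initial_particles V ze)"
  and rc: "!!p t. p : initial_particles V ze ==> 0 <= t ==> \<forall>\<^sub>F r in at_right t. s p r = s p t"
  and H: "finite H" and T: "0 <= T"
  and ws: "\<forall>\<^sub>F k in sequentially. well_sampled s (initial_particles V ze) T' (dt k)"
  and fr: "AE t in lborel. t : {0..T} --> (\<forall>\<^sub>F k in sequentially.
   frozen s (initial_particles V ze) {real (nat \<lfloor>t / dt k\<rfloor>) * dt k..t})"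
  and n: "!!k. T <= real (n k) * dt k" "!!k. real (n k) * dt k <= T'"
 shows "(%k. grid_occupation (occ_weight H T (dt k)) h 0 (initial_particles V ze)
   (map (%i p. s p (real i * dt k)) [0..<n k])) ~~> enn2real (occupation_time H (finite_dlas V ze s h) T)"
  (is "?G ~~> _")
  and "occupation_time H (finite_dlas V ze s h) T <= ennreal (T * real (card (initial_particles V ze)))"
proof -
 let ?P = "initial_particles V ze"
 have snd: "ALL p:?P. snd p ~= 0" by (auto simp: initial_particles_def)
 have TT': "T <= T'" using n[of 0] by linarith
 obtain k0 where "well_sampled s ?P T' (dt k0)" using ws by (auto simp: eventually_sequentially)
 hence "{t : {0..T'}. s p t = x} : sets borel" if "p : ?P" for p x
  using that by (rule well_sampled_measurable)
 hence "{t : {0..T'}. s p t = x} Int {0..T} : sets borel" if "p : ?P" for p x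
  using that by (intro sets.Int) auto
 moreover have "{t : {0..T'}. s p t = x} Int {0..T} = {t : {0..T}. s p t = x}" for p x
  using TT' by auto
 ultimately have meas: "{t : {0..T}. s p t = x} : sets borel" if "p : ?P" for p x
  using that by metis
 obtain ta where ta: "annihilation_times s h ?P ta" and occ: "occupation_time H (finite_dlas V ze s h) T =
   (\<integral>\<^sup>+t\<in>{0..T}. ennreal (real (card {p : alive ?P ta t. type_A p & s p t : H})) \<partial>lborel)"
  using finite_dlas_occupation[where s = s and h = h and T = T, OF P rc meas H] by blast
 define f where "f t = real (card {p : alive ?P ta t. type_A p & s p t : H})" for t
 have fP: "0 <= f t" "f t <= real (card ?P)" for t
  unfolding f_def using P by (auto intro!: card_mono simp: alive_def)
 have "occupation_time H (finite_dlas V ze s h) T = (\<integral>\<^sup>+t. ennreal (f t) * indicator {0..T} t \<partial>lborel)"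
  unfolding occ f_def ..
 also have "... <= (\<integral>\<^sup>+t. ennreal (real (card ?P)) * indicator {0..T} t \<partial>lborel)"
  by (intro nn_integral_mono mult_right_mono ennreal_leI fP) simp
 also have "... = ennreal (T * real (card ?P))"
  using T by (subst nn_integral_cmult_indicator) (auto simp: ennreal_mult' mult.commute)
 finally show "occupation_time H (finite_dlas V ze s h) T <= ennreal (T * real (card ?P))" .
 define cell where "cell k j = {real j * dt k..<real (Suc j) * dt k} Int {0..T}" for k j
 define G where "G k t = (\<Sum>j<n k. f (real j * dt k) * indicator (cell k j) t)" for k t
 have cell_int: "integrable lborel (%t. f (real j * dt k) * indicator (cell k j) t)" for j k
 proof -
  have "emeasure lborel (cell k j) <= emeasure lborel {0..T}"
   by (rule emeasure_mono) (auto simp: cell_def)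
  hence "emeasure lborel (cell k j) < \<infinity>"
   using T by (auto intro: le_less_trans[OF _ ennreal_less_top])
  thus ?thesis by (intro integrable_mult_right integrable_real_indicator) (auto simp: cell_def)
 qed
 have Gint: "integrable lborel (G k)" "(\<integral>t. G k t \<partial>lborel) = (\<Sum>j<n k. f (real j * dt k) * cell_weight T (dt k) j)" for k
 proof -
  show "integrable lborel (G k)"
   unfolding G_def by (intro Bochner_Integration.integrable_sum cell_int)
  have "cell_weight T (dt k) j = measure lborel (cell k j)" for j
   by (simp only: cell_weight_def cell_def)
  thus "(\<integral>t. G k t \<partial>lborel) = (\<Sum>j<n k. f (real j * dt k) * cell_weight T (dt k) j)"
   unfolding G_def by (subst Bochner_Integration.integral_sum[OF cell_int]) (simp add: cell_def[of k])
 qed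
 have G_eq: "G k t = (if t : {0..T} & nat \<lfloor>t / dt k\<rfloor> < n k then f (real (nat \<lfloor>t / dt k\<rfloor>) * dt k) else 0)"
  if "0 < dt k" for k t
 proof (cases "t : {0..T}")
  case True
  hence "t : cell k j \<longleftrightarrow> j = nat \<lfloor>t / dt k\<rfloor>" for j
   using floor_cell[OF that, of t j] True by (simp only: cell_def Int_iff atLeastAtMost_iff simp_thms)
  hence "indicator (cell k j) t = (if j = nat \<lfloor>t / dt k\<rfloor> then 1 else (0::real))" for j
   by (simp add: indicator_def)
  hence "G k t = (\<Sum>j<n k. if j = nat \<lfloor>t / dt k\<rfloor> then f (real j * dt k) else 0)"
   unfolding G_def by (intro sum.cong) auto
  thus ?thesis using True by (simp add: sum.delta)
 next
  case False
  hence "t ~: cell k j" for j by (auto simp: cell_def)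
  hence "G k t = 0" by (simp add: G_def)
  thus ?thesis by (simp only: False simp_thms if_False)
 qed
 have pos: "\<forall>\<^sub>F k in sequentially. 0 < dt k" using ws by eventually_elim (simp add: well_sampled_def)
 have G_grid: "\<forall>\<^sub>F k in sequentially. ?G k = (\<integral>t. G k t \<partial>lborel)"
  using ws
 proof eventually_elim
  case (elim k)
  have dt: "0 < dt k" using elim by (simp add: well_sampled_def)
  have step: "EX u. real i * dt k < u & u <= real (Suc i) * dt k &
   frozen s ?P {real i * dt k..<u} & frozen s ?P {u..real (Suc i) * dt k}" if "Suc i < n k" for i
  proof -
   have "real i * dt k <= real (n k) * dt k" using that dt by (intro mult_right_mono) auto
   also have "... <= T'" by (rule n(2))
   finally show ?thesis using elim unfolding well_sampled_def by blast
  qed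
  have inner: "(\<Sum>p | p \<in> alive ?P ta (real i * dt k) & type_A p. occ_weight H T (dt k) (s p (real i * dt k)) i)
    = f (real i * dt k) * cell_weight T (dt k) i" for i
  proof -
   let ?A = "{p. p : alive ?P ta (real i * dt k) & type_A p}"
   have "finite ?A" using P by (simp add: alive_def)
   hence "(SUM p:?A. occ_weight H T (dt k) (s p (real i * dt k)) i)
    = (SUM p:{p\<in>?A. s p (real i * dt k) : H}. cell_weight T (dt k) i)"
    unfolding occ_weight_def by (rule sum.inter_filter[symmetric])
   also have "{p\<in>?A. s p (real i * dt k) : H} = {p : alive ?P ta (real i * dt k). type_A p & s p (real i * dt k) : H}"
    by auto
   finally show ?thesis by (simp add: f_def)
  qed
  have "?G k = (\<Sum>i=0..<n k. \<Sum>p | p \<in> alive ?P ta (real i * dt k) & type_A p.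
    occ_weight H T (dt k) (s p (real i * dt k)) i)"
   using grid_occupation_alive[OF P snd ta dt _ step, where j = 0 and c = "occ_weight H T (dt k)"] by simp
  thus ?case by (simp add: inner Gint lessThan_atLeast0)
 qed
 have lim: "AE t in lborel. (%k. G k t) ~~> f t * indicator {0..T} t"
  \<comment> \<open>The end point is excluded because \<open>real (n k) * dt k\<close> may equal
    \<open>T\<close>; the cell starting at \<open>T\<close> is then not among the summands.\<close>
  using fr AE_lborel_singleton[of T]
 proof eventually_elim
  case (elim t)
  show ?case
  proof (cases "t : {0..T}")
   case True
   hence "\<forall>\<^sub>F k in sequentially. frozen s ?P {real (nat \<lfloor>t / dt k\<rfloor>) * dt k..t}" using elim by blast
   hence "\<forall>\<^sub>F k in sequentially. G k t = f t"
    using pos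
   proof eventually_elim
    case k: (elim k)
    let ?q = "real (nat \<lfloor>t / dt k\<rfloor>) * dt k"
    have t: "0 <= t" "t < T" using True elim(2) by auto
    have mem: "t : {?q..<real (Suc (nat \<lfloor>t / dt k\<rfloor>)) * dt k}"
     using floor_cell[OF k(2) t(1)] by blast
    have q: "0 <= ?q" "?q <= t"
     using mem k(2) by (simp_all only: atLeastLessThan_iff mult_nonneg_nonneg of_nat_0_le_iff less_imp_le)
    have "?q < real (n k) * dt k" using q(2) t(2) n(1)[of k] by linarith
    hence "nat \<lfloor>t / dt k\<rfloor> < n k" using k(2) by simp
    moreover have "alive ?P ta t = alive ?P ta ?q"
     using alive_frozen[OF P snd ta q k(1)] .
    moreover have "s p ?q = s p t" if "p : alive ?P ta t" for p
     using k(1) q that by (auto simp: frozen_def alive_def)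
    hence "{p : alive ?P ta t. type_A p & s p t : H} = {p : alive ?P ta t. type_A p & s p ?q : H}"
     by (intro Collect_cong conj_cong refl) simp
    ultimately show ?case using True G_eq[OF k(2), of t] by (simp add: f_def)
   qed
   thus ?thesis using True by (auto intro: tendsto_eventually)
  next
   case False
   thus ?thesis by (simp add: G_def cell_def)
  qed
 qed
 \<comment> \<open>The pointwise limit is a measurable version of \<open>f\<close> on
   \<open>{0..T}\<close>.\<close>
 define F where "F t = lim (%k. G k t)" for t
 have Fm: "F : borel_measurable lborel"
  unfolding F_def by (intro borel_measurable_lim_metric borel_measurable_integrable Gint)
 have F_eq: "AE t in lborel. F t = f t * indicator {0..T} t"
  using lim by eventually_elim (simp add: F_def limI)
 have bound: "AE t in lborel. norm (G k t) <= real (card ?P) * indicator {0..T} t" if "0 < dt k" for k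
  by (intro AE_I2) (simp add: G_eq[OF that] fP)
 obtain k1 where k1: "!!k. k1 <= k ==> 0 < dt k" using pos by (auto simp: eventually_sequentially)
 have "(%k. \<integral>t. G (k + k1) t \<partial>lborel) ~~> (\<integral>t. F t \<partial>lborel)"
 proof (rule integral_dominated_convergence[where w = "%t. real (card ?P) * indicator {0..T} t"])
  show "AE t in lborel. (%k. G (k + k1) t) ~~> F t"
   using lim F_eq
  proof eventually_elim
   case (elim t)
   thus ?case using LIMSEQ_ignore_initial_segment[OF elim(1), of k1] by (simp only: elim(2))
  qed
  show "integrable lborel (%t. real (card ?P) * indicator {0..T} t)"
   by (intro integrable_mult_right integrable_real_indicator) (auto simp: T)
  show "AE t in lborel. norm (G (k + k1) t) <= real (card ?P) * indicator {0..T} t" for k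
   by (rule bound) (simp add: k1)
 qed (use Fm Gint in auto)
 hence "(%k. \<integral>t. G k t \<partial>lborel) ~~> (\<integral>t. F t \<partial>lborel)" by (rule LIMSEQ_offset)
 moreover have "(\<integral>t. F t \<partial>lborel) = enn2real (occupation_time H (finite_dlas V ze s h) T)"
 proof -
  have "(\<integral>t. F t \<partial>lborel) = enn2real (\<integral>\<^sup>+t. ennreal (F t) \<partial>lborel)"
   by (rule integral_eq_nn_integral[OF Fm]) (use F_eq in eventually_elim, simp add: fP)
  also have "(\<integral>\<^sup>+t. ennreal (F t) \<partial>lborel) = (\<integral>\<^sup>+t. ennreal (f t) * indicator {0..T} t \<partial>lborel)"
   by (rule nn_integral_cong_AE) (use F_eq in eventually_elim, simp add: indicator_def)
  finally show ?thesis by (simp add: occ f_def)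
 qed
 ultimately show "?G ~~> enn2real (occupation_time H (finite_dlas V ze s h) T)"
  using tendsto_cong[OF G_grid] by simp
qed

section \<open>Counting renewals on a grid\<close>

text \<open>
 \<open>fits dt a ns w\<close>: a renewal process with waiting times \<open>w\<close> has \<open>ns ! 0\<close> points up to time \<open>a\<close> and
 \<open>ns ! j\<close> points in the \<open>j\<close>th of the following intervals of length \<open>dt\<close>.
\<close>

primrec fits1 :: "((nat => real) => bool) => nat => real => (nat => real) => bool" where
 "fits1 C 0 a w \<longleftrightarrow> a < w 0 & C (case_nat (w 0 - a) (%i. w (Suc i)))"
| "fits1 C (Suc m) a w \<longleftrightarrow> w 0 <= a & fits1 C m (a - w 0) (%i. w (Suc i))"

primrec fits :: "real => real => nat list => (nat => real) => bool" where
 "fits dt a [] w \<longleftrightarrow> True"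
| "fits dt a (m # ns) w \<longleftrightarrow> fits1 (fits dt dt ns) m a w"

text \<open>\<open>fits1\<close> consumes waiting times and keeps the residual of the current one;
  unrolling it turns residuals back into partial sums. The argument \<open>a\<close> is the time
  left in the current interval.\<close>

lemma fits_iff:
 assumes "0 <= a" "0 <= dt" "!!i. 0 <= w i"
 shows "fits dt a ns w \<longleftrightarrow> (\<forall>j<length ns.
  (\<Sum>i<sum_list (take (Suc j) ns). w i) <= a + real j * dt &
  a + real j * dt < (\<Sum>i<Suc (sum_list (take (Suc j) ns)). w i))"
 using assms
proof (induction ns arbitrary: a w)
 case Nil
 thus ?case by simp
next
 case (Cons m ns)
 show ?case
  using Cons.prems
 proof (induction m arbitrary: a w)
  case 0
  let ?w = "case_nat (w 0 - a) (%i. w (Suc i))"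
  have all: "(\<forall>j<length (0 # ns). P j) \<longleftrightarrow> P 0 & (\<forall>j<length ns. P (Suc j))" for P
   by (auto simp: less_Suc_eq_0_disj)
  have sum: "(\<Sum>i<Suc k. ?w i) = (\<Sum>i<Suc k. w i) - a" for k
   by (simp add: sum.lessThan_Suc_shift del: sum.lessThan_Suc)
  have le: "(\<Sum>i<k. ?w i) <= dt + real j * dt \<longleftrightarrow> (\<Sum>i<k. w i) <= a + real (Suc j) * dt" for k j
  proof (cases k)
   case 0
   have "0 <= dt + real j * dt" "0 <= a + real (Suc j) * dt" using Cons.prems(2) "0.prems"(1) by auto
   thus ?thesis by (simp only: 0 lessThan_0 sum.empty)
  next
   case (Suc k')
   thus ?thesis unfolding Suc sum by (simp add: field_simps)
  qed
  have lt: "dt + real j * dt < (\<Sum>i<Suc k. ?w i) \<longleftrightarrow> a + real (Suc j) * dt < (\<Sum>i<Suc k. w i)" for k j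
   unfolding sum by (simp add: field_simps)
  show ?case
  proof (cases "a < w 0")
   case True
   hence nn: "0 <= ?w i" for i using "0.prems"(3) by (cases i) auto
   have "fits dt a (0 # ns) w \<longleftrightarrow> fits dt dt ns ?w" using True by simp
   also have "... \<longleftrightarrow> (\<forall>j<length ns.
    (\<Sum>i<sum_list (take (Suc j) ns). ?w i) <= dt + real j * dt &
    dt + real j * dt < (\<Sum>i<Suc (sum_list (take (Suc j) ns)). ?w i))"
    by (rule Cons.IH) (use Cons.prems(2) nn in auto)
   also have "... \<longleftrightarrow> (\<forall>j<length (0 # ns).
    (\<Sum>i<sum_list (take (Suc j) (0 # ns)). w i) <= a + real j * dt &
    a + real j * dt < (\<Sum>i<Suc (sum_list (take (Suc j) (0 # ns))). w i))"
    unfolding all le lt using True "0.prems"(1) by simp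
   finally show ?thesis .
  next
   case False
   thus ?thesis unfolding all by simp
  qed
 next
  case (Suc m)
  have all: "(\<forall>j<length (k # ns). P j) \<longleftrightarrow> P 0 & (\<forall>j<length ns. P (Suc j))" for P and k :: nat
   by (auto simp: less_Suc_eq_0_disj)
  have sum: "(\<Sum>i<Suc k. w i) = w 0 + (\<Sum>i<k. w (Suc i))" for k
   by (simp add: sum.lessThan_Suc_shift del: sum.lessThan_Suc)
  show ?case
  proof (cases "w 0 <= a")
   case True
   have "fits dt a (Suc m # ns) w \<longleftrightarrow> fits dt (a - w 0) (m # ns) (%i. w (Suc i))"
    using True by simp
   also have "... \<longleftrightarrow> (\<forall>j<length (m # ns).
    (\<Sum>i<sum_list (take (Suc j) (m # ns)). w (Suc i)) <= a - w 0 + real j * dt &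
    a - w 0 + real j * dt < (\<Sum>i<Suc (sum_list (take (Suc j) (m # ns))). w (Suc i)))"
    by (rule Suc.IH) (use True Suc.prems in auto)
   also have "... \<longleftrightarrow> (\<forall>j<length (Suc m # ns).
    (\<Sum>i<Suc (sum_list (take (Suc j) (m # ns))). w i) <= a + real j * dt &
    a + real j * dt < (\<Sum>i<Suc (Suc (sum_list (take (Suc j) (m # ns)))). w i))"
    unfolding sum[of "Suc (sum_list _)"] sum[of "sum_list _"] by (simp only: list.size) (auto simp: algebra_simps)
   finally show ?thesis by simp
  next
   case False
   have "0 <= (\<Sum>i<k. w (Suc i))" for k using Suc.prems by (intro sum_nonneg) auto
   note this[of m]
   hence "\<not> (\<Sum>i<sum_list (take (Suc 0) (Suc m # ns)). w i) <= a + real 0 * dt"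
    using False sum[of m] \<open>0 <= (\<Sum>i<m. w (Suc i))\<close> by (simp del: sum.lessThan_Suc)
   thus ?thesis using False unfolding all by simp
  qed
 qed
qed

section \<open>Poisson counts from exponential waiting times\<close>

abbreviation exp_measure :: "real measure" where
 "exp_measure \<equiv> density lborel (exponential_density 1)"

abbreviation exp_seq :: "(nat => real) measure" where
 "exp_seq \<equiv> PiM UNIV (%_. exp_measure)"

lemma exp_seq_space: "sequence_space exp_measure"
proof -
 interpret prob_space exp_measure by (rule prob_space_exponential_density) simp
 show ?thesis by unfold_locales
qed

lemma measurable_exp_seq_component [measurable]: "(%w. w i) : borel_measurable exp_seq"
 using measurable_component_singleton[of i UNIV "%_. exp_measure"] by simp

lemma measurable_exp_seqI:
 assumes "!!i. (%x. f x i) : borel_measurable M"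
 shows "f : measurable M exp_seq"
 using assms by (intro measurable_PiM_single') (auto simp: PiE_def)

lemma measurable_fits1:
 assumes C: "Measurable.pred exp_seq C"
 shows "Measurable.pred (borel \<Otimes>\<^sub>M exp_seq) (%(a, w). fits1 C m a w)"
proof (induction m)
 case 0
 have "(%x. case_nat (snd x 0 - fst x) (%i. snd x (Suc i))) : measurable (borel \<Otimes>\<^sub>M exp_seq) exp_seq"
  by (rule measurable_exp_seqI) (simp split: nat.split)
 from measurable_compose[OF this C] show ?case by (simp add: case_prod_beta)
next
 case (Suc m)
 have "(%x. (fst x - snd x 0, %i. snd x (Suc i))) : measurable (borel \<Otimes>\<^sub>M exp_seq) (borel \<Otimes>\<^sub>M exp_seq)"
  by (intro measurable_Pair measurable_exp_seqI) auto
 from measurable_compose[OF this Suc] show ?case by (simp add: case_prod_beta)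
qed

lemma measurable_fits1' [measurable]:
 "Measurable.pred exp_seq C ==> Measurable.pred exp_seq (fits1 C m a)"
 using measurable_compose[OF measurable_Pair1'[of a borel exp_seq] measurable_fits1[of C m]] by simp

lemma measurable_fits [measurable]: "Measurable.pred exp_seq (fits dt a ns)"
proof (induction ns arbitrary: a)
 case Nil
 have "fits dt a [] = (%_. True)" by (simp add: fun_eq_iff)
 thus ?case by simp
next
 case (Cons m ns)
 have "fits dt a (m # ns) = fits1 (fits dt dt ns) m a" by (simp add: fun_eq_iff)
 thus ?case using measurable_fits1'[OF Cons] by simp
qed

lemma space_exp_seq [simp]: "space exp_seq = UNIV" by (simp add: space_PiM PiE_def)

lemma exp_seq_case_nat:
 assumes C [measurable]: "Measurable.pred exp_seq C"
 shows "(\<integral>\<^sup>+w. indicator {w. C w} (case_nat x w) \<partial>exp_seq) = emeasure exp_seq {w. C (case_nat x w)}"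
  and "(%x. emeasure exp_seq {w. C (case_nat x w)}) : borel_measurable borel"
proof -
 interpret sequence_space exp_measure by (rule exp_seq_space)
 have set: "{w. C w} : sets exp_seq" using C by (simp add: pred_def)
 have m: "case_nat x : measurable exp_seq exp_seq" for x
  by (rule measurable_exp_seqI) (simp split: nat.split)
 have "{w. C (case_nat x w)} : sets exp_seq" for x
  using measurable_compose[OF m C, of x] by (simp add: pred_def)
 note csets = this
 show eq: "(\<integral>\<^sup>+w. indicator {w. C w} (case_nat x w) \<partial>exp_seq) = emeasure exp_seq {w. C (case_nat x w)}" for x
 proof -
  have "(%w. indicator {w. C w} (case_nat x w) :: ennreal) = indicator {w. C (case_nat x w)}"
   by (simp add: fun_eq_iff indicator_def)
  thus ?thesis using csets[of x] by (simp only: nn_integral_indicator)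
 qed
 have "(%(x, w). case_nat x w) : measurable (borel \<Otimes>\<^sub>M exp_seq) exp_seq"
  by (rule measurable_exp_seqI) (simp split: nat.split add: case_prod_beta)
 hence "(%z. indicator {w. C w} ((%(x, w). case_nat x w) z) :: ennreal) : borel_measurable (borel \<Otimes>\<^sub>M exp_seq)"
  by (rule measurable_compose) (use set in simp)
 hence "(%(x, w). indicator {w. C w} (case_nat x w) :: ennreal) : borel_measurable (borel \<Otimes>\<^sub>M exp_seq)"
  by (simp add: case_prod_beta)
 from P.borel_measurable_nn_integral[OF this]
 show "(%x. emeasure exp_seq {w. C (case_nat x w)}) : borel_measurable borel" by (simp add: eq)
qed

lemma emeasure_exp_seq_split:
 assumes C [measurable]: "Measurable.pred exp_seq C"
 shows "emeasure exp_seq {w. C w} =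
  (\<integral>\<^sup>+x. ennreal (exponential_density 1 x) * emeasure exp_seq {w. C (case_nat x w)} \<partial>lborel)"
proof -
 interpret sequence_space exp_measure by (rule exp_seq_space)
 have set: "{w. C w} : sets exp_seq" using C by (simp add: pred_def)
 have m: "(%(s, om). case_nat s om) : measurable (exp_measure \<Otimes>\<^sub>M exp_seq) exp_seq"
  by (rule measurable_exp_seqI) (simp split: nat.split add: case_prod_beta)
 have i: "(indicator {w. C w} :: _ => ennreal) : borel_measurable exp_seq" using set by simp
 have "emeasure exp_seq {w. C w} = (\<integral>\<^sup>+w. indicator {w. C w} w \<partial>exp_seq)"
  using set by simp
 also have "... = (\<integral>\<^sup>+w. indicator {w. C w} w \<partial>distr (exp_measure \<Otimes>\<^sub>M exp_seq) exp_seq (%(s, om). case_nat s om))"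
  by (simp only: PiM_iter)
 also have "... = (\<integral>\<^sup>+z. indicator {w. C w} ((%(s, om). case_nat s om) z) \<partial>(exp_measure \<Otimes>\<^sub>M exp_seq))"
  using i by (subst nn_integral_distr[OF m]) simp_all
 also have "... = (\<integral>\<^sup>+x. \<integral>\<^sup>+w. indicator {w. C w} (case_nat x w) \<partial>exp_seq \<partial>exp_measure)"
  using P.nn_integral_fst[OF measurable_compose[OF m i]] by simp
 also have "... = (\<integral>\<^sup>+x. emeasure exp_seq {w. C (case_nat x w)} \<partial>exp_measure)"
  by (simp add: exp_seq_case_nat(1)[OF C])
 also have "... = (\<integral>\<^sup>+x. ennreal (exponential_density 1 x) * emeasure exp_seq {w. C (case_nat x w)} \<partial>lborel)"
  by (rule nn_integral_density) (use exp_seq_case_nat(2)[OF C] in simp_all)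
 finally show ?thesis .
qed

text \<open>Memorylessness. For \<open>m = 0\<close> the first waiting time exceeds \<open>a\<close>
  with probability \<open>exp (- a)\<close>, and the excess is exponential again. For
  \<open>Suc m\<close> one integrates over the first waiting time \<open>x\<close>; the two
  exponentials combine to \<open>exp (- a)\<close>, and the integral of
  \<open>(a - x) ^ m / fact m\<close> gives the next Poisson weight.\<close>

lemma emeasure_fits1:
 assumes C [measurable]: "Measurable.pred exp_seq C" and "0 <= a"
 shows "emeasure exp_seq {w. fits1 C m a w} = ennreal (a ^ m / fact m * exp (- a)) * emeasure exp_seq {w. C w}"
 using \<open>0 <= a\<close>
proof (induction m arbitrary: a)
 case 0
 define ph where "ph y = emeasure exp_seq {w. C (case_nat y w)}" for y
 have ph: "ph : borel_measurable borel" unfolding ph_def by (rule exp_seq_case_nat(2)[OF C])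
 have "emeasure exp_seq {w. fits1 C 0 a w} =
   (\<integral>\<^sup>+x. ennreal (exponential_density 1 x) * emeasure exp_seq {w. fits1 C 0 a (case_nat x w)} \<partial>lborel)"
  by (rule emeasure_exp_seq_split) (rule measurable_fits1'[OF C])
 also have "... = (\<integral>\<^sup>+x. ennreal (exponential_density 1 x) * (indicator {a<..} x * ph (x - a)) \<partial>lborel)"
  by (intro nn_integral_cong) (auto simp: ph_def indicator_def)
 also have "... = (\<integral>\<^sup>+y. ennreal (exponential_density 1 (a + 1 * y)) * (indicator {a<..} (a + 1 * y) * ph (a + 1 * y - a)) \<partial>lborel)"
  using ph by (subst nn_integral_real_affine[of _ 1 a]) simp_all
 also have "... = (\<integral>\<^sup>+y. ennreal (exp (- a)) * (ennreal (exponential_density 1 y) * ph y) \<partial>lborel)"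
 proof (rule nn_integral_cong_AE)
  show "AE y in lborel. ennreal (exponential_density 1 (a + 1 * y)) * (indicator {a<..} (a + 1 * y) * ph (a + 1 * y - a))
   = ennreal (exp (- a)) * (ennreal (exponential_density 1 y) * ph y)"
   using AE_lborel_singleton[of 0]
  proof eventually_elim
   case (elim y)
   thus ?case using "0.prems"
    by (auto simp: exponential_density_def indicator_def exp_add[symmetric] ennreal_mult'[symmetric] mult.assoc[symmetric])
  qed
 qed
 also have "... = ennreal (exp (- a)) * emeasure exp_seq {w. C w}"
  unfolding emeasure_exp_seq_split[OF C] ph_def[symmetric] by (rule nn_integral_cmult) (use ph in simp)
 finally show ?case by simp
next
 case (Suc m)
 let ?c = "emeasure exp_seq {w. C w}"
 have "emeasure exp_seq {w. fits1 C (Suc m) a w} =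
   (\<integral>\<^sup>+x. ennreal (exponential_density 1 x) * emeasure exp_seq {w. fits1 C (Suc m) a (case_nat x w)} \<partial>lborel)"
  by (rule emeasure_exp_seq_split) (rule measurable_fits1'[OF C])
 also have "... = (\<integral>\<^sup>+x. (ennreal (exp (- a) * (a - x) ^ m / fact m) * indicator {0..a} x) * ?c \<partial>lborel)"
 proof (intro nn_integral_cong)
  fix x :: real
  have "exp (- x) * ((a - x) ^ m / fact m * exp (- (a - x))) = exp (- a) * (a - x) ^ m / fact m"
   by (simp add: exp_diff exp_minus field_simps)
  hence *: "ennreal (exp (- x)) * ennreal ((a - x) ^ m / fact m * exp (- (a - x))) = ennreal (exp (- a) * (a - x) ^ m / fact m)"
   by (simp only: ennreal_mult'[symmetric] exp_ge_zero)
  show "ennreal (exponential_density 1 x) * emeasure exp_seq {w. fits1 C (Suc m) a (case_nat x w)}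
    = (ennreal (exp (- a) * (a - x) ^ m / fact m) * indicator {0..a} x) * ?c"
  proof (cases "0 <= x & x <= a")
   case True
   have "emeasure exp_seq {w. fits1 C m (a - x) w} = ennreal ((a - x) ^ m / fact m * exp (- (a - x))) * ?c"
    by (rule Suc.IH) (use True in simp)
   thus ?thesis using True *
    by (simp add: exponential_density_def mult.assoc[symmetric] del: fact_Suc)
  next
   case False
   thus ?thesis by (auto simp: exponential_density_def indicator_def)
  qed
 qed
 also have "... = (\<integral>\<^sup>+x. ennreal (exp (- a) * (a - x) ^ m / fact m) * indicator {0..a} x \<partial>lborel) * ?c"
  by (rule nn_integral_multc) simp
 also have "(\<integral>\<^sup>+x. ennreal (exp (- a) * (a - x) ^ m / fact m) * indicator {0..a} x \<partial>lborel) =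
   ennreal ((- (exp (- a) * (a - a) ^ Suc m / fact (Suc m))) - (- (exp (- a) * (a - 0) ^ Suc m / fact (Suc m))))"
 proof (rule nn_integral_FTC_Icc[where F = "%x. - (exp (- a) * (a - x) ^ Suc m / fact (Suc m))"])
  fix x assume "x : {0..a}"
  have "((%x. - (exp (- a) * (a - x) ^ Suc m / fact (Suc m))) has_real_derivative
   - (exp (- a) * (real (Suc m) * (a - x) ^ m * (0 - 1)) / fact (Suc m))) (at x)"
   by (auto intro!: derivative_eq_intros simp del: power_Suc fact_Suc)
  moreover have "- (exp (- a) * (real (Suc m) * (a - x) ^ m * (0 - 1)) / fact (Suc m)) = exp (- a) * (a - x) ^ m / fact m"
   by (simp add: field_simps del: of_nat_Suc)
  ultimately show "((%x. - (exp (- a) * (a - x) ^ Suc m / fact (Suc m))) has_real_derivative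
   exp (- a) * (a - x) ^ m / fact m) (at x)" by simp
 qed (use Suc.prems in auto)
 finally show ?case by (simp add: mult.commute)
qed

section \<open>Path laws of chains and their Poissonisation\<close>

primrec kernel_power :: "('v => 'v pmf) => nat => 'v => 'v pmf" where
 "kernel_power K 0 x = return_pmf x"
| "kernel_power K (Suc m) x = bind_pmf (K x) (kernel_power K m)"

primrec chain :: "('v => 'v pmf) => nat => 'v => 'v list pmf" where
 "chain K 0 x = return_pmf [x]"
| "chain K (Suc n) x = map_pmf ((#) x) (bind_pmf (K x) (chain K n))"

primrec subsample :: "nat list => 'v list => 'v list" where
 "subsample [] l = [hd l]"
| "subsample (m # ns) l = hd l # subsample ns (drop m l)"

primrec poisson_counts :: "real => nat => nat list pmf" where
 "poisson_counts dt 0 = return_pmf []"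
| "poisson_counts dt (Suc n) = bind_pmf (poisson_pmf dt) (%m. map_pmf ((#) m) (poisson_counts dt n))"

text \<open>The transition kernel over time \<open>dt\<close> of the continuous-time walk that jumps
  by \<open>K\<close> at unit rate.\<close>

definition poisson_kernel :: "('v => 'v pmf) => real => 'v => 'v pmf" where
 "poisson_kernel K dt x = bind_pmf (poisson_pmf dt) (%m. kernel_power K m x)"

lemma set_pmf_kernel_power:
 assumes "ALL x:V. set_pmf (K x) <= V"
 shows "x : V ==> set_pmf (kernel_power K m x) <= V"
 using assms by (induction m arbitrary: x) (simp_all, blast)

lemma set_pmf_poisson_kernel:
 assumes "ALL x:V. set_pmf (K x) <= V"
 shows "x : V ==> set_pmf (poisson_kernel K dt x) <= V"
 using set_pmf_kernel_power[of V K, OF assms] by (auto simp: poisson_kernel_def)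

lemma set_pmf_chain:
 assumes "ALL x:V. set_pmf (K x) <= V"
 shows "x : V ==> l : set_pmf (chain K n x) ==> length l = Suc n & hd l = x & set l <= V"
 using assms by (induction n arbitrary: x l) (auto, blast+)

lemma chain_shape: "l : set_pmf (chain K n x) ==> length l = Suc n & hd l = x"
 using set_pmf_chain[of UNIV K x l n] by simp

lemma pmf_chain:
 "pmf (chain K n x) l =
  (if length l = Suc n & hd l = x then \<Prod>i<n. pmf (K (l ! i)) (l ! Suc i) else 0)"
proof (induction n arbitrary: x l)
 case 0
 thus ?case by (cases l) (auto simp: pmf_return)
next
 case (Suc n)
 show ?case
 proof (cases l)
  case Nil
  hence "l ~: set_pmf (chain K (Suc n) x)" by auto
  thus ?thesis using Nil by (simp add: set_pmf_iff del: chain.simps)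
 next
  case (Cons y l')
  have "pmf (chain K (Suc n) x) l = (if y = x then pmf (bind_pmf (K x) (chain K n)) l' else 0)"
  proof (cases "y = x")
   case True
   thus ?thesis using Cons by (simp add: pmf_map_inj')
  next
   case False
   hence "l ~: set_pmf (chain K (Suc n) x)" using Cons by auto
   thus ?thesis using False by (simp add: set_pmf_iff del: chain.simps)
  qed
  also have "pmf (bind_pmf (K x) (chain K n)) l' =
    (\<integral>z. pmf (chain K n (hd l')) l' * indicator {hd l'} z \<partial>measure_pmf (K x))"
   unfolding pmf_bind by (intro Bochner_Integration.integral_cong) (auto simp: Suc indicator_def)
  also have "... = pmf (K x) (hd l') * pmf (chain K n (hd l')) l'"
   by (simp add: measure_pmf_single)
  finally show ?thesis
  proof -
   assume *: "pmf (chain K (Suc n) x) l =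
    (if y = x then pmf (K x) (hd l') * pmf (chain K n (hd l')) l' else 0)"
   have "(\<Prod>i<Suc n. pmf (K (l ! i)) (l ! Suc i)) = pmf (K y) (l' ! 0) * (\<Prod>i<n. pmf (K (l' ! i)) (l' ! Suc i))"
    using Cons by (simp add: prod.lessThan_Suc_shift del: prod.lessThan_Suc)
   thus ?thesis unfolding * Suc using Cons by (cases l') (auto simp: hd_conv_nth)
  qed
 qed
qed

lemma chain_drop: "map_pmf (drop m) (chain K (m + k) x) = bind_pmf (kernel_power K m x) (chain K k)"
proof (induction m arbitrary: x)
 case 0
 thus ?case by (simp add: bind_return_pmf map_pmf_ident[unfolded id_def] drop_0[abs_def])
next
 case (Suc m)
 have "map_pmf (drop (Suc m)) (chain K (Suc m + k) x) = bind_pmf (K x) (%y. map_pmf (drop m) (chain K (m + k) y))"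
  by (simp add: pmf.map_comp o_def map_bind_pmf)
 thus ?case by (simp add: Suc bind_assoc_pmf)
qed

primrec subsampled_chain :: "('v => 'v pmf) => nat list => 'v => 'v list pmf" where
 "subsampled_chain K [] x = return_pmf [x]"
| "subsampled_chain K (m # ns) x = map_pmf ((#) x) (bind_pmf (kernel_power K m x) (subsampled_chain K ns))"

lemma map_subsample: "map_pmf (subsample ns) (chain K (sum_list ns) x) = subsampled_chain K ns x"
proof (induction ns arbitrary: x)
 case Nil
 thus ?case by simp
next
 case (Cons m ns)
 have "map_pmf (subsample (m # ns)) (chain K (sum_list (m # ns)) x) =
   map_pmf (%l. x # subsample ns (drop m l)) (chain K (m + sum_list ns) x)"
  by (rule map_pmf_cong) (use chain_shape in \<open>force+\<close>)
 also have "... = map_pmf (%l. x # subsample ns l) (map_pmf (drop m) (chain K (m + sum_list ns) x))"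
  by (simp add: pmf.map_comp o_def)
 also have "... = map_pmf ((#) x) (bind_pmf (kernel_power K m x) (%y. map_pmf (subsample ns) (chain K (sum_list ns) y)))"
  unfolding chain_drop by (simp add: map_bind_pmf pmf.map_comp o_def)
 finally show ?case by (simp only: Cons subsampled_chain.simps)
qed

text \<open>Each count is averaged separately: a stretch of \<open>m\<close> steps of
  \<open>K\<close> with Poisson \<open>m\<close> becomes one step of \<open>poisson_kernel\<close>,
  and the later counts are independent of where it ends.\<close>

lemma bind_poisson_counts:
 "bind_pmf (poisson_counts dt n) (%ns. subsampled_chain K ns x) = chain (poisson_kernel K dt) n x"
proof (induction n arbitrary: x)
 case 0
 thus ?case by (simp add: bind_return_pmf)
next
 case (Suc n)
 have "bind_pmf (poisson_counts dt (Suc n)) (%ns. subsampled_chain K ns x) =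
  bind_pmf (poisson_pmf dt) (%m. bind_pmf (poisson_counts dt n)
   (%ns. bind_pmf (kernel_power K m x) (%y. map_pmf ((#) x) (subsampled_chain K ns y))))"
  by (simp add: bind_assoc_pmf bind_map_pmf map_bind_pmf)
 also have "... = bind_pmf (poisson_pmf dt) (%m. bind_pmf (kernel_power K m x)
   (%y. bind_pmf (poisson_counts dt n) (%ns. map_pmf ((#) x) (subsampled_chain K ns y))))"
  by (subst bind_commute_pmf) (rule refl)
 also have "... = map_pmf ((#) x) (bind_pmf (poisson_pmf dt) (%m. bind_pmf (kernel_power K m x)
   (%y. bind_pmf (poisson_counts dt n) (%ns. subsampled_chain K ns y))))"
  by (simp add: map_bind_pmf)
 finally show ?case by (simp add: Suc poisson_kernel_def bind_assoc_pmf)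
qed

lemma pmf_poisson_counts:
 assumes "0 < dt"
 shows "length ns = n ==> pmf (poisson_counts dt n) ns = (\<Prod>m\<leftarrow>ns. dt ^ m / fact m * exp (- dt))"
proof (induction ns arbitrary: n)
 case Nil
 thus ?case by simp
next
 case (Cons m ns)
 then obtain n' where n: "n = Suc n'" "length ns = n'" by auto
 have "pmf (poisson_counts dt n) (m # ns) =
   (\<integral>k. pmf (poisson_counts dt n') ns * indicator {m} k \<partial>measure_pmf (poisson_pmf dt))"
  unfolding n poisson_counts.simps pmf_bind
 proof (intro Bochner_Integration.integral_cong refl)
  fix k
  show "pmf (map_pmf ((#) k) (poisson_counts dt n')) (m # ns) = pmf (poisson_counts dt n') ns * indicator {m} k"
  proof (cases "k = m")
   case True
   thus ?thesis by (simp add: pmf_map_inj')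
  next
   case False
   hence "m # ns ~: set_pmf (map_pmf ((#) k) (poisson_counts dt n'))" by auto
   hence "pmf (map_pmf ((#) k) (poisson_counts dt n')) (m # ns) = 0" by (simp only: set_pmf_iff not_not)
   thus ?thesis using False by simp
  qed
 qed
 also have "... = pmf (poisson_pmf dt) m * pmf (poisson_counts dt n') ns" by (simp add: measure_pmf_single)
 finally show ?case using Cons.IH[OF n(2)] assms by simp
qed

lemma set_poisson_counts: "ns : set_pmf (poisson_counts dt n) ==> length ns = n"
 by (induction n arbitrary: ns) auto

lemma emeasure_fits:
 assumes "0 < dt"
 shows "emeasure exp_seq {w. fits dt dt ns w} = ennreal (pmf (poisson_counts dt (length ns)) ns)"
proof (induction ns)
 case Nil
 interpret prob_space exp_seq using exp_seq_space
  by (simp add: product_prob_space_def sequence_space_def prob_space_PiM product_prob_space_axioms_def)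
 show ?case using emeasure_space_1 by simp
next
 case (Cons m ns)
 have "emeasure exp_seq {w. fits dt dt (m # ns) w} = emeasure exp_seq {w. fits1 (fits dt dt ns) m dt w}" by simp
 also have "... = ennreal (dt ^ m / fact m * exp (- dt)) * ennreal (pmf (poisson_counts dt (length ns)) ns)"
  using emeasure_fits1[OF measurable_fits, of dt dt dt ns m] Cons assms by simp
 also have "... = ennreal (pmf (poisson_counts dt (length (m # ns))) (m # ns))"
  unfolding pmf_poisson_counts[OF assms refl] using assms
  by (subst ennreal_mult[symmetric]) (auto intro!: prod_list_nonneg)
 finally show ?case .
qed

section \<open>Laws of walks sampled on a grid\<close>

definition samples :: "real => nat => (real => 'v) => 'v list" where
 "samples dt n s = map (%i. s (real i * dt)) [0..<Suc n]"

text \<open>\<open>markov_chain\<close> prescribes the probabilities of single finite paths; as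
  \<open>V\<close> is countable, these determine the probability of every set \<open>B\<close> of
  paths.\<close>

lemma (in prob_space) chain_law:
 assumes Y: "markov_chain M V K x Y" and V: "countable V" and K: "ALL x:V. set_pmf (K x) <= V" and x: "x : V"
 shows "emeasure M {om : space M. map (%i. Y i om) [0..<Suc m] : B} = emeasure (measure_pmf (chain K m x)) B"
proof -
 let ?L = "%om. map (%i. Y i om) [0..<Suc m]"
 have Yi [measurable]: "Y i : measurable M (count_space V)" for i using Y by (simp add: markov_chain_def)
 have YV: "Y i om : V" if "om : space M" for i om using measurable_space[OF Yi that, of i] by simp
 have cl: "countable (lists V)" using V by simp
 have L1: "{om : space M. ?L om = l} = (if length l = Suc m then {om : space M. \<forall>i\<le>m. Y i om = l ! i} else {})" for l
  by (auto simp: list_eq_iff_nth_eq less_Suc_eq_le simp del: upt_Suc)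
 have S: "{om : space M. ?L om = l} : sets M" if "l : lists V" for l
 proof (cases "length l = Suc m")
  case True
  have "{om : space M. Y i om = l ! i} : sets M" if "i <= m" for i
  proof -
   have "l ! i : V" using \<open>l : lists V\<close> True that by auto
   hence "Y i -` {l ! i} Int space M : sets M" by (intro measurable_sets[OF Yi]) simp
   thus ?thesis by (simp add: vimage_def Int_def conj_commute)
  qed
  hence "{om : space M. ALL i:{..m}. Y i om = l ! i} : sets M" by (intro sets.sets_Collect_finite_All) auto
  thus ?thesis unfolding L1 by (simp add: True)
 qed (simp add: L1 del: upt_Suc)
 have L: "?L : measurable M (count_space (lists V))"
  unfolding measurable_count_space_eq_countable[OF cl]
 proof (intro conjI ballI funcsetI)
  fix om assume "om : space M" thus "?L om : lists V" using YV by auto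
 next
  fix l assume "l : lists V"
  from S[OF this] show "?L -` {l} Int space M : sets M" by (simp add: vimage_def Int_def conj_commute)
 qed
 have pt: "emeasure M {om : space M. ?L om = l} = emeasure (measure_pmf (chain K m x)) {l}" for l
 proof (cases "length l = Suc m")
  case True
  hence "measure M {om : space M. ?L om = l} = pmf (chain K m x) l"
   using Y unfolding L1 markov_chain_def pmf_chain by (simp add: hd_conv_nth)
    (metis hd_conv_nth list.size(3) nat.distinct(1))
  thus ?thesis by (simp add: emeasure_eq_measure emeasure_pmf_single)
 next
  case False
  hence "pmf (chain K m x) l = 0" by (simp add: pmf_chain)
  thus ?thesis using False by (simp add: L1 emeasure_pmf_single del: upt_Suc)
 qed
 have "{om : space M. ?L om : B} = ?L -` (B Int lists V) Int space M" using YV by auto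
 hence "emeasure M {om : space M. ?L om : B} = emeasure (distr M (count_space (lists V)) ?L) (B Int lists V)"
  by (subst emeasure_distr[OF L]) auto
 also have "... = (\<integral>\<^sup>+l. emeasure (distr M (count_space (lists V)) ?L) {l} \<partial>count_space (B Int lists V))"
  by (rule emeasure_countable_singleton) (use cl in auto)
 also have "... = (\<integral>\<^sup>+l. emeasure (measure_pmf (chain K m x)) {l} \<partial>count_space (B Int lists V))"
 proof (intro nn_integral_cong)
  fix l assume "l : space (count_space (B Int lists V))"
  thus "emeasure (distr M (count_space (lists V)) ?L) {l} = emeasure (measure_pmf (chain K m x)) {l}"
   using pt[of l] by (subst emeasure_distr[OF L]) (auto simp: vimage_def Int_def conj_commute)
 qed
 also have "... = emeasure (measure_pmf (chain K m x)) (B Int lists V)"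
  by (rule emeasure_countable_singleton[symmetric]) (use cl in auto)
 also have "... = emeasure (measure_pmf (chain K m x)) B"
  using set_pmf_chain[of V K x _ m, OF K x] by (intro emeasure_eq_AE) (auto simp: AE_measure_pmf_iff)
 finally show ?thesis .
qed

lemma (in prob_space) discrete_walk_law:
 assumes X: "discrete_time_walk M V K x X" and V: "countable V" and K: "ALL x:V. set_pmf (K x) <= V" and x: "x : V"
  and meas: "{om : space M. samples 1 n (X om) = l} : sets M"
 shows "emeasure M {om : space M. samples 1 n (X om) = l} = pmf (chain K n x) l"
proof -
 obtain Y where Y: "markov_chain M V K x Y" and XY: "AE om in M. ALL n t. real n <= t & t < real (Suc n) --> X om t = Y n om"
  using X by (auto simp: discrete_time_walk_def)
 have "emeasure M {om : space M. samples 1 n (X om) = l} = emeasure M {om : space M. map (%i. Y i om) [0..<Suc n] : {l}}"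
 proof (rule emeasure_eq_AE)
  show "AE om in M. om : {om : space M. samples 1 n (X om) = l} \<longleftrightarrow> om : {om : space M. map (%i. Y i om) [0..<Suc n] : {l}}"
   using XY
  proof eventually_elim
   case (elim om)
   hence "X om (real i) = Y i om" for i by simp
   thus ?case by (simp add: samples_def del: upt_Suc)
  qed
  show "{om : space M. map (%i. Y i om) [0..<Suc n] : {l}} : sets M"
  proof -
   have Yi: "Y i : measurable M (count_space V)" for i using Y by (simp add: markov_chain_def)
   have "{om : space M. Y i om = y} : sets M" for i y
   proof -
    have "{om : space M. Y i om = y} = Y i -` ({y} Int V) Int space M" using measurable_space[OF Yi, of _ i] by auto
    thus ?thesis using measurable_sets[OF Yi, of "{y} Int V" i] by simp
   qed
   hence "{om : space M. ALL i:{..n}. Y i om = l ! i} : sets M" by (intro sets.sets_Collect_finite_All) auto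
   moreover have "{om : space M. map (%i. Y i om) [0..<Suc n] : {l}} = (if length l = Suc n then {om : space M. ALL i:{..n}. Y i om = l ! i} else {})"
    by (auto simp: list_eq_iff_nth_eq less_Suc_eq_le simp del: upt_Suc)
   ultimately show ?thesis by simp
  qed
 qed (rule meas)
 also have "... = pmf (chain K n x) l" unfolding chain_law[OF Y V K x] by (simp only: emeasure_pmf_single)
 finally show ?thesis .
qed

lemma subsample_nth:
 "sum_list ns < length l ==> subsample ns l = map (%j. l ! sum_list (take j ns)) [0..<Suc (length ns)]"
proof (induction ns arbitrary: l)
 case Nil
 thus ?case by (cases l) auto
next
 case (Cons m ns)
 have "hd l = l ! 0" using Cons.prems by (cases l) auto
 moreover have "subsample ns (drop m l) = map (%j. drop m l ! sum_list (take j ns)) [0..<Suc (length ns)]"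
  by (rule Cons.IH) (use Cons.prems in simp)
 moreover have "map (%j. l ! sum_list (take j (m # ns))) [0..<Suc (length (m # ns))] =
   l ! 0 # map (%j. l ! (m + sum_list (take j ns))) [0..<Suc (length ns)]"
  by (simp add: map_upt_Suc del: upt_Suc)
 ultimately show ?case using Cons.prems by (simp del: upt_Suc)
qed

lemma (in prob_space) AE_waiting_positive:
 assumes "distributed M lborel W (exponential_density 1)"
 shows "AE om in M. 0 < W om"
proof -
 have W: "W : measurable M lborel" using assms by (simp add: distributed_def)
 have "AE x in distr M lborel W. 0 < x"
  unfolding distributed_distr_eq_density[OF assms]
 proof (subst AE_density)
  show "AE x in lborel. 0 < ennreal (exponential_density 1 x) --> 0 < x"
   using AE_lborel_singleton[of 0] by eventually_elim (auto simp: exponential_density_def)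
 qed simp
 thus ?thesis by (subst (asm) AE_distr_iff[OF W]) auto
qed

lemma (in prob_space) waiting_times_law:
 assumes "indep_vars (%_. borel) W UNIV" "!!i. distributed M lborel (W i) (exponential_density 1)"
 shows "distr M (PiM UNIV (%_. borel)) (%om i. W i om) = exp_seq"
proof -
 have "distr M borel (W i) = exp_measure" for i
  using distributed_distr_eq_density[OF assms(2)[of i]] by (simp cong: distr_cong)
 moreover have "distr M (PiM UNIV (%_. borel)) (%om. \<lambda>i\<in>UNIV. W i om) = PiM UNIV (%i. distr M borel (W i))"
  using assms(1) by (subst indep_vars_iff_distr_eq_PiM'[symmetric]) (auto simp: indep_vars_def)
 ultimately show ?thesis by (simp add: restrict_def)
qed

text \<open>The events \<open>E ns\<close>, on which the numbers of jumps in successive cells are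
  \<open>ns\<close>, partition the space up to a null set. On \<open>E ns\<close> the samples are
  the jump chain subsampled at the counts, and the chain is independent of the waiting times. The
  walk is described almost surely only, hence the hypothesis that the sampled event is
  measurable.\<close>

lemma (in prob_space) continuous_walk_law:
 assumes X: "continuous_time_walk M V K x X" and V: "countable V" and K: "ALL x:V. set_pmf (K x) <= V" and x: "x : V"
  and dt: "0 < dt" and meas: "{om : space M. samples dt n (X om) = l} : sets M"
 shows "emeasure M {om : space M. samples dt n (X om) = l} = pmf (chain (poisson_kernel K dt) n x) l"
proof -
 obtain Y W where Y: "markov_chain M V K x Y" and W: "indep_vars (%_. borel) W UNIV"
  and D: "!!i. distributed M lborel (W i) (exponential_density 1)"
  and ind: "indep_set (sets (vimage_algebra (space M) (%om n. Y n om) (PiM UNIV (%_. count_space V))))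
     (sets (vimage_algebra (space M) (%om i. W i om) (PiM UNIV (%_. borel))))"
  and XY: "AE om in M. ALL n t. (\<Sum>i<n. W i om) <= t & t < (\<Sum>i<Suc n. W i om) --> X om t = Y n om"
  using X unfolding continuous_time_walk_def by blast
 have Yi: "Y i : measurable M (count_space V)" for i using Y by (simp add: markov_chain_def)
 have YV: "Y i om : V" if "om : space M" for i om using measurable_space[OF Yi that, of i] by simp
 have Wi: "W i : borel_measurable M" for i using W by (auto simp: indep_vars_def)
 have Wseq: "(%om i. W i om) : measurable M (PiM UNIV (%_. borel))"
  by (intro measurable_PiM_single') (use Wi in auto)
 define F where "F ns = {w :: nat => real. length ns = n & fits dt dt ns w}" for ns
 define E where "E ns = (%om i. W i om) -` F ns Int space M" for ns
 define C where "C ns = {om : space M. subsample ns (map (%i. Y i om) [0..<Suc (sum_list ns)]) = l}" for ns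
 have Fsets: "F ns : sets (PiM UNIV (%_. borel))" for ns
 proof -
  have "{w. fits dt dt ns w} : sets exp_seq" using measurable_fits[of dt dt ns] by (simp add: pred_def)
  moreover have "sets exp_seq = sets (PiM UNIV (%_. borel))" by (intro sets_PiM_cong) auto
  ultimately show ?thesis by (cases "length ns = n") (auto simp: F_def)
 qed
 have E_alg: "E ns : sets (vimage_algebra (space M) (%om i. W i om) (PiM UNIV (%_. borel)))" for ns
  unfolding E_def by (rule in_vimage_algebra) (rule Fsets)
 have EM: "E ns : sets M" for ns unfolding E_def by (rule measurable_sets[OF Wseq Fsets])
 have C_alg: "C ns : sets (vimage_algebra (space M) (%om n. Y n om) (PiM UNIV (%_. count_space V)))" for ns
 proof -
  let ?P = "PiM UNIV (%_::nat. count_space V)"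
  let ?f = "%y. map y [0..<Suc (sum_list ns)]"
  have cl: "countable (lists V)" using V by simp
  have f: "?f : measurable ?P (count_space (lists V))"
   unfolding measurable_count_space_eq_countable[OF cl]
  proof (intro conjI ballI funcsetI)
   fix y assume "y : space ?P" thus "?f y : lists V" by (auto simp: space_PiM PiE_def Pi_def)
  next
   fix k assume "k : lists V"
   have "{y : space ?P. ALL i:{..sum_list ns}. y i = k ! i} : sets ?P"
   proof (intro sets.sets_Collect_finite_All)
    fix i
    have "{y : space ?P. y i = k ! i} = (%y. y i) -` ({k ! i} Int V) Int space ?P"
     by (auto simp: space_PiM PiE_def Pi_def)
    also have "... : sets ?P" by (rule measurable_sets[OF measurable_component_singleton]) auto
    finally show "{y : space ?P. y i = k ! i} : sets ?P" .
   qed simp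
   moreover have "?f y = k \<longleftrightarrow> length k = Suc (sum_list ns) & (ALL i:{..sum_list ns}. y i = k ! i)" for y
    by (auto simp: list_eq_iff_nth_eq less_Suc_eq_le simp del: upt_Suc)
   hence "?f -` {k} Int space ?P = (if length k = Suc (sum_list ns) then {y : space ?P. ALL i:{..sum_list ns}. y i = k ! i} else {})"
    by (simp only: vimage_def Int_def mem_Collect_eq singleton_iff) auto
   ultimately show "?f -` {k} Int space ?P : sets ?P" by (simp del: upt_Suc)
  qed
  have "{y : space ?P. subsample ns (?f y) = l} = ?f -` {k : lists V. subsample ns k = l} Int space ?P"
   using measurable_space[OF f] by auto
  hence "{y : space ?P. subsample ns (?f y) = l} : sets ?P"
   using measurable_sets[OF f, of "{k : lists V. subsample ns k = l}"] by auto
  from in_vimage_algebra[OF this, of "%om n. Y n om" "space M"]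
  show ?thesis
   by (rule back_subst[where P = "%A. A : _"]) (use YV in \<open>auto simp: C_def space_PiM simp del: upt_Suc\<close>)
 qed
 have CM: "C ns : sets M" for ns
  using C_alg indep_setD_ev1[OF ind] by blast
 have PE: "emeasure M (E ns) = pmf (poisson_counts dt n) ns" for ns
 proof (cases "length ns = n")
  case True
  have "emeasure M (E ns) = emeasure (distr M (PiM UNIV (%_. borel)) (%om i. W i om)) (F ns)"
   unfolding E_def by (rule emeasure_distr[OF Wseq Fsets, symmetric])
  thus ?thesis unfolding waiting_times_law[OF W D] using emeasure_fits[OF dt, of ns] True by (simp add: F_def)
 next
  case False
  hence "ns ~: set_pmf (poisson_counts dt n)" using set_poisson_counts by blast
  thus ?thesis using False by (simp add: E_def F_def set_pmf_iff)
 qed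
 have PC: "emeasure M (C ns) = pmf (subsampled_chain K ns x) l" for ns
 proof -
  have "C ns = {om : space M. map (%i. Y i om) [0..<Suc (sum_list ns)] : subsample ns -` {l}}" by (auto simp: C_def)
  hence "emeasure M (C ns) = emeasure (measure_pmf (chain K (sum_list ns) x)) (subsample ns -` {l})"
   by (simp only: chain_law[OF Y V K x])
  also have "... = emeasure (measure_pmf (map_pmf (subsample ns) (chain K (sum_list ns) x))) {l}" by simp
  finally show ?thesis unfolding map_subsample by (simp add: emeasure_pmf_single)
 qed
 have PEC: "emeasure M (C ns Int E ns) = ennreal (pmf (poisson_counts dt n) ns) * ennreal (pmf (subsampled_chain K ns x) l)" for ns
 proof -
  have "prob (C ns Int E ns) = prob (C ns) * prob (E ns)" by (rule indep_setD[OF ind C_alg E_alg])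
  moreover have "prob (C ns) = pmf (subsampled_chain K ns x) l" "prob (E ns) = pmf (poisson_counts dt n) ns"
   using PC[of ns] PE[of ns] by (simp_all add: emeasure_eq_measure)
  ultimately show ?thesis by (simp add: emeasure_eq_measure ennreal_mult mult.commute)
 qed
 have pos: "AE om in M. ALL i. 0 < W i om" unfolding AE_all_countable using AE_waiting_positive[OF D] by simp
 have on_E: "AE om in M. ALL ns. om : E ns --> (\<forall>j<n. (\<Sum>i<sum_list (take (Suc j) ns). W i om) <= real (Suc j) * dt &
   real (Suc j) * dt < (\<Sum>i<Suc (sum_list (take (Suc j) ns)). W i om))"
  using pos
 proof eventually_elim
  case (elim om)
  hence "0 <= W i om" for i by (simp add: less_imp_le)
  hence "fits dt dt ns (%i. W i om) \<longleftrightarrow> (\<forall>j<length ns.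
   (\<Sum>i<sum_list (take (Suc j) ns). W i om) <= dt + real j * dt &
   dt + real j * dt < (\<Sum>i<Suc (sum_list (take (Suc j) ns)). W i om))" for ns
   by (intro fits_iff) (use dt in auto)
  moreover have "dt + real j * dt = real (Suc j) * dt" for j by (simp add: algebra_simps)
  ultimately show ?case by (simp add: E_def F_def del: sum.lessThan_Suc of_nat_Suc)
 qed
 have smp: "AE om in M. ALL ns. om : E ns --> samples dt n (X om) = subsample ns (map (%i. Y i om) [0..<Suc (sum_list ns)])"
  using on_E XY pos
 proof eventually_elim
  case (elim om)
  show ?case
  proof (intro allI impI)
   fix ns assume ns: "om : E ns"
   hence len: "length ns = n" by (auto simp: E_def F_def)
   have "X om (real j * dt) = Y (sum_list (take j ns)) om" if "j <= n" for j
   proof (cases j)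
    case 0
    thus ?thesis using elim(2,3) by simp
   next
    case (Suc j')
    hence "j' < n" using that by simp
    from elim(1)[rule_format, OF ns this] show ?thesis unfolding Suc by (intro elim(2)[rule_format])
   qed
   moreover have "sum_list (take j ns) < Suc (sum_list ns)" for j
   proof -
    have "sum_list ns = sum_list (take j ns) + sum_list (drop j ns)"
     by (metis append_take_drop_id sum_list_append)
    thus ?thesis by simp
   qed
   ultimately show "samples dt n (X om) = subsample ns (map (%i. Y i om) [0..<Suc (sum_list ns)])"
    by (subst subsample_nth) (auto simp: samples_def len less_Suc_eq_le simp del: upt_Suc)
  qed
 qed
 have disj: "disjoint_family E"
 proof -
  have "E ns Int E ms = {}" if "ns ~= ms" for ns ms
  proof -
   have uniq: "fits1 P m a w ==> fits1 Q m' a w ==> m = m' & (EX w'. P w' & Q w')" for P Q m m' a and w :: "nat => real"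
   proof (induction m arbitrary: m' a w)
    case 0 thus ?case by (cases m') auto
   next
    case (Suc m) thus ?case by (cases m') auto
   qed
   have "length ns = length ms ==> fits dt a ns w ==> fits dt a ms w ==> ns = ms" for a w
   proof (induction ns ms arbitrary: a w rule: list_induct2)
    case (Cons m ns m' ms)
    hence "m = m' & (EX w'. fits dt dt ns w' & fits dt dt ms w')" by (intro uniq[of "fits dt dt ns" m a w "fits dt dt ms" m']) auto
    thus ?case using Cons.IH by blast
   qed simp
   thus ?thesis using that by (auto simp: E_def F_def)
  qed
  thus ?thesis by (auto simp: disjoint_family_on_def)
 qed
 \<comment> \<open>The probabilities of the events \<open>E ns\<close> are the values of a pmf, so
   they sum to one; this excludes infinitely many jumps in finite time.\<close>
 have total: "AE om in M. EX ns. om : E ns"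
 proof -
  have "emeasure M (\<Union>ns. E ns) = (\<integral>\<^sup>+ns. emeasure M (E ns) \<partial>count_space UNIV)"
   by (rule emeasure_UN_countable) (use EM disj in auto)
  also have "... = emeasure (measure_pmf (poisson_counts dt n)) UNIV"
   unfolding PE nn_integral_pmf ..
  finally have "emeasure M (\<Union>ns. E ns) = 1" by simp
  hence "AE om in M. om : (\<Union>ns. E ns)"
   by (intro prob_eq_1[THEN iffD1]) (use EM in \<open>auto simp: emeasure_eq_measure\<close>)
  thus ?thesis by simp
 qed
 have "emeasure M {om : space M. samples dt n (X om) = l} = emeasure M (\<Union>ns. C ns Int E ns)"
 proof (rule emeasure_eq_AE)
  show "AE om in M. om : {om : space M. samples dt n (X om) = l} \<longleftrightarrow> om : (\<Union>ns. C ns Int E ns)"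
   using total smp AE_space by eventually_elim (auto simp: C_def simp del: upt_Suc)
 qed (use meas CM EM in auto)
 also have "... = (\<integral>\<^sup>+ns. emeasure M (C ns Int E ns) \<partial>count_space UNIV)"
 proof (rule emeasure_UN_countable)
  show "disjoint_family (%ns. C ns Int E ns)" using disj unfolding disjoint_family_on_def by blast
 qed (use CM EM in auto)
 also have "... = (\<integral>\<^sup>+ns. ennreal (pmf (subsampled_chain K ns x) l) \<partial>measure_pmf (poisson_counts dt n))"
  unfolding PEC nn_integral_measure_pmf ..
 also have "... = pmf (chain (poisson_kernel K dt) n x) l"
  unfolding bind_poisson_counts[symmetric] ennreal_pmf_bind ..
 finally show ?thesis .
qed

lemma samples_path_element: "0 <= dt ==> samples dt n (path_element X om) = samples dt n (X om)"
 by (simp add: samples_def path_element_def)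

lemma samples_in_path_space:
 assumes "0 <= dt"
 shows "{s : space (path_space V). samples dt n s = l} : sets (path_space V)"
proof -
 have "{s : space (path_space V). ALL i:{..n}. s (real i * dt) = l ! i} : sets (path_space V)"
 proof (intro sets.sets_Collect_finite_All)
  fix i
  have t: "real i * dt : {0..}" using assms by simp
  have "{s : space (path_space V). s (real i * dt) = l ! i} = (%s. s (real i * dt)) -` ({l ! i} Int V) Int space (path_space V)"
   using t by (auto simp: path_space_def space_PiM PiE_def Pi_def)
  also have "... : sets (path_space V)"
   unfolding path_space_def by (rule measurable_sets[OF measurable_component_singleton[OF t]]) simp
  finally show "{s : space (path_space V). s (real i * dt) = l ! i} : sets (path_space V)" .
 qed simp
 moreover have "{s : space (path_space V). samples dt n s = l} =
   (if length l = Suc n then {s : space (path_space V). ALL i:{..n}. s (real i * dt) = l ! i} else {})"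
  by (auto simp: samples_def list_eq_iff_nth_eq less_Suc_eq_le simp del: upt_Suc)
 ultimately show ?thesis by simp
qed

lemma (in prob_space) joint_samples_law:
 assumes ind: "indep_vars (%_. path_space V) (%p. path_element (S p)) L" and A: "finite A" "A <= L" and dt: "0 <= dt"
  and law: "!!p l. p : A ==> {om : space M. samples dt n (S p om) = l} : sets M ==>
   emeasure M {om : space M. samples dt n (S p om) = l} = ennreal (pmf (q p) l)"
 shows "emeasure M {om : space M. ALL p:A. samples dt n (S p om) = pa p} = (PROD p:A. ennreal (pmf (q p) (pa p)))"
proof (cases "A = {}")
 case True
 thus ?thesis by (simp add: emeasure_space_1)
next
 case False
 have S: "path_element (S p) : measurable M (path_space V)" if "p : A" for p
  using ind A that by (auto simp: indep_vars_def)
 let ?B = "%p. {s : space (path_space V). samples dt n s = pa p}"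
 have eq: "path_element (S p) -` ?B p Int space M = {om : space M. samples dt n (S p om) = pa p}" if "p : A" for p
  using measurable_space[OF S[OF that]] by (auto simp: samples_path_element[OF dt])
 have ev: "{om : space M. samples dt n (S p om) = pa p} : sets M" if "p : A" for p
  using measurable_sets[OF S[OF that] samples_in_path_space[OF dt, of V n "pa p"]] eq[OF that] by simp
 have "{om : space M. ALL p:A. samples dt n (S p om) = pa p} = (\<Inter>p\<in>A. path_element (S p) -` ?B p Int space M)"
  using eq False by auto
 moreover have "prob (\<Inter>p\<in>A. path_element (S p) -` ?B p Int space M) = (PROD p:A. prob (path_element (S p) -` ?B p Int space M))"
  by (rule indep_varsD[OF ind False A(1,2)]) (rule samples_in_path_space[OF dt])
 ultimately have "prob {om : space M. ALL p:A. samples dt n (S p om) = pa p} = (PROD p:A. prob (path_element (S p) -` ?B p Int space M))"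
  by (simp only:)
 also have "... = (PROD p:A. pmf (q p) (pa p))"
 proof (rule prod.cong[OF refl])
  fix p assume "p : A"
  with law[OF this ev[OF this]] have "prob {om : space M. samples dt n (S p om) = pa p} = pmf (q p) (pa p)"
   by (simp add: emeasure_eq_measure)
  with \<open>p : A\<close> show "prob (path_element (S p) -` ?B p Int space M) = pmf (q p) (pa p)"
   by (simp only: eq)
 qed
 finally show ?thesis by (simp add: emeasure_eq_measure prod_ennreal)
qed

text \<open>Independent steps of all particles, taken time by time, are regrouped particle by
  particle. This is the form in which independence of the paths is given in a regular
  system.\<close>

lemma trajectory_chains:
 fixes pos :: "'v particle => 'v"
 assumes A: "finite A"
 shows "trajectory Q A (Suc n) pos =
  map_pmf (%F. map (%i p. if p : A then F p ! i else pos p) [0..<Suc n]) (Pi_pmf A undefined (%p. chain Q n (pos p)))"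
proof (induction n arbitrary: pos)
 case 0
 have "Pi_pmf A undefined (%p. chain Q 0 (pos p)) = return_pmf (%p. if p : A then [pos p] else undefined)"
  using Pi_pmf_return_pmf[OF A, of undefined "%p. [pos p]"] by simp
 moreover have "trajectory Q A 0 = (%_. return_pmf [])" by (simp add: fun_eq_iff)
 moreover have "(%p. if p : A then (if p : A then [pos p] else undefined) ! 0 else pos p) = pos"
  by (simp add: fun_eq_iff)
 ultimately show ?case by simp
next
 case (Suc n)
 let ?up = "%f p. if p : A then f p else pos p"
 let ?M = "%n pos F. map (%i p. if p : A then F p ! i else pos p) [0..<Suc n]"
 have "Pi_pmf A undefined (%p. chain Q (Suc n) (pos p)) =
   Pi_pmf A undefined (%p. bind_pmf (Q (pos p)) (%y. map_pmf ((#) (pos p)) (chain Q n y)))"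
  by (simp add: map_bind_pmf)
 also have "... = bind_pmf (Pi_pmf A undefined (%p. Q (pos p))) (%f. Pi_pmf A undefined (%p. map_pmf ((#) (pos p)) (chain Q n (f p))))"
  by (rule Pi_pmf_bind[OF A])
 also have "... = bind_pmf (Pi_pmf A undefined (%p. Q (pos p)))
   (%f. map_pmf (%F p. if p : A then pos p # F p else undefined) (Pi_pmf A undefined (%p. chain Q n (?up f p))))"
 proof (intro bind_pmf_cong refl)
  fix f
  have "Pi_pmf A undefined (%p. map_pmf ((#) (pos p)) (chain Q n (f p))) =
    Pi_pmf A undefined (%p. bind_pmf (chain Q n (?up f p)) (%l. return_pmf (pos p # l)))"
   by (intro Pi_pmf_cong) (auto simp: map_pmf_def)
  also have "... = bind_pmf (Pi_pmf A undefined (%p. chain Q n (?up f p))) (%F. Pi_pmf A undefined (%p. return_pmf (pos p # F p)))"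
   by (rule Pi_pmf_bind[OF A])
  finally show "Pi_pmf A undefined (%p. map_pmf ((#) (pos p)) (chain Q n (f p))) =
    map_pmf (%F p. if p : A then pos p # F p else undefined) (Pi_pmf A undefined (%p. chain Q n (?up f p)))"
   by (simp add: map_pmf_def Pi_pmf_return_pmf[OF A])
 qed
 finally have eq: "Pi_pmf A undefined (%p. chain Q (Suc n) (pos p)) = ..." .
 have M: "?M (Suc n) pos (%p. if p : A then pos p # F p else undefined) = pos # ?M n (?up f) F" for f F
 proof -
  have "[0..<Suc (Suc n)] = 0 # map Suc [0..<Suc n]" by (simp add: upt_conv_Cons map_Suc_upt del: upt_Suc)
  thus ?thesis by (auto simp: fun_eq_iff simp del: upt_Suc)
 qed
 have "trajectory Q A (Suc (Suc n)) pos =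
   map_pmf ((#) pos) (bind_pmf (jump Q A pos) (trajectory Q A (Suc n)))" by simp
 also have "... = bind_pmf (Pi_pmf A undefined (%p. Q (pos p)))
   (%f. map_pmf (%F. pos # ?M n (?up f) F) (Pi_pmf A undefined (%p. chain Q n (?up f p))))"
  unfolding Suc jump_def by (simp add: bind_map_pmf map_bind_pmf pmf.map_comp o_def del: upt_Suc)
 also have "... = map_pmf (?M (Suc n) pos) (Pi_pmf A undefined (%p. chain Q (Suc n) (pos p)))"
  unfolding eq map_bind_pmf pmf.map_comp o_def by (intro bind_pmf_cong map_pmf_cong refl) (rule M[symmetric])
 finally show ?case .
qed

text \<open>
 \<open>hits K A Z n y\<close> is the probability that the chain from \<open>y\<close> hits \<open>A\<close> within its first \<open>n\<close>
 positions without visiting \<open>Z\<close> before or at that time.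
\<close>

primrec hits :: "('v => 'v pmf) => 'v set => 'v set => nat => 'v => ennreal" where
 "hits K A Z 0 y = 0"
| "hits K A Z (Suc n) y = (if y : Z then 0 else if y : A then 1 else \<integral>\<^sup>+y'. hits K A Z n y' \<partial>K y)"

lemma hits_le_1: "hits K A Z n y <= 1"
proof (induction n arbitrary: y)
 case (Suc n)
 have "(\<integral>\<^sup>+y'. hits K A Z n y' \<partial>K y) <= (\<integral>\<^sup>+y'. 1 \<partial>K y)" by (intro nn_integral_mono Suc)
 thus ?case by simp
qed simp

text \<open>The second part is an inequality because a path may visit \<open>Z\<close> after it has
  hit \<open>A\<close>; such a path is counted by \<open>hits\<close>.\<close>

lemma hits_chain:
 shows "hits K A {} (Suc n) y = emeasure (measure_pmf (chain K n y)) {l. set l Int A ~= {}}"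
  and "emeasure (measure_pmf (chain K n y)) {l. set l Int A ~= {} & set l Int Z = {}} <= hits K A Z (Suc n) y"
proof (induction n arbitrary: y)
 case 0
 have 0: "hits K A Z 0 = (%_. 0)" for Z by (simp add: fun_eq_iff)
 { case 1 show ?case by (simp add: 0 del: hits.simps(1)) }
 { case 2 show ?case by (simp add: 0 indicator_def del: hits.simps(1)) }
next
 case (Suc n)
 have int: "emeasure (measure_pmf (chain K (Suc n) y)) {l. P l} = (\<integral>\<^sup>+y'. emeasure (measure_pmf (chain K n y')) {l. P (y # l)} \<partial>K y)" for P y
  by (simp add: measure_pmf_bind[symmetric] emeasure_bind_pmf vimage_def)
 { case 1
  show ?case
  proof (cases "y : A")
   case True
   hence "{l. set (y # l) Int A ~= {}} = UNIV" by auto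
   thus ?thesis unfolding int using True by (simp del: Int_insert_left)
  next
   case False
   have "hits K A {} (Suc n) = (%y'. emeasure (measure_pmf (chain K n y')) {l. set l Int A ~= {}})"
    by (rule ext) (rule Suc(1))
   thus ?thesis unfolding int hits.simps(2)[of K A "{}" "Suc n"] using False by simp
  qed
 }
 { case 2
  show ?case
  proof (cases "y : Z")
   case True
   hence "{l. set (y # l) Int A ~= {} & set (y # l) Int Z = {}} = {}" by auto
   thus ?thesis unfolding int[where P = "%l. set l Int A ~= {} & set l Int Z = {}"] by (simp only: emeasure_empty nn_integral_const mult_zero_left) simp
  next
   case False
   show ?thesis
   proof (cases "y : A")
    case True
    have "(\<integral>\<^sup>+y'. emeasure (measure_pmf (chain K n y')) {l. set (y # l) Int A ~= {} & set (y # l) Int Z = {}} \<partial>K y) <= (\<integral>\<^sup>+y'. 1 \<partial>K y)"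
     by (intro nn_integral_mono measure_pmf.emeasure_le_1)
    thus ?thesis unfolding int[where P = "%l. set l Int A ~= {} & set l Int Z = {}"] using True False by simp
   next
    case F: False
    have "(\<integral>\<^sup>+y'. emeasure (measure_pmf (chain K n y')) {l. set (y # l) Int A ~= {} & set (y # l) Int Z = {}} \<partial>K y)
     <= (\<integral>\<^sup>+y'. hits K A Z (Suc n) y' \<partial>K y)"
     using F False by (intro nn_integral_mono) (simp del: hits.simps add: Suc(2))
    thus ?thesis unfolding int[where P = "%l. set l Int A ~= {} & set l Int Z = {}"] hits.simps(2)[of K A Z "Suc n"] using F False by (simp only: if_False)
   qed
  qed
 }
qed

text \<open>
 A set chosen uniformly among the subsets of \<open>X\<close> contains the starting point of a given path of
 \<open>Suc n\<close> positions and none of its other positions with probability at least \<open>2 ^ - Suc n\<close>.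
\<close>

lemma hits_random_obstacle:
 assumes X: "finite X" "x : X"
 shows "2 ^ card X * hits K H {} (Suc n) x <= 2 ^ Suc n * (\<Sum>D | D <= X & x \<in> D. hits K H (D - {x}) (Suc n) x)"
proof -
 let ?\<D> = "{D. D <= X & x : D}"
 have fin: "finite ?\<D>" using X by (auto intro: finite_subset[of _ "Pow X"])
 have "2 ^ card X * hits K H {} (Suc n) x = (\<integral>\<^sup>+l. 2 ^ card X * indicator {l. set l Int H ~= {}} l \<partial>chain K n x)"
  unfolding hits_chain(1) by (simp add: nn_integral_cmult)
 also have "... <= (\<integral>\<^sup>+l. 2 ^ Suc n * (SUM D:?\<D>. indicator {l. set l Int H ~= {} & set l Int (D - {x}) = {}} l) \<partial>chain K n x)"
 proof (rule nn_integral_mono_AE, unfold AE_measure_pmf_iff, intro ballI)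
  fix l assume "l : set_pmf (chain K n x)"
  hence l: "length l = Suc n" "x : set l" using chain_shape[of l K n x] by (auto, cases l, auto)
  show "2 ^ card X * indicator {l. set l Int H ~= {}} l \<le>
    2 ^ Suc n * (SUM D:?\<D>. indicator {l. set l Int H ~= {} & set l Int (D - {x}) = {}} l :: ennreal)"
  proof (cases "set l Int H = {}")
   case False
   \<comment> \<open>The obstacle sets that meet the path \<open>l\<close> in \<open>x\<close>
     alone. As \<open>l\<close> has \<open>Suc n\<close> entries, they make up at least a fraction
     \<open>2 ^ - Suc n\<close> of all subsets of \<open>X\<close>.\<close>
   let ?\<E> = "insert x ` Pow (X - set l)"
   have sub: "?\<E> <= ?\<D>" using X by auto
   have "inj_on (insert x) (Pow (X - set l))" using l(2) by (intro inj_onI) (metis Diff_insert_absorb Diff_iff PowD insertI1 insert_Diff_if subsetD)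
   hence card: "card ?\<E> = 2 ^ card (X - set l)" using X by (simp add: card_image card_Pow)
   have "card X <= card (X - set l) + card (set l)" using X
    by (metis card_Diff_subset_Int diff_le_self card_mono finite_Int Int_lower2 List.finite_set add.commute le_diff_conv diff_le_mono2)
   also have "card (set l) <= Suc n" using card_length[of l] l(1) by simp
   finally have "(2::nat) ^ card X <= 2 ^ (card (X - set l) + Suc n)" by (intro power_increasing) auto
   hence c: "2 ^ card X <= 2 ^ Suc n * card ?\<E>" unfolding card power_add by (simp only: mult.commute)
   have "(2 :: ennreal) ^ card X = of_nat (2 ^ card X)" by simp
   also have "... <= of_nat (2 ^ Suc n * card ?\<E>)" using c by (simp only: of_nat_le_iff)
   also have "... = 2 ^ Suc n * (SUM D:?\<E>. 1)" by simp
   also have "(SUM D:?\<E>. 1) = (SUM D:?\<E>. indicator {l. set l Int H ~= {} & set l Int (D - {x}) = {}} l :: ennreal)"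
    using False by (intro sum.cong refl) (auto simp: indicator_def)
   also have "... <= (SUM D:?\<D>. indicator {l. set l Int H ~= {} & set l Int (D - {x}) = {}} l)"
    by (rule sum_mono2[OF fin sub]) simp
   finally show ?thesis using False by (simp add: mult_left_mono)
  qed simp
 qed
 also have "... = 2 ^ Suc n * (SUM D:?\<D>. emeasure (measure_pmf (chain K n x)) {l. set l Int H ~= {} & set l Int (D - {x}) = {}})"
  by (simp add: nn_integral_cmult nn_integral_sum)
 also have "... <= 2 ^ Suc n * (SUM D:?\<D>. hits K H (D - {x}) (Suc n) x)"
  by (intro mult_left_mono sum_mono hits_chain(2)) simp
 finally show ?thesis .
qed

section \<open>A single token\<close>

lemma hits_0_fun: "hits K A Z 0 = (%_. 0)"
 by (simp add: fun_eq_iff)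

text \<open>The expected value collected by one token in the environment \<open>b\<close>, with
  \<open>n\<close> time steps left. The token waits step by step while its site is occupied, and no
  B-particle is taken: from its departure on the site is clear anyway, so its own trace never
  matters to it.\<close>

primrec solo :: "('v => 'v pmf) => ('v => nat => ennreal) => 'v env => nat => nat => 'v => ennreal" where
 "solo Q c b 0 t y = 0"
| "solo Q c b (Suc n) t y =
  (if b y t ~= 0 then solo Q c b n (Suc t) y else c y t + (\<integral>\<^sup>+y'. solo Q c b n (Suc t) y' \<partial>Q y))"

lemma solo_cong:
 assumes "!!z j. t <= j ==> j < t + n ==> b z j = 0 \<longleftrightarrow> b' z j = 0"
 shows "solo Q c b n t y = solo Q c b' n t y"
 using assms
proof (induction n arbitrary: t y)
 case (Suc n)
 hence "solo Q c b n (Suc t) = solo Q c b' n (Suc t)" by (intro ext) simp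
 thus ?case using Suc.prems[of t y] by simp
qed simp

lemma solo_horizon:
 assumes "!!y j. t + n <= j ==> c y j = 0"
 shows "solo Q c b (n + m) t y = solo Q c b n t y"
 using assms
proof (induction n arbitrary: t y)
 case 0
 have "solo Q c b m t y = 0" if "!!y j. t <= j ==> c y j = 0" for t y
  using that
 proof (induction m arbitrary: t y)
  case (Suc m)
  hence "solo Q c b m (Suc t) = (%_. 0)" by (intro ext) simp
  thus ?case using Suc.prems by simp
 qed simp
 thus ?case using 0 by simp
next
 case (Suc n)
 hence "solo Q c b (n + m) (Suc t) = solo Q c b n (Suc t)" by (intro ext) simp
 thus ?case by simp
qed

lemma solo_wait:
 assumes "!!j. t <= j ==> j < t + k ==> b y j ~= 0"
 shows "solo Q c b (k + n) t y = solo Q c b n (t + k) y"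
 using assms
proof (induction k arbitrary: t)
 case (Suc k)
 have "solo Q c b (k + n) (Suc t) y = solo Q c b n (Suc t + k) y" by (rule Suc.IH) (use Suc.prems in auto)
 thus ?case using Suc.prems[of t] by simp
qed simp

lemma expect_single:
 fixes c :: "'v => nat => real"
 assumes b: "admissible N b" and c: "!!y j. 0 <= c y j"
 shows "0 <= v ==> expect Q N c ennreal b v {#(y, t)#} = ennreal v + solo Q (%y j. ennreal (c y j)) b (N - t) t y"
 using b
proof (induction "N - t" arbitrary: t y v b rule: less_induct)
 case less
 define l where "l = max t (clear_time b y)"
 have clear: "b y j = 0 \<longleftrightarrow> clear_time b y <= j" for j using clear_time_iff[OF less.prems(2)] .
 show ?case
 proof (cases "N <= l")
  case True
  have "solo Q (%y j. ennreal (c y j)) b ((N - t) + 0) t y = solo Q (%y j. ennreal (c y j)) b 0 (t + (N - t)) y"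
   by (rule solo_wait) (use True clear in \<open>auto simp: l_def\<close>)
  thus ?thesis using True by (simp add: expect_add_mset[OF less.prems(2)] l_def Let_def)
 next
  case False
  hence l: "t <= l" "l < N" by (auto simp: l_def)
  have "solo Q (%y j. ennreal (c y j)) b ((l - t) + (N - l)) t y = solo Q (%y j. ennreal (c y j)) b (N - l) (t + (l - t)) y"
   by (rule solo_wait) (use clear in \<open>auto simp: l_def\<close>)
  hence s: "solo Q (%y j. ennreal (c y j)) b (N - t) t y = solo Q (%y j. ennreal (c y j)) b (Suc (N - Suc l)) l y"
   using l by (simp add: Suc_diff_Suc del: solo.simps)
  have bl: "b y l = 0" using clear by (simp add: l_def)
  have tk: "take_B b y t z j = 0 \<longleftrightarrow> b z j = 0" if "Suc l <= j" for z j
   using that clear[of j] by (auto simp: take_B_def l_def)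
  have "expect Q N c ennreal b v {#(y, t)#} =
    (\<integral>\<^sup>+y'. expect Q N c ennreal (take_B b y t) (v + c y l) {#(y', Suc l)#} \<partial>Q y)"
   using False by (simp add: expect_add_mset[OF less.prems(2)] l_def Let_def)
  also have "... = (\<integral>\<^sup>+y'. ennreal (v + c y l) + solo Q (%y j. ennreal (c y j)) b (N - Suc l) (Suc l) y' \<partial>Q y)"
  proof (intro nn_integral_cong)
   fix y'
   have "expect Q N c ennreal (take_B b y t) (v + c y l) {#(y', Suc l)#} =
     ennreal (v + c y l) + solo Q (%y j. ennreal (c y j)) (take_B b y t) (N - Suc l) (Suc l) y'"
    by (rule less.hyps) (use l less.prems c admissible_take_B in \<open>auto intro: add_nonneg_nonneg\<close>)
   thus "expect Q N c ennreal (take_B b y t) (v + c y l) {#(y', Suc l)#} =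
     ennreal (v + c y l) + solo Q (%y j. ennreal (c y j)) b (N - Suc l) (Suc l) y'"
    using solo_cong[where t = "Suc l" and b = "take_B b y t" and b' = b and n = "N - Suc l"] tk by simp
  qed
  also have "... = ennreal v + (ennreal (c y l) + (\<integral>\<^sup>+y'. solo Q (%y j. ennreal (c y j)) b (N - Suc l) (Suc l) y' \<partial>Q y))"
   using less.prems(1) c by (subst nn_integral_add) (auto simp: ennreal_plus add.assoc)
  finally show ?thesis unfolding s using bl by simp
 qed
qed

text \<open>A stay at \<open>y\<close> consists of \<open>i\<close> lazy steps, of weight
  \<open>q ^ i\<close>, followed by a step of \<open>K\<close> of weight \<open>p\<close>; at each
  of these times \<open>c\<close> is collected. The other transitions of \<open>Q\<close> are
  dropped.\<close>

lemma solo_stay: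
 fixes Q K :: "'v => 'v pmf"
 assumes Q: "!!f. q * f y + p * (\<integral>\<^sup>+y'. f y' \<partial>K y) <= (\<integral>\<^sup>+y'. f y' \<partial>Q y)" and b: "!!j. b y j = 0"
 shows "m <= n ==> (\<Sum>i<m. q ^ i * (c y (t + i) + p * (\<integral>\<^sup>+y'. solo Q c b (n - Suc i) (t + Suc i) y' \<partial>K y))) <= solo Q c b n t y"
proof (induction m arbitrary: n t)
 case (Suc m)
 then obtain n' where n: "n = Suc n'" "m <= n'" by (cases n) auto
 have "(\<Sum>i<Suc m. q ^ i * (c y (t + i) + p * (\<integral>\<^sup>+y'. solo Q c b (n - Suc i) (t + Suc i) y' \<partial>K y))) =
   c y t + p * (\<integral>\<^sup>+y'. solo Q c b n' (Suc t) y' \<partial>K y) +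
   q * (\<Sum>i<m. q ^ i * (c y (Suc t + i) + p * (\<integral>\<^sup>+y'. solo Q c b (n' - Suc i) (Suc t + Suc i) y' \<partial>K y)))"
  unfolding sum.lessThan_Suc_shift n by (simp add: sum_distrib_left mult.assoc)
 also have "... <= c y t + p * (\<integral>\<^sup>+y'. solo Q c b n' (Suc t) y' \<partial>K y) + q * solo Q c b n' (Suc t) y"
  by (intro add_left_mono mult_left_mono Suc.IH n) simp
 also have "... <= c y t + (\<integral>\<^sup>+y'. solo Q c b n' (Suc t) y' \<partial>Q y)"
  using add_left_mono[OF Q[of "solo Q c b n' (Suc t)"], of "c y t"] by (simp add: ac_simps)
 finally show ?case using b n by simp
qed simp

text \<open>Every position of a path of \<open>K\<close> is allotted up to \<open>m\<close> time
  steps. A stay that ends in a jump has total weight \<open>p * (\<Sum>i<m. q ^ i)\<close>, and the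
  stay at the first site of \<open>H\<close> collects at least
  \<open>w * (\<Sum>i<m. q ^ i)\<close>; \<open>j\<close> positions require \<open>j - 1\<close>
  jumps. By \<open>s\<close> an earlier hit is covered by the same bound.\<close>

lemma solo_lower:
 fixes q p w :: ennreal and Q K :: "'v => 'v pmf"
 assumes Q: "!!f y. q * f y + p * (\<integral>\<^sup>+y'. f y' \<partial>K y) <= (\<integral>\<^sup>+y'. f y' \<partial>Q y)"
  and c: "!!y j. y : H ==> j < N ==> w <= c y j"
  and b: "!!y j. b y j = 0 \<longleftrightarrow> y ~: Z"
  and s: "p * (\<Sum>i<m. q ^ i) <= 1"
 shows "j * m <= n ==> t + n <= N ==>
  w * (\<Sum>i<m. q ^ i) * (p * (\<Sum>i<m. q ^ i)) ^ (j - 1) * hits K H Z j y <= solo Q c b n t y"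
proof (induction j arbitrary: n t y)
 case (Suc j)
 let ?g = "w * (\<Sum>i<m. q ^ i)" and ?s = "p * (\<Sum>i<m. q ^ i)"
 have mn: "m <= n" using Suc.prems by simp
 show ?case
 proof (cases "y : Z")
  case False
  hence by0: "b y i = 0" for i using b by simp
  note stay = solo_stay[of q y p K Q b, OF Q by0 mn, of c t]
  show ?thesis
  proof (cases "y : H")
   case True
   have "?g * ?s ^ (Suc j - 1) * hits K H Z (Suc j) y <= ?g * 1 * 1"
    by (intro mult_mono power_le_one s hits_le_1) auto
   also have "... = (\<Sum>i<m. q ^ i * (w + 0))" by (simp add: sum_distrib_left mult.commute)
   also have "... <= (\<Sum>i<m. q ^ i * (c y (t + i) + p * (\<integral>\<^sup>+y'. solo Q c b (n - Suc i) (t + Suc i) y' \<partial>K y)))"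
    by (intro sum_mono mult_left_mono add_mono c True) (use Suc.prems mn in auto)
   finally show ?thesis using stay by (rule order_trans)
  next
   case F: False
   show ?thesis
   proof (cases "j = 0")
    case True
    have "hits K H Z (Suc 0) y = 0" using F False by (simp add: hits_0_fun)
    thus ?thesis unfolding True by (simp only: mult_zero_right zero_le)
   next
    case j: False
    define I where "I = (\<integral>\<^sup>+y'. hits K H Z j y' \<partial>K y)"
    have "hits K H Z (Suc j) y = I" "?s ^ j = ?s ^ (j - 1) * ?s"
     using F False j by (simp_all add: I_def power_eq_if mult.commute)
    hence "?g * ?s ^ j * hits K H Z (Suc j) y = (\<Sum>i<m. q ^ i) * (0 + p * (?g * ?s ^ (j - 1) * I))"
     by (simp add: ac_simps)
    also have "... = (\<Sum>i<m. q ^ i * (0 + p * (?g * ?s ^ (j - 1) * (\<integral>\<^sup>+y'. hits K H Z j y' \<partial>K y))))"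
     unfolding I_def by (rule sum_distrib_right)
    also have "... <= (\<Sum>i<m. q ^ i * (c y (t + i) + p * (\<integral>\<^sup>+y'. solo Q c b (n - Suc i) (t + Suc i) y' \<partial>K y)))"
    proof (intro sum_mono mult_left_mono add_mono)
     fix i assume "i : {..<m}"
     hence "j * m <= n - Suc i" "t + Suc i + (n - Suc i) <= N" using Suc.prems by auto
     hence "?g * ?s ^ (j - 1) * hits K H Z j y' <= solo Q c b (n - Suc i) (t + Suc i) y'" for y'
      by (rule Suc.IH)
     hence "(\<integral>\<^sup>+y'. ?g * ?s ^ (j - 1) * hits K H Z j y' \<partial>K y) <= (\<integral>\<^sup>+y'. solo Q c b (n - Suc i) (t + Suc i) y' \<partial>K y)"
      by (intro nn_integral_mono) auto
     thus "?g * ?s ^ (j - 1) * (\<integral>\<^sup>+y'. hits K H Z j y' \<partial>K y) <= (\<integral>\<^sup>+y'. solo Q c b (n - Suc i) (t + Suc i) y' \<partial>K y)"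
      by (simp add: nn_integral_cmult)
    qed auto
    finally show ?thesis using stay by simp
   qed
  qed
 qed simp
qed simp

text \<open>
 The steps of the kernel \<open>Q\<close> are divided into lazy ones, of total weight \<open>q\<close>, and the other ones,
 described by the operator \<open>B\<close>.
\<close>

locale lazy_kernel =
 fixes Q :: "'v => 'v pmf" and q :: ennreal and B :: "('v => ennreal) => 'v => ennreal"
 assumes decomp: "!!f y. (\<integral>\<^sup>+y'. f y' \<partial>Q y) = q * f y + B f y"
  and B_add: "!!f g y. B (%x. f x + g x) y = B f y + B g y"
  and B_cmult: "!!a f y. B (%x. a * f x) y = a * B f y"
  and B_mono: "!!f g y. (!!x. f x <= g x) ==> B f y <= B g y"
begin

text \<open>The part of \<open>solo\<close> that is collected after the \<open>J\<close>th non-lazy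
  step; from then on the walk is unrestricted. \<open>few_steps\<close> is the part collected
  before.\<close>

primrec many_steps :: "('v => nat => ennreal) => 'v env => nat => nat => nat => 'v => ennreal" where
 "many_steps c b 0 J t y = (if J = 0 then solo Q c b 0 t y else 0)"
| "many_steps c b (Suc n) J t y =
  (if J = 0 then solo Q c b (Suc n) t y
   else if b y t ~= 0 then many_steps c b n J (Suc t) y
   else q * many_steps c b n J (Suc t) y + B (many_steps c b n (J - 1) (Suc t)) y)"

primrec few_steps :: "('v => nat => ennreal) => 'v env => nat => nat => nat => 'v => ennreal" where
 "few_steps c b 0 J t y = 0"
| "few_steps c b (Suc n) J t y =
  (if J = 0 then 0
   else if b y t ~= 0 then few_steps c b n J (Suc t) y
   else c y t + (q * few_steps c b n J (Suc t) y + B (few_steps c b n (J - 1) (Suc t)) y))"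

lemma many_steps_0: "many_steps c b n 0 t y = solo Q c b n t y"
 by (cases n) simp_all

lemma solo_split: "solo Q c b n t y = few_steps c b n J t y + many_steps c b n J t y"
proof (induction n arbitrary: J t y)
 case (Suc n)
 show ?case
 proof (cases "J = 0 \<or> b y t ~= 0")
  case True
  thus ?thesis using Suc[of "Suc t" y J] by (cases "J = 0") auto
 next
  case False
  have s: "solo Q c b n (Suc t) = (%y. few_steps c b n (J - 1) (Suc t) y + many_steps c b n (J - 1) (Suc t) y)"
   by (rule ext) (rule Suc)
  have "solo Q c b (Suc n) t y = c y t + (q * solo Q c b n (Suc t) y + B (solo Q c b n (Suc t)) y)"
   using False by (simp add: decomp)
  also have "solo Q c b n (Suc t) y = few_steps c b n J (Suc t) y + many_steps c b n J (Suc t) y" by (rule Suc)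
  also have "B (solo Q c b n (Suc t)) y = B (few_steps c b n (J - 1) (Suc t)) y + B (many_steps c b n (J - 1) (Suc t)) y"
   by (subst s) (rule B_add)
  finally show ?thesis using False by (simp add: distrib_left ac_simps)
 qed
qed simp

lemma B_zero: "B (%_. 0) y = 0"
 using B_cmult[of 0 "%_. 0" y] by simp

lemma mass: "q + B (%_. 1) y = 1"
 using decomp[where f = "%_. 1" and y = y] by simp

lemma q_le_1: "q <= 1"
 by (metis le_iff_add mass)

text \<open>The token is at \<open>y\<close> one step later either because it has to wait or because
  its step is lazy.\<close>

lemma lazy_step: "q * solo Q c b n (Suc t) y <= solo Q c b (Suc n) t y"
proof (cases "b y t = 0")
 case True
 thus ?thesis by (simp add: decomp add_increasing add_increasing2)
next
 case False
 thus ?thesis using mult_right_mono[OF q_le_1, of "solo Q c b n (Suc t) y"] by simp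
qed

text \<open>
 In twice the time a walk has about \<open>2 ^ J\<close> times as many opportunities to make \<open>J\<close> steps.
\<close>

lemma many_steps_scaling:
 assumes b: "!!y. antimono (b y)" and c: "!!y j. c y j <= c' y (2 * j)"
 shows "2 * n <= n' ==> 2 ^ J * q ^ (2 * n) * many_steps c b n J t y <= solo Q c' b n' (2 * t) y"
proof (induction n arbitrary: J t y n')
 case (Suc n)
 then obtain m where "n' = 2 * Suc n + m" by (metis le_iff_add)
 then obtain m where m: "n' = Suc (Suc m)" "2 * n <= m" by simp
 define S where "S = solo Q c' b m (2 * Suc t)"
 have IH: "2 ^ J * q ^ (2 * n) * many_steps c b n J (Suc t) z <= S z" for J z
  unfolding S_def by (rule Suc.IH) (rule m)
 have qS: "q * S z <= solo Q c' b (Suc m) (Suc (2 * t)) z" for z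
  using lazy_step[of c' b m "Suc (2 * t)" z] by (simp add: S_def del: solo.simps)
 have q2: "q * q * S y <= solo Q c' b n' (2 * t) y"
  using mult_left_mono[OF qS[of y], of q] lazy_step[of c' b "Suc m" "2 * t" y]
  by (simp add: m mult.assoc del: solo.simps)
 show ?case
 proof (cases "b y t = 0")
  case False
  hence "many_steps c b (Suc n) J t y = many_steps c b n J (Suc t) y" by (simp add: many_steps_0)
  hence "2 ^ J * q ^ (2 * Suc n) * many_steps c b (Suc n) J t y =
    q * q * (2 ^ J * q ^ (2 * n) * many_steps c b n J (Suc t) y)" by (simp add: ac_simps)
  also have "... <= q * q * S y" by (intro mult_left_mono IH) simp
  finally show ?thesis using q2 by (rule order_trans)
 next
  case True
  \<comment> \<open>A site that is clear at \<open>t\<close> stays clear, so waiting in doubled time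
    is never longer than in the original time.\<close>
  have b0: "b y (2 * t) = 0" "b y (Suc (2 * t)) = 0"
   using antimonoD[OF b[of y], of t "2 * t"] antimonoD[OF b[of y], of t "Suc (2 * t)"] True by simp_all
  \<comment> \<open>Two steps of doubled time replace one original step. The events kept are that
    both are lazy or that exactly one is not; the latter can happen in two orders, which is the
    factor \<open>2\<close> gained for each non-lazy step.\<close>
  have "c' y (2 * t) + q * (q * S y + B S y) + B (%z. q * S z) y
    <= c' y (2 * t) + q * solo Q c' b (Suc m) (Suc (2 * t)) y + B (solo Q c' b (Suc m) (Suc (2 * t))) y"
  proof (intro add_mono mult_left_mono B_mono qS order_refl)
   show "q * S y + B S y <= solo Q c' b (Suc m) (Suc (2 * t)) y"
    using b0(2) by (simp add: decomp S_def add_increasing)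
  qed simp
  also have "... = solo Q c' b n' (2 * t) y" using b0(1) by (simp add: m decomp add.assoc del: many_steps.simps)
  finally have low: "c' y (2 * t) + q * q * S y + 2 * q * B S y <= solo Q c' b n' (2 * t) y"
   by (simp add: B_cmult distrib_left mult_2 mult_2_right distrib_right ac_simps)
  have qn: "q ^ k <= 1" for k using q_le_1 by (simp add: power_le_one)
  have BJ: "2 ^ J * q ^ (2 * n) * B (many_steps c b n J (Suc t)) y <= B S y" for J
   unfolding B_cmult[symmetric] by (rule B_mono) (rule IH)
  show ?thesis
  proof (cases J)
   case 0
   have "2 ^ J * q ^ (2 * Suc n) * many_steps c b (Suc n) J t y =
     q ^ (2 * Suc n) * c y t + q * (q * q * (2 ^ 0 * q ^ (2 * n) * many_steps c b n 0 (Suc t) y)) +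
     q * q * (2 ^ 0 * q ^ (2 * n) * B (many_steps c b n 0 (Suc t)) y)"
    using True 0 by (simp add: decomp many_steps_0[abs_def] distrib_left ac_simps)
   also have "... <= 1 * c' y (2 * t) + 1 * (q * q * S y) + 2 * q * B S y"
    by (intro add_mono mult_mono IH BJ c qn q_le_1 order_refl) (use q_le_1 in \<open>auto intro: order_trans\<close>)
   finally show ?thesis using low by simp
  next
   case (Suc J')
   have "2 ^ J * q ^ (2 * Suc n) * many_steps c b (Suc n) J t y =
     q * (q * q * (2 ^ J * q ^ (2 * n) * many_steps c b n J (Suc t) y)) +
     2 * q * q * (2 ^ J' * q ^ (2 * n) * B (many_steps c b n J' (Suc t)) y)"
    using True Suc by (simp add: distrib_left ac_simps)
   also have "... <= 1 * (q * q * S y) + 2 * q * 1 * B S y"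
    by (intro add_mono mult_mono IH BJ q_le_1 order_refl) auto
   also have "... <= c' y (2 * t) + q * q * S y + 2 * q * B S y" by (simp add: add_increasing)
   finally show ?thesis using low by (rule order_trans)
  qed
 qed
qed simp

lemma many_steps_zero:
 assumes "q = 0"
 shows "n <= J ==> many_steps c b n J t y = 0"
proof (induction n arbitrary: J t y)
 case (Suc n)
 hence 0: "many_steps c b n (J - 1) (Suc t) = (%_. 0)" "many_steps c b n J (Suc t) y = 0" by (simp_all add: fun_eq_iff)
 have "q * x = 0" for x by (simp only: assms mult_zero_left)
 thus ?case using 0 Suc.prems by (simp add: B_zero)
qed simp

lemma few_steps_le:
 assumes c: "!!y j. c y j <= w"
 shows "few_steps c b n J t y <= of_nat n * w"
proof (induction n arbitrary: J t y)
 case (Suc n)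
 have "c y t + (q * few_steps c b n J (Suc t) y + B (few_steps c b n (J - 1) (Suc t)) y) \<le>
   w + (q * (of_nat n * w) + B (%_. of_nat n * w * 1) y)"
  by (intro add_mono c mult_left_mono Suc B_mono) (simp_all add: Suc)
 also have "... = w + of_nat n * w * (q + B (%_. 1) y)" unfolding B_cmult by (simp add: distrib_left ac_simps)
 also have "... = of_nat (Suc n) * w" by (simp add: mass distrib_right)
 finally have 1: "c y t + (q * few_steps c b n J (Suc t) y + B (few_steps c b n (J - 1) (Suc t)) y) <= of_nat (Suc n) * w" .
 have "few_steps c b n J (Suc t) y <= of_nat (Suc n) * w"
  by (rule order_trans[OF Suc]) (simp add: distrib_right add_increasing)
 with 1 show ?case by simp
qed simp

text \<open>Before the \<open>J\<close>th non-lazy step anything is collected only if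
  \<open>H\<close> is among the first \<open>J\<close> positions. A non-lazy step is a step of
  \<open>K\<close> up to an error \<open>e\<close>, which may be paid at each of the
  \<open>n\<close> times, and one token collects at most \<open>n * w\<close>.\<close>

lemma few_steps_hits:
 fixes K :: "'v => 'v pmf"
 assumes c: "!!y j. c y j <= (if y : H then w else 0)"
  and B: "!!f y. (!!x. f x <= 1) ==> B f y <= p * (\<integral>\<^sup>+y'. f y' \<partial>K y) + e" and p: "q + p <= 1"
 shows "few_steps c b n J t y <= of_nat n * w * (hits K H {} J y + of_nat n * e)"
proof (induction n arbitrary: J t y)
 case (Suc n)
 have mono: "of_nat n * w * (hits K H {} J y + of_nat n * e) <= of_nat (Suc n) * w * (hits K H {} J y + of_nat (Suc n) * e)"
  by (intro mult_mono add_mono order_refl) (auto simp: of_nat_mono)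
 show ?case
 proof (cases "J = 0 \<or> b y t ~= 0")
  case True
  thus ?thesis using order_trans[OF Suc mono] by auto
 next
  case False
  then obtain J' where J: "J = Suc J'" by (cases J) auto
  show ?thesis
  proof (cases "y : H")
   case True
   have "few_steps c b (Suc n) J t y <= of_nat (Suc n) * w" by (rule few_steps_le) (rule order_trans[OF c], simp)
   also have "... <= of_nat (Suc n) * w * (hits K H {} J y + of_nat (Suc n) * e)"
    using True J mult_left_mono[of 1 "1 + of_nat (Suc n) * e" "of_nat (Suc n) * w"] by simp
   finally show ?thesis .
  next
   case H: False
   hence h: "hits K H {} J y = (\<integral>\<^sup>+y'. hits K H {} J' y' \<partial>K y)" using J by simp
   have Bh: "B (hits K H {} J') y <= p * hits K H {} J y + e"
    unfolding h by (rule B) (rule hits_le_1)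
   have "few_steps c b (Suc n) J t y = q * few_steps c b n J (Suc t) y + B (few_steps c b n J' (Suc t)) y"
    using False H c[of y t] J by simp
   also have "... <= q * (of_nat n * w * (hits K H {} J y + of_nat n * e)) +
     B (%y. of_nat n * w * (hits K H {} J' y + of_nat n * e * 1)) y"
    by (intro add_mono mult_left_mono Suc B_mono) (simp_all add: Suc)
   also have "... = of_nat n * w * (q * hits K H {} J y + B (hits K H {} J') y + of_nat n * e * (q + B (%_. 1) y))"
    unfolding B_cmult B_add by (simp add: distrib_left ac_simps)
   also have "... <= of_nat n * w * (q * hits K H {} J y + (p * hits K H {} J y + e) + of_nat n * e)"
    unfolding mass mult_1_right by (intro mult_left_mono add_mono order_refl Bh) simp_all
   also have "... = of_nat n * w * ((q + p) * hits K H {} J y + of_nat (Suc n) * e)"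
    by (simp add: distrib_right distrib_left ac_simps)
   also have "... <= of_nat (Suc n) * w * (1 * hits K H {} J y + of_nat (Suc n) * e)"
    by (intro mult_mono add_mono order_refl p) (auto simp: of_nat_mono)
   finally show ?thesis by simp
  qed
 qed
qed simp

end

section \<open>Systems started from a given configuration\<close>

definition static :: "nat => ('v => enat) => 'v env" where
 "static N a y j = (if j < N then a y else 0)"

definition B_start :: "'v set => ('v => int) => 'v => enat" where
 "B_start R ze y = (if y : R then enat (nat (- ze y)) else 0)"

text \<open>Infinitely many B-particles outside \<open>R\<close> absorb every particle that leaves \<open>R\<close>.\<close>

definition B_kill :: "'v set => ('v => int) => 'v => enat" where
 "B_kill R ze y = (if y : R then enat (nat (- ze y)) else \<infinity>)"

definition A_start :: "'v set => ('v => int) => ('v \<times> nat) multiset" where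
 "A_start R ze = (SUM y:R. replicate_mset (nat (ze y)) (y, 0))"

lemma admissible_static [simp]: "admissible N (static N a)"
 by (auto simp: admissible_def static_def intro!: antimonoI)

lemma clear_time_static: "clear_time (static N a) y = (if a y = 0 then 0 else N)"
 by (rule clear_time_eqI) (auto simp: static_def)

lemma take_B_static: "take_B (static N a) y 0 = static N (a(y := a y - 1))"
 by (auto simp: take_B_def static_def fun_eq_iff)

lemma expect_die:
 "admissible N b ==> N <= max t (clear_time b y) ==>
  expect Q N c g b v (add_mset (y, t) M) = expect Q N c g (take_B b y t) v M"
 by (simp add: expect_add_mset Let_def)

lemma expect_move:
 "admissible N b ==> l = max t (clear_time b y) ==> l < N ==>
  expect Q N c g b v (add_mset (y, t) M) =
  (\<integral>\<^sup>+y'. expect Q N c g (take_B b y t) (v + c y l) (add_mset (y', Suc l) M) \<partial>Q y)"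
 by (simp only: expect_add_mset Let_def not_le[symmetric] if_False)

text \<open>In a static environment an occupied site stays occupied up to the horizon, so the token
  dies and takes one B-particle with it. This is the cancellation of an A-B pair at a common
  starting site.\<close>

lemma expect_cancel:
 "a y ~= 0 ==> expect Q N c g (static N a) v (add_mset (y, 0) M) = expect Q N c g (static N (a(y := a y - 1))) v M"
 by (simp add: expect_add_mset clear_time_static take_B_static)

lemma expect_cancel_replicate:
 "enat n <= a y ==> expect Q N c g (static N a) v (replicate_mset n (y, 0) + M) = expect Q N c g (static N (a(y := a y - enat n))) v M"
proof (induction n arbitrary: a)
 case 0
 thus ?case by (simp add: zero_enat_def[symmetric])
next
 case (Suc n)
 have "a y ~= 0" using Suc.prems by (auto simp: enat_0_iff)
 moreover have "a y - 1 - enat n = a y - enat (Suc n)" "enat n <= a y - 1"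
  using Suc.prems by (cases "a y"; auto simp: one_enat_def)+
 ultimately have "expect Q N c g (static N (a(y := a y - 1))) v (replicate_mset n (y, 0) + M) =
   expect Q N c g (static N (a(y := a y - enat (Suc n)))) v M"
  by (subst Suc.IH) (simp_all only: fun_upd_same fun_upd_upd)
 with \<open>a y ~= 0\<close> show ?case by (simp add: expect_cancel del: fun_upd_apply)
qed

lemma expect_cancel_sum:
 assumes "finite F"
 shows "(!!y. y : F ==> enat (n y) <= a y) ==>
  expect Q N c g (static N a) v ((SUM y:F. replicate_mset (n y) (y, 0)) + M) =
  expect Q N c g (static N (%y. if y : F then a y - enat (n y) else a y)) v M"
 using assms
proof (induction F arbitrary: a)
 case (insert x F)
 have "expect Q N c g (static N a) v ((SUM y:insert x F. replicate_mset (n y) (y, 0)) + M) =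
   expect Q N c g (static N (a(x := a x - enat (n x)))) v ((SUM y:F. replicate_mset (n y) (y, 0)) + M)"
  using insert expect_cancel_replicate[of "n x" a x] by (simp add: add.assoc)
 also have "... = expect Q N c g (static N (%y. if y : F then (a(x := a x - enat (n x))) y - enat (n y) else (a(x := a x - enat (n x))) y)) v M"
  by (rule insert.IH) (use insert in auto)
 also have "(%y. if y : F then (a(x := a x - enat (n x))) y - enat (n y) else (a(x := a x - enat (n x))) y) =
   (%y. if y : insert x F then a y - enat (n y) else a y)" using insert by auto
 finally show ?case .
qed simp

lemma expect_hom:
 assumes "admissible N b" "!!x y. f (x + y) = f x + f y"
 shows "expect Q N (%y j. f (c y j)) g b (f v) M = expect Q N c (%v. g (f v)) b v M"
 unfolding expect_def run_hom[OF assms, where Q = Q, symmetric] by (simp add: nn_integral_map_pmf)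

lemma expect_cong_support:
 assumes "!!z. z : set_pmf (run Q N c b v M) ==> g (snd z) = g' (snd z)"
 shows "expect Q N c g b v M = expect Q N c g' b v M"
 unfolding expect_def by (intro nn_integral_cong_AE AE_pmfI assms)

lemma expect_le_1: "(!!v. g v <= 1) ==> expect Q N c g b v M <= 1"
 unfolding expect_def by (rule order_trans[OF nn_integral_mono[where v = "%_. 1"]]) auto

lemma run_bound:
 fixes c :: "'v => nat => real"
 assumes "admissible N b" and w: "!!y j. c y j <= w j" "!!j. 0 <= w j"
 shows "z : set_pmf (run Q N c b v M) ==> snd z <= v + (\<Sum>x\<in>#M. \<Sum>j=snd x..<N. w j)"
 using assms(1)
proof (induction b v M arbitrary: z rule: run_induct[where c = c])
 case (die b v y t M)
 hence "snd z <= v + (\<Sum>x\<in>#M. \<Sum>j=snd x..<N. w j)" by (simp add: run_die)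
 moreover have "0 <= (\<Sum>j=t..<N. w j)" by (intro sum_nonneg w)
 ultimately show ?case by simp
next
 case (move b v y t M l)
 then obtain y' where "z : set_pmf (run Q N c (take_B b y t) (v + c y l) (add_mset (y', Suc l) M))"
  by (auto simp: run_move[OF move(1-3)])
 from move(4)[OF this] have "snd z <= v + c y l + (\<Sum>x\<in>#add_mset (y', Suc l) M. \<Sum>j=snd x..<N. w j)" .
 moreover have "c y l + (\<Sum>j=Suc l..<N. w j) <= (\<Sum>j=l..<N. w j)"
  using move(3) w(1)[of y l] by (simp add: sum.atLeast_Suc_lessThan)
 moreover have "(\<Sum>j=l..<N. w j) <= (\<Sum>j=t..<N. w j)"
  by (rule sum_mono2) (use move(2) w in auto)
 ultimately show ?case by simp
qed simp

lemma run_bound_0: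
 fixes c :: "'v => nat => real"
 assumes "admissible N b" "!!y j. c y j <= w j" "!!j. 0 <= w j" "!!x. x \<in># M ==> snd x = 0"
  and "z : set_pmf (run Q N c b v M)"
 shows "snd z <= v + real (size M) * (\<Sum>j<N. w j)"
proof -
 have "(\<Sum>x\<in>#M. \<Sum>j=snd x..<N. w j) = (\<Sum>x\<in>#M. \<Sum>j<N. w j)"
  using assms(4) by (intro arg_cong[of _ _ sum_mset] image_mset_cong) (simp add: atLeast0LessThan)
 thus ?thesis using run_bound[OF assms(1-3,5)] by simp
qed

lemma A_start_0: "x \<in># A_start R ze ==> snd x = 0"
 by (cases "finite R") (auto simp: A_start_def in_Union_mset_iff set_mset_sum split: if_splits)

section \<open>Exponential functionals and potentials of the token process\<close>

lemma exp_le_half: "0 <= x ==> x <= 1 ==> exp (- x) <= 1 - x / 2" for x :: real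
proof -
 assume "0 <= x" "x <= 1"
 hence "1 / (1 + x) <= 1 - x / 2" using mult_left_mono[of x 1 x] by (auto simp: field_simps)
 moreover have "exp (- x) <= 1 / (1 + x)"
  using \<open>0 <= x\<close> exp_ge_add_one_self[of x] by (simp add: exp_minus field_simps)
 ultimately show ?thesis by simp
qed

lemma solo_eq_increment:
 fixes c :: "'v => nat => real"
 assumes "admissible N b" "!!y j. 0 <= c y j"
 shows "solo Q (%y j. ennreal (c y j)) b N 0 x = (\<integral>\<^sup>+z. ennreal (snd z - v) \<partial>run Q N c b v {#(x, 0)#})"
 using expect_single[where N = N and b = b and v = 0 and Q = Q and y = x and t = 0 and c = c] assms
  expect_translate[where N = N and b = b and Q = Q and c = c and g = "%u. ennreal (u - v)" and u = v and v = 0 and M = "{#(x, 0)#}"]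
 by (simp add: expect_def)

text \<open>By \<open>wr\<close> the increment due to a single token, multiplied by
  \<open>r\<close>, is at most \<open>1\<close>, which is the range where \<open>exp_le_half\<close>
  applies.\<close>

locale bounded_weights =
 fixes Q :: "'v => 'v pmf" and N :: nat and c :: "'v => nat => real" and w :: "nat => real" and r :: real
 assumes c0: "!!y j. 0 <= c y j" and cmono: "!!y i j. i <= j ==> c y j <= c y i"
  and cw: "!!y j. c y j <= w j" and r: "0 < r" and wr: "r * (\<Sum>j<N. w j) <= 1"
begin

lemma w0: "0 <= w j"
 using c0 cw order_trans by blast

abbreviation sol :: "'v env => 'v => ennreal" where
 "sol b x \<equiv> solo Q (%y j. ennreal (c y j)) b N 0 x"

lemma single_token:
 assumes b: "admissible N b" and z: "z : set_pmf (run Q N c b v {#(x, 0)#})"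
 shows "v <= snd z" "r * (snd z - v) <= 1"
proof -
 show "v <= snd z" using run_increasing[OF b c0 z] .
 have "snd z <= v + real (size {#(x, 0::nat)#}) * (\<Sum>j<N. w j)"
  by (rule run_bound_0[OF b cw w0 _ z]) auto
 hence "r * (snd z - v) <= r * (\<Sum>j<N. w j)" using r by (intro mult_left_mono) auto
 thus "r * (snd z - v) <= 1" using wr by simp
qed

lemma sol_eq: "admissible N b ==> sol b x = (\<integral>\<^sup>+z. ennreal (snd z - v) \<partial>run Q N c b v {#(x, 0)#})"
 by (rule solo_eq_increment[OF _ c0])

lemma sol_finite: "admissible N b ==> sol b x ~= top"
proof -
 assume b: "admissible N b"
 have "sol b x <= (\<integral>\<^sup>+z. ennreal (1 / r) \<partial>run Q N c b 0 {#(x, 0)#})"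
  unfolding sol_eq[OF b, where v = 0]
  by (intro nn_integral_mono_AE AE_pmfI ennreal_leI) (use single_token(2)[OF b, of _ 0 x] r in \<open>auto simp: field_simps\<close>)
 thus ?thesis by (auto simp: top_unique)
qed

lemma sol_mono:
 assumes "admissible N b" "admissible N b'" "!!y j. b y j <= b' y j"
 shows "sol b' x <= sol b x"
 using expect_mono[OF c0 cmono, where g = ennreal and N = N and b = b' and b' = b and v = 0 and v' = 0
   and M = "{#(x, 0)#}" and M' = "{#(x, 0)#}" and Q = Q and E = "{#}"] assms
  expect_single[OF _ c0, where N = N and b = b and v = 0 and Q = Q and y = x and t = 0]
  expect_single[OF _ c0, where N = N and b = b' and v = 0 and Q = Q and y = x and t = 0]
 by (simp add: rel_mset_no_later_refl mono_def ennreal_leI)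

lemma expect_decay_single:
 assumes b: "admissible N b"
 shows "expect Q N c (%v. ennreal (exp (- r * v))) b v {#(x, 0)#} <= ennreal (exp (- r * v)) * (1 - ennreal (r / 2) * sol b x)"
proof -
 let ?R = "run Q N c b v {#(x, 0)#}"
 have "(\<integral>\<^sup>+z. ennreal (exp (- r * snd z)) + ennreal (exp (- r * v) * (r / 2)) * ennreal (snd z - v) \<partial>?R) <= (\<integral>\<^sup>+z. ennreal (exp (- r * v)) \<partial>?R)"
 proof (intro nn_integral_mono_AE AE_pmfI)
  fix z assume "z : set_pmf ?R"
  note st = single_token[OF b this]
  have "exp (- (r * (snd z - v))) <= 1 - r * (snd z - v) / 2" using st r by (intro exp_le_half) auto
  hence "exp (- r * v) * exp (- (r * (snd z - v))) <= exp (- r * v) * (1 - r * (snd z - v) / 2)" by simp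
  moreover have "exp (- r * v) * exp (- (r * (snd z - v))) = exp (- r * snd z)"
   by (simp add: exp_add[symmetric] algebra_simps)
  ultimately have "exp (- r * snd z) + exp (- r * v) * (r / 2) * (snd z - v) <= exp (- r * v)"
   by (simp add: algebra_simps)
  thus "ennreal (exp (- r * snd z)) + ennreal (exp (- r * v) * (r / 2)) * ennreal (snd z - v) <= ennreal (exp (- r * v))"
   using st r by (simp add: ennreal_mult[symmetric] ennreal_plus[symmetric] ennreal_leI del: ennreal_plus)
 qed
 hence "expect Q N c (%v. ennreal (exp (- r * v))) b v {#(x, 0)#} + ennreal (exp (- r * v)) * (ennreal (r / 2) * sol b x) <= ennreal (exp (- r * v))"
  unfolding expect_def sol_eq[OF b, where v = v] mult.assoc[symmetric] ennreal_mult[OF exp_ge_zero, of "r / 2" "- r * v", symmetric, OF less_imp_le[OF half_gt_zero[OF r]]]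
  by (simp add: nn_integral_add nn_integral_cmult)
 hence le: "expect Q N c (%v. ennreal (exp (- r * v))) b v {#(x, 0)#} <= ennreal (exp (- r * v)) - ennreal (exp (- r * v)) * (ennreal (r / 2) * sol b x)"
  by (simp only: ennreal_le_minus_iff simp_thms)
 also have "... = ennreal (exp (- r * v)) * (1 - ennreal (r / 2) * sol b x)"
  by (subst ennreal_right_diff_distrib) simp_all
 finally show ?thesis .
qed

text \<open>Every token contributes one factor. Tokens that have already run have only removed
  B-particles, so the environment is still below \<open>e x\<close>, and a token collects at least
  what it would collect in \<open>e x\<close>.\<close>

lemma expect_decay:
 fixes M :: "'v multiset"
 shows "admissible N b ==> (!!x y j. x \<in># M ==> b y j <= e x y j) ==> (!!x. x \<in># M ==> admissible N (e x)) ==>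
  expect Q N c (%v. ennreal (exp (- r * v))) b v (image_mset (%x. (x, 0)) M) \<le>
  ennreal (exp (- r * v)) * (\<Prod>x\<in>#M. 1 - ennreal (r / 2) * sol (e x) x)"
proof (induction M arbitrary: b v)
 case (add x M)
 let ?g = "%v. ennreal (exp (- r * v))" and ?P = "\<Prod>x\<in>#M. 1 - ennreal (r / 2) * sol (e x) x"
 have "expect Q N c ?g b v ({#(x, 0)#} + image_mset (%x. (x, 0)) M) =
   (\<integral>\<^sup>+z. expect Q N c ?g (fst z) (snd z) (image_mset (%x. (x, 0)) M) \<partial>run Q N c b v {#(x, 0)#})"
  by (rule expect_union[OF add.prems(1)])
 also have "... <= (\<integral>\<^sup>+z. ?g (snd z) * ?P \<partial>run Q N c b v {#(x, 0)#})"
 proof (intro nn_integral_mono_AE AE_pmfI add.IH)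
  fix z assume z: "z : set_pmf (run Q N c b v {#(x, 0)#})"
  note dec = run_decreasing[OF add.prems(1) z]
  show "admissible N (fst z)" using dec by simp
  show "fst z y j <= e x' y j" if "x' \<in># M" for x' y j
   using dec add.prems(2)[of x' y j] that by (auto intro: order_trans)
 qed (use add.prems in auto)
 also have "... = expect Q N c ?g b v {#(x, 0)#} * ?P" by (simp add: nn_integral_multc expect_def)
 also have "... <= (?g v * (1 - ennreal (r / 2) * sol b x)) * ?P"
  by (intro mult_right_mono expect_decay_single add.prems(1)) simp
 also have "... <= (?g v * (1 - ennreal (r / 2) * sol (e x) x)) * ?P"
  by (intro mult_right_mono mult_left_mono ennreal_minus_mono sol_mono order_refl) (use add.prems in auto)
 finally show ?case by (simp add: mult.assoc)
qed simp

text \<open>The B-particles in \<open>F\<close> are neutralised by adding one token for each of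
  them; such a token changes the functional by a factor of at most \<open>exp 1\<close>, since
  \<open>r\<close> times its contribution is at most \<open>1\<close>. Dropping the tokens of
  \<open>F\<close> then only increases the functional. A site \<open>x\<close> of \<open>D\<close>
  where a token starts holds no B-particle, so the B-particles left are dominated by infinitely many
  at every site of \<open>D - {x}\<close>.\<close>

lemma expect_obstacles:
 assumes F: "finite F" "finite D" "F Int D = {}"
 shows "expect Q N c (%v. ennreal (exp (- r * v))) (static N (B_start (F Un D) ze)) 0 (A_start (F Un D) ze) \<le>
  ennreal (exp (SUM y:F. real (nat (- ze y)))) *
  (PROD x:D. (1 - ennreal (r / 2) * sol (static N (%y. if y : D - {x} then \<infinity> else 0)) x) ^ nat (ze x))"
proof -
 let ?g = "%v. ennreal (exp (- r * v))"
 define C :: "('v \<times> nat) multiset" where "C = (SUM y:F. replicate_mset (nat (- ze y)) (y, 0))"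
 let ?b = "static N (B_start (F Un D) ze)" and ?b' = "static N (B_start D ze)"
 have Cn: "size C = (SUM y:F. nat (- ze y))" by (simp add: C_def size_multiset_sum)
 have C0: "x \<in># C ==> snd x = 0" for x
  using F(1) by (auto simp: C_def set_mset_sum split: if_splits)
 have split: "A_start (F Un D) ze = A_start D ze + A_start F ze"
  unfolding A_start_def using F by (subst sum.union_disjoint) (auto simp: add.commute)
 have eq: "expect Q N c ?g ?b 0 (A_start (F Un D) ze + C) = expect Q N c ?g ?b' 0 (A_start (F Un D) ze)"
 proof -
  have "expect Q N c ?g ?b 0 (C + A_start (F Un D) ze) =
   expect Q N c ?g (static N (%y. if y : F then B_start (F Un D) ze y - enat (nat (- ze y)) else B_start (F Un D) ze y)) 0 (A_start (F Un D) ze)"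
   unfolding C_def by (rule expect_cancel_sum[OF F(1)]) (simp add: B_start_def)
  also have "(%y. if y : F then B_start (F Un D) ze y - enat (nat (- ze y)) else B_start (F Un D) ze y) = B_start D ze"
   using F(3) by (auto simp: B_start_def fun_eq_iff zero_enat_def)
  finally show ?thesis by (simp add: add.commute)
 qed
 have "expect Q N c ?g ?b 0 (A_start (F Un D) ze) = expect Q N c (%v. ennreal (exp (real (size C))) * ennreal (exp (- r * v - size C))) ?b 0 (A_start (F Un D) ze)"
  by (simp add: ennreal_mult[symmetric] exp_add[symmetric])
 also have "... = ennreal (exp (real (size C))) * (\<integral>\<^sup>+z. ennreal (exp (- r * snd z - size C)) \<partial>run Q N c ?b 0 (A_start (F Un D) ze))"
  by (simp add: expect_def nn_integral_cmult)
 also have "... <= ennreal (exp (real (size C))) * (\<integral>\<^sup>+z. expect Q N c ?g (fst z) (snd z) C \<partial>run Q N c ?b 0 (A_start (F Un D) ze))"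
 proof (intro mult_left_mono nn_integral_mono_AE AE_pmfI)
  fix z assume "z : set_pmf (run Q N c ?b 0 (A_start (F Un D) ze))"
  hence z: "admissible N (fst z)" using run_decreasing[OF admissible_static] by blast
  have "ennreal (exp (- r * snd z - size C)) = (\<integral>\<^sup>+z'. ennreal (exp (- r * snd z - size C)) \<partial>run Q N c (fst z) (snd z) C)"
   by simp
  also have "... <= (\<integral>\<^sup>+z'. ?g (snd z') \<partial>run Q N c (fst z) (snd z) C)"
  proof (intro nn_integral_mono_AE AE_pmfI)
   fix z' assume "z' : set_pmf (run Q N c (fst z) (snd z) C)"
   from run_bound_0[OF z cw w0 C0 this] have "snd z' <= snd z + real (size C) * (\<Sum>j<N. w j)" .
   hence "r * snd z' <= r * (snd z + real (size C) * (\<Sum>j<N. w j))" using r by simp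
   also have "... = r * snd z + real (size C) * (r * (\<Sum>j<N. w j))" by (simp add: algebra_simps)
   also have "... <= r * snd z + real (size C) * 1" by (intro add_left_mono mult_left_mono wr) simp
   finally show "ennreal (exp (- r * snd z - size C)) <= ?g (snd z')" by (intro ennreal_leI) simp
  qed
  finally show "ennreal (exp (- r * snd z - size C)) <= expect Q N c ?g (fst z) (snd z) C" by (simp add: expect_def)
 qed simp
 also have "... = ennreal (exp (real (size C))) * expect Q N c ?g ?b' 0 (A_start D ze + A_start F ze)"
  by (simp only: expect_union[OF admissible_static, symmetric] eq split[symmetric])
 also have "expect Q N c ?g ?b' 0 (A_start D ze + A_start F ze) <= expect Q N c ?g ?b' 0 (A_start D ze)"
 proof -
  have "expect Q N c ?g ?b' 0 (A_start D ze + A_start F ze) <= (\<integral>\<^sup>+z. ?g (snd z) \<partial>run Q N c ?b' 0 (A_start D ze))"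
   unfolding expect_union[OF admissible_static]
  proof (intro nn_integral_mono_AE AE_pmfI)
   fix z assume "z : set_pmf (run Q N c ?b' 0 (A_start D ze))"
   hence z: "admissible N (fst z)" using run_decreasing[OF admissible_static] by blast
   have "expect Q N c ?g (fst z) (snd z) (A_start F ze) <= (\<integral>\<^sup>+z'. ?g (snd z) \<partial>run Q N c (fst z) (snd z) (A_start F ze))"
    unfolding expect_def
    by (intro nn_integral_mono_AE AE_pmfI ennreal_leI) (use run_increasing[OF z c0] r in simp)
   thus "expect Q N c ?g (fst z) (snd z) (A_start F ze) <= ?g (snd z)" by simp
  qed
  thus ?thesis by (simp add: expect_def)
 qed
 also have "expect Q N c ?g ?b' 0 (A_start D ze) <= ennreal (exp (- r * 0)) *
   (\<Prod>x\<in>#(SUM x:D. replicate_mset (nat (ze x)) x). 1 - ennreal (r / 2) * sol (static N (%y. if y : D - {x} then \<infinity> else 0)) x)"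
 proof -
  have A: "A_start D ze = image_mset (%x. (x, 0)) (SUM x:D. replicate_mset (nat (ze x)) x)"
   unfolding A_start_def using F(2) by (induction D) simp_all
  show ?thesis unfolding A
  proof (rule expect_decay)
   fix x y j assume "x \<in># (SUM x:D. replicate_mset (nat (ze x)) x)"
   hence "0 < ze x" using F(2) by (auto simp: set_mset_sum split: if_splits)
   thus "?b' y j <= static N (%y. if y : D - {x} then \<infinity> else 0) y j"
    by (auto simp: static_def B_start_def zero_enat_def)
  qed auto
 qed
 also have "(\<Prod>x\<in>#(SUM x:D. replicate_mset (nat (ze x)) x). 1 - ennreal (r / 2) * sol (static N (%y. if y : D - {x} then \<infinity> else 0)) x)
   = (PROD x:D. (1 - ennreal (r / 2) * sol (static N (%y. if y : D - {x} then \<infinity> else 0)) x) ^ nat (ze x))"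
 proof -
  have "(\<Prod>x\<in>#(SUM x:D. replicate_mset (nat (ze x)) x). f x) = (PROD x:D. f x ^ nat (ze x))" for f :: "'v => ennreal"
   using F(2) by (induction D) simp_all
  thus ?thesis .
 qed
 finally show ?thesis by (simp add: Cn mult_left_mono)
qed

text \<open>The potential \<open>Ph\<close> is built so that a gain in \<open>u\<close> pays for a
  gain in \<open>v\<close>. Relative to \<open>exp (- r * u0)\<close>, the expected gain of
  \<open>v\<close> is at most \<open>ep + et * sol b x\<close> by \<open>hyp\<close>, while
  \<open>exp (- r * u)\<close> loses at least \<open>r / 2\<close> times the gain in
  \<open>u\<close>; with the weight \<open>2 * et / r\<close> the two terms in \<open>et\<close>
  cancel.\<close>

lemma tail_single:
 fixes c' :: "'v => nat => real"
 assumes b: "admissible N b" and c': "!!y j. 0 <= c' y j" and et: "0 <= et" and x0: "0 <= x0" "0 <= u0"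
  and hyp: "solo Q (%y j. ennreal (c' y j)) b N 0 x <= ep + ennreal et * sol b x"
 defines "Ph \<equiv> %(v, u). ennreal ((min 1 v + 2 * et / r) * exp (- r * u))"
 shows "expect Q N (%y j. (c' y j, c y j)) Ph b (x0, u0) {#(x, 0)#} <= Ph (x0, u0) + ep"
proof -
 let ?cc = "%y j. (c' y j, c y j)"
 let ?R = "run Q N ?cc b (x0, u0) {#(x, 0)#}"
 have fst: "map_pmf (map_prod id fst) ?R = run Q N c' b x0 {#(x, 0)#}"
  using run_hom[OF b, of fst Q ?cc "(x0, u0)" "{#(x, 0)#}"] by simp
 have snd: "map_pmf (map_prod id snd) ?R = run Q N c b u0 {#(x, 0)#}"
  using run_hom[OF b, of snd Q ?cc "(x0, u0)" "{#(x, 0)#}"] by simp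
 have s': "(\<integral>\<^sup>+z. ennreal (fst (snd z) - x0) \<partial>?R) = solo Q (%y j. ennreal (c' y j)) b N 0 x"
  unfolding solo_eq_increment[OF b c', where v = x0] fst[symmetric] by (simp add: nn_integral_map_pmf)
 have s: "(\<integral>\<^sup>+z. ennreal (snd (snd z) - u0) \<partial>?R) = sol b x"
  unfolding sol_eq[OF b, where v = u0] snd[symmetric] by (simp add: nn_integral_map_pmf)
 have "(\<integral>\<^sup>+z. Ph (snd z) + ennreal (exp (- r * u0) * et) * ennreal (snd (snd z) - u0) \<partial>?R)
   <= (\<integral>\<^sup>+z. Ph (x0, u0) + ennreal (exp (- r * u0)) * ennreal (fst (snd z) - x0) \<partial>?R)"
 proof (intro nn_integral_mono_AE AE_pmfI)
  fix z assume z: "z : set_pmf ?R"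
  define v u where "v = fst (snd z)" and "u = snd (snd z)"
  have "map_prod id fst z : set_pmf (run Q N c' b x0 {#(x, 0)#})" "map_prod id snd z : set_pmf (run Q N c b u0 {#(x, 0)#})"
   unfolding fst[symmetric] snd[symmetric] using z by (auto intro: imageI)
  from run_increasing[OF b c' this(1)] single_token[OF b this(2)]
  have v: "x0 <= v" and u: "u0 <= u" "r * (u - u0) <= 1" by (simp_all add: v_def u_def)
  have "exp (- r * u) = exp (- r * u0) * exp (- (r * (u - u0)))" by (simp add: exp_add[symmetric] algebra_simps)
  also have "... <= exp (- r * u0) * (1 - r * (u - u0) / 2)"
   using u r by (intro mult_left_mono exp_le_half) auto
  finally have e: "exp (- r * u) <= exp (- r * u0) * (1 - r * (u - u0) / 2)" .
  have e1: "exp (- r * u) <= exp (- r * u0)" using u r by simp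
  have m: "min 1 v <= min 1 x0 + (v - x0)" "0 <= min 1 v" using v x0 by auto
  have t1: "min 1 v * exp (- r * u) <= min 1 v * exp (- r * u0)" by (rule mult_left_mono[OF e1 m(2)])
  have t2: "2 * et / r * exp (- r * u) <= 2 * et / r * (exp (- r * u0) * (1 - r * (u - u0) / 2))"
   by (rule mult_left_mono[OF e]) (use et r in simp)
  have "(min 1 v + 2 * et / r) * exp (- r * u) <= min 1 v * exp (- r * u0) + 2 * et / r * (exp (- r * u0) * (1 - r * (u - u0) / 2))"
   unfolding distrib_right by (rule add_mono[OF t1 t2])
  also have "... <= (min 1 x0 + (v - x0)) * exp (- r * u0) + 2 * et / r * (exp (- r * u0) * (1 - r * (u - u0) / 2))"
   by (rule add_right_mono, rule mult_right_mono[OF m(1)]) simp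
  also have "... = (min 1 x0 + 2 * et / r) * exp (- r * u0) + exp (- r * u0) * (v - x0) - exp (- r * u0) * et * (u - u0)"
   using r by (simp add: field_simps)
  finally have fin: "(min 1 v + 2 * et / r) * exp (- r * u) + exp (- r * u0) * et * (u - u0) <= (min 1 x0 + 2 * et / r) * exp (- r * u0) + exp (- r * u0) * (v - x0)" by simp
  have nn: "0 <= (min 1 v + 2 * et / r) * exp (- r * u)" "0 <= (min 1 x0 + 2 * et / r) * exp (- r * u0)"
   using m(2) x0 et r by (auto intro!: mult_nonneg_nonneg add_nonneg_nonneg)
  have "Ph (snd z) + ennreal (exp (- r * u0) * et) * ennreal (u - u0) = ennreal ((min 1 v + 2 * et / r) * exp (- r * u) + exp (- r * u0) * et * (u - u0))"
   using nn(1) u et by (simp add: Ph_def case_prod_beta v_def[symmetric] u_def[symmetric] ennreal_mult)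
  also have "... <= ennreal ((min 1 x0 + 2 * et / r) * exp (- r * u0) + exp (- r * u0) * (v - x0))" by (rule ennreal_leI[OF fin])
  also have "... = Ph (x0, u0) + ennreal (exp (- r * u0)) * ennreal (v - x0)"
   using nn(2) v by (simp add: Ph_def ennreal_mult)
  finally show "Ph (snd z) + ennreal (exp (- r * u0) * et) * ennreal (snd (snd z) - u0) <= Ph (x0, u0) + ennreal (exp (- r * u0)) * ennreal (fst (snd z) - x0)"
   by (simp only: v_def u_def)
 qed
 hence "expect Q N ?cc Ph b (x0, u0) {#(x, 0)#} + ennreal (exp (- r * u0) * et) * sol b x
   <= Ph (x0, u0) + ennreal (exp (- r * u0)) * solo Q (%y j. ennreal (c' y j)) b N 0 x"
  by (simp add: nn_integral_add nn_integral_cmult s s' expect_def)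
 also have "... <= Ph (x0, u0) + ennreal (exp (- r * u0)) * (ep + ennreal et * sol b x)"
  by (intro add_left_mono mult_left_mono hyp) simp
 also have "... = Ph (x0, u0) + ennreal (exp (- r * u0)) * ep + ennreal (exp (- r * u0) * et) * sol b x"
  using et by (simp add: distrib_left ennreal_mult ac_simps)
 finally have "expect Q N ?cc Ph b (x0, u0) {#(x, 0)#} <= Ph (x0, u0) + ennreal (exp (- r * u0)) * ep"
  using sol_finite[OF b, of x] by (simp add: add.commute[of _ "_ * sol b x"] ennreal_add_left_cancel_le ennreal_mult_eq_top_iff)
 also have "ennreal (exp (- r * u0)) * ep <= 1 * ep"
  using x0 r by (intro mult_right_mono) auto
 finally show ?thesis by simp
qed

lemma tail_bound:
 fixes c' :: "'v => nat => real" and M :: "'v multiset"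
 assumes c': "!!y j. 0 <= c' y j" and et: "0 <= et"
  and hyp: "!!x b. x \<in># M ==> admissible N b ==> solo Q (%y j. ennreal (c' y j)) b N 0 x <= ep x + ennreal et * sol b x"
 defines "Ph \<equiv> %(v, u). ennreal ((min 1 v + 2 * et / r) * exp (- r * u))"
 shows "admissible N b ==> 0 <= x0 ==> 0 <= u0 ==>
  expect Q N (%y j. (c' y j, c y j)) Ph b (x0, u0) (image_mset (%x. (x, 0)) M) <= Ph (x0, u0) + (\<Sum>x\<in>#M. ep x)"
 using hyp
proof (induction M arbitrary: b x0 u0)
 case (add x M)
 let ?cc = "%y j. (c' y j, c y j)" and ?S = "\<Sum>x\<in>#M. ep x"
 let ?R = "run Q N ?cc b (x0, u0) {#(x, 0)#}"
 have "expect Q N ?cc Ph b (x0, u0) ({#(x, 0)#} + image_mset (%x. (x, 0)) M) =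
   (\<integral>\<^sup>+z. expect Q N ?cc Ph (fst z) (snd z) (image_mset (%x. (x, 0)) M) \<partial>?R)"
  by (rule expect_union[OF add.prems(1)])
 also have "... <= (\<integral>\<^sup>+z. Ph (snd z) + ?S \<partial>?R)"
 proof (intro nn_integral_mono_AE AE_pmfI)
  fix z assume z: "z : set_pmf ?R"
  have "map_prod id fst z : set_pmf (map_pmf (map_prod id fst) ?R)" "map_prod id snd z : set_pmf (map_pmf (map_prod id snd) ?R)"
   using z by (auto intro: imageI)
  hence "map_prod id fst z : set_pmf (run Q N c' b x0 {#(x, 0)#})" "map_prod id snd z : set_pmf (run Q N c b u0 {#(x, 0)#})"
   using run_hom[OF add.prems(1), of fst Q ?cc "(x0, u0)" "{#(x, 0)#}"] run_hom[OF add.prems(1), of snd Q ?cc "(x0, u0)" "{#(x, 0)#}"] by simp_all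
  from run_increasing[OF add.prems(1) c' this(1)] run_increasing[OF add.prems(1) c0 this(2)]
  have "0 <= fst (snd z)" "0 <= snd (snd z)" using add.prems by auto
  moreover have "admissible N (fst z)" using run_decreasing[OF add.prems(1) z] by simp
  ultimately show "expect Q N ?cc Ph (fst z) (snd z) (image_mset (%x. (x, 0)) M) <= Ph (snd z) + ?S"
   using add.IH[of "fst z" "fst (snd z)" "snd (snd z)"] add.prems(4) by simp
 qed
 also have "... = expect Q N ?cc Ph b (x0, u0) {#(x, 0)#} + ?S" by (simp add: nn_integral_add expect_def)
 also have "... <= (Ph (x0, u0) + ep x) + ?S"
  unfolding Ph_def by (intro add_right_mono tail_single) (use add.prems c' et in auto)
 finally show ?case by (simp add: add.assoc)
qed simp

text \<open>As long as the second functional is below \<open>A\<close>, the gain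
  \<open>min 1 v\<close> is at most \<open>exp (r * A)\<close> times the potential, whose growth
  \<open>tail_bound\<close> controls token by token. Otherwise the change of \<open>g\<close> is at
  most \<open>1\<close> and is charged to \<open>ps\<close>.\<close>

lemma tail_effect:
 fixes c' :: "'v => nat => real" and M :: "'v multiset" and g ps :: "real => ennreal"
 assumes b: "admissible N b" and c': "!!y j. 0 <= c' y j" and et: "0 <= et"
  and hyp: "!!x b. x \<in># M ==> admissible N b ==> solo Q (%y j. ennreal (c' y j)) b N 0 x <= ep x + ennreal et * sol b x"
  and g: "!!v d. 0 <= d ==> g (v + d) <= g v + ennreal (min 1 d)" and ps: "!!u. A <= u ==> 1 <= ps u"
 shows "expect Q N c' g b 0 (M0 + image_mset (%x. (x, 0)) M) \<le>
  expect Q N c' g b 0 M0 + ennreal (exp (r * A)) * (min 1 (\<Sum>x\<in>#M. ep x) + ennreal (2 * et / r)) +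
  expect Q N c ps b 0 (M0 + image_mset (%x. (x, 0)) M)"
proof -
 let ?cc = "%y j. (c' y j, c y j)" and ?M = "image_mset (%x. (x, 0)) M"
 let ?R = "run Q N ?cc b (0, 0) M0"
 define Ph where "Ph = (%(v, u). ennreal ((min 1 v + 2 * et / r) * exp (- r * u)))"
 define E where "E = ennreal (exp (r * A)) * (min 1 (\<Sum>x\<in>#M. ep x) + ennreal (2 * et / r))"
 have fstE: "expect Q N c' f b' v' M' = expect Q N ?cc (%p. f (fst p)) b' (v', u') M'" if "admissible N b'" for f b' v' u' M'
  using expect_hom[OF that, where f = fst and c = ?cc and v = "(v', u')" and Q = Q and M = M' and g = f] by simp
 have sndE: "expect Q N c f b' u' M' = expect Q N ?cc (%p. f (snd p)) b' (v', u') M'" if "admissible N b'" for f b' v' u' M'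
  using expect_hom[OF that, where f = snd and c = ?cc and v = "(v', u')" and Q = Q and M = M' and g = f] by simp
 have main: "expect Q N ?cc (%p. g (fst p)) b' (v, u) ?M <= g v + E + expect Q N ?cc (%p. ps (snd p)) b' (v, u) ?M"
  if b': "admissible N b'" and u: "0 <= u" for b' v u
 proof -
  let ?R' = "run Q N ?cc b' (0, u) ?M"
  have pos: "0 <= fst (snd z)" "u <= snd (snd z)" if z: "z : set_pmf ?R'" for z
  proof -
   have "map_prod id fst z : set_pmf (map_pmf (map_prod id fst) ?R')" "map_prod id snd z : set_pmf (map_pmf (map_prod id snd) ?R')"
    using z by (auto intro: imageI)
   hence "map_prod id fst z : set_pmf (run Q N c' b' 0 ?M)" "map_prod id snd z : set_pmf (run Q N c b' u ?M)"
    using run_hom[OF b', of fst Q ?cc "(0, u)" ?M] run_hom[OF b', of snd Q ?cc "(0, u)" ?M] by simp_all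
   from run_increasing[OF b' c' this(1)] run_increasing[OF b' c0 this(2)]
   show "0 <= fst (snd z)" "u <= snd (snd z)" by auto
  qed
  have "expect Q N ?cc (%p. g (fst p)) b' (v, u) ?M = expect Q N c' g b' (v + 0) ?M" by (simp add: fstE[OF b', of g v ?M u])
  also have "... = expect Q N c' (%x. g (v + x)) b' 0 ?M" by (rule expect_translate[OF b'])
  also have "... = (\<integral>\<^sup>+z. g (v + fst (snd z)) \<partial>?R')" unfolding fstE[OF b', of _ 0 ?M u] by (simp add: expect_def)
  also have "... <= (\<integral>\<^sup>+z. g v + ennreal (exp (r * A)) * min 1 (Ph (snd z)) + ps (snd (snd z)) \<partial>?R')"
  proof (intro nn_integral_mono_AE AE_pmfI)
   fix z assume "z : set_pmf ?R'"
   note p = pos[OF this]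
   have "ennreal (min 1 (fst (snd z))) <= ennreal (exp (r * A)) * min 1 (Ph (snd z)) + ps (snd (snd z))"
   proof (cases "A <= snd (snd z)")
    case True
    have "ennreal (min 1 (fst (snd z))) <= 1" by (simp add: ennreal_le_1)
    also have "1 <= ps (snd (snd z))" using ps True by simp
    finally show ?thesis by (simp add: add_increasing)
   next
    case False
    define a where "a = min 1 (fst (snd z)) * exp (- r * snd (snd z))"
    have "0 <= r * snd (snd z)" using p u r by simp
    hence a: "0 <= a" "a <= 1" using p unfolding a_def by (auto intro!: mult_le_one)
    have "ennreal a <= Ph (snd z)" unfolding Ph_def a_def case_prod_beta
     using et r by (intro ennreal_leI mult_right_mono) auto
    hence "ennreal (exp (r * A)) * ennreal a <= ennreal (exp (r * A)) * min 1 (Ph (snd z))"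
     using a by (intro mult_left_mono) (auto simp: ennreal_le_1)
    moreover have "min 1 (fst (snd z)) <= exp (r * A) * a"
    proof -
     have "exp (r * A) * a = min 1 (fst (snd z)) * (exp (r * A) * exp (- r * snd (snd z)))"
      by (simp only: a_def mult.left_commute)
     also have "exp (r * A) * exp (- r * snd (snd z)) = exp (r * (A - snd (snd z)))"
      by (simp add: exp_add[symmetric] algebra_simps)
     finally have "exp (r * A) * a = min 1 (fst (snd z)) * exp (r * (A - snd (snd z)))" .
     moreover have "1 <= exp (r * (A - snd (snd z)))" using False r by simp
     ultimately show ?thesis using p(1) mult_left_mono[of 1 "exp (r * (A - snd (snd z)))" "min 1 (fst (snd z))"] by simp
    qed
    hence "ennreal (min 1 (fst (snd z))) <= ennreal (exp (r * A)) * ennreal a"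
     using a(1) by (simp add: ennreal_mult[symmetric] ennreal_leI)
    ultimately show ?thesis by (simp add: add_increasing2)
   qed
   thus "g (v + fst (snd z)) <= g v + ennreal (exp (r * A)) * min 1 (Ph (snd z)) + ps (snd (snd z))"
    using order_trans[OF g[OF p(1), of v] add_left_mono] by (simp add: add.assoc)
  qed
  also have "... = g v + ennreal (exp (r * A)) * (\<integral>\<^sup>+z. min 1 (Ph (snd z)) \<partial>?R') + (\<integral>\<^sup>+z. ps (snd (snd z)) \<partial>?R')"
   by (simp add: nn_integral_add nn_integral_cmult)
  also have "(\<integral>\<^sup>+z. min 1 (Ph (snd z)) \<partial>?R') <= min 1 (\<Sum>x\<in>#M. ep x) + ennreal (2 * et / r)"
  proof -
   have 1: "(\<integral>\<^sup>+z. min 1 (Ph (snd z)) \<partial>?R') <= 1"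
    using nn_integral_mono[of "measure_pmf ?R'" "%z. min 1 (Ph (snd z))" "%_. 1"] by simp
   have "(\<integral>\<^sup>+z. min 1 (Ph (snd z)) \<partial>?R') <= expect Q N ?cc Ph b' (0, u) ?M"
    unfolding expect_def by (intro nn_integral_mono) simp
   also have "... <= Ph (0, u) + (\<Sum>x\<in>#M. ep x)"
    unfolding Ph_def by (rule tail_bound) (use c' et hyp b' u in auto)
   also have "Ph (0, u) <= ennreal (2 * et / r)"
   proof -
    have "2 * et / r * exp (- r * u) <= 2 * et / r * 1" using u r et by (intro mult_left_mono) auto
    thus ?thesis unfolding Ph_def case_prod_conv by (intro ennreal_leI) simp
   qed
   finally have 2: "(\<integral>\<^sup>+z. min 1 (Ph (snd z)) \<partial>?R') <= ennreal (2 * et / r) + (\<Sum>x\<in>#M. ep x)" by simp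
   show ?thesis
   proof (cases "(\<Sum>x\<in>#M. ep x) <= 1")
    case True with 2 show ?thesis by (simp add: min_absorb2 add.commute)
   next
    case False with 1 show ?thesis by (simp add: min_absorb1 add_increasing2)
   qed
  qed
  also have "(\<integral>\<^sup>+z. ps (snd (snd z)) \<partial>?R') = expect Q N ?cc (%p. ps (snd p)) b' (v, u) ?M"
   using sndE[OF b', of ps u ?M 0] sndE[OF b', of ps u ?M v] by (simp add: expect_def)
  finally show ?thesis by (simp add: E_def mult_left_mono)
 qed
 have "expect Q N c' g b 0 (M0 + ?M) = (\<integral>\<^sup>+z. expect Q N ?cc (%p. g (fst p)) (fst z) (snd z) ?M \<partial>?R)"
  unfolding fstE[OF b, of g 0 _ 0] by (rule expect_union[OF b])
 also have "... <= (\<integral>\<^sup>+z. g (fst (snd z)) + E + expect Q N ?cc (%p. ps (snd p)) (fst z) (snd z) ?M \<partial>?R)"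
 proof (intro nn_integral_mono_AE AE_pmfI)
  fix z assume z: "z : set_pmf ?R"
  have "map_prod id snd z : set_pmf (map_pmf (map_prod id snd) ?R)" using z by (auto intro: imageI)
  hence "map_prod id snd z : set_pmf (run Q N c b 0 M0)"
   using run_hom[OF b, of snd Q ?cc "(0, 0)" M0] by simp
  from run_increasing[OF b c0 this] have "0 <= snd (snd z)" by simp
  moreover have "admissible N (fst z)" using run_decreasing[OF b z] by simp
  ultimately show "expect Q N ?cc (%p. g (fst p)) (fst z) (snd z) ?M <= g (fst (snd z)) + E + expect Q N ?cc (%p. ps (snd p)) (fst z) (snd z) ?M"
   using main[of "fst z" "snd (snd z)" "fst (snd z)"] by simp
 qed
 also have "... = expect Q N ?cc (%p. g (fst p)) b (0, 0) M0 + E + expect Q N ?cc (%p. ps (snd p)) b (0, 0) (M0 + ?M)"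
  unfolding expect_union[OF b] by (simp add: nn_integral_add expect_def)
 finally show ?thesis unfolding E_def fstE[OF b, of g 0 M0 0] sndE[OF b, of ps 0 "M0 + ?M" 0] .
qed

end

lemma hits_mono: "m <= n ==> hits K A Z m y <= hits K A Z n y"
proof (induction m arbitrary: n y)
 case (Suc m)
 then obtain n' where n: "n = Suc n'" "m <= n'" by (cases n) auto
 have "(\<integral>\<^sup>+y'. hits K A Z m y' \<partial>K y) <= (\<integral>\<^sup>+y'. hits K A Z n' y' \<partial>K y)"
  by (intro nn_integral_mono Suc.IH n)
 thus ?case by (simp add: n)
qed simp

text \<open>The two environments act alike until some token leaves \<open>R\<close>; from then on
  \<open>g \<le> 1\<close> bounds the difference. Waiting only uses up time, so a walk without
  waiting is at least as likely to leave within the remaining time.\<close>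

lemma expect_exit:
 fixes c :: "'v => nat => 'a::comm_monoid_add"
 assumes g: "!!v. g v <= 1"
 shows "admissible N b ==> admissible N b' ==> (!!y. y : R ==> b y = b' y) ==>
  expect Q N c g b v M <= expect Q N c g b' v M + (\<Sum>x\<in>#M. hits Q (- R) {} (Suc (N - snd x)) (fst x))"
proof (induction b v M arbitrary: b' rule: run_induct[where c = c])
 case (empty b v)
 thus ?case by simp
next
 case (die b v y t M)
 let ?S = "\<Sum>x\<in>#M. hits Q (- R) {} (Suc (N - snd x)) (fst x)" and ?h = "hits Q (- R) {} (Suc (N - t)) y"
 have "expect Q N c g b v (add_mset (y, t) M) <= expect Q N c g b' v (add_mset (y, t) M) + (?h + ?S)"
 proof (cases "y : R")
  case True
  hence l: "clear_time b' y = clear_time b y" using die.prems by (simp add: clear_time_def)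
  have "take_B b y t z = take_B b' y t z" if "z : R" for z
   using fun_cong[OF die.prems(2)[OF that]] fun_cong[OF die.prems(2)[OF True]] by (auto simp: take_B_def fun_eq_iff)
  hence "expect Q N c g (take_B b y t) v M <= expect Q N c g (take_B b' y t) v M + ?S"
   by (rule die.IH[OF admissible_take_B[OF die.prems(1)]])
  also have "... <= expect Q N c g (take_B b' y t) v M + (?h + ?S)"
   by (intro add_left_mono add_increasing zero_le order_refl)
  finally show ?thesis using die.hyps die.prems l by (simp only: expect_die)
 next
  case False
  have "expect Q N c g b v (add_mset (y, t) M) <= 1" by (rule expect_le_1) (rule g)
  also have "1 = ?h" using False by simp
  also have "?h <= expect Q N c g b' v (add_mset (y, t) M) + (?h + ?S)"
   by (intro add_increasing add_increasing2 zero_le order_refl)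
  finally show ?thesis .
 qed
 thus ?case by (simp only: image_mset_add_mset sum_mset.add_mset fst_conv snd_conv)
next
 case (move b v y t M l)
 let ?S = "\<Sum>x\<in>#M. hits Q (- R) {} (Suc (N - snd x)) (fst x)" and ?h = "hits Q (- R) {} (Suc (N - t)) y"
 have "expect Q N c g b v (add_mset (y, t) M) <= expect Q N c g b' v (add_mset (y, t) M) + (?h + ?S)"
 proof (cases "y : R")
  case True
  hence l: "clear_time b' y = clear_time b y" using move.prems by (simp add: clear_time_def)
  have tk: "take_B b y t z = take_B b' y t z" if "z : R" for z
   using fun_cong[OF move.prems(2)[OF that]] fun_cong[OF move.prems(2)[OF True]] by (auto simp: take_B_def fun_eq_iff)
  have "expect Q N c g b v (add_mset (y, t) M) = (\<integral>\<^sup>+y'. expect Q N c g (take_B b y t) (v + c y l) (add_mset (y', Suc l) M) \<partial>Q y)"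
   using move.hyps by (intro expect_move)
  also have "... <= (\<integral>\<^sup>+y'. expect Q N c g (take_B b' y t) (v + c y l) (add_mset (y', Suc l) M) + (hits Q (- R) {} (Suc (N - Suc l)) y' + ?S) \<partial>Q y)"
  proof (intro nn_integral_mono)
   fix y'
   have "expect Q N c g (take_B b y t) (v + c y l) (add_mset (y', Suc l) M) <= expect Q N c g (take_B b' y t) (v + c y l) (add_mset (y', Suc l) M) +
    (\<Sum>x\<in>#add_mset (y', Suc l) M. hits Q (- R) {} (Suc (N - snd x)) (fst x))"
    by (rule move.IH[OF admissible_take_B[OF move.prems(1)] tk])
   thus "expect Q N c g (take_B b y t) (v + c y l) (add_mset (y', Suc l) M) \<le>
     expect Q N c g (take_B b' y t) (v + c y l) (add_mset (y', Suc l) M) + (hits Q (- R) {} (Suc (N - Suc l)) y' + ?S)"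
    by (simp only: image_mset_add_mset sum_mset.add_mset fst_conv snd_conv)
  qed
  also have "... = (\<integral>\<^sup>+y'. expect Q N c g (take_B b' y t) (v + c y l) (add_mset (y', Suc l) M) \<partial>Q y) +
    ((\<integral>\<^sup>+y'. hits Q (- R) {} (Suc (N - Suc l)) y' \<partial>Q y) + ?S)"
   by (simp add: nn_integral_add del: hits.simps)
  also have "(\<integral>\<^sup>+y'. hits Q (- R) {} (Suc (N - Suc l)) y' \<partial>Q y) = hits Q (- R) {} (Suc (Suc (N - Suc l))) y"
   using True by (subst (2) hits.simps(2)) (simp del: hits.simps)
  also have "hits Q (- R) {} (Suc (Suc (N - Suc l))) y <= ?h" using move.hyps by (intro hits_mono) auto
  also have "(\<integral>\<^sup>+y'. expect Q N c g (take_B b' y t) (v + c y l) (add_mset (y', Suc l) M) \<partial>Q y) = expect Q N c g b' v (add_mset (y, t) M)"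
   using move.hyps move.prems l by (intro expect_move[symmetric]) simp_all
  finally show ?thesis by (simp only: add_left_mono add_right_mono)
 next
  case False
  have "expect Q N c g b v (add_mset (y, t) M) <= 1" by (rule expect_le_1) (rule g)
  also have "1 = ?h" using False by simp
  also have "?h <= expect Q N c g b' v (add_mset (y, t) M) + (?h + ?S)"
   by (intro add_increasing add_increasing2 zero_le order_refl)
  finally show ?thesis .
 qed
 thus ?case by (simp only: image_mset_add_mset sum_mset.add_mset fst_conv snd_conv)
qed

section \<open>Distant particles rarely arrive\<close>

lemma (in bounded_weights) sol_le: "admissible N b ==> ennreal r * sol b x <= 1"
proof -
 assume b: "admissible N b"
 have "ennreal r * sol b x = (\<integral>\<^sup>+z. ennreal r * ennreal (snd z - 0) \<partial>run Q N c b 0 {#(x, 0)#})"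
  unfolding sol_eq[OF b, where v = 0] by (simp add: nn_integral_cmult)
 also have "... <= (\<integral>\<^sup>+z. 1 \<partial>run Q N c b 0 {#(x, 0)#})"
 proof (intro nn_integral_mono_AE AE_pmfI)
  fix z assume "z : set_pmf (run Q N c b 0 {#(x, 0)#})"
  from single_token[OF b this] r show "ennreal r * ennreal (snd z - 0) <= 1"
   by (simp add: ennreal_mult[symmetric] ennreal_le_1)
 qed
 finally show ?thesis by simp
qed

lemma power_one_minus_le:
 fixes a :: ennreal
 assumes "a <= 1"
 shows "(1 - a) ^ n + min 1 (of_nat n * a) / 2 <= 1"
proof -
 obtain x where x: "a = ennreal x" "0 <= x" "x <= 1" using assms by (cases a) (auto simp: ennreal_le_1 top_unique)
 have "(1 - x) ^ n <= exp (- x) ^ n" using x exp_ge_add_one_self[of "- x"] by (intro power_mono) auto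
 also have "... = exp (- (real n * x))" by (simp add: exp_of_nat_mult[symmetric])
 also have "... <= exp (- min 1 (real n * x))" by simp
 also have "... <= 1 - min 1 (real n * x) / 2" using x by (intro exp_le_half) auto
 finally have "(1 - x) ^ n + min 1 (real n * x) / 2 <= 1" by simp
 hence "ennreal ((1 - x) ^ n + min 1 (real n * x) / 2) <= ennreal 1" by (rule ennreal_leI)
 moreover have "(1 - a) ^ n = ennreal ((1 - x) ^ n)"
  using x by (simp add: ennreal_1[symmetric] ennreal_minus ennreal_power del: ennreal_1)
 moreover have "min 1 (of_nat n * a) / 2 = ennreal (min 1 (real n * x) / 2)"
 proof -
  have "min 1 (ennreal y) = ennreal (min 1 y)" for y by (simp add: min_def ennreal_ge_1)
  moreover have "of_nat n * a = ennreal (real n * x)"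
   using x by (simp add: ennreal_of_nat_eq_real_of_nat ennreal_mult[symmetric])
  ultimately show ?thesis using x by (simp add: ennreal_divide_numeral)
 qed
 ultimately show ?thesis using x by (simp add: ennreal_plus[symmetric] del: ennreal_plus)
qed

lemma min_cmult_le: "t <= 1 ==> t * min 1 y <= min 1 (t * y)" for t y :: ennreal
 using mult_mono[of t 1 "min 1 y" 1] by (auto intro!: mult_left_mono)

text \<open>\<open>min 1 (n * h) / h\<close> decreases in \<open>h\<close>; this is written without
  division.\<close>

lemma min_exchange:
 fixes n h h' :: ennreal
 assumes "h' <= h"
 shows "min 1 (n * h) * h' <= min 1 (n * h') * h"
proof (cases "n * h' <= 1")
 case True
 have "min 1 (n * h) * h' <= n * h * h'" by (intro mult_right_mono) auto
 thus ?thesis using True by (simp add: min_absorb2 ac_simps)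
next
 case False
 have "min 1 (n * h) * h' <= 1 * h" using assms by (intro mult_mono) auto
 thus ?thesis using False by (simp add: min_absorb1)
qed

text \<open>With \<open>f\<close> a hitting probability this bounds the probability that some
  A-particle from \<open>x\<close> arrives. The truncation at \<open>1\<close> keeps it finite
  without moments of the initial numbers.\<close>

definition arrivals :: "('v => int pmf) => ('v => ennreal) => 'v => ennreal" where
 "arrivals p f x = (\<integral>\<^sup>+z. min 1 (of_nat (nat z) * f x) \<partial>p x)"

lemma arrivals_le_1: "arrivals p f x <= 1"
 unfolding arrivals_def using nn_integral_mono[of "measure_pmf (p x)" "%z. min 1 (of_nat (nat z) * f x)" "%_. 1"] by simp

lemma hits_obstacle_le: "hits K H Z n y <= hits K H {} n y"
 by (induction n arbitrary: y) (auto intro!: nn_integral_mono)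

text \<open>Average over all subsets \<open>D\<close> of \<open>X\<close>: by
  \<open>hits_random_obstacle\<close> a random obstacle costs a factor \<open>2 ^ Suc n\<close> in
  the hitting probabilities, and \<open>min_exchange\<close> carries this over to
  \<open>arrivals\<close>. A maximising \<open>D\<close> is at least as good as the average.\<close>

lemma random_obstacles:
 assumes X: "finite X"
 shows "\<exists>D\<subseteq>X. (SUM x:X. arrivals p (hits K H {} (Suc n)) x) <= 2 ^ Suc n * (SUM x:D. arrivals p (hits K H (D - {x}) (Suc n)) x)"
proof -
 let ?h = "hits K H {} (Suc n)" and ?hD = "%D x. hits K H (D - {x}) (Suc n) x"
 let ?u = "%D x. arrivals p (hits K H (D - {x}) (Suc n)) x"
 let ?\<D> = "%x. {D. D <= X & x : D}"
 have fin: "finite (?\<D> x)" for x using X by (auto intro: finite_subset[of _ "Pow X"])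
 have one: "2 ^ card X * arrivals p ?h x <= 2 ^ Suc n * (SUM D:?\<D> x. ?u D x)" if x: "x : X" for x
 proof (cases "?h x = 0")
  case True
  thus ?thesis by (simp add: arrivals_def del: hits.simps)
 next
  case False
  have fin_h: "?h x ~= \<infinity>" using hits_le_1[of K H "{}" "Suc n" x] by (auto simp: top_unique simp del: hits.simps)
  have ex: "arrivals p ?h x * ?hD D x <= ?u D x * ?h x" for D
  proof -
   have "arrivals p ?h x * ?hD D x = (\<integral>\<^sup>+z. min 1 (of_nat (nat z) * ?h x) * ?hD D x \<partial>p x)"
    unfolding arrivals_def by (rule nn_integral_multc[symmetric]) simp
   also have "... <= (\<integral>\<^sup>+z. min 1 (of_nat (nat z) * ?hD D x) * ?h x \<partial>p x)"
    by (intro nn_integral_mono min_exchange hits_obstacle_le)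
   also have "... = ?u D x * ?h x"
    unfolding arrivals_def by (rule nn_integral_multc) simp
   finally show ?thesis .
  qed
  have "?h x * (2 ^ card X * arrivals p ?h x) = arrivals p ?h x * (2 ^ card X * ?h x)" by (simp add: ac_simps del: hits.simps)
  also have "... <= arrivals p ?h x * (2 ^ Suc n * (SUM D:?\<D> x. ?hD D x))"
   by (intro mult_left_mono hits_random_obstacle[OF X x]) simp
  also have "... = 2 ^ Suc n * (SUM D:?\<D> x. arrivals p ?h x * ?hD D x)" by (simp add: sum_distrib_left ac_simps del: hits.simps)
  also have "... <= 2 ^ Suc n * (SUM D:?\<D> x. ?u D x * ?h x)" by (intro mult_left_mono sum_mono ex) simp
  also have "... = ?h x * (2 ^ Suc n * (SUM D:?\<D> x. ?u D x))" by (simp add: sum_distrib_left ac_simps del: hits.simps)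
  finally show ?thesis using False fin_h
   by (subst (asm) ennreal_mult_le_mult_iff) (auto simp del: hits.simps)
 qed
 obtain D where D: "D <= X" "!!D'. D' <= X ==> (SUM x:D'. ?u D' x) <= (SUM x:D. ?u D x)"
 proof -
  let ?S = "(%D. SUM x:D. ?u D x) ` Pow X"
  have "finite ?S" "?S ~= {}" using X by auto
  from Max_in[OF this] obtain D where "D <= X" "(SUM x:D. ?u D x) = Max ?S" by auto
  moreover have "(SUM x:D'. ?u D' x) <= Max ?S" if "D' <= X" for D'
   by (rule Max_ge[OF \<open>finite ?S\<close>]) (use that in blast)
  ultimately show thesis using that[of D] by simp
 qed
 have "2 ^ card X * (SUM x:X. arrivals p ?h x) <= (SUM x:X. 2 ^ Suc n * (SUM D:?\<D> x. ?u D x))"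
  by (subst sum_distrib_left) (intro sum_mono one)
 also have "... = 2 ^ Suc n * (SUM D:Pow X. SUM x:D. ?u D x)"
 proof -
  have "(SUM x:X. SUM D:?\<D> x. ?u D x) = (SUM x:X. SUM D:{D : Pow X. x : D}. ?u D x)" by (intro sum.cong refl) auto
  also have "... = (SUM D:Pow X. SUM x:{x : X. x : D}. ?u D x)" by (rule sum.swap_restrict) (use X in auto)
  also have "... = (SUM D:Pow X. SUM x:D. ?u D x)" by (intro sum.cong refl) auto
  finally show ?thesis by (simp add: sum_distrib_left[symmetric] del: hits.simps)
 qed
 also have "... <= 2 ^ Suc n * (SUM D':Pow X. SUM x:D. ?u D x)" by (intro mult_left_mono sum_mono D(2)) auto
 also have "... = 2 ^ card X * (2 ^ Suc n * (SUM x:D. ?u D x))" using X by (simp add: card_Pow ac_simps del: hits.simps)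
 finally have "(SUM x:X. arrivals p ?h x) <= 2 ^ Suc n * (SUM x:D. ?u D x)"
  by (subst (asm) ennreal_mult_le_mult_iff) (auto simp: power_eq_top_ennreal simp del: hits.simps)
 with D(1) show ?thesis by blast
qed

abbreviation start_expect where
 "start_expect Q N c g R ze \<equiv> expect Q N c g (static N (B_start R ze)) 0 (A_start R ze)"

lemma prob_bounded_B:
 fixes p :: "'v => int pmf"
 assumes "finite F" "0 < \<theta>"
 shows "\<exists>b::nat. measure_pmf.prob (Pi_pmf F 0 p) {ze. b < (SUM y:F. nat (- ze y))} < \<theta>"
proof -
 let ?A = "%b::nat. {ze. b < (SUM y:F. nat (- ze y))}"
 have "(%b. measure_pmf.prob (Pi_pmf F 0 p) (?A b)) ~~> measure_pmf.prob (Pi_pmf F 0 p) (\<Inter>b. ?A b)"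
  by (rule measure_pmf.finite_Lim_measure_decseq) (auto simp: decseq_def)
 moreover have "(\<Inter>b. ?A b) = {}" by auto
 ultimately have "(%b. measure_pmf.prob (Pi_pmf F 0 p) (?A b)) ~~> 0" by simp
 hence "\<forall>\<^sub>F b in sequentially. measure_pmf.prob (Pi_pmf F 0 p) (?A b) < \<theta>" using assms(2) by (rule order_tendstoD)
 thus ?thesis by (auto simp: eventually_sequentially)
qed

text \<open>If \<open>F\<close> has at most \<open>b\<close> B-particles,
  \<open>expect_obstacles\<close> gives a product over \<open>D\<close> whose factors are averaged
  independently. On the remaining event the functional is at most \<open>1\<close>.\<close>

lemma (in bounded_weights) start_decay:
 assumes F: "finite F" "finite D" "F Int D = {}" and ta: "ta <= 1"
  and low: "!!x. x : D ==> ta * f x <= ennreal (r / 2) * sol (static N (%y. if y : D - {x} then \<infinity> else 0)) x"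
 shows "(\<integral>\<^sup>+ze. start_expect Q N c (%v. ennreal (exp (- r * v))) (F Un D) ze \<partial>Pi_pmf (F Un D) 0 p) \<le>
  ennreal (measure_pmf.prob (Pi_pmf F 0 p) {ze. b < (SUM y:F. nat (- ze y))}) +
  ennreal (exp (real b)) * (PROD x:D. 1 - ta * arrivals p f x / 2)"
proof -
 let ?P = "Pi_pmf (F Un D) 0 p" and ?B = "%ze. SUM y:F. nat (- ze y)"
 define a where "a x = ennreal (r / 2) * sol (static N (%y. if y : D - {x} then \<infinity> else 0)) x" for x
 have a1: "a x <= 1" for x
 proof -
  have "a x <= ennreal r * sol (static N (%y. if y : D - {x} then \<infinity> else 0)) x"
   unfolding a_def using r by (intro mult_right_mono ennreal_leI) auto
  also have "... <= 1" by (rule sol_le) simp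
  finally show ?thesis .
 qed
 have Fp: "Pi_pmf F 0 p = map_pmf (%ze x. if x : F then ze x else 0) ?P"
  by (rule Pi_pmf_subset) (use F in auto)
 have "(\<integral>\<^sup>+ze. start_expect Q N c (%v. ennreal (exp (- r * v))) (F Un D) ze \<partial>?P) \<le>
   (\<integral>\<^sup>+ze. indicator {ze. b < ?B ze} ze + ennreal (exp (real b)) * (PROD x:D. (1 - a x) ^ nat (ze x)) \<partial>?P)"
 proof (intro nn_integral_mono)
  fix ze :: "'v => int"
  let ?L = "start_expect Q N c (%v. ennreal (exp (- r * v))) (F Un D) ze"
  show "?L <= indicator {ze. b < ?B ze} ze + ennreal (exp (real b)) * (PROD x:D. (1 - a x) ^ nat (ze x))"
  proof (cases "b < ?B ze")
   case True
   have nn: "0 <= snd z" if "z : set_pmf (run Q N c (static N (B_start (F Un D) ze)) 0 (A_start (F Un D) ze))" for z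
    using run_increasing[OF admissible_static c0 that] .
   have "?L <= (\<integral>\<^sup>+z. 1 \<partial>run Q N c (static N (B_start (F Un D) ze)) 0 (A_start (F Un D) ze))"
    unfolding expect_def by (intro nn_integral_mono_AE AE_pmfI) (use nn r in \<open>simp add: ennreal_le_1\<close>)
   thus ?thesis using True by (simp add: add_increasing2)
  next
   case False
   have "?L <= ennreal (exp (SUM y:F. real (nat (- ze y)))) * (PROD x:D. (1 - a x) ^ nat (ze x))"
    unfolding a_def by (rule expect_obstacles[OF F])
   also have "... <= ennreal (exp (real b)) * (PROD x:D. (1 - a x) ^ nat (ze x))"
   proof (intro mult_right_mono ennreal_leI)
    have "real (?B ze) <= real b" using False by (simp only: of_nat_le_iff not_less)
    thus "exp (SUM y:F. real (nat (- ze y))) <= exp (real b)" by (simp only: exp_le_cancel_iff of_nat_sum)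
   qed simp
   finally show ?thesis by (simp add: add_increasing)
  qed
 qed
 also have "... = (\<integral>\<^sup>+ze. indicator {ze. b < ?B ze} ze \<partial>?P) + ennreal (exp (real b)) * (\<integral>\<^sup>+ze. (PROD x:D. (1 - a x) ^ nat (ze x)) \<partial>?P)"
  by (simp add: nn_integral_add nn_integral_cmult)
 also have "(\<integral>\<^sup>+ze. indicator {ze. b < ?B ze} ze \<partial>?P) = ennreal (measure_pmf.prob (Pi_pmf F 0 p) {ze. b < ?B ze})"
  unfolding Fp by (simp add: measure_pmf.emeasure_eq_measure[symmetric] vimage_def)
 also have "(\<integral>\<^sup>+ze. (PROD x:D. (1 - a x) ^ nat (ze x)) \<partial>?P) = (\<integral>\<^sup>+ze. (PROD x:F Un D. if x : D then (1 - a x) ^ nat (ze x) else 1) \<partial>?P)"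
  by (intro nn_integral_cong prod.mono_neutral_cong_left) (use F in auto)
 also have "... = (PROD x:F Un D. \<integral>\<^sup>+z. (if x : D then (1 - a x) ^ nat z else 1) \<partial>p x)"
  by (rule nn_integral_prod_Pi_pmf) (use F in auto)
 also have "... = (PROD x:D. \<integral>\<^sup>+z. (1 - a x) ^ nat z \<partial>p x)"
  by (intro prod.mono_neutral_cong_right) (use F in auto)
 also have "... <= (PROD x:D. 1 - ta * arrivals p f x / 2)"
 proof (intro prod_mono_ennreal)
  fix x assume x: "x : D"
  have "(\<integral>\<^sup>+z. (1 - a x) ^ nat z \<partial>p x) + ta * arrivals p f x / 2 =
    (\<integral>\<^sup>+z. (1 - a x) ^ nat z + ta * min 1 (of_nat (nat z) * f x) / 2 \<partial>p x)"
   by (simp add: nn_integral_add nn_integral_cmult nn_integral_divide arrivals_def)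
  also have "... <= (\<integral>\<^sup>+z. 1 \<partial>p x)"
  proof (intro nn_integral_mono)
   fix z
   have "ta * min 1 (of_nat (nat z) * f x) <= min 1 (ta * (of_nat (nat z) * f x))" by (rule min_cmult_le[OF ta])
   also have "... <= min 1 (of_nat (nat z) * a x)"
    using mult_left_mono[OF low[OF x], of "of_nat (nat z)"] by (intro min.mono) (auto simp: a_def ac_simps)
   finally have "(1 - a x) ^ nat z + ta * min 1 (of_nat (nat z) * f x) / 2 <= (1 - a x) ^ nat z + min 1 (of_nat (nat z) * a x) / 2"
    by (intro add_left_mono divide_right_mono_ennreal)
   also have "... <= 1" by (rule power_one_minus_le[OF a1])
   finally show "(1 - a x) ^ nat z + ta * min 1 (of_nat (nat z) * f x) / 2 <= 1" .
  qed
  finally show "(\<integral>\<^sup>+z. (1 - a x) ^ nat z \<partial>p x) <= 1 - ta * arrivals p f x / 2"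
   by (simp add: ennreal_le_minus_iff)
 qed
 finally show ?thesis by (simp add: mult_left_mono)
qed

text \<open>The expectation in \<open>pos\<close> is bounded above by a product over the set
  \<open>D\<close> of \<open>random_obstacles\<close>. A large sum of arrivals would make this
  product too small for the lower bound \<theta>.\<close>

theorem arrivals_summable:
 fixes Q :: "nat => 'v => 'v pmf" and p :: "'v => int pmf" and ka \<theta> :: real
 assumes bw: "!!k. bounded_weights (N k) (c k) (w k) r"
  and ka: "0 < ka" "ka * r <= 2" and \<theta>: "0 < \<theta>" and F: "finite F" "F <= V"
  and low: "\<forall>\<^sub>F k in sequentially. ALL Z x. ennreal ka * hits K H Z (Suc n) x \<le>
   solo (Q k) (%y j. ennreal (c k y j)) (static (N k) (%y. if y : Z then \<infinity> else 0)) (N k) 0 x"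
  and pos: "!!R. finite R ==> F <= R ==> R <= V ==> \<forall>\<^sub>F k in sequentially. ennreal \<theta> \<le>
   (\<integral>\<^sup>+ze. start_expect (Q k) (N k) (c k) (%v. ennreal (exp (- r * v))) R ze \<partial>Pi_pmf R 0 p)"
 shows "\<exists>C::real. ALL X. finite X --> X <= V - F --> (SUM x:X. arrivals p (hits K H {} (Suc n)) x) <= ennreal C"
proof -
 obtain b where b: "measure_pmf.prob (Pi_pmf F 0 p) {ze. b < (SUM y:F. nat (- ze y))} < \<theta> / 2"
  using prob_bounded_B[OF F(1), of "\<theta> / 2"] \<theta> by auto
 have r: "0 < r" using bw bounded_weights.r by blast
 define ta where "ta = ka * r / 2"
 have ta: "0 < ta" "ta <= 1" using ka r by (auto simp: ta_def)
 \<comment> \<open>The solution of \<open>exp (b - ta / 2 * C0) = \<theta> / 2\<close>; the other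
   half of \<theta> is spent on the event of more than \<open>b\<close> B-particles in
   \<open>F\<close>.\<close>
 define C0 where "C0 = 2 / ta * (ln (2 / \<theta>) + b)"
 have "(SUM x:X. arrivals p (hits K H {} (Suc n)) x) <= ennreal (2 ^ Suc n * C0)" if X: "finite X" "X <= V - F" for X
 proof -
  obtain D where D: "D <= X" "(SUM x:X. arrivals p (hits K H {} (Suc n)) x) <= 2 ^ Suc n * (SUM x:D. arrivals p (hits K H (D - {x}) (Suc n)) x)"
   using random_obstacles[OF X(1)] by blast
  have Dfin: "finite D" "F Int D = {}" using D X finite_subset by auto
  define u where "u x = enn2real (arrivals p (hits K H (D - {x}) (Suc n)) x)" for x
  have u: "arrivals p (hits K H (D - {x}) (Suc n)) x = ennreal (u x)" "0 <= u x" "u x <= 1" for x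
  proof -
   note 1 = arrivals_le_1[of p "hits K H (D - {x}) (Suc n)" x]
   thus "arrivals p (hits K H (D - {x}) (Suc n)) x = ennreal (u x)"
    unfolding u_def by (subst ennreal_enn2real) (auto simp: less_top[symmetric] top_unique)
   show "0 <= u x" by (simp add: u_def)
   show "u x <= 1" using enn2real_mono[OF 1] by (simp add: u_def)
  qed
  have "\<forall>\<^sub>F k in sequentially. ennreal \<theta> \<le>
    (\<integral>\<^sup>+ze. start_expect (Q k) (N k) (c k) (%v. ennreal (exp (- r * v))) (F Un D) ze \<partial>Pi_pmf (F Un D) 0 p)"
   by (rule pos) (use F Dfin D X in auto)
  from eventually_happens[OF eventually_conj[OF low this]]
  obtain k where lk: "!!Z x. ennreal ka * hits K H Z (Suc n) x \<le>
    solo (Q k) (%y j. ennreal (c k y j)) (static (N k) (%y. if y : Z then \<infinity> else 0)) (N k) 0 x"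
   and pk: "ennreal \<theta> <= (\<integral>\<^sup>+ze. start_expect (Q k) (N k) (c k) (%v. ennreal (exp (- r * v))) (F Un D) ze \<partial>Pi_pmf (F Un D) 0 p)"
   by auto
  note pk
  also have "(\<integral>\<^sup>+ze. start_expect (Q k) (N k) (c k) (%v. ennreal (exp (- r * v))) (F Un D) ze \<partial>Pi_pmf (F Un D) 0 p) \<le>
   ennreal (measure_pmf.prob (Pi_pmf F 0 p) {ze. b < (SUM y:F. nat (- ze y))}) +
   ennreal (exp (real b)) * (PROD x:D. 1 - ennreal ta * arrivals p (%x. hits K H (D - {x}) (Suc n) x) x / 2)"
  proof (rule bounded_weights.start_decay[OF bw F(1) Dfin])
   show "ennreal ta <= 1" using ta by (simp add: ennreal_le_1)
   fix x
   have "ennreal ta * hits K H (D - {x}) (Suc n) x = ennreal (r / 2) * (ennreal ka * hits K H (D - {x}) (Suc n) x)"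
    using r ka by (simp add: ta_def ennreal_mult[symmetric] mult.assoc[symmetric] mult.commute[of r] del: hits.simps)
   also have "... <= ennreal (r / 2) * solo (Q k) (%y j. ennreal (c k y j)) (static (N k) (%y. if y : D - {x} then \<infinity> else 0)) (N k) 0 x"
    by (intro mult_left_mono lk) simp
   finally show "ennreal ta * hits K H (D - {x}) (Suc n) x <= ..." .
  qed
  also have "... <= ennreal (\<theta> / 2) + ennreal (exp (real b)) * (PROD x:D. 1 - ennreal ta * ennreal (u x) / 2)"
  proof -
   have "arrivals p (%x. hits K H (D - {x}) (Suc n) x) x = ennreal (u x)" for x
    unfolding u(1)[symmetric] arrivals_def ..
   thus ?thesis using b by (intro add_mono) (auto intro: ennreal_leI)
  qed
  also have "(PROD x:D. 1 - ennreal ta * ennreal (u x) / 2) <= (PROD x:D. ennreal (exp (- (ta * u x / 2))))"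
  proof (intro prod_mono_ennreal)
   fix x
   have "1 - ennreal ta * ennreal (u x) / 2 = ennreal (1 - ta * u x / 2)"
    using ta u(2)[of x] by (simp add: ennreal_mult[symmetric] ennreal_minus[symmetric] divide_ennreal[symmetric] ennreal_numeral)
   also have "... <= ennreal (exp (- (ta * u x / 2)))"
    using exp_ge_add_one_self[of "- (ta * u x / 2)"] by (intro ennreal_leI) simp
   finally show "1 - ennreal ta * ennreal (u x) / 2 <= ennreal (exp (- (ta * u x / 2)))" .
  qed
  also have "(PROD x:D. ennreal (exp (- (ta * u x / 2)))) = ennreal (exp (- (ta / 2 * (SUM x:D. u x))))"
   using Dfin(1) by (simp add: prod_ennreal exp_sum[symmetric] sum_negf sum_distrib_left)
  finally have "ennreal \<theta> <= ennreal (\<theta> / 2 + exp (real b) * exp (- (ta / 2 * (SUM x:D. u x))))"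
   using \<theta> by (simp add: ennreal_mult mult_left_mono)
  hence "\<theta> / 2 <= exp (real b) * exp (- (ta / 2 * (SUM x:D. u x)))"
   using \<theta> by (subst (asm) ennreal_le_iff) (auto intro: add_nonneg_nonneg)
  hence "ln (\<theta> / 2) <= real b - ta / 2 * (SUM x:D. u x)"
  proof -
   assume "\<theta> / 2 <= exp (real b) * exp (- (ta / 2 * (SUM x:D. u x)))"
   hence "\<theta> / 2 <= exp (real b - ta / 2 * (SUM x:D. u x))" by (simp only: exp_add[symmetric] diff_conv_add_uminus)
   hence "ln (\<theta> / 2) <= ln (exp (real b - ta / 2 * (SUM x:D. u x)))"
    using \<theta> by (subst ln_le_cancel_iff) auto
   thus ?thesis by simp
  qed
  hence "ta / 2 * (SUM x:D. u x) <= real b + ln (2 / \<theta>)" using \<theta> by (simp add: ln_div)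
  hence "(SUM x:D. u x) <= C0" unfolding C0_def using ta by (simp add: field_simps)
  hence "2 ^ Suc n * (SUM x:D. ennreal (u x)) <= ennreal (2 ^ Suc n * C0)"
   using u(2) by (simp add: sum_ennreal ennreal_leI ennreal_mult' ennreal_power[symmetric] ennreal_numeral mult_left_mono sum_nonneg)
  with D(2) show ?thesis unfolding u(1) by (rule order_trans)
 qed
 thus ?thesis by blast
qed

text \<open>A finite set \<open>X0\<close> whose sum is within \<open>ep\<close> of the supremum
  over all finite sets leaves at most \<open>ep\<close> for any set disjoint from it.\<close>

corollary arrivals_tail:
 fixes f :: "'v => ennreal"
 assumes "!!X. finite X ==> X <= V - F ==> (SUM x:X. f x) <= ennreal C" and F: "finite F" "F <= V" and ep: "0 < ep"
 shows "EX F'. finite F' & F <= F' & F' <= V & (ALL X. finite X --> X <= V - F' --> (SUM x:X. f x) <= ennreal ep)"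
proof -
 let ?\<X> = "{X. finite X & X <= V - F}"
 define S where "S = (SUP X\<in>?\<X>. SUM x:X. f x)"
 have "S <= ennreal C" unfolding S_def using assms(1) by (intro SUP_least) auto
 hence Sfin: "S < top" by (simp add: le_less_trans)
 obtain s where s: "S = ennreal s" "0 <= s" using Sfin by (cases S) auto
 obtain X0 where X0: "finite X0" "X0 <= V - F" "S <= (SUM x:X0. f x) + ennreal ep"
 proof (cases "s <= ep")
  case True thus ?thesis using that[of "{}"] s by (simp add: ennreal_leI)
 next
  case False
  hence "ennreal (s - ep) < S" unfolding s using ep by (intro ennreal_lessI) auto
  then obtain X0 where "X0 : ?\<X>" "ennreal (s - ep) < (SUM x:X0. f x)" unfolding S_def less_SUP_iff by blast
  moreover have "S = ennreal (s - ep) + ennreal ep" using s False ep by (simp add: ennreal_plus[symmetric] del: ennreal_plus)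
  ultimately show ?thesis using that[of X0] by (auto intro!: add_right_mono)
 qed
 have "(SUM x:X. f x) <= ennreal ep" if X: "finite X" "X <= V - (F Un X0)" for X
 proof -
  have "(SUM x:X0. f x) + (SUM x:X. f x) = (SUM x:X0 Un X. f x)"
   using X X0 by (intro sum.union_disjoint[symmetric]) auto
  also have "... <= S" unfolding S_def by (rule SUP_upper) (use X X0 in auto)
  also have "... <= (SUM x:X0. f x) + ennreal ep" by (rule X0)
  finally show ?thesis using assms(1)[OF X0(1,2)] by (auto simp: ennreal_add_left_cancel_le top_unique)
 qed
 thus ?thesis using F X0 by (intro exI[of _ "F Un X0"]) auto
qed

section \<open>The law of the sampled system\<close>

lemma survivors_cong:
 assumes "!!p. p : P ==> pos p = pos' p" "!!p q. p : P ==> q : P ==> h p < h q \<longleftrightarrow> h' p < h' q"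
 shows "survivors h P pos = survivors h' P pos'"
proof -
 have "{q : P. pos q = pos p & (type_A q \<longleftrightarrow> type_A p) & h p < h q} = {q : P. pos' q = pos' p & (type_A q \<longleftrightarrow> type_A p) & h' p < h' q}"
  "{q : P. pos q = pos p & (type_A q \<longleftrightarrow> type_B p)} = {q : P. pos' q = pos' p & (type_A q \<longleftrightarrow> type_B p)}" if "p : P" for p
  by (rule Collect_cong, rule conj_cong, rule refl, simp add: assms that)+
 thus ?thesis unfolding survivors_def annihilated_def by auto
qed

text \<open>Braveness enters through its order only. For finitely many particles this reduces the
  braveness of all particles to finitely many cases.\<close>

lemma grid_occupation_cong_subset:
 assumes "list_all2 (%pos pos'. ALL p:P0. pos p = pos' p) xs ys" "!!p q. p : P0 ==> q : P0 ==> h p < h q \<longleftrightarrow> h' p < h' q"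
 shows "P <= P0 ==> grid_occupation c h j P xs = grid_occupation c h' j P ys"
 using assms(1)
proof (induction xs ys arbitrary: j P rule: list_all2_induct)
 case (Cons pos xs pos' ys)
 have s: "survivors h P pos = survivors h' P pos'"
  by (rule survivors_cong, rule bspec[OF Cons.hyps(1)], rule subsetD[OF Cons.prems(1)], assumption,
    rule assms(2); rule subsetD[OF Cons.prems(1)])
 have sub: "survivors h' P pos' <= P0" using survivors_subset Cons.prems by blast
 have "(\<Sum>p | p \<in> survivors h' P pos' & type_A p. c (pos p) j) = (\<Sum>p | p \<in> survivors h' P pos' & type_A p. c (pos' p) j)"
 proof (rule sum.cong[OF refl])
  fix p assume "p : {p. p : survivors h' P pos' & type_A p}"
  hence "p : P0" using sub by blast
  thus "c (pos p) j = c (pos' p) j" using Cons.hyps(1) by simp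
 qed
 thus ?case by (simp add: s Cons.IH[OF sub])
qed simp

lemmas grid_occupation_cong = grid_occupation_cong_subset[OF _ _ order_refl]

lemma initial_particles_finite:
 assumes "finite R" "R <= V"
 shows "finite (initial_particles V (%y. if y : R then ze y else 0))"
proof -
 have "initial_particles V (%y. if y : R then ze y else 0) <= Sigma R (%x. {- \<bar>ze x\<bar>..\<bar>ze x\<bar>})"
  by (auto simp: initial_particles_def split: if_splits)
 thus ?thesis by (rule finite_subset) (use assms in auto)
qed

lemma initial_A_particles:
 assumes "R <= V"
 shows "{p : initial_particles V (%y. if y : R then ze y else 0). type_A p} = Sigma R (%x. {1..ze x})"
 using assms by (auto simp: initial_particles_def split: if_splits)

lemma tokens_initial:
 assumes "finite R" "R <= V"
 shows "tokens fst 0 {p : initial_particles V (%y. if y : R then ze y else 0). type_A p} = A_start R ze"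
proof -
 have im: "image_mset f (mset_set A) = (SUM x:A. {#f x#})" if "finite A" for f :: "'b => 'c" and A
  using that by (induction A) auto
 have "tokens fst 0 (Sigma R (%x. {1..ze x})) = (SUM p:Sigma R (%x. {1..ze x}). {#(fst p, 0)#})"
  using assms by (intro im) auto
 also have "... = (SUM x:R. SUM j:{1..ze x}. {#(x, 0)#})"
  using assms by (subst sum.Sigma) (auto intro!: sum.cong)
 also have "... = A_start R ze"
 proof -
  have "(SUM j:B. {#y#}) = replicate_mset (card B) y" if "finite B" for B :: "int set" and y :: "'a \<times> nat"
   using that by (induction B) auto
  thus ?thesis by (simp add: A_start_def)
 qed
 finally show ?thesis unfolding initial_A_particles[OF assms(2)] .
qed

lemma B_initial:
 assumes "R <= V"
 shows "enat (card (B_at fst (initial_particles V (%y. if y : R then ze y else 0)) y)) = B_start R ze y"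
proof -
 have "B_at fst (initial_particles V (%y. if y : R then ze y else 0)) y = (if y : R then Pair y ` {ze y..-1} else {})"
  using assms by (auto simp: B_at_def initial_particles_def split: if_splits)
 thus ?thesis by (simp add: B_start_def card_image inj_on_def zero_enat_def)
qed

lemma nn_integral_discrete:
 fixes F :: "'w => 'c" and D :: "'c pmf"
 assumes C: "countable C" "!!om. om : Z ==> F om : C" "set_pmf D <= C"
  and Z: "!!pa. pa : C ==> {om : Z. F om = pa} : sets M" "!!pa. pa : C ==> emeasure M {om : Z. F om = pa} = a * ennreal (pmf D pa)"
 shows "(\<integral>\<^sup>+om. Ph (F om) * indicator Z om \<partial>M) = a * (\<integral>\<^sup>+pa. Ph pa \<partial>D)"
proof -
 have "(\<integral>\<^sup>+om. Ph (F om) * indicator Z om \<partial>M) = (\<integral>\<^sup>+om. \<integral>\<^sup>+pa. Ph pa * indicator {om : Z. F om = pa} om \<partial>count_space C \<partial>M)"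
 proof (intro nn_integral_cong)
  fix om
  show "Ph (F om) * indicator Z om = (\<integral>\<^sup>+pa. Ph pa * indicator {om : Z. F om = pa} om \<partial>count_space C)"
  proof (cases "om : Z")
   case True
   have "(\<integral>\<^sup>+pa. Ph pa * indicator {om : Z. F om = pa} om \<partial>count_space C) = (\<integral>\<^sup>+pa. Ph (F om) * indicator {F om} pa \<partial>count_space C)"
    using True by (intro nn_integral_cong) (auto simp: indicator_def)
   also have "... = Ph (F om)" using C(2)[OF True] by (subst nn_integral_cmult_indicator) auto
   finally show ?thesis using True by simp
  qed simp
 qed
 also have "... = (\<integral>\<^sup>+pa. \<integral>\<^sup>+om. Ph pa * indicator {om : Z. F om = pa} om \<partial>M \<partial>count_space C)"
  by (rule nn_integral_count_space_nn_integral) (use C Z in auto)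
 also have "... = (\<integral>\<^sup>+pa. a * (ennreal (pmf D pa) * Ph pa) \<partial>count_space C)"
  using Z by (intro nn_integral_cong) (simp add: nn_integral_cmult_indicator ac_simps)
 also have "... = a * (\<integral>\<^sup>+pa. ennreal (pmf D pa) * Ph pa \<partial>count_space C)" by (rule nn_integral_cmult) simp
 also have "(\<integral>\<^sup>+pa. ennreal (pmf D pa) * Ph pa \<partial>count_space C) = (\<integral>\<^sup>+pa. ennreal (pmf D pa) * Ph pa \<partial>count_space UNIV)"
 proof (rule nn_integral_count_space_eq)
  fix x assume "x : UNIV - C"
  hence "pmf D x = 0" using C(3) by (auto simp: set_pmf_iff)
  thus "ennreal (pmf D x) * Ph x = 0" by simp
 qed auto
 finally show ?thesis by (simp add: nn_integral_measure_pmf)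
qed

definition well_sampled_limit :: "(nat => real) => real => ('v particle => real => 'v) => 'v particle set => bool" where
 "well_sampled_limit dt T' s P \<longleftrightarrow> (\<forall>\<^sub>F k in sequentially. well_sampled s P T' (dt k)) &
  (AE t in lborel. 0 <= t --> (\<forall>\<^sub>F k in sequentially. frozen s P {real (nat \<lfloor>t / dt k\<rfloor>) * dt k..t}))"

text \<open>The interface between regular systems and the token process: A-particles observed on the
  \<open>k\<close>th grid are independent chains with kernel \<open>Q k\<close>, and almost all
  paths are resolved by fine grids. Discrete and continuous time differ only in \<open>Q\<close> and
  \<open>dt\<close>.\<close>

locale sampled_dlas = regular_dlas M G \<xi>0 S h \<xi>
 for M :: "'w measure" and G :: "('v, 'e) pre_digraph" and \<xi>0 S h \<xi> +
 fixes Q :: "nat => 'v => 'v pmf" and dt :: "nat => real" and n :: "nat => nat" and T' :: real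
 assumes dt: "!!k. 0 < dt k" and n: "!!k. real (Suc (n k)) * dt k <= T'"
  and Q: "!!k x. x : verts G ==> set_pmf (Q k x) <= verts G"
  and law: "!!k m A pa. finite A ==> A <= {p : labels (verts G). type_A p} ==>
   emeasure M {om : space M. ALL p:A. samples (dt k) m (S p om) = pa p} = (PROD p:A. ennreal (pmf (chain (Q k) m (fst p)) (pa p)))"
  and good: "!!P. finite P ==> P <= labels (verts G) ==> AE om in M. well_sampled_limit dt T' (%p. S p om) P"
begin

abbreviation "V \<equiv> verts G"

definition start_event :: "'v set => ('v => int) => 'w set" where
 "start_event R ze = {om : space M. ALL x:R. \<xi>0 x om = ze x}"

definition order_event :: "'v particle set => ('v particle \<times> 'v particle) set => 'w set" where
 "order_event P sg = {om : space M. {(p, q). p : P & q : P & h p om < h q om} = sg}"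

definition path_event :: "nat => 'v particle set => ('v particle => 'v list) => 'w set" where
 "path_event k A pa = {om : space M. ALL p:A. samples (dt k) (n k) (S p om) = pa p}"

lemma start_event_alg:
 assumes "finite R" "R <= V"
 shows "start_event R ze : sets (vimage_algebra (space M) (initial_element V \<xi>0) (initial_space V))"
proof -
 have "{z : space (initial_space V). ALL x:R. z x = ze x} : sets (initial_space V)"
 proof (intro sets.sets_Collect_finite_All assms(1))
  fix x assume "x : R"
  hence "x : V" using assms by auto
  from measurable_sets[OF measurable_component_singleton[OF this], of "{ze x}" "%_. count_space UNIV"]
  show "{z : space (initial_space V). z x = ze x} : sets (initial_space V)"
   by (simp add: initial_space_def vimage_def Int_def conj_commute)
 qed
 from in_vimage_algebra[OF this, of "initial_element V \<xi>0" "space M"]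
 show ?thesis
  by (rule back_subst[where P = "%A. A : _"])
   (use assms in \<open>auto simp: start_event_def initial_element_def initial_space_def space_PiM\<close>)
qed

lemma order_event_alg:
 assumes "finite P" "P <= labels V"
 shows "order_event P sg : sets (vimage_algebra (space M) (bravery_element V h) (bravery_space V))"
proof -
 let ?B = "bravery_space V"
 have lt: "{b : space ?B. b p < b q} : sets ?B" if "p : P" "q : P" for p q
 proof -
  have "(%b. b p) : borel_measurable ?B" "(%b. b q) : borel_measurable ?B"
   unfolding bravery_space_def using that assms by (auto intro!: measurable_component_singleton)
  thus ?thesis by measurable
 qed
 have "{b : space ?B. ALL pq:P \<times> P. (b (fst pq) < b (snd pq)) = (pq : sg)} : sets ?B"
 proof (intro sets.sets_Collect_finite_All)
  fix pq assume "pq : P \<times> P"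
  hence "{b : space ?B. b (fst pq) < b (snd pq)} : sets ?B" using lt by auto
  thus "{b : space ?B. (b (fst pq) < b (snd pq)) = (pq : sg)} : sets ?B"
   by (cases "pq : sg") (auto simp: not_less[symmetric] intro: sets.sets_Collect_neg)
 qed (use assms in auto)
 from in_vimage_algebra[OF this, of "bravery_element V h" "space M"]
 have "(bravery_element V h -` {b : space ?B. ALL pq:P \<times> P. (b (fst pq) < b (snd pq)) = (pq : sg)} Int space M)
  : sets (vimage_algebra (space M) (bravery_element V h) ?B)" .
 moreover have "bravery_element V h -` {b : space ?B. ALL pq:P \<times> P. (b (fst pq) < b (snd pq)) = (pq : sg)} Int space M =
   {om : space M. ALL p:P. ALL q:P. (h p om < h q om) = ((p, q) : sg)}"
 proof -
  have "bravery_element V h om : space ?B" for om by (auto simp: bravery_element_def bravery_space_def space_PiM)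
  moreover have "bravery_element V h om p = h p om" if "p : P" for p om using that assms by (auto simp: bravery_element_def)
  ultimately show ?thesis by auto
 qed
 moreover have "order_event P sg = (if sg <= P \<times> P then {om : space M. ALL p:P. ALL q:P. (h p om < h q om) = ((p, q) : sg)} else {})"
  unfolding order_event_def by auto
 ultimately show ?thesis by simp
qed

lemma path_in_space: "p : labels V ==> om : space M ==> path_element (S p) om : space (path_space V)"
proof -
 assume p: "p : labels V" "om : space M"
 hence "path_element (S p) : measurable M (path_space V)" using indep_paths unfolding indep_vars_def by blast
 from measurable_space[OF this p(2)] show ?thesis .
qed

lemma path_event_alg:
 assumes "finite A" "A <= labels V"
 shows "path_event k A pa : sets (vimage_algebra (space M) (paths_element V S) (paths_space V))"
proof -
 let ?E = "{f : space (paths_space V). ALL p:A. samples (dt k) (n k) (f p) = pa p}"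
 have "?E : sets (paths_space V)"
 proof (intro sets.sets_Collect_finite_All assms(1))
  fix p assume "p : A"
  hence p: "p : labels V" using assms by auto
  have "(%f. f p) -` {s : space (path_space V). samples (dt k) (n k) s = pa p} Int space (paths_space V) : sets (paths_space V)"
   unfolding paths_space_def by (rule measurable_sets[OF measurable_component_singleton[OF p] samples_in_path_space]) (use dt[of k] in simp)
  also have "(%f. f p) -` {s : space (path_space V). samples (dt k) (n k) s = pa p} Int space (paths_space V) = {f : space (paths_space V). samples (dt k) (n k) (f p) = pa p}"
  proof -
   have "f p : space (path_space V)" if "f : space (paths_space V)" for f
    using that p unfolding paths_space_def space_PiM by (rule PiE_mem)
   thus ?thesis by blast
  qed
  finally show "{f : space (paths_space V). samples (dt k) (n k) (f p) = pa p} : sets (paths_space V)" .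
 qed
 from in_vimage_algebra[OF this, of "paths_element V S" "space M"]
 have "paths_element V S -` ?E Int space M : sets (vimage_algebra (space M) (paths_element V S) (paths_space V))" .
 moreover have "paths_element V S -` ?E Int space M = path_event k A pa"
 proof -
  have "paths_element V S om : space (paths_space V)" if "om : space M" for om
   unfolding paths_element_def paths_space_def space_PiM
   by (rule restrict_PiE_iff[THEN iffD2]) (use path_in_space[OF _ that] in blast)
  moreover have "samples (dt k) (n k) (paths_element V S om p) = samples (dt k) (n k) (S p om)" if "p : A" for p om
   using subsetD[OF assms(2) that] dt[of k] by (simp add: paths_element_def samples_path_element less_imp_le)
  ultimately show ?thesis unfolding path_event_def by (simp add: vimage_def Int_def) blast
 qed
 ultimately show ?thesis by simp
qed

lemma alg_sets:
 "sets (vimage_algebra (space M) (initial_element V \<xi>0) (initial_space V)) <= sets M"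
 "sets (vimage_algebra (space M) (paths_element V S) (paths_space V)) <= sets M"
 "sets (vimage_algebra (space M) (bravery_element V h) (bravery_space V)) <= sets M"
proof -
 let ?L = "[vimage_algebra (space M) (initial_element V \<xi>0) (initial_space V),
      vimage_algebra (space M) (paths_element V S) (paths_space V),
      vimage_algebra (space M) (bravery_element V h) (bravery_space V)]"
 have "sets (?L ! k) <= sets M" if "k < 3" for k using indep_collections that unfolding indep_sets_def by auto
 from this[of 0] this[of 1] this[of 2]
 show "sets (vimage_algebra (space M) (initial_element V \<xi>0) (initial_space V)) <= sets M"
  "sets (vimage_algebra (space M) (paths_element V S) (paths_space V)) <= sets M"
  "sets (vimage_algebra (space M) (bravery_element V h) (bravery_space V)) <= sets M" by simp_all
qed

lemma indep_events:
 assumes R: "finite R" "R <= V" and P: "finite P" "P <= labels V" and A: "finite A" "A <= labels V"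
 shows "prob (start_event R ze Int path_event k A pa Int order_event P sg) =
  prob (start_event R ze) * prob (path_event k A pa) * prob (order_event P sg)"
proof -
 let ?A = "%i. [start_event R ze, path_event k A pa, order_event P sg] ! i"
 have i3: "{..<3::nat} = {0, 1, 2}" by auto
 have "prob (\<Inter>i\<in>{..<3}. ?A i) = (PROD i:{..<3}. prob (?A i))"
  by (rule indep_setsD[OF indep_collections])
   (auto simp: i3 start_event_alg[OF R] path_event_alg[OF A] order_event_alg[OF P])
 thus ?thesis by (simp add: i3 mult.assoc Int_assoc)
qed

definition particles :: "'v set => ('v => int) => 'v particle set" where
 "particles R ze = initial_particles V (%y. if y : R then ze y else 0)"

lemma particles_labels: "particles R ze <= labels V"
 by (auto simp: particles_def initial_particles_def labels_def)

definition sampled_occupation :: "('v => nat => real) => nat => 'v set => ('v => int) => 'w => real" where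
 "sampled_occupation c k R ze om = grid_occupation c (%p. h p om) 0 (particles R ze) (map (%i p. S p om (real i * dt k)) [0..<Suc (n k)])"

text \<open>Given the starting configuration and the order of the braveness values, the sampled
  occupation is a function of finitely many sampled A-paths, whose law is discrete and which are
  independent of both. Stationarity of the B-particles and distinctness of the braveness values hold
  almost surely only, hence the measurable version \<open>f\<close>.\<close>

lemma sampled_occupation_law:
 assumes R: "finite R" "R <= V"
 shows "EX f. f : borel_measurable M & (AE om in M. f om = g (sampled_occupation c k R ze om) * indicator (start_event R ze) om) &
  (\<integral>\<^sup>+om. f om \<partial>M) = ennreal (prob (start_event R ze)) * start_expect (Q k) (Suc (n k)) c g R ze"
proof -
 let ?P = "particles R ze"
 define A where "A = {p : ?P. type_A p}"
 have P: "finite ?P" "?P <= labels V" using initial_particles_finite[OF R] particles_labels by (auto simp: particles_def)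
 have A: "finite A" "A <= labels V" "A <= {p : labels V. type_A p}" using P by (auto simp: A_def)
 define F where "F om = (%p. if p : A then samples (dt k) (n k) (S p om) else undefined)" for om
 define D where "D = Pi_pmf A undefined (%p. chain (Q k) (n k) (fst p))"
 define C where "C = PiE_dflt A undefined (%_. lists V)"
 \<comment> \<open>The number of less brave particles; it turns an order relation back into
   numerical values that induce this order.\<close>
 define rank where "rank sg p = real (card {q : ?P. (q, p) : sg})" for sg and p :: "'v particle"
 define Ph where "Ph sg pa = g (grid_occupation c (rank sg) 0 ?P (map (%i p. if p : A then pa p ! i else fst p) [0..<Suc (n k)]))" for sg pa
 define ord where "ord b = {(p, q). p : ?P & q : ?P & b p < b q}" for b :: "'v particle => real"
 define Or where "Or = ord ` {b. inj_on b ?P}"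
 have Orfin: "finite Or"
  by (rule finite_subset[of _ "Pow (?P \<times> ?P)"]) (use P in \<open>auto simp: Or_def ord_def\<close>)
 define Z where "Z sg = start_event R ze Int order_event ?P sg" for sg
 have Vc: "countable V" by (rule countable_verts)
 have C: "countable C"
 proof -
  have "C <= (%f p. if p : A then f p else undefined) ` PiE A (%_. lists V)"
  proof
   fix f assume "f : C"
   hence "f = (%p. if p : A then restrict f A p else undefined)" "restrict f A : PiE A (%_. lists V)"
    by (auto simp: C_def PiE_dflt_def fun_eq_iff)
   thus "f : (%f p. if p : A then f p else undefined) ` PiE A (%_. lists V)" by blast
  qed
  moreover have "countable (PiE A (%_. lists V))" by (rule countable_PiE[OF A(1)]) (rule countable_lists[OF Vc])
  ultimately show ?thesis by (meson countable_image countable_subset)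
 qed
 have SV: "S p om t : V" if "p : labels V" "om : space M" "0 <= t" for p om t
 proof -
  have "t : {0..}" using that by simp
  with path_in_space[OF that(1,2)] have "path_element (S p) om t : V"
   unfolding path_space_def space_PiM space_count_space by (rule PiE_mem)
  thus ?thesis using that by (simp add: path_element_def)
 qed
 have FC: "F om : C" if om: "om : space M" for om
 proof -
  have "samples (dt k) (n k) (S p om) : lists V" if p: "p : A" for p
   using SV[OF subsetD[OF A(2) p] om] dt[of k] by (auto simp: samples_def simp del: upt_Suc)
  thus ?thesis by (simp add: F_def C_def PiE_dflt_def)
 qed
 have DC: "set_pmf D <= C"
 proof
  fix f assume "f : set_pmf D"
  hence "f : PiE_dflt A undefined (%p. set_pmf (chain (Q k) (n k) (fst p)))" unfolding D_def by (simp add: set_Pi_pmf[OF A(1)] o_def)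
  moreover have "set_pmf (chain (Q k) (n k) (fst p)) <= lists V" if "p : A" for p
  proof -
   have "fst p : V" using subsetD[OF A(2) that] by (auto simp: labels_def)
   moreover have "ALL x:V. set_pmf (Q k x) <= V" using Q by blast
   ultimately show ?thesis using set_pmf_chain[of V "Q k" "fst p"] by blast
  qed
  ultimately show "f : C" unfolding C_def PiE_dflt_def by blast
 qed
 have ev: "{om : Z sg. F om = pa} = start_event R ze Int path_event k A pa Int order_event ?P sg" if "pa : C" for pa sg
  using that by (auto simp: Z_def F_def path_event_def start_event_def C_def PiE_dflt_def fun_eq_iff)
 have evs: "start_event R ze Int path_event k A pa Int order_event ?P sg : sets M" "Z sg : sets M" for pa sg
  using start_event_alg[OF R] path_event_alg[OF A(1,2)] order_event_alg[OF P] alg_sets unfolding Z_def by blast+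
 have PD: "ennreal (prob (path_event k A pa)) = ennreal (pmf D pa)" if "pa : C" for pa
 proof -
  have "ennreal (prob (path_event k A pa)) = (PROD p:A. ennreal (pmf (chain (Q k) (n k) (fst p)) (pa p)))"
   unfolding path_event_def emeasure_eq_measure[symmetric] by (rule law[OF A(1,3)])
  also have "... = ennreal (pmf D pa)"
   using that A(1) by (auto simp: D_def pmf_Pi C_def PiE_dflt_def prod_ennreal)
  finally show ?thesis .
 qed
 have int: "(\<integral>\<^sup>+om. Ph sg (F om) * indicator (Z sg) om \<partial>M) =
   ennreal (prob (start_event R ze)) * ennreal (prob (order_event ?P sg)) * (\<integral>\<^sup>+pa. Ph sg pa \<partial>D)" for sg
 proof (rule nn_integral_discrete[OF C _ DC])
  show "F om : C" if "om : Z sg" for om using that FC by (auto simp: Z_def start_event_def)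
  fix pa assume pa: "pa : C"
  show "{om : Z sg. F om = pa} : sets M" unfolding ev[OF pa] by (rule evs)
  show "emeasure M {om : Z sg. F om = pa} = ennreal (prob (start_event R ze)) * ennreal (prob (order_event ?P sg)) * ennreal (pmf D pa)"
   unfolding ev[OF pa] emeasure_eq_measure indep_events[OF R P A(1,2)] PD[OF pa, symmetric]
   by (simp add: ennreal_mult ac_simps)
 qed
 have FM: "(%om. Ph sg (F om) * indicator (Z sg) om) : borel_measurable M" for sg
 proof -
  have "(%om. F om) : measurable (restrict_space M (Z sg)) (count_space C)"
   unfolding measurable_count_space_eq_countable[OF C]
  proof (intro conjI ballI funcsetI)
   fix om assume "om : space (restrict_space M (Z sg))" thus "F om : C" using FC by (simp add: space_restrict_space)
  next
   fix pa assume pa: "pa : C"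
   have "F -` {pa} Int space (restrict_space M (Z sg)) = {om : Z sg. F om = pa}"
    using sets.sets_into_space[OF evs(2)[of sg]] by (auto simp: space_restrict_space)
   thus "F -` {pa} Int space (restrict_space M (Z sg)) : sets (restrict_space M (Z sg))"
    using ev[OF pa, of sg] evs by (auto simp: sets_restrict_space_iff)
  qed
  from measurable_compose[OF this, of "Ph sg" borel]
  have "(%om. Ph sg (F om)) : borel_measurable (restrict_space M (Z sg))" by simp
  thus ?thesis using evs(2)[of sg] by (subst (asm) borel_measurable_restrict_space_iff_ennreal) (auto simp: mult.commute)
 qed
 have law_run: "(\<integral>\<^sup>+pa. Ph sg pa \<partial>D) = start_expect (Q k) (Suc (n k)) c g R ze" if sgO: "sg : Or" for sg
 proof -
  obtain b :: "'v particle => real" where b: "inj_on b ?P" "sg = {(p, q). p : ?P & q : ?P & b p < b q}"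
   using sgO unfolding Or_def ord_def[symmetric] by blast
  have Bp: "B_start R ze y = enat (card (B_at fst ?P y))" for y using B_initial[OF R(2), of ze y] by (simp add: particles_def)
  have rk: "rank sg p < rank sg q \<longleftrightarrow> b p < b q" if "p : ?P" "q : ?P" for p q
  proof -
   have r: "rank sg p = real (card {r : ?P. b r < b p})" if "p : ?P" for p
    using that unfolding rank_def b(2) by (intro arg_cong[of _ _ real] arg_cong[of _ _ card]) auto
   have lt: "card {r : ?P. b r < b p} < card {r : ?P. b r < b q}" if "b p < b q" "p : ?P" for p q
    by (rule psubset_card_mono) (use P that in auto)
   show ?thesis using lt[of p q] lt[of q p] that r inj_onD[OF b(1), of p q] by (cases "b p" "b q" rule: linorder_cases) auto
  qed
  have "inj_on (rank sg) ?P"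
  proof (rule inj_onI)
   fix p q assume "p : ?P" "q : ?P" "rank sg p = rank sg q"
   hence "b p = b q" using rk[of p q] rk[of q p] by simp
   thus "p = q" using b(1) \<open>p : ?P\<close> \<open>q : ?P\<close> by (simp add: inj_on_eq_iff)
  qed
  hence "map_pmf (%xs. 0 + grid_occupation c (rank sg) 0 ?P xs) (trajectory (Q k) A (Suc (n k)) fst) =
    map_pmf snd (run (Q k) (Suc (n k)) c (static (Suc (n k)) (B_start R ze)) 0 (tokens fst 0 {p : ?P. type_A p}))"
   by (intro grid_occupation_law) (use P A in \<open>auto simp: A_def Bp static_def labels_def\<close>)
  hence "(\<integral>\<^sup>+x. g x \<partial>map_pmf (%xs. 0 + grid_occupation c (rank sg) 0 ?P xs) (trajectory (Q k) A (Suc (n k)) fst)) =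
    (\<integral>\<^sup>+x. g x \<partial>map_pmf snd (run (Q k) (Suc (n k)) c (static (Suc (n k)) (B_start R ze)) 0 (A_start R ze)))"
   unfolding particles_def tokens_initial[OF R] by simp
  thus ?thesis
   unfolding trajectory_chains[OF A(1)] Ph_def D_def by (simp add: expect_def nn_integral_map_pmf del: upt_Suc)
 qed
 define f where "f om = (SUM sg:Or. Ph sg (F om) * indicator (Z sg) om)" for om
 have stat: "AE om in M. ALL p:?P - A. ALL t>=0. S p om t = fst p"
 proof (rule AE_finite_allI)
  fix p assume "p : ?P - A"
  hence "fst p : V" "snd p < 0" by (auto simp: A_def particles_def initial_particles_def)
  with B_stationary have "AE om in M. ALL t>=0. S (fst p, snd p) om t = fst p" by blast
  thus "AE om in M. ALL t>=0. S p om t = fst p" by simp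
 qed (use P in auto)
 have inj: "AE om in M. inj_on (%p. h p om) ?P"
  using valid_instructions unfolding instructions_def by eventually_elim (use P(2) in \<open>blast intro: inj_on_subset\<close>)
 have "AE om in M. f om = g (sampled_occupation c k R ze om) * indicator (start_event R ze) om"
  using stat inj AE_space
 proof eventually_elim
  case (elim om)
  let ?sg = "{(p, q). p : ?P & q : ?P & h p om < h q om}"
  have sg: "?sg : Or" using elim(2) unfolding Or_def ord_def[symmetric] by blast
  have "f om = (SUM sg:Or. if sg = ?sg then Ph sg (F om) * indicator (start_event R ze) om else 0)"
   unfolding f_def using elim(3) by (intro sum.cong refl) (auto simp: Z_def order_event_def indicator_def)
  also have "... = Ph ?sg (F om) * indicator (start_event R ze) om" using sg Orfin by simp
  also have "Ph ?sg (F om) = g (sampled_occupation c k R ze om)"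
  proof -
   have "grid_occupation c (rank ?sg) 0 ?P (map (%i p. if p : A then F om p ! i else fst p) [0..<Suc (n k)]) =
     grid_occupation c (%p. h p om) 0 ?P (map (%i p. S p om (real i * dt k)) [0..<Suc (n k)])"
   proof (rule grid_occupation_cong)
    show "list_all2 (%pos pos'. ALL p:?P. pos p = pos' p) (map (%i p. if p : A then F om p ! i else fst p) [0..<Suc (n k)])
      (map (%i p. S p om (real i * dt k)) [0..<Suc (n k)])"
    proof -
     have "(if p : A then F om p ! i else fst p) = S p om (real i * dt k)" if "p : ?P" "i < Suc (n k)" for p i
      using elim(1) that dt[of k] by (simp add: F_def samples_def del: upt_Suc)
     thus ?thesis by (simp add: list_all2_conv_all_nth del: upt_Suc)
    qed
    fix p q assume pq: "p : ?P" "q : ?P"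
    have r: "rank ?sg p = real (card {r : ?P. h r om < h p om})" if "p : ?P" for p
     using that unfolding rank_def by (intro arg_cong[of _ _ real] arg_cong[of _ _ card]) auto
    have lt: "card {r : ?P. h r om < h p om} < card {r : ?P. h r om < h q om}" if "h p om < h q om" "p : ?P" for p q
     by (rule psubset_card_mono) (use P that in auto)
    show "rank ?sg p < rank ?sg q \<longleftrightarrow> h p om < h q om"
     using lt[of p q] lt[of q p] pq r inj_onD[OF elim(2), of p q] by (cases "h p om" "h q om" rule: linorder_cases) auto
   qed
   thus ?thesis by (simp add: Ph_def sampled_occupation_def)
  qed
  finally show ?case .
 qed
 moreover have "(\<integral>\<^sup>+om. f om \<partial>M) = ennreal (prob (start_event R ze)) * start_expect (Q k) (Suc (n k)) c g R ze"
 proof -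
  have "(\<integral>\<^sup>+om. f om \<partial>M) = (SUM sg:Or. ennreal (prob (start_event R ze)) * ennreal (prob (order_event ?P sg)) * start_expect (Q k) (Suc (n k)) c g R ze)"
   unfolding f_def by (subst nn_integral_sum) (auto simp: FM int law_run intro!: sum.cong)
  also have "... = ennreal (prob (start_event R ze)) * start_expect (Q k) (Suc (n k)) c g R ze * (SUM sg:Or. ennreal (prob (order_event ?P sg)))"
   unfolding sum_distrib_left by (intro sum.cong refl) (simp only: ac_simps)
  also have "(SUM sg:Or. ennreal (prob (order_event ?P sg))) = 1"
  proof -
   have os: "order_event ?P sg : sets M" for sg using order_event_alg[OF P] alg_sets by blast
   have "(SUM sg:Or. prob (order_event ?P sg)) = prob (UN sg:Or. order_event ?P sg)"
    by (rule finite_measure_finite_Union[symmetric]) (use Orfin os in \<open>auto simp: disjoint_family_on_def order_event_def\<close>)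
   also have "... = 1"
   proof (rule prob_eq_1[THEN iffD2])
    show "AE om in M. om : (UN sg:Or. order_event ?P sg)"
     using inj AE_space
    proof eventually_elim
     case (elim om)
     hence "ord (%p. h p om) : Or" "om : order_event ?P (ord (%p. h p om))"
      by (simp_all add: Or_def order_event_def ord_def)
     thus ?case by blast
    qed
   qed (use Orfin os in auto)
   finally show ?thesis by (simp add: sum_ennreal)
  qed
  finally show ?thesis by simp
 qed
 moreover have "f : borel_measurable M" unfolding f_def using FM by (intro borel_measurable_sum) auto
 ultimately show ?thesis by blast
qed

definition occupation :: "'v set => real => 'v set => 'w => real" where
 "occupation H T R om = enn2real (occupation_time H (finite_dlas V (%y. if y : R then \<xi>0 y om else 0) (%p. S p om) (%p. h p om)) T)"

lemma start_limit:
 fixes g :: "real => real"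
 assumes R: "finite R" "R <= V" and H: "finite H" and T: "0 <= T" "!!k. T <= real (Suc (n k)) * dt k"
  and g: "continuous_on UNIV g" "!!v. g v <= B"
 shows "EX u. u : borel_measurable M & (AE om in M. u om = ennreal (g (occupation H T R om)) * indicator (start_event R ze) om) &
  (%k. ennreal (prob (start_event R ze)) * start_expect (Q k) (Suc (n k)) (occ_weight H T (dt k)) (%v. ennreal (g v)) R ze) ~~> (\<integral>\<^sup>+om. u om \<partial>M)"
proof -
 let ?so = "%k. sampled_occupation (occ_weight H T (dt k)) k R ze"
 have "ALL k. EX f. f : borel_measurable M & (AE om in M. f om = ennreal (g (?so k om)) * indicator (start_event R ze) om) &
  (\<integral>\<^sup>+om. f om \<partial>M) = ennreal (prob (start_event R ze)) * start_expect (Q k) (Suc (n k)) (occ_weight H T (dt k)) (%v. ennreal (g v)) R ze"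
  by (intro allI) (rule sampled_occupation_law[OF R, where g = "%v. ennreal (g v)"])
 from choice[OF this] obtain f where f: "!!k. f k : borel_measurable M"
   "!!k. AE om in M. f k om = ennreal (g (?so k om)) * indicator (start_event R ze) om"
   "!!k. (\<integral>\<^sup>+om. f k om \<partial>M) = ennreal (prob (start_event R ze)) * start_expect (Q k) (Suc (n k)) (occ_weight H T (dt k)) (%v. ennreal (g v)) R ze"
  by blast
 have fAE: "AE om in M. ALL k. f k om = ennreal (g (?so k om)) * indicator (start_event R ze) om"
  unfolding AE_all_countable using f(2) by simp
 have Pfin: "finite (particles R ze)" unfolding particles_def by (rule initial_particles_finite[OF R])
 have lim: "AE om in M. (%k. f k om) ~~> ennreal (g (occupation H T R om)) * indicator (start_event R ze) om"
  using fAE good[OF Pfin particles_labels] valid_instructions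
 proof eventually_elim
  case (elim om)
  show ?case
  proof (cases "om : start_event R ze")
   case True
   have z: "(%y. if y : R then \<xi>0 y om else 0) = (%y. if y : R then ze y else 0)"
    using True by (auto simp: start_event_def fun_eq_iff)
   have "(%k. grid_occupation (occ_weight H T (dt k)) (%p. h p om) 0 (initial_particles V (%y. if y : R then ze y else 0))
     (map (%i p. S p om (real i * dt k)) [0..<Suc (n k)])) ~~>
    enn2real (occupation_time H (finite_dlas V (%y. if y : R then ze y else 0) (%p. S p om) (%p. h p om)) T)"
   proof (rule grid_occupation_limit(1)[OF initial_particles_finite[OF R] _ H T(1) _ _ T(2) n])
    fix p and t :: real assume p: "p : initial_particles V (%y. if y : R then ze y else 0)" and "0 <= t"
    hence "p : labels V" using particles_labels[of R ze] by (auto simp: particles_def)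
    thus "\<forall>\<^sub>F r in at_right t. S p om r = S p om t"
     using elim(3) \<open>0 <= t\<close> by (auto simp: instructions_def cadlag_path_def)
   next
    show "\<forall>\<^sub>F k in sequentially. well_sampled (%p. S p om) (initial_particles V (%y. if y : R then ze y else 0)) T' (dt k)"
     using elim(2) by (simp add: well_sampled_limit_def particles_def)
    have "AE t in lborel. 0 <= t --> (\<forall>\<^sub>F k in sequentially. frozen (%p. S p om) (particles R ze) {real (nat \<lfloor>t / dt k\<rfloor>) * dt k..t})"
     using elim(2) by (simp add: well_sampled_limit_def)
    thus "AE t in lborel. t : {0..T} --> (\<forall>\<^sub>F k in sequentially.
      frozen (%p. S p om) (initial_particles V (%y. if y : R then ze y else 0)) {real (nat \<lfloor>t / dt k\<rfloor>) * dt k..t})"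
     unfolding particles_def by eventually_elim simp
   qed
   hence "(%k. ?so k om) ~~> occupation H T R om"
    unfolding sampled_occupation_def occupation_def z particles_def .
   hence "(%k. g (?so k om)) ~~> g (occupation H T R om)"
    using g(1) by (auto intro: continuous_on_tendsto_compose)
   hence "(%k. ennreal (g (?so k om))) ~~> ennreal (g (occupation H T R om))" by (rule tendsto_ennrealI)
   thus ?thesis using True elim(1) by simp
  qed (use elim(1) in simp)
 qed
 define u where "u om = liminf (%k. f k om)" for om
 have um: "u : borel_measurable M" unfolding u_def by (intro borel_measurable_liminf f)
 have ueq: "AE om in M. u om = ennreal (g (occupation H T R om)) * indicator (start_event R ze) om"
  using lim unfolding u_def by eventually_elim (simp add: lim_imp_Liminf)
 have "(%k. \<integral>\<^sup>+om. f k om \<partial>M) ~~> (\<integral>\<^sup>+om. u om \<partial>M)"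
 proof (rule nn_integral_dominated_convergence[where w = "%_. ennreal B"])
  show "AE om in M. f k om <= ennreal B" for k
   using f(2)[of k] by eventually_elim (auto simp: indicator_def intro: ennreal_leI g)
  show "AE om in M. (%k. f k om) ~~> u om"
   using lim ueq by eventually_elim simp
 qed (use f um in \<open>auto simp: emeasure_space_1\<close>)
 with um ueq show ?thesis unfolding f(3) by blast
qed

end

section \<open>Limits of finite systems along grids and along finite vertex sets\<close>

context sampled_dlas
begin

definition start_law :: "'v => int pmf" where
 "start_law x = (if x : V then embed_pmf (%z. prob {om : space M. \<xi>0 x om = z}) else return_pmf 0)"

lemma \<xi>0_measurable: "x : V ==> \<xi>0 x : measurable M (count_space UNIV)"
 using indep_initial unfolding indep_vars_def by blast

lemma pmf_start_law: "x : V ==> pmf (start_law x) z = prob {om : space M. \<xi>0 x om = z}"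
proof -
 assume x: "x : V"
 have s: "{om : space M. \<xi>0 x om = z} : sets M" for z
  using measurable_sets[OF \<xi>0_measurable[OF x], of "{z}"] by (simp add: vimage_def Int_def conj_commute)
 have "(\<integral>\<^sup>+z. ennreal (prob {om : space M. \<xi>0 x om = z}) \<partial>count_space UNIV) = emeasure M (\<Union>z. {om : space M. \<xi>0 x om = z})"
  unfolding emeasure_eq_measure[symmetric]
  by (rule emeasure_UN_countable[symmetric]) (use s in \<open>auto simp: disjoint_family_on_def\<close>)
 also have "(\<Union>z. {om : space M. \<xi>0 x om = z}) = space M" by auto
 finally show ?thesis using x unfolding start_law_def by (simp add: pmf_embed_pmf emeasure_space_1)
qed

lemma prob_start_event:
 assumes R: "finite R" "R <= V" and ze: "!!x. x ~: R ==> ze x = 0"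
 shows "prob (start_event R ze) = pmf (Pi_pmf R 0 start_law) ze"
proof -
 have "prob (start_event R ze) = (PROD x:R. prob (\<xi>0 x -` {ze x} Int space M))"
 proof (cases "R = {}")
  case True thus ?thesis by (simp add: start_event_def prob_space)
 next
  case False
  have "start_event R ze = (\<Inter>x\<in>R. \<xi>0 x -` {ze x} Int space M)" using False by (auto simp: start_event_def)
  moreover have "prob (\<Inter>x\<in>R. \<xi>0 x -` {ze x} Int space M) = (PROD x:R. prob (\<xi>0 x -` {ze x} Int space M))"
   by (rule indep_varsD[OF indep_initial False R]) simp
  ultimately show ?thesis by (simp only:)
 qed
 also have "... = (PROD x:R. pmf (start_law x) (ze x))"
  using R by (intro prod.cong refl) (auto simp: pmf_start_law vimage_def Int_def conj_commute)
 finally show ?thesis using R ze by (simp add: pmf_Pi)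
qed

text \<open>On the event of a fixed configuration the sampled occupations converge almost surely, so
  the token expectation for this configuration converges as well. There are only countably many
  configurations on a finite \<open>R\<close>, and the pieces are summed.\<close>

lemma occupation_law_limit:
 fixes g :: "real => real"
 assumes R: "finite R" "R <= V" and H: "finite H" and T: "0 <= T" "!!k. T <= real (Suc (n k)) * dt k"
  and g: "continuous_on UNIV g" "!!v. 0 <= g v" "!!v. g v <= B"
 defines "L \<equiv> %k ze. start_expect (Q k) (Suc (n k)) (occ_weight H T (dt k)) (%v. ennreal (g v)) R ze"
 shows "\<exists>La. ALL ze:set_pmf (Pi_pmf R 0 start_law). (%k. L k ze) ~~> La ze" (is ?A)
  and "EX u. u : borel_measurable M & (AE om in M. u om = ennreal (g (occupation H T R om))) &
   (%k. \<integral>\<^sup>+ze. L k ze \<partial>Pi_pmf R 0 start_law) ~~> (\<integral>\<^sup>+om. u om \<partial>M)" (is ?B)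
proof -
 let ?p = "Pi_pmf R 0 start_law"
 have "ALL ze. EX u. u : borel_measurable M & (AE om in M. u om = ennreal (g (occupation H T R om)) * indicator (start_event R ze) om) &
  (%k. ennreal (prob (start_event R ze)) * L k ze) ~~> (\<integral>\<^sup>+om. u om \<partial>M)"
  unfolding L_def by (intro allI) (rule start_limit[OF R H T g(1,3)])
 from choice[OF this] obtain u where u: "!!ze. u ze : borel_measurable M"
   "!!ze. AE om in M. u ze om = ennreal (g (occupation H T R om)) * indicator (start_event R ze) om"
   "!!ze. (%k. ennreal (prob (start_event R ze)) * L k ze) ~~> (\<integral>\<^sup>+om. u ze om \<partial>M)"
  by blast
 define C where "C = set_pmf ?p"
 have C0: "ze x = 0" if "ze : C" "x ~: R" for ze x
  using that unfolding C_def set_Pi_pmf[OF R(1)] PiE_dflt_def by blast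
 have pr: "prob (start_event R ze) = pmf ?p ze" if "ze : C" for ze
  by (rule prob_start_event[OF R C0[OF that]])
 define La where "La ze = (\<integral>\<^sup>+om. u ze om \<partial>M) / ennreal (pmf ?p ze)" for ze
 have lim: "(%k. L k ze) ~~> La ze" if "ze : C" for ze
 proof -
  have pos: "0 < pmf ?p ze" using that by (simp add: C_def pmf_positive)
  have "(%k. ennreal (1 / pmf ?p ze) * (ennreal (pmf ?p ze) * L k ze)) ~~> ennreal (1 / pmf ?p ze) * (\<integral>\<^sup>+om. u ze om \<partial>M)"
   using u(3)[of ze] by (intro ennreal_tendsto_cmult) (simp_all add: pr[OF that])
  moreover have "ennreal (1 / pmf ?p ze) * (ennreal (pmf ?p ze) * x) = x" for x
   using pos by (simp add: mult.assoc[symmetric] ennreal_mult[symmetric])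
  moreover have "ennreal (1 / pmf ?p ze) * (\<integral>\<^sup>+om. u ze om \<partial>M) = La ze"
   using pos by (simp add: La_def divide_ennreal_def inverse_ennreal mult.commute inverse_eq_divide)
  ultimately show ?thesis by simp
 qed
 thus ?A unfolding C_def by blast
 have Lle: "L k ze <= ennreal B" for k ze
  unfolding L_def expect_def
  by (rule order_trans[OF nn_integral_mono[where v = "%_. ennreal B"]]) (auto intro: ennreal_leI g(3))
 have conv: "(%k. \<integral>\<^sup>+ze. L k ze \<partial>?p) ~~> (\<integral>\<^sup>+ze. La ze \<partial>?p)"
  by (rule nn_integral_dominated_convergence[where w = "%_. ennreal B"])
   (use Lle lim in \<open>auto simp: AE_measure_pmf_iff C_def\<close>)
 define U where "U om = (\<integral>\<^sup>+ze. u ze om \<partial>count_space C)" for om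
 have Cc: "countable C" by (simp add: C_def)
 have "(\<integral>\<^sup>+ze. La ze \<partial>?p) = (\<integral>\<^sup>+ze. \<integral>\<^sup>+om. u ze om \<partial>M \<partial>count_space C)"
 proof -
  have "(\<integral>\<^sup>+ze. La ze \<partial>?p) = (\<integral>\<^sup>+ze. ennreal (pmf ?p ze) * La ze \<partial>count_space UNIV)" by (rule nn_integral_measure_pmf)
  also have "... = (\<integral>\<^sup>+ze. ennreal (pmf ?p ze) * La ze \<partial>count_space C)"
   by (rule nn_integral_count_space_eq) (auto simp: C_def set_pmf_iff)
  also have "... = (\<integral>\<^sup>+ze. \<integral>\<^sup>+om. u ze om \<partial>M \<partial>count_space C)"
  proof (intro nn_integral_cong)
   fix ze assume "ze : space (count_space C)"
   hence "0 < pmf ?p ze" by (simp add: C_def pmf_positive)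
   thus "ennreal (pmf ?p ze) * La ze = (\<integral>\<^sup>+om. u ze om \<partial>M)"
    by (simp add: La_def ennreal_times_divide ennreal_mult_divide_eq mult.commute)
  qed
  finally show ?thesis .
 qed
 also have "... = (\<integral>\<^sup>+om. U om \<partial>M)" unfolding U_def
  by (rule nn_integral_count_space_nn_integral[symmetric]) (use Cc u in auto)
 finally have LU: "(\<integral>\<^sup>+ze. La ze \<partial>?p) = (\<integral>\<^sup>+om. U om \<partial>M)" .
 have "U : borel_measurable M"
 proof -
  have "(%(om, ze). u ze om) : borel_measurable (M \<Otimes>\<^sub>M count_space C)"
  proof -
   have "(%x. u (snd x) (fst x)) : borel_measurable (M \<Otimes>\<^sub>M count_space C)"
    by (rule measurable_compose_countable'[where f = "%i x. u i (fst x)" and g = snd and I = C]) (use u(1) Cc in auto)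
   thus ?thesis by (simp add: case_prod_beta)
  qed
  moreover have "sigma_finite_measure (count_space C)" using Cc by (rule sigma_finite_measure_count_space_countable)
  ultimately show ?thesis unfolding U_def using sigma_finite_measure.borel_measurable_nn_integral by blast
 qed
 moreover have "AE om in M. U om = ennreal (g (occupation H T R om))"
 proof -
  have a: "AE om in M. ALL ze:C. u ze om = ennreal (g (occupation H T R om)) * indicator (start_event R ze) om"
   using Cc u(2) by (simp add: AE_ball_countable)
  have b: "AE om in M. (%x. if x : R then \<xi>0 x om else 0) : C"
  proof -
   have "AE om in M. ALL x:R. \<xi>0 x om : set_pmf (start_law x)"
   proof (rule AE_finite_allI[OF R(1)])
    fix x assume x: "x : R"
    hence xV: "x : V" using R by auto
    have "AE om in M. ALL z:- set_pmf (start_law x). \<xi>0 x om ~= z"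
    proof (subst AE_ball_countable)
     show "ALL z:- set_pmf (start_law x). AE om in M. \<xi>0 x om ~= z"
     proof
      fix z assume "z : - set_pmf (start_law x)"
      hence "prob {om : space M. \<xi>0 x om = z} = 0" using pmf_start_law[OF xV, of z] by (simp add: set_pmf_iff)
      moreover have "{om : space M. \<xi>0 x om = z} : sets M"
       using measurable_sets[OF \<xi>0_measurable[OF xV], of "{z}"] by (simp add: vimage_def Int_def conj_commute)
      ultimately show "AE om in M. \<xi>0 x om ~= z"
       by (intro AE_I[where N = "{om : space M. \<xi>0 x om = z}"]) (auto simp: emeasure_eq_measure)
     qed
    qed simp
    thus "AE om in M. \<xi>0 x om : set_pmf (start_law x)" by eventually_elim auto
   qed
   thus ?thesis by eventually_elim (auto simp: C_def set_Pi_pmf[OF R(1)] PiE_dflt_def)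
  qed
  show ?thesis using a b AE_space
  proof eventually_elim
   case (elim om)
   let ?z = "%x. if x : R then \<xi>0 x om else 0"
   have "U om = (\<integral>\<^sup>+ze. ennreal (g (occupation H T R om)) * indicator {?z} ze \<partial>count_space C)"
    unfolding U_def
   proof (intro nn_integral_cong)
    fix ze assume ze: "ze : space (count_space C)"
    have "om : start_event R ze \<longleftrightarrow> ze = ?z"
     using elim(3) C0 ze by (auto simp: start_event_def fun_eq_iff)
    thus "u ze om = ennreal (g (occupation H T R om)) * indicator {?z} ze"
     using elim(1) ze by (simp add: indicator_def)
   qed
   also have "... = ennreal (g (occupation H T R om))" using elim(2) by (subst nn_integral_cmult_indicator) auto
   finally show ?case .
  qed
 qed
 ultimately show ?B using conv unfolding LU by blast
qed

abbreviation "final H T om \<equiv> enn2real (occupation_time H (\<xi> om) T)"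

text \<open>By \<open>finite_approximation\<close> the occupation of a finite \<open>H\<close> is
  eventually constant along the exhaustion, so expectations of bounded functions converge.
  Measurable versions are constructed on the way, as the occupation is determined up to null sets
  only.\<close>

lemma exhaustion_limit:
 fixes g :: "real => real"
 assumes Rs: "!!m. finite (Rs m)" "!!m. Rs m <= V" "!!m. Rs m <= Rs (Suc m)" "(\<Union>m. Rs m) = V"
  and H: "finite H" "H <= V" and T: "0 <= T" "!!k. T <= real (Suc (n k)) * dt k"
  and g: "continuous_on UNIV g" "!!v. 0 <= g v" "!!v. g v <= B"
 shows "EX u. u : borel_measurable M & (AE om in M. u om = ennreal (g (final H T om)))"
  and "(%m. \<integral>\<^sup>+om. ennreal (g (occupation H T (Rs m) om)) \<partial>M) ~~> (\<integral>\<^sup>+om. ennreal (g (final H T om)) \<partial>M)"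
  and "AE om in M. \<forall>\<^sub>F m in sequentially. occupation H T (Rs m) om = final H T om &
   occupation_time H (\<xi> om) T = occupation_time H (finite_dlas V (%y. if y : Rs m then \<xi>0 y om else 0) (%p. S p om) (%p. h p om)) T"
proof -
 have "finite_exhaustion G (%m. G \<restriction> Rs m)"
  unfolding finite_exhaustion_def
 proof (intro conjI allI)
  fix m
  have wf: "wf_digraph (G \<restriction> Rs m)" by (rule wellformed_induce_subgraph)
  have "finite (arcs (G \<restriction> Rs m))"
   by (rule finite_subset[of _ "UN v:Rs m. out_arcs G v"])
    (use Rs(1,2) locally_finite in \<open>auto simp: out_arcs_def\<close>)
  thus "fin_digraph (G \<restriction> Rs m)"
   using wf Rs(1)[of m] by (intro fin_digraph.intro fin_digraph_axioms.intro) auto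
  have "symmetric (G \<restriction> Rs m)"
   by (rule induced_graph_imp_symmetric[OF sym_arcs induced_induce[OF Rs(2)]])
  thus "sym_digraph (G \<restriction> Rs m)" using wf by (intro sym_digraph.intro sym_digraph_axioms.intro)
  show "subgraph (G \<restriction> Rs m) G" using induced_induce[OF Rs(2)] by (rule induced_imp_subgraph)
  show "subgraph (G \<restriction> Rs m) (G \<restriction> Rs (Suc m))"
   unfolding subgraph_def using Rs(3)[of m] wf wellformed_induce_subgraph by (auto simp: compatible_def)
 next
  show "(\<Union>m. verts (G \<restriction> Rs m)) = V" using Rs(4) by simp
  have inc: "i <= j ==> Rs i <= Rs j" for i j by (rule lift_Suc_mono_le[of Rs]) (rule Rs(3))
  show "(\<Union>m. arcs (G \<restriction> Rs m)) = arcs G"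
  proof (intro equalityI subsetI)
   fix e assume e: "e : arcs G"
   then obtain i j where "tail G e : Rs i" "head G e : Rs j"
    using tail_in_verts[OF e] head_in_verts[OF e] Rs(4) by blast
   hence "tail G e : Rs (max i j)" "head G e : Rs (max i j)" using inc[of i "max i j"] inc[of j "max i j"] by auto
   thus "e : (\<Union>m. arcs (G \<restriction> Rs m))" using e by auto
  qed auto
 qed
 hence "AE om in M. \<forall>\<^sub>F m in sequentially. ALL t:{0..T}. ALL x:H.
   finite_dlas V (%y. if y : verts (G \<restriction> Rs m) then \<xi>0 y om else 0) (%p. S p om) (%p. h p om) t x = \<xi> om t x"
  using finite_approximation H T(1) by blast
 thus ev: "AE om in M. \<forall>\<^sub>F m in sequentially. occupation H T (Rs m) om = final H T om &
   occupation_time H (\<xi> om) T = occupation_time H (finite_dlas V (%y. if y : Rs m then \<xi>0 y om else 0) (%p. S p om) (%p. h p om)) T"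
 proof eventually_elim
  case (elim om)
  thus ?case
  proof eventually_elim
   case (elim m)
   have "occupation_time H (finite_dlas V (%y. if y : Rs m then \<xi>0 y om else 0) (%p. S p om) (%p. h p om)) T = occupation_time H (\<xi> om) T"
    unfolding occupation_time_def
    by (intro infsum_cong nn_integral_cong) (use elim in \<open>auto simp: indicator_def\<close>)
   thus ?case by (simp add: occupation_def)
  qed
 qed
 have "ALL m. EX u. u : borel_measurable M & (AE om in M. u om = ennreal (g (occupation H T (Rs m) om)))"
  using occupation_law_limit(2)[OF Rs(1,2) H(1) T g] by blast
 from choice[OF this] obtain u where u: "!!m. u m : borel_measurable M" "!!m. AE om in M. u m om = ennreal (g (occupation H T (Rs m) om))" by blast
 have uAE: "AE om in M. ALL m. u m om = ennreal (g (occupation H T (Rs m) om))" unfolding AE_all_countable using u(2) by simp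
 have lim: "AE om in M. (%m. u m om) ~~> ennreal (g (final H T om))"
  using ev uAE
 proof eventually_elim
  case (elim om)
  from elim(1) have "\<forall>\<^sub>F m in sequentially. u m om = ennreal (g (final H T om))"
   by eventually_elim (simp add: elim(2))
  thus ?case by (rule tendsto_eventually)
 qed
 define U where "U om = liminf (%m. u m om)" for om
 have U: "U : borel_measurable M" unfolding U_def by (intro borel_measurable_liminf u)
 have Ueq: "AE om in M. U om = ennreal (g (final H T om))"
  using lim unfolding U_def by eventually_elim (simp add: lim_imp_Liminf)
 with U show "EX u. u : borel_measurable M & (AE om in M. u om = ennreal (g (final H T om)))" by blast
 have "(%m. \<integral>\<^sup>+om. u m om \<partial>M) ~~> (\<integral>\<^sup>+om. U om \<partial>M)"
 proof (rule nn_integral_dominated_convergence[where w = "%_. ennreal B"])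
  show "AE om in M. u m om <= ennreal B" for m
   using u(2)[of m] by eventually_elim (auto intro: ennreal_leI g)
  show "AE om in M. (%m. u m om) ~~> U om" using lim Ueq by eventually_elim simp
 qed (use u U in \<open>auto simp: emeasure_space_1\<close>)
 moreover have "(\<integral>\<^sup>+om. u m om \<partial>M) = (\<integral>\<^sup>+om. ennreal (g (occupation H T (Rs m) om)) \<partial>M)" for m
  by (rule nn_integral_cong_AE) (rule u)
 moreover have "(\<integral>\<^sup>+om. U om \<partial>M) = (\<integral>\<^sup>+om. ennreal (g (final H T om)) \<partial>M)"
  by (rule nn_integral_cong_AE) (rule Ueq)
 ultimately show "(%m. \<integral>\<^sup>+om. ennreal (g (occupation H T (Rs m) om)) \<partial>M) ~~> (\<integral>\<^sup>+om. ennreal (g (final H T om)) \<partial>M)"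
  by simp
qed

text \<open>
 Since the approximation holds for every exhaustion, the limit is along the net of all finite
 vertex sets.
\<close>

theorem net_limit:
 fixes g :: "real => real"
 assumes H: "finite H" "H <= V" and T: "0 <= T" "!!k. T <= real (Suc (n k)) * dt k"
  and g: "continuous_on UNIV g" "!!v. 0 <= g v" "!!v. g v <= B" and ep: "0 < ep"
 defines "L \<equiv> %R k. \<integral>\<^sup>+ze. start_expect (Q k) (Suc (n k)) (occ_weight H T (dt k)) (%v. ennreal (g v)) R ze \<partial>Pi_pmf R 0 start_law"
  and "E \<equiv> \<integral>\<^sup>+om. ennreal (g (final H T om)) \<partial>M"
 shows "EX F. finite F & F <= V & (ALL R. finite R --> F <= R --> R <= V -->
  (\<forall>\<^sub>F k in sequentially. L R k <= E + ennreal ep & E <= L R k + ennreal ep))"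
proof (rule ccontr)
 define bad where "bad R \<longleftrightarrow> \<not> (\<forall>\<^sub>F k in sequentially. L R k <= E + ennreal ep & E <= L R k + ennreal ep)" for R
 assume "\<not> ?thesis"
 hence no: "\<not> (EX F. finite F & F <= V & (ALL R. finite R --> F <= R --> R <= V --> \<not> bad R))"
  unfolding bad_def not_not .
 have ex: "EX R. finite R & F <= R & R <= V & bad R" if F: "finite F" "F <= V" for F
 proof (rule ccontr)
  assume "\<not> ?thesis"
  hence "ALL R. finite R --> F <= R --> R <= V --> \<not> bad R" by blast
  with F have "EX F. finite F & F <= V & (ALL R. finite R --> F <= R --> R <= V --> \<not> bad R)"
   by (intro exI[of _ F] conjI)
  with no show False by (rule notE)
 qed
 \<comment> \<open>If every finite set had a bad superset, bad sets could be chosen one after the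
   other so as to exhaust the graph; along this exhaustion the expectations would not converge to
   \<open>E\<close>.\<close>
 define pick where "pick F = (SOME R. finite R & F <= R & R <= V & bad R)" for F
 have pick: "finite (pick F)" "F <= pick F" "pick F <= V" "bad (pick F)" if "finite F" "F <= V" for F
  using someI_ex[OF ex[OF that]] unfolding pick_def by blast+
 obtain e :: "nat => 'v set" where e: "!!m. finite (e m)" "(\<Union>m. e m) = V"
 proof (cases "V = {}")
  case True thus ?thesis using that[of "%_. {}"] by simp
 next
  case False
  have "range (from_nat_into V) = V" by (rule range_from_nat_into[OF False countable_verts])
  thus ?thesis using that[of "%m. {from_nat_into V m}"] by auto
 qed
 define Rs where "Rs = rec_nat (pick (e 0)) (%m R. pick (R Un e (Suc m)))"
 have eV: "e m <= V" for m using e(2) by blast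
 have Rs: "finite (Rs m) & Rs m <= V & e m <= Rs m & bad (Rs m)" for m
 proof (induction m)
  case 0
  thus ?case using pick[OF e(1) eV, of 0] by (simp add: Rs_def)
 next
  case (Suc m)
  have "finite (Rs m Un e (Suc m))" "Rs m Un e (Suc m) <= V" using Suc e(1) eV by auto
  from pick[OF this] show ?case by (simp add: Rs_def)
 qed
 have inc: "Rs m <= Rs (Suc m)" for m
 proof -
  have "finite (Rs m Un e (Suc m))" "Rs m Un e (Suc m) <= V" using Rs[of m] e(1) eV by auto
  from pick(2)[OF this] show ?thesis by (simp add: Rs_def)
 qed
 have un: "(\<Union>m. Rs m) = V"
 proof (intro equalityI UN_least)
  show "Rs m <= V" for m using Rs[of m] by blast
  have "(\<Union>m. e m) <= (\<Union>m. Rs m)" by (rule UN_mono) (use Rs in simp_all)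
  thus "V <= (\<Union>m. Rs m)" by (simp only: e(2))
 qed
 let ?e = "%m. \<integral>\<^sup>+om. ennreal (g (occupation H T (Rs m) om)) \<partial>M"
 have lim: "?e ~~> E"
  unfolding E_def by (rule exhaustion_limit(2)[OF _ _ inc un H T g]) (use Rs in auto)
 have "E <= (\<integral>\<^sup>+om. ennreal B \<partial>M)" unfolding E_def by (intro nn_integral_mono ennreal_leI g)
 hence Efin: "E < top" by (simp add: emeasure_space_1 le_less_trans)
 have close: "\<forall>\<^sub>F x in F. f x <= a + ennreal ep' & a <= f x + ennreal ep'"
  if fa: "(f \<longlongrightarrow> a) F" "a < top" "0 < ep'" for f :: "nat => ennreal" and a F ep'
 proof -
  obtain x where x: "a = ennreal x" "0 <= x" using fa(2) by (cases a) auto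
  have "\<forall>\<^sub>F x in F. f x < a + ennreal ep'"
   by (rule order_tendstoD(2)[OF fa(1)]) (use x fa(3) in \<open>simp add: ennreal_plus[symmetric] ennreal_less_iff del: ennreal_plus\<close>)
  moreover have "\<forall>\<^sub>F y in F. a <= f y + ennreal ep'"
  proof (cases "x < ep'")
   case True
   thus ?thesis by (intro always_eventually allI) (simp add: x add_increasing ennreal_leI)
  next
   case False
   have "\<forall>\<^sub>F y in F. ennreal (x - ep') < f y"
    by (rule order_tendstoD(1)[OF fa(1)]) (use x fa(3) False in \<open>simp add: ennreal_less_iff\<close>)
   thus ?thesis
   proof eventually_elim
    case (elim y)
    have "a = ennreal (x - ep') + ennreal ep'" using x False fa(3) by (simp add: ennreal_plus[symmetric] del: ennreal_plus)
    thus ?case using elim by (simp add: add_right_mono less_imp_le)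
   qed
  qed
  ultimately show ?thesis by eventually_elim (simp add: less_imp_le)
 qed
 have half: "ennreal ep = ennreal (ep / 2) + ennreal (ep / 2)" using ep by (simp add: ennreal_plus[symmetric] del: ennreal_plus)
 from eventually_happens[OF close[OF lim Efin, of "ep / 2"]] ep
 obtain m where m: "?e m <= E + ennreal (ep / 2)" "E <= ?e m + ennreal (ep / 2)" by auto
 have "finite (Rs m)" "Rs m <= V" using Rs by auto
 from occupation_law_limit(2)[OF this H(1) T g]
 obtain u where u: "AE om in M. u om = ennreal (g (occupation H T (Rs m) om))" "(%k. L (Rs m) k) ~~> (\<integral>\<^sup>+om. u om \<partial>M)"
  unfolding L_def by blast
 have "(\<integral>\<^sup>+om. u om \<partial>M) = ?e m" by (rule nn_integral_cong_AE) (rule u)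
 moreover have "?e m < top" using m(1) Efin by (auto simp: less_top[symmetric] top_unique)
 ultimately have "\<forall>\<^sub>F k in sequentially. L (Rs m) k <= ?e m + ennreal (ep / 2) & ?e m <= L (Rs m) k + ennreal (ep / 2)"
  using close[of "L (Rs m)" "?e m" sequentially "ep / 2"] u(2) ep by simp
 hence "\<forall>\<^sub>F k in sequentially. L (Rs m) k <= E + ennreal ep & E <= L (Rs m) k + ennreal ep"
 proof eventually_elim
  case (elim k)
  have "L (Rs m) k <= E + ennreal (ep / 2) + ennreal (ep / 2)" using elim m(1) by (auto intro: order_trans add_right_mono)
  moreover have "E <= L (Rs m) k + ennreal (ep / 2) + ennreal (ep / 2)" using elim m(2) by (auto intro: order_trans add_right_mono)
  ultimately show ?case unfolding half by (simp add: add.assoc)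
 qed
 thus False using Rs[of m] by (simp add: bad_def)
qed

end

section \<open>Regularity of paths\<close>

lemma cadlag_punctured:
 assumes P: "finite P" "ALL p:P. cadlag_path V (s p)" and t: "0 <= t"
 shows "\<exists>e>0. frozen s P {t..<t + e} & frozen s P ({t - e<..<t} Int {0..})"
proof -
 have "\<forall>\<^sub>F r in at_right t. ALL p:P. s p r = s p t"
  using P t by (intro eventually_ball_finite) (auto simp: cadlag_path_def)
 then obtain b where b: "b > t" "!!r p. t < r ==> r < b ==> p : P ==> s p r = s p t"
  by (auto simp: eventually_at_right_field)
 obtain a where a: "a < t" "!!r r' p. a < r ==> r < t ==> 0 <= r ==> a < r' ==> r' < t ==> 0 <= r' ==> p : P ==> s p r = s p r'"
 proof (cases "t = 0")
  case True
  show ?thesis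
  proof (rule that[of "-1"])
   fix r r' p assume "r < t" "0 <= r"
   with True show "s p r = s p r'" by simp
  qed (simp add: True)
 next
  case False
  have "EX y. \<forall>\<^sub>F r in at_left t. s p r = y" if "p : P" for p
  proof -
   have "cadlag_path V (s p)" "0 < t" using P(2) that t False by auto
   thus ?thesis unfolding cadlag_path_def by blast
  qed
  hence "ALL p:P. EX y. \<forall>\<^sub>F r in at_left t. s p r = y" by blast
  from bchoice[OF this] obtain y where "ALL p:P. \<forall>\<^sub>F r in at_left t. s p r = y p" by blast
  hence "\<forall>\<^sub>F r in at_left t. ALL p:P. s p r = y p" using P by (intro eventually_ball_finite) auto
  then obtain a where "a < t" "!!r p. a < r ==> r < t ==> p : P ==> s p r = y p" by (auto simp: eventually_at_left_field)
  thus ?thesis using that[of a] by metis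
 qed
 define e where "e = min (b - t) (t - a)"
 have e: "0 < e" "e <= b - t" "e <= t - a" using a(1) b(1) by (auto simp: e_def)
 have "s p r = s p t" if "p : P" "r : {t..<t + e}" for p r
  using b(2)[of r p] that e by (cases "r = t") auto
 hence "frozen s P {t..<t + e}" unfolding frozen_def by metis
 moreover have "frozen s P ({t - e<..<t} Int {0..})" unfolding frozen_def
  by (intro ballI a(2)) (use e in auto)
 ultimately show ?thesis using e(1) by blast
qed

lemma frozen_mono: "frozen s P I ==> I' <= I ==> frozen s P I'"
 by (auto simp: frozen_def)

text \<open>Around every time there is a neighbourhood in which the paths can change only at its
  centre. A Lebesgue number of this cover of a compact interval yields one mesh for all short
  intervals.\<close>

lemma cadlag_lebesgue:
 assumes P: "finite P" "ALL p:P. cadlag_path V (s p)"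
 shows "\<exists>d>0. ALL a b. 0 <= a --> a <= b --> b <= T --> b - a < d -->
  (EX t. frozen s P ({a..b} Int {..<t}) & frozen s P ({a..b} Int {t..}))"
proof (cases "0 <= T")
 case True
 define e where "e t = (SOME e. 0 < e & frozen s P {t..<t + e} & frozen s P ({t - e<..<t} Int {0..}))" for t
 have "0 < e t & frozen s P {t..<t + e t} & frozen s P ({t - e t<..<t} Int {0..})" if "0 <= t" for t
  unfolding e_def by (rule someI_ex) (rule cadlag_punctured[OF P that])
 hence e: "!!t. 0 <= t ==> 0 < e t" "!!t. 0 <= t ==> frozen s P {t..<t + e t}" "!!t. 0 <= t ==> frozen s P ({t - e t<..<t} Int {0..})"
  by blast+
 obtain d where d: "0 < d" "!!S. S <= {0..T} ==> diameter S < d ==> EX B:(%t. ball t (e t)) ` {0..T}. S <= B"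
 proof (rule Lebesgue_number_lemma[OF compact_Icc[of 0 T], of "(%t. ball t (e t)) ` {0..T}"])
  show "(%t. ball t (e t)) ` {0..T} ~= {}" using True by simp
  show "{0..T} <= \<Union> ((%t. ball t (e t)) ` {0..T})" using e(1) by auto
 qed (auto intro: that)
 have "EX t. frozen s P ({a..b} Int {..<t}) & frozen s P ({a..b} Int {t..})" if ab: "0 <= a" "a <= b" "b <= T" "b - a < d" for a b
 proof -
  have "{a..b} <= {0..T}" "diameter {a..b} < d" using ab by (auto simp: diameter_closed_interval)
  from d(2)[OF this] obtain t where t: "0 <= t" "{a..b} <= ball t (e t)" by auto
  have "frozen s P ({a..b} Int {..<t})"
   by (rule frozen_mono[OF e(3)[OF t(1)]]) (use t(2) ab in \<open>auto simp: subset_iff dist_real_def\<close>)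
  moreover have "frozen s P ({a..b} Int {t..})"
   by (rule frozen_mono[OF e(2)[OF t(1)]]) (use t(2) ab in \<open>auto simp: subset_iff dist_real_def\<close>)
  ultimately show ?thesis by blast
 qed
 with d(1) show ?thesis by blast
next
 case False
 thus ?thesis by (intro exI[of _ 1]) auto
qed

lemma cadlag_finite_range:
 assumes "cadlag_path V s"
 shows "finite (s ` {0..T})"
proof -
 \<comment> \<open>A dummy label, so that the statement about families of paths applies to a single
   path.\<close>
 let ?P = "{(undefined, 0)}"
 have ex: "ALL t:{0..}. EX e. 0 < e & frozen (%_. s) ?P {t..<t + e} & frozen (%_. s) ?P ({t - e<..<t} Int {0..})"
 proof
  fix t :: real assume "t : {0..}"
  hence t: "0 <= t" by simp
  have P: "finite ?P" "ALL p:?P. cadlag_path V ((%_. s) p)" using assms by blast+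
  show "EX e. 0 < e & frozen (%_. s) ?P {t..<t + e} & frozen (%_. s) ?P ({t - e<..<t} Int {0..})"
   using cadlag_punctured[OF P t] by blast
 qed
 obtain e where e0: "ALL t:{0..}. 0 < e t & frozen (%_. s) ?P {t..<t + e t} & frozen (%_. s) ?P ({t - e t<..<t} Int {0..})"
  using bchoice[OF ex] by blast
 hence e: "!!t. 0 <= t ==> 0 < e t" "!!t. 0 <= t ==> frozen (%_. s) ?P {t..<t + e t}"
   "!!t. 0 <= t ==> frozen (%_. s) ?P ({t - e t<..<t} Int {0..})"
  by simp_all
 have const: "finite (s ` I)" if fr: "frozen (%_. s) ?P I" for I
 proof (cases "I = {}")
  case False
  then obtain x where x: "x : I" by blast
  have "ALL t:I. s t = s x" using fr x unfolding frozen_def by blast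
  hence "s ` I <= {s x}" by blast
  thus ?thesis by (rule finite_subset) simp
 qed simp
 have cov: "{0..T} <= (UN t:{0..T}. ball t (e t))" using e(1) by (auto intro!: bexI)
 obtain D where D: "D <= {0..T}" "finite D" "{0..T} <= (UN t:D. ball t (e t))"
  by (rule compactE_image[OF compact_Icc _ cov]) simp_all
 have "s ` {0..T} <= (UN t:D. s ` {t..<t + e t} Un s ` ({t - e t<..<t} Int {0..}))"
 proof
  fix y assume "y : s ` {0..T}"
  then obtain u where u: "u : {0..T}" "y = s u" by blast
  then obtain t where t: "t : D" "dist t u < e t" using D(3) by auto
  have "0 <= u" using u by simp
  with t(2) have "u : {t..<t + e t} \<or> u : {t - e t<..<t} Int {0..}" unfolding dist_real_def by (cases "t <= u") simp_all
  thus "y : (UN t:D. s ` {t..<t + e t} Un s ` ({t - e t<..<t} Int {0..}))" using t u by blast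
 qed
 moreover have "finite (UN t:D. s ` {t..<t + e t} Un s ` ({t - e t<..<t} Int {0..}))"
  using D const e by (intro finite_UN_I) auto
 ultimately show ?thesis by (rule finite_subset)
qed

lemma well_sampled_limit_cadlag:
 assumes P: "finite P" "ALL p:P. cadlag_path V (s p)" and dt: "!!k. 0 < dt k" "dt ~~> 0"
 shows "well_sampled_limit dt T' s P"
 unfolding well_sampled_limit_def
proof
 obtain d where d: "0 < d" "!!a b. 0 <= a ==> a <= b ==> b <= T' + 1 ==> b - a < d ==>
  EX t. frozen s P ({a..b} Int {..<t}) & frozen s P ({a..b} Int {t..})"
  using cadlag_lebesgue[OF P, where T = "T' + 1"] by blast
 have "\<forall>\<^sub>F k in sequentially. dt k < min d 1" using order_tendstoD(2)[OF dt(2), of "min d 1"] d(1) by simp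
 thus "\<forall>\<^sub>F k in sequentially. well_sampled s P T' (dt k)"
 proof eventually_elim
  case (elim k)
  show ?case unfolding well_sampled_def
  proof (intro conjI allI impI dt)
   fix i :: nat
   define a b where "a = real i * dt k" and "b = real (Suc i) * dt k"
   assume "real i * dt k <= T'"
   hence ab: "0 <= a" "a < b" "b <= T' + 1" "b - a < d"
    using elim dt(1)[of k] by (auto simp: a_def b_def distrib_right)
   from d(2)[OF ab(1) less_imp_le[OF ab(2)] ab(3,4)]
   obtain t where t: "frozen s P ({a..b} Int {..<t})" "frozen s P ({a..b} Int {t..})" by blast
   \<comment> \<open>If the switching time \<open>t\<close> lies outside the cell, the paths are
     constant on all of it and the right end point serves as \<open>u\<close>.\<close>
   define u where "u = (if a < t & t <= b then t else b)"
   have "frozen s P {a..<u}" "frozen s P {u..b}"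
    using ab(2) by (auto simp: u_def intro: frozen_mono[OF t(1)] frozen_mono[OF t(2)])
   moreover have "a < u" "u <= b" using ab by (auto simp: u_def)
   ultimately show "\<exists>u>real i * dt k. u <= real (Suc i) * dt k & frozen s P {real i * dt k..<u} & frozen s P {u..real (Suc i) * dt k}"
    unfolding a_def b_def by blast
  qed
 qed
next
 have sm: "\<forall>\<^sub>F k in sequentially. dt k < e" if "0 < e" for e using order_tendstoD(2)[OF dt(2) that] .
 \<comment> \<open>The times at which some path jumps. After each of them the paths rest for a
   while, so rational numbers separate them and \<open>D\<close> is countable.\<close>
 define D where "D = {t. 0 <= t & (\<forall>e>0. \<not> frozen s P ({t - e<..t} Int {0..}))}"
 have step: "\<forall>\<^sub>F k in sequentially. frozen s P {real (nat \<lfloor>t / dt k\<rfloor>) * dt k..t}" if t: "0 <= t" "t ~: D" for t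
 proof -
  obtain e where e: "0 < e" "frozen s P ({t - e<..t} Int {0..})" using t by (auto simp: D_def)
  show ?thesis using sm[OF e(1)]
  proof eventually_elim
   case (elim k)
   have "t / dt k < real_of_int \<lfloor>t / dt k\<rfloor> + 1" by linarith
   moreover have nn: "0 <= \<lfloor>t / dt k\<rfloor>" using t dt(1)[of k] by simp
   ultimately have "t / dt k < real (nat \<lfloor>t / dt k\<rfloor>) + 1" by simp
   from mult_strict_right_mono[OF this dt(1)[of k]]
   have "t < (real (nat \<lfloor>t / dt k\<rfloor>) + 1) * dt k" using less_imp_neq[OF dt(1)[of k]] by simp
   hence "t - e < real (nat \<lfloor>t / dt k\<rfloor>) * dt k" using elim by (simp add: distrib_right)
   moreover have "0 <= real (nat \<lfloor>t / dt k\<rfloor>) * dt k" using dt(1)[of k] by simp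
   ultimately show ?case by (intro frozen_mono[OF e(2)]) auto
  qed
 qed
 have "countable D"
 proof -
  have "ALL t:D. \<exists>e>0. {t<..<t + e} Int D = {}"
  proof
   fix t assume "t : D"
   hence "0 <= t" by (simp add: D_def)
   from cadlag_punctured[OF P this] obtain e where e: "0 < e" "frozen s P {t..<t + e}" by blast
   have "u ~: D" if "t < u" "u < t + e" for u
   proof -
    have "frozen s P ({u - (u - t)<..u} Int {0..})" by (rule frozen_mono[OF e(2)]) (use that in auto)
    thus ?thesis using that by (auto simp: D_def intro!: exI[of _ "u - t"])
   qed
   thus "\<exists>e>0. {t<..<t + e} Int D = {}" using e(1) by (intro exI[of _ e]) auto
  qed
  then obtain e where e: "!!t. t : D ==> 0 < e t" "!!t. t : D ==> {t<..<t + e t} Int D = {}" by metis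
  have "ALL t:D. \<exists>q::rat. t < real_of_rat q & real_of_rat q < t + e t" using e(1) of_rat_dense by (metis less_add_same_cancel1)
  then obtain q :: "real => rat" where q: "!!t. t : D ==> t < real_of_rat (q t)" "!!t. t : D ==> real_of_rat (q t) < t + e t" by metis
  have "inj_on q D"
  proof (rule inj_onI)
   fix t u assume tu: "t : D" "u : D" "q t = q u"
   have "\<not> t < u" if "t : D" "u : D" "q t = q u" for t u
   proof
    assume "t < u"
    moreover have "u ~: {t<..<t + e t}" using e(2)[OF that(1)] that(2) by blast
    ultimately have "t + e t <= u" by simp
    thus False using q(1)[OF that(2)] q(2)[OF that(1)] that(3) by simp
   qed
   from this[OF tu] this[OF tu(2,1) tu(3)[symmetric]] show "t = u" by simp
  qed
  thus ?thesis by (rule countableI')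
 qed
 hence "AE t in lborel. t ~: D" by (intro AE_not_in) (simp add: countable_imp_null_set_lborel)
 thus "AE t in lborel. 0 <= t --> (\<forall>\<^sub>F k in sequentially. frozen s P {real (nat \<lfloor>t / dt k\<rfloor>) * dt k..t})"
  by eventually_elim (use step in blast)
qed

lemma well_sampled_limit_unit:
 assumes "!!p i t. p : P ==> real i <= t ==> t < real (Suc i) ==> s p t = s p (real i)"
 shows "well_sampled_limit (%_. 1) T' s P"
proof -
 have "frozen s P {real i..<real (Suc i)}" for i unfolding frozen_def using assms by (metis atLeastLessThan_iff)
 moreover have "frozen s P {x..x}" for x by (simp add: frozen_def)
 ultimately have "well_sampled s P T' 1" unfolding well_sampled_def
  by (intro conjI allI impI zero_less_one) (rule_tac x = "real (Suc i)" in exI, simp)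
 moreover have "frozen s P {real (nat \<lfloor>t / 1\<rfloor>) * 1..t}" if "0 <= t" for t
  unfolding frozen_def
 proof (intro ballI)
  fix p u u' assume p: "p : P" and u: "u : {real (nat \<lfloor>t / 1\<rfloor>) * 1..t}" "u' : {real (nat \<lfloor>t / 1\<rfloor>) * 1..t}"
  have "t < real (Suc (nat \<lfloor>t\<rfloor>))" using that by linarith
  hence "real (nat \<lfloor>t\<rfloor>) <= u" "u < real (Suc (nat \<lfloor>t\<rfloor>))" "real (nat \<lfloor>t\<rfloor>) <= u'" "u' < real (Suc (nat \<lfloor>t\<rfloor>))"
   using u by auto
  thus "s p u = s p u'" using assms[OF p, of "nat \<lfloor>t\<rfloor>" u] assms[OF p, of "nat \<lfloor>t\<rfloor>" u'] by simp
 qed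
 ultimately show ?thesis unfolding well_sampled_limit_def by simp
qed

section \<open>Weights and kernels of the two time scales\<close>

lemma cell_weight_eq:
 assumes "0 < dt"
 shows "cell_weight T dt j = max 0 (min T (real (Suc j) * dt) - real j * dt)"
proof -
 have j: "0 <= real j * dt" "real j * dt < real (Suc j) * dt" using assms by auto
 show ?thesis
 proof (cases "real (Suc j) * dt <= T")
  case True
  hence "{real j * dt..<real (Suc j) * dt} Int {0..T} = {real j * dt..<real (Suc j) * dt}" using j by auto
  thus ?thesis using True j by (simp add: cell_weight_def)
 next
  case False
  hence "{real j * dt..<real (Suc j) * dt} Int {0..T} = {real j * dt..T}" using j by auto
  thus ?thesis using False j by (auto simp: cell_weight_def max_def)
 qed
qed

lemma cell_weight_props:
 assumes dt: "0 < dt"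
 shows "0 <= cell_weight T dt j" "cell_weight T dt j <= dt" "i <= j ==> cell_weight T dt j <= cell_weight T dt i"
  "T <= real j * dt ==> cell_weight T dt j = 0" "real (Suc j) * dt <= T ==> cell_weight T dt j = dt"
  "0 <= T ==> (\<Sum>j<N. cell_weight T dt j) <= T"
proof -
 show "0 <= cell_weight T dt j" "cell_weight T dt j <= dt" "T <= real j * dt ==> cell_weight T dt j = 0"
  "real (Suc j) * dt <= T ==> cell_weight T dt j = dt"
  using dt by (auto simp: cell_weight_eq distrib_right max_def min_def)
 show "cell_weight T dt j <= cell_weight T dt i" if "i <= j"
 proof -
  have "max 0 (min T (dt + y) - y) <= max 0 (min T (dt + x) - x)" if "x <= y" for x y :: real
   using that by (auto simp: max_def min_def)
  from this[of "real i * dt" "real j * dt"] show ?thesis using that dt by (simp add: cell_weight_eq distrib_right)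
 qed
 have "(\<Sum>j<N. cell_weight T dt j) = max 0 (min T (real N * dt))" if "0 <= T"
 proof (induction N)
  case (Suc N)
  have "0 <= real N * dt" using dt by simp
  with Suc that dt show ?case by (auto simp: cell_weight_eq distrib_right max_def min_def)
 qed (use that in simp)
 thus "(\<Sum>j<N. cell_weight T dt j) <= T" if "0 <= T" using that by simp
qed

lemma occupation_bounded_weights:
 assumes "0 < dt" "0 < T"
 shows "bounded_weights N (occ_weight H T dt) (cell_weight T dt) (1 / T)"
 by unfold_locales
  (use assms cell_weight_props[OF assms(1)] in \<open>auto simp: occ_weight_def field_simps\<close>)

text \<open>What either time scale has to provide. In any environment, and up to a fraction
  \<open>et\<close> of the occupation with weights \<open>c2\<close>, a token contributes to
  \<open>c\<close> only if the chain \<open>K\<close> hits \<open>H\<close> among its first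
  \<open>Suc J\<close> positions. Conversely such a hit along a path avoiding \<open>Z\<close>
  guarantees a fixed amount \<open>ka\<close> for \<open>c2\<close>, even if every site of
  \<open>Z\<close> is blocked forever.\<close>

definition level_bounds :: "('v => 'v pmf) => 'v set => (nat => 'v => 'v pmf) => (nat => nat)
  => (nat => 'v => nat => real) => (nat => 'v => nat => real) => bool" where
 "level_bounds K H Q N c c2 \<longleftrightarrow> (\<forall>et>0. \<exists>J C ka err. 0 < ka & 0 <= C & err ~~> 0 &
   (ALL k y b. admissible (N k) b --> solo (Q k) (%y j. ennreal (c k y j)) b (N k) 0 y \<le>
    ennreal C * (hits K H {} (Suc J) y + err k) + ennreal et * solo (Q k) (%y j. ennreal (c2 k y j)) b (N k) 0 y) &
   (\<forall>\<^sub>F k in sequentially. ALL Z x. ennreal ka * hits K H Z (Suc J) x \<le>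
    solo (Q k) (%y j. ennreal (c2 k y j)) (static (N k) (%y. if y : Z then \<infinity> else 0)) (N k) 0 x))"

text \<open>Here no step is lazy, so \<open>q = 0\<close>: \<open>Suc N\<close> time steps leave
  nothing after the \<open>Suc N\<close>th step, and the lower bound holds with
  \<open>ka = 1\<close>.\<close>

lemma level_bounds_discrete:
 fixes K :: "'v => 'v pmf"
 assumes N: "T <= real (Suc N)"
 shows "level_bounds K H (%_. K) (%_. Suc N) (%_. occ_weight H T 1) (%_. occ_weight H (real (Suc N)) 1)"
 unfolding level_bounds_def
proof (intro allI impI)
 fix et :: real assume et: "0 < et"
 interpret lazy_kernel K 0 "%f y. \<integral>\<^sup>+y'. f y' \<partial>K y"
  by unfold_locales (auto simp: nn_integral_add nn_integral_cmult intro!: nn_integral_mono)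
 have up: "solo K (%y j. ennreal (occ_weight H T 1 y j)) b (Suc N) 0 y <= ennreal (real (Suc N)) * (hits K H {} (Suc N) y + 0) +
   ennreal et * solo K (%y j. ennreal (occ_weight H (real (Suc N)) 1 y j)) b (Suc N) 0 y" for y b
 proof -
  have "few_steps (%y j. ennreal (occ_weight H T 1 y j)) b (Suc N) (Suc N) 0 y <= of_nat (Suc N) * 1 * (hits K H {} (Suc N) y + of_nat (Suc N) * 0)"
   by (rule few_steps_hits[where p = 1]) (use cell_weight_props(2)[of 1 T] in \<open>auto simp: occ_weight_def ennreal_le_1\<close>)
  moreover have "many_steps (%y j. ennreal (occ_weight H T 1 y j)) b (Suc N) (Suc N) 0 y = 0"
   by (rule many_steps_zero) auto
  ultimately show ?thesis
   unfolding solo_split[of _ b "Suc N" 0 y "Suc N"]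
   by (simp add: ennreal_of_nat_eq_real_of_nat add_increasing2 del: hits.simps few_steps.simps many_steps.simps)
 qed
 have low: "ennreal 1 * hits K H Z (Suc N) x <= solo K (%y j. ennreal (occ_weight H (real (Suc N)) 1 y j))
   (static (Suc N) (%y. if y : Z then \<infinity> else 0)) (Suc N) 0 x" for Z x
 proof -
  have "1 * (\<Sum>i<1. 0 ^ i) * (1 * (\<Sum>i<1. 0 ^ i)) ^ (Suc N - 1) * hits K H Z (Suc N) x \<le>
    solo K (%y j. ennreal (occ_weight H (real (Suc N)) 1 y j)) (%y j. if y : Z then \<infinity> else 0) (Suc N) 0 x"
   by (rule solo_lower[where N = "Suc N"]) (auto simp: occ_weight_def cell_weight_props(5))
  thus ?thesis
   by (subst solo_cong[where b' = "%y j. if y : Z then \<infinity> else 0"]) (auto simp: static_def)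
 qed
 show "\<exists>J C ka err. 0 < ka & 0 <= C & err ~~> 0 &
   (ALL k y b. admissible (Suc N) b --> solo K (%y j. ennreal (occ_weight H T 1 y j)) b (Suc N) 0 y \<le>
    ennreal C * (hits K H {} (Suc J) y + err k) + ennreal et * solo K (%y j. ennreal (occ_weight H (real (Suc N)) 1 y j)) b (Suc N) 0 y) &
   (\<forall>\<^sub>F k in sequentially. ALL Z x. ennreal ka * hits K H Z (Suc J) x \<le>
    solo K (%y j. ennreal (occ_weight H (real (Suc N)) 1 y j)) (static (Suc N) (%y. if y : Z then \<infinity> else 0)) (Suc N) 0 x)"
  by (rule exI[of _ N], rule exI[of _ "real (Suc N)"], rule exI[of _ 1], rule exI[of _ "%_. 0"])
   (use up low in \<open>auto simp del: hits.simps solo.simps\<close>)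
qed

text \<open>During \<open>dt\<close> there is no jump with probability \<open>exp (- dt)\<close> and
  exactly one with probability \<open>dt * exp (- dt)\<close>; the remaining probability is at most
  the square of \<open>dt\<close>, which stays negligible after summation over the order of
  \<open>1 / dt\<close> cells.\<close>

lemma lazy_poisson:
 fixes K :: "'v => 'v pmf"
 assumes "0 < dt"
 defines "B \<equiv> %f y. \<integral>\<^sup>+m. (if m = 0 then 0 else \<integral>\<^sup>+y'. f y' \<partial>kernel_power K m y) \<partial>poisson_pmf dt"
 shows "lazy_kernel (poisson_kernel K dt) (ennreal (exp (- dt))) B"
  and "ennreal (dt * exp (- dt)) * (\<integral>\<^sup>+y'. f y' \<partial>K y) <= B f y"
  and "(!!x. f x <= 1) ==> B f y <= ennreal (dt * exp (- dt)) * (\<integral>\<^sup>+y'. f y' \<partial>K y) + ennreal (dt\<^sup>2)"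
proof -
 have K1: "kernel_power K (Suc 0) y = K y" for y
 proof -
  have "kernel_power K 0 = return_pmf" by (rule ext) simp
  thus ?thesis by (simp add: bind_return_pmf' del: kernel_power.simps(1))
 qed
 show "lazy_kernel (poisson_kernel K dt) (ennreal (exp (- dt))) B"
 proof
  fix f :: "'v => ennreal" and y
  have "(\<integral>\<^sup>+y'. f y' \<partial>poisson_kernel K dt y) = (\<integral>\<^sup>+m. (\<integral>\<^sup>+y'. f y' \<partial>kernel_power K m y) \<partial>poisson_pmf dt)"
   unfolding poisson_kernel_def by simp
  also have "... = (\<integral>\<^sup>+m. f y * indicator {0} m + (if m = 0 then 0 else \<integral>\<^sup>+y'. f y' \<partial>kernel_power K m y) \<partial>poisson_pmf dt)"
   by (intro nn_integral_cong) (simp add: indicator_def)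
  also have "... = ennreal (exp (- dt)) * f y + B f y"
   using assms by (simp add: nn_integral_add nn_integral_cmult_indicator emeasure_pmf_single B_def mult.commute)
  finally show "(\<integral>\<^sup>+y'. f y' \<partial>poisson_kernel K dt y) = ennreal (exp (- dt)) * f y + B f y" .
 next
  fix f g :: "'v => ennreal" and y
  show "B (%x. f x + g x) y = B f y + B g y"
  proof -
   have "(%m. if m = 0 then 0 else \<integral>\<^sup>+y'. f y' + g y' \<partial>kernel_power K m y) =
     (%m. (if m = 0 then 0 else \<integral>\<^sup>+y'. f y' \<partial>kernel_power K m y) + (if m = 0 then 0 else \<integral>\<^sup>+y'. g y' \<partial>kernel_power K m y))"
    by (simp add: fun_eq_iff nn_integral_add)
   thus ?thesis unfolding B_def by (simp only:) (rule nn_integral_add, simp_all)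
  qed
 next
  fix a and f :: "'v => ennreal" and y
  show "B (%x. a * f x) y = a * B f y"
  proof -
   have "(%m. if m = 0 then 0 else \<integral>\<^sup>+y'. a * f y' \<partial>kernel_power K m y) =
     (%m. a * (if m = 0 then 0 else \<integral>\<^sup>+y'. f y' \<partial>kernel_power K m y))"
    by (simp add: fun_eq_iff nn_integral_cmult)
   thus ?thesis unfolding B_def by (simp only:) (rule nn_integral_cmult, simp_all)
  qed
 next
  fix f g :: "'v => ennreal" and y assume "!!x. f x <= g x"
  thus "B f y <= B g y" unfolding B_def by (auto intro!: nn_integral_mono)
 qed
 have one: "(\<integral>\<^sup>+m. (\<integral>\<^sup>+y'. f y' \<partial>K y) * indicator {Suc 0} m \<partial>poisson_pmf dt) = ennreal (dt * exp (- dt)) * (\<integral>\<^sup>+y'. f y' \<partial>K y)" for f :: "'v => ennreal" and y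
  using assms by (simp add: nn_integral_cmult_indicator emeasure_pmf_single mult.commute)
 show "ennreal (dt * exp (- dt)) * (\<integral>\<^sup>+y'. f y' \<partial>K y) <= B f y"
  unfolding one[symmetric] B_def by (intro nn_integral_mono) (auto simp: indicator_def K1 simp del: kernel_power.simps)
 assume f: "!!x. f x <= 1"
 have "B f y <= (\<integral>\<^sup>+m. (\<integral>\<^sup>+y'. f y' \<partial>K y) * indicator {Suc 0} m + indicator {2..} m \<partial>poisson_pmf dt)"
  unfolding B_def
 proof (intro nn_integral_mono)
  fix m
  have "(\<integral>\<^sup>+y'. f y' \<partial>kernel_power K m y) <= (\<integral>\<^sup>+y'. 1 \<partial>kernel_power K m y)" by (intro nn_integral_mono f)
  thus "(if m = 0 then 0 else \<integral>\<^sup>+y'. f y' \<partial>kernel_power K m y) <= (\<integral>\<^sup>+y'. f y' \<partial>K y) * indicator {Suc 0} m + indicator {2..} m"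
   by (cases "m = 0 \<or> m = Suc 0") (auto simp: indicator_def K1 simp del: kernel_power.simps)
 qed
 also have "... = ennreal (dt * exp (- dt)) * (\<integral>\<^sup>+y'. f y' \<partial>K y) + ennreal (measure_pmf.prob (poisson_pmf dt) {2..})"
  by (simp add: nn_integral_add one measure_pmf.emeasure_eq_measure)
 also have "measure_pmf.prob (poisson_pmf dt) {2..} <= dt\<^sup>2"
 proof -
  have "{2..} = UNIV - {0, Suc 0}" by auto
  hence "measure_pmf.prob (poisson_pmf dt) {2..} = 1 - measure_pmf.prob (poisson_pmf dt) {0, Suc 0}"
   using measure_pmf.prob_compl[of "{0, Suc 0}" "poisson_pmf dt"] by simp
  also have "measure_pmf.prob (poisson_pmf dt) {0, Suc 0} = exp (- dt) + dt * exp (- dt)"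
   using assms by (subst measure_measure_pmf_finite) auto
  also have "1 - (exp (- dt) + dt * exp (- dt)) <= 1 - (1 + dt) * (1 - dt)"
   using exp_ge_add_one_self[of "- dt"] mult_left_mono[of "1 - dt" "exp (- dt)" "1 + dt"] assms by (simp add: algebra_simps)
  also have "... = dt\<^sup>2" by (simp add: power2_eq_square algebra_simps)
  finally show ?thesis .
 qed
 finally show "B f y <= ennreal (dt * exp (- dt)) * (\<integral>\<^sup>+y'. f y' \<partial>K y) + ennreal (dt\<^sup>2)"
  by (simp add: add_left_mono ennreal_leI)
qed

text \<open>The part after \<open>Suc J\<close> jumps up to time \<open>m\<close> is compared with
  time \<open>2 * m\<close> by \<open>many_steps_scaling\<close>. The loss there is
  \<open>exp (- 2 * real m)\<close> on every grid, so a single \<open>J\<close> with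
  \<open>2 ^ Suc J\<close> large enough serves all \<open>k\<close>. The extra \<open>2\<close> in
  the horizon keeps the doubled cells inside it and makes it positive for
  \<open>m = 0\<close>.\<close>

lemma level_bounds_continuous:
 fixes K :: "'v => 'v pmf" and m :: nat
 assumes m: "T <= real m"
 defines "dt \<equiv> %k::nat. (1 / 2) ^ k :: real" and "N \<equiv> %k::nat. (2 * m + 2) * 2 ^ k"
 shows "level_bounds K H (%k. poisson_kernel K (dt k)) N (%k. occ_weight H T (dt k)) (%k. occ_weight H (real (2 * m + 2)) (dt k))"
 unfolding level_bounds_def
proof (intro allI impI)
 fix et :: real assume et: "0 < et"
 let ?c = "%k y j. ennreal (occ_weight H T (dt k) y j)"
 let ?c2 = "%k y j. ennreal (occ_weight H (real (2 * m + 2)) (dt k) y j)"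
 have dt: "0 < dt k" "dt k <= 1" "dt k * 2 ^ k = 1" for k
  by (auto simp: dt_def power_le_one power_mult_distrib[symmetric])
 have dt0: "dt ~~> 0" unfolding dt_def by (rule LIMSEQ_power_zero) simp
 obtain J where J: "exp (2 * real m) / et <= 2 ^ Suc J"
 proof -
  obtain J where "exp (2 * real m) / et < 2 ^ J" using real_arch_pow[of 2 "exp (2 * real m) / et"] by auto
  also have "(2::real) ^ J <= 2 ^ Suc J" by simp
  finally show ?thesis using that[of J] by simp
 qed
 have up: "solo (poisson_kernel K (dt k)) (?c k) b (N k) 0 y <= ennreal (real m) * (hits K H {} (Suc J) y + ennreal (real m * dt k)) +
   ennreal et * solo (poisson_kernel K (dt k)) (?c2 k) b (N k) 0 y" if b: "admissible (N k) b" for k b y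
 proof -
  let ?q = "ennreal (exp (- dt k))" and ?n = "m * 2 ^ k"
  interpret lazy_kernel "poisson_kernel K (dt k)" ?q
    "%f y. \<integral>\<^sup>+m. (if m = 0 then 0 else \<integral>\<^sup>+y'. f y' \<partial>kernel_power K m y) \<partial>poisson_pmf (dt k)"
   by (rule lazy_poisson[OF dt(1)])
  have nd: "real ?n * dt k = real m" using dt(3)[of k] by (simp add: ac_simps)
  have split: "N k = ?n + (N k - ?n)" by (simp add: N_def)
  have "solo (poisson_kernel K (dt k)) (?c k) b (N k) 0 y = solo (poisson_kernel K (dt k)) (?c k) b ?n 0 y"
  proof (subst split, rule solo_horizon)
   fix y j assume "0 + ?n <= j"
   hence "real ?n <= real j" by (simp only: of_nat_le_iff add_0)
   hence "real ?n * dt k <= real j * dt k" using dt(1)[of k] by (intro mult_right_mono) auto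
   hence "T <= real j * dt k" using m unfolding nd by linarith
   thus "?c k y j = 0" by (simp add: occ_weight_def cell_weight_props(4)[OF dt(1)])
  qed
  also have "... = few_steps (?c k) b ?n (Suc J) 0 y + many_steps (?c k) b ?n (Suc J) 0 y" by (rule solo_split)
  also have "few_steps (?c k) b ?n (Suc J) 0 y <= of_nat ?n * ennreal (dt k) * (hits K H {} (Suc J) y + of_nat ?n * ennreal ((dt k)\<^sup>2))"
  proof (rule few_steps_hits[where p = "ennreal (dt k * exp (- dt k))"])
   show "?q + ennreal (dt k * exp (- dt k)) <= 1"
   proof -
    have "exp (- dt k) + dt k * exp (- dt k) = (1 + dt k) / exp (dt k)" by (simp add: exp_minus field_simps)
    also have "... <= 1" using exp_ge_add_one_self[of "dt k"] by simp
    finally show ?thesis using dt(1)[of k] by (simp add: ennreal_plus[symmetric] ennreal_le_1 del: ennreal_plus)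
   qed
   show "?c k y j <= (if y : H then ennreal (dt k) else 0)" for y j
    using cell_weight_props(2)[OF dt(1)] by (simp add: occ_weight_def ennreal_leI)
  qed (rule lazy_poisson(3)[OF dt(1)])
  also have "of_nat ?n * ennreal (dt k) = ennreal (real m)"
   unfolding ennreal_of_nat_eq_real_of_nat nd[symmetric] by (rule ennreal_mult[symmetric]) (use dt(1)[of k] in simp_all)
  also have "of_nat ?n * ennreal ((dt k)\<^sup>2) = ennreal (real m * dt k)"
   using nd dt(1)[of k] by (simp add: ennreal_of_nat_eq_real_of_nat ennreal_mult'[symmetric] power2_eq_square mult.assoc[symmetric])
  also have "many_steps (?c k) b ?n (Suc J) 0 y <= ennreal et * solo (poisson_kernel K (dt k)) (?c2 k) b (N k) 0 y"
  proof -
   have "2 ^ Suc J * ?q ^ (2 * ?n) * many_steps (?c k) b ?n (Suc J) 0 y <= solo (poisson_kernel K (dt k)) (?c2 k) b (N k) (2 * 0) y"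
   proof (rule many_steps_scaling)
    show "antimono (b y)" for y using b by (simp add: admissible_def)
    show "2 * ?n <= N k" by (simp add: N_def)
    fix y j
    show "?c k y j <= ?c2 k y (2 * j)"
    proof (cases "real j * dt k < real m")
     case True
     have "real (Suc (2 * j)) * dt k = 2 * (real j * dt k) + dt k" by (simp add: algebra_simps)
     hence "real (Suc (2 * j)) * dt k <= real (2 * m + 2)" using True dt(2)[of k] by simp
     thus ?thesis using cell_weight_props(2,5)[OF dt(1)] by (simp add: occ_weight_def ennreal_leI)
    next
     case False
     thus ?thesis using cell_weight_props(4)[OF dt(1)[of k], of T j] m by (simp add: occ_weight_def)
    qed
   qed
   moreover have "?q ^ (2 * ?n) = ennreal (exp (- 2 * real m))"
    using nd by (simp add: ennreal_power exp_of_nat_mult[symmetric] algebra_simps)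
   moreover have "(2 :: ennreal) ^ Suc J = ennreal (2 ^ Suc J)" by (simp add: ennreal_power[symmetric] ennreal_numeral del: power_Suc)
   ultimately have le: "ennreal (2 ^ Suc J * exp (- 2 * real m)) * many_steps (?c k) b ?n (Suc J) 0 y <= solo (poisson_kernel K (dt k)) (?c2 k) b (N k) 0 y"
    by (simp add: ennreal_mult del: power_Suc many_steps.simps)
   have "1 <= et * (2 ^ Suc J * exp (- 2 * real m))"
   proof -
    have "exp (2 * real m) <= et * 2 ^ Suc J" using J et by (simp add: field_simps del: power_Suc)
    hence "exp (2 * real m) * exp (- 2 * real m) <= et * 2 ^ Suc J * exp (- 2 * real m)" by (intro mult_right_mono) auto
    thus ?thesis by (simp add: exp_add[symmetric] mult.assoc del: power_Suc)
   qed
   hence "1 <= ennreal (et * (2 ^ Suc J * exp (- 2 * real m)))" by (simp only: ennreal_ge_1)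
   hence "many_steps (?c k) b ?n (Suc J) 0 y <= ennreal (et * (2 ^ Suc J * exp (- 2 * real m))) * many_steps (?c k) b ?n (Suc J) 0 y"
    using mult_right_mono[of 1 _ "many_steps (?c k) b ?n (Suc J) 0 y"] by simp
   also have "... = ennreal et * (ennreal (2 ^ Suc J * exp (- 2 * real m)) * many_steps (?c k) b ?n (Suc J) 0 y)"
    using et by (simp add: ennreal_mult mult.assoc del: power_Suc many_steps.simps)
   also have "... <= ennreal et * solo (poisson_kernel K (dt k)) (?c2 k) b (N k) 0 y" by (intro mult_left_mono le) simp
   finally show ?thesis .
  qed
  finally show ?thesis by (simp add: add_mono)
 qed
 \<comment> \<open>Each of \<open>Suc J\<close> positions is allotted \<open>2 ^ k div Suc J\<close>
   cells, which for fine grids is a time of at least \<open>1 / (2 * real (Suc J))\<close>;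
   \<open>a\<close> is the probability of a jump within that time. In \<open>ka\<close> one factor
   \<open>a\<close> stands for the time spent in \<open>H\<close> and \<open>J\<close> factors for
   stays ended by a single jump, with \<open>exp (-1)\<close> as a lower bound for
   \<open>exp (- dt k)\<close>.\<close>
 define a where "a = 1 - exp (- (1 / (2 * real (Suc J))))"
 have a: "0 < a" by (simp add: a_def)
 define ka where "ka = a * (exp (-1) * a) ^ J"
 have ka: "0 < ka" using a by (simp add: ka_def)
 have low: "\<forall>\<^sub>F k in sequentially. ALL Z x. ennreal ka * hits K H Z (Suc J) x \<le>
   solo (poisson_kernel K (dt k)) (?c2 k) (static (N k) (%y. if y : Z then \<infinity> else 0)) (N k) 0 x"
 proof -
  have ev: "\<forall>\<^sub>F k in sequentially. dt k < 1 / (2 * real (Suc J))" by (rule order_tendstoD(2)[OF dt0]) simp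
  show ?thesis using ev
 proof (rule eventually_mono, intro allI)
  fix k Z x assume dk: "dt k < 1 / (2 * real (Suc J))"
  let ?q = "exp (- dt k)"
  define l where "l = 2 ^ k div Suc J"
  define S where "S = (\<Sum>i<l. ?q ^ i)"
  have S0: "0 <= S" by (simp add: S_def sum_nonneg)
  have Sq: "S * (1 - ?q) = 1 - ?q ^ l"
   using geometric_sum[of ?q l] dt(1)[of k] by (simp add: S_def field_simps)
  have ld: "1 / (2 * real (Suc J)) <= real l * dt k"
  proof -
   have "(2::nat) ^ k < Suc J * Suc l" unfolding l_def by (metis dividend_less_times_div zero_less_Suc mult_Suc_right add.commute)
   hence "real (2 ^ k) <= real (Suc J * Suc l)" by (simp only: of_nat_le_iff less_imp_le)
   hence "2 ^ k <= real (Suc J) * real (Suc l)" by (simp only: of_nat_mult of_nat_power of_nat_numeral)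
   hence "dt k * 2 ^ k <= dt k * (real (Suc J) * real (Suc l))" using dt(1)[of k] by (intro mult_left_mono) auto
   hence "1 <= real (Suc J) * (real l * dt k + dt k)" by (simp add: dt(3) algebra_simps)
   hence "1 / real (Suc J) <= real l * dt k + dt k" by (simp add: field_simps del: of_nat_Suc)
   moreover have "1 / real (Suc J) = 1 / (2 * real (Suc J)) + 1 / (2 * real (Suc J))" by (simp add: field_simps)
   moreover have "h <= L" if "X <= L + d" "X = h + h" "d < h" for h L d X :: real using that by linarith
   ultimately show ?thesis using dk by blast
  qed
  have "?q ^ l = exp (- (real l * dt k))" by (simp add: exp_of_nat_mult[symmetric])
  also have "... <= exp (- (1 / (2 * real (Suc J))))" using ld by simp
  finally have qa: "a <= 1 - ?q ^ l" by (simp add: a_def)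
  have q1: "1 - ?q <= dt k" using exp_ge_add_one_self[of "- dt k"] by simp
  have dS: "a <= dt k * S" using qa Sq mult_left_mono[OF q1 S0] by (simp add: mult.commute)
  have pS: "exp (-1) * a <= dt k * ?q * S"
  proof -
   have "exp (-1) * a <= ?q * (dt k * S)" using dt(2)[of k] a dS by (intro mult_mono) auto
   thus ?thesis by (simp add: ac_simps)
  qed
  have pS1: "dt k * ?q * S <= 1"
  proof -
   have "dt k * ?q <= 1 - ?q"
    using exp_ge_add_one_self[of "dt k"] mult_right_mono[of "1 + dt k" "exp (dt k)" ?q] by (simp add: exp_add[symmetric] algebra_simps)
   hence "dt k * ?q * S <= (1 - ?q) * S" using S0 by (rule mult_right_mono)
   also have "... = 1 - ?q ^ l" using Sq by (simp add: mult.commute)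
   also have "... <= 1" by simp
   finally show ?thesis .
  qed
  have es: "(\<Sum>i<l. ennreal ?q ^ i) = ennreal S"
  proof -
   have "(\<Sum>i<l. ennreal ?q ^ i) = (\<Sum>i<l. ennreal (?q ^ i))" by (intro sum.cong refl) (simp add: ennreal_power)
   also have "... = ennreal S" unfolding S_def by (rule sum_ennreal) simp
   finally show ?thesis .
  qed
  have "ennreal (dt k) * (\<Sum>i<l. ennreal ?q ^ i) * (ennreal (dt k * ?q) * (\<Sum>i<l. ennreal ?q ^ i)) ^ (Suc J - 1) * hits K H Z (Suc J) x \<le>
    solo (poisson_kernel K (dt k)) (?c2 k) (%y j. if y : Z then \<infinity> else 0) (N k) 0 x"
  proof (rule solo_lower[where N = "N k"])
   show "ennreal ?q * f y + ennreal (dt k * ?q) * (\<integral>\<^sup>+y'. f y' \<partial>K y) <= (\<integral>\<^sup>+y'. f y' \<partial>poisson_kernel K (dt k) y)" for f y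
    using lazy_poisson(2)[OF dt(1)[of k], where K = K and y = y and f = f]
     lazy_kernel.decomp[OF lazy_poisson(1)[OF dt(1)[of k]], where f = f and y = y] by (simp add: add_left_mono)
   show "ennreal (dt k) <= ?c2 k y j" if "y : H" "j < N k" for y j
   proof -
    have "real (Suc j) * dt k <= real (N k) * dt k" using that dt(1)[of k] by (intro mult_right_mono) auto
    also have "... = real (2 * m + 2) * (2 ^ k * dt k)" unfolding N_def by (simp only: of_nat_mult of_nat_power of_nat_numeral mult.assoc)
    also have "... = real (2 * m + 2)" by (simp add: dt(3) mult.commute[of "2 ^ k"])
    finally show ?thesis using that cell_weight_props(5)[OF dt(1)] by (simp add: occ_weight_def)
   qed
   show "ennreal (dt k * ?q) * (\<Sum>i<l. ennreal ?q ^ i) <= 1"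
    using pS1 dt(1)[of k] S0 by (simp add: es ennreal_mult[symmetric] ennreal_le_1)
   have "Suc J * l <= 2 ^ k" unfolding l_def by (rule times_div_less_eq_dividend)
   also have "... <= N k" by (simp add: N_def)
   finally show "Suc J * l <= N k" .
  qed auto
  also have "... = solo (poisson_kernel K (dt k)) (?c2 k) (static (N k) (%y. if y : Z then \<infinity> else 0)) (N k) 0 x"
   by (rule solo_cong) (auto simp: static_def)
  finally have fin: "ennreal (dt k * S * (dt k * ?q * S) ^ J) * hits K H Z (Suc J) x <= solo (poisson_kernel K (dt k)) (?c2 k) (static (N k) (%y. if y : Z then \<infinity> else 0)) (N k) 0 x"
   using dt(1)[of k] S0 by (simp add: es ennreal_mult ennreal_power[symmetric] del: hits.simps)
  have "ka <= dt k * S * (dt k * ?q * S) ^ J"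
   unfolding ka_def by (rule mult_mono[OF dS power_mono[OF pS]]) (use a S0 dt(1)[of k] in \<open>auto intro!: mult_nonneg_nonneg zero_le_power less_imp_le\<close>)
  hence "ennreal ka * hits K H Z (Suc J) x <= ennreal (dt k * S * (dt k * ?q * S) ^ J) * hits K H Z (Suc J) x"
   by (intro mult_right_mono ennreal_leI) auto
  thus "ennreal ka * hits K H Z (Suc J) x <= solo (poisson_kernel K (dt k)) (?c2 k) (static (N k) (%y. if y : Z then \<infinity> else 0)) (N k) 0 x"
   using fin by (rule order_trans)
 qed
 qed
 have err: "(%k. ennreal (real m * dt k)) ~~> 0"
  using tendsto_ennrealI[OF tendsto_mult_right_zero[OF dt0, of "real m"]] by simp
 show "\<exists>J C ka err. 0 < ka & 0 <= C & err ~~> 0 &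
   (ALL k y b. admissible (N k) b --> solo (poisson_kernel K (dt k)) (?c k) b (N k) 0 y \<le>
    ennreal C * (hits K H {} (Suc J) y + err k) + ennreal et * solo (poisson_kernel K (dt k)) (?c2 k) b (N k) 0 y) &
   (\<forall>\<^sub>F k in sequentially. ALL Z x. ennreal ka * hits K H Z (Suc J) x \<le>
    solo (poisson_kernel K (dt k)) (?c2 k) (static (N k) (%y. if y : Z then \<infinity> else 0)) (N k) 0 x)"
  by (rule exI[of _ J], rule exI[of _ "real m"], rule exI[of _ ka], rule exI[of _ "%k. ennreal (real m * dt k)"])
   (intro conjI ka err allI impI up low of_nat_0_le_iff)
qed

subsection \<open>Killing at the boundary\<close>

lemma image_mset_sum_replicate:
 "finite F ==> image_mset (%x. (x, 0::nat)) (SUM y:F. replicate_mset (m y) y) = (SUM y:F. replicate_mset (m y) (y, 0))"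
 by (induction F rule: finite_induct) simp_all

lemma sum_mset_sum_replicate:
 fixes e :: "'b => ennreal"
 shows "finite F ==> (\<Sum>x\<in>#(SUM y:F. replicate_mset (m y) (f y)). e x) = (SUM y:F. of_nat (m y) * e (f y))"
 by (induction F rule: finite_induct) simp_all

lemma A_start_split:
 assumes "finite R" "F <= R"
 shows "A_start R ze = A_start F ze + (SUM y:R - F. replicate_mset (nat (ze y)) (y, 0))"
 unfolding A_start_def by (subst sum.subset_diff[OF assms(2,1)]) (simp add: add.commute)

lemma min_1_add: "min 1 (a + b) <= min 1 a + min 1 b" for a b :: ennreal
proof (cases "a <= 1 & b <= 1")
 case True
 thus ?thesis by (simp add: min_absorb2)
next
 case False
 hence "1 <= min 1 a + min 1 b"
  by (metis add_increasing add_increasing2 min.absorb1 nle_le order_refl zero_le)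
 thus ?thesis by (rule order_trans[rotated]) simp
qed

lemma min_1_sum: "finite F ==> min 1 (SUM x:F. f x) <= (SUM x:F. min 1 (f x))" for f :: "'a => ennreal"
proof (induction F rule: finite_induct)
 case (insert x F)
 have "min 1 (f x + sum f F) <= min 1 (f x) + min 1 (sum f F)" by (rule min_1_add)
 also have "... <= min 1 (f x) + (SUM x:F. min 1 (f x))" by (rule add_left_mono[OF insert.IH])
 finally show ?case using insert by simp
qed simp

lemma min_1_cmult: "min 1 (C * x) <= (C + 1) * min 1 x" for C x :: ennreal
proof (cases "x <= 1")
 case True
 hence "C * x <= (C + 1) * min 1 x" by (simp add: min_absorb2 distrib_right)
 thus ?thesis by (rule order_trans[rotated]) simp
next
 case False
 thus ?thesis by (simp add: min_absorb1 add_increasing min.coboundedI1)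
qed

lemma countable_exhaustion:
 assumes "countable V" "finite F" "F <= V"
 obtains Rs :: "nat => 'a set" where "!!m. finite (Rs m)" "!!m. Rs m <= V" "!!m. Rs m <= Rs (Suc m)" "(\<Union>m. Rs m) = V"
  "!!m. F <= Rs m" "!!A. finite A ==> A <= V ==> EX m. A <= Rs m"
proof (rule that[of "%m. F Un (to_nat_on V -` {..m} Int V)"])
 fix A assume A: "finite A" "A <= V"
 have "to_nat_on V a <= Max (insert 0 (to_nat_on V ` A))" if "a : A" for a using A that by (intro Max_ge) auto
 thus "EX m. A <= F Un (to_nat_on V -` {..m} Int V)" using A by (intro exI[of _ "Max (insert 0 (to_nat_on V ` A))"]) auto
qed (use assms in \<open>auto intro!: finite_vimage_IntI inj_on_to_nat_on\<close>)

lemma countable_finite_exhaustion: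
 assumes "countable V"
 shows "\<exists>Rs :: nat => 'a set. (ALL m. finite (Rs m)) & (ALL m. Rs m <= V) & (ALL m. Rs m <= Rs (Suc m)) & (\<Union>m. Rs m) = V &
  (ALL A. finite A --> A <= V --> (EX m. A <= Rs m))"
proof (rule countable_exhaustion[OF assms finite.emptyI empty_subsetI])
 fix Rs :: "nat => 'a set"
 assume Rs: "!!m. finite (Rs m)" "!!m. Rs m <= V" "!!m. Rs m <= Rs (Suc m)" "(\<Union>m. Rs m) = V"
  "!!A. finite A ==> A <= V ==> EX m. A <= Rs m"
 show ?thesis by (intro exI[of _ Rs] conjI allI impI Rs)
qed

abbreviation kill_expect where
 "kill_expect Q N c g R ze \<equiv> expect Q N c g (static N (B_kill R ze)) 0 (A_start R ze)"

text \<open>The tokens from \<open>R - F\<close> are first removed at the cost given by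
  \<open>tail_effect\<close>. With only the tokens of \<open>F\<close> left, killing outside
  \<open>R\<close> matters only if one of them leaves \<open>R\<close>. Putting the tokens from
  \<open>R - F\<close> back into the killed system can only increase the value.\<close>

lemma truncation_bound:
 fixes g ps :: "real => ennreal" and c c' :: "'v => nat => real"
 assumes bw: "bounded_weights N c w r" and c': "!!y j. 0 <= c' y j" "!!y i j. i <= j ==> c' y j <= c' y i" and et: "0 <= et"
  and hyp: "!!y b. admissible N b ==> solo Q (%y j. ennreal (c' y j)) b N 0 y \<le>
   ennreal C * (f y + e) + ennreal et * solo Q (%y j. ennreal (c y j)) b N 0 y"
  and g: "!!v d. 0 <= d ==> g (v + d) <= g v + ennreal (min 1 d)" "!!v. g v <= 1" "mono g"
  and ps: "!!u. A <= u ==> 1 <= ps u" and R: "finite R" "F <= R"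
 shows "start_expect Q N c' g R ze <= kill_expect Q N c' g R ze
  + (SUM x:F. min 1 (of_nat (nat (ze x)) * hits Q (- R) {} (Suc N) x))
  + ennreal (exp (r * A)) * ((ennreal C + 1) * (SUM y:R - F. min 1 (of_nat (nat (ze y)) * f y))
    + min 1 (ennreal C * (SUM y:R. of_nat (nat (ze y))) * e) + ennreal (2 * et / r))
  + start_expect Q N c ps R ze"
proof -
 let ?b = "static N (B_start R ze)" and ?b' = "static N (B_kill R ze)" and ?M = "SUM y:R - F. replicate_mset (nat (ze y)) y"
 let ?m = "%y. of_nat (nat (ze y)) :: ennreal" and ?E = "A_start F ze"
 let ?S = "SUM y:F. ?m y * hits Q (- R) {} (Suc N) y"
 have fin: "finite F" "finite (R - F)" using R by (auto intro: finite_subset)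
 have A: "A_start R ze = ?E + image_mset (%x. (x, 0)) ?M"
  using A_start_split[OF R] image_mset_sum_replicate[OF fin(2), of "%y. nat (ze y)"] by simp
 have t1: "start_expect Q N c' g R ze <= expect Q N c' g ?b 0 ?E
   + ennreal (exp (r * A)) * (min 1 (\<Sum>x\<in>#?M. ennreal C * (f x + e)) + ennreal (2 * et / r)) + start_expect Q N c ps R ze"
  unfolding A by (rule bounded_weights.tail_effect[OF bw admissible_static c'(1) et _ g(1) ps]) (rule hyp)
 have "(\<Sum>x\<in>#?M. ennreal C * (f x + e)) = (SUM y:R - F. ?m y * (ennreal C * (f y + e)))"
  by (rule sum_mset_sum_replicate[OF fin(2), where f = "%y. y"])
 also have "... = ennreal C * (SUM y:R - F. ?m y * f y) + ennreal C * (SUM y:R - F. ?m y) * e"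
  by (simp only: sum_distrib_left sum_distrib_right sum.distrib[symmetric]) (simp add: algebra_simps)
 finally have "min 1 (\<Sum>x\<in>#?M. ennreal C * (f x + e)) \<le>
   min 1 (ennreal C * (SUM y:R - F. ?m y * f y)) + min 1 (ennreal C * (SUM y:R - F. ?m y) * e)"
  by (simp only: min_1_add)
 also have "... <= (ennreal C + 1) * (SUM y:R - F. min 1 (?m y * f y)) + min 1 (ennreal C * (SUM y:R. ?m y) * e)"
 proof (rule add_mono)
  have "min 1 (ennreal C * (SUM y:R - F. ?m y * f y)) <= (ennreal C + 1) * min 1 (SUM y:R - F. ?m y * f y)" by (rule min_1_cmult)
  also have "... <= (ennreal C + 1) * (SUM y:R - F. min 1 (?m y * f y))" by (rule mult_left_mono[OF min_1_sum[OF fin(2)]]) simp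
  finally show "min 1 (ennreal C * (SUM y:R - F. ?m y * f y)) <= (ennreal C + 1) * (SUM y:R - F. min 1 (?m y * f y))" .
  have "(SUM y:R - F. ?m y) <= (SUM y:R. ?m y)" using R by (intro sum_mono2) auto
  thus "min 1 (ennreal C * (SUM y:R - F. ?m y) * e) <= min 1 (ennreal C * (SUM y:R. ?m y) * e)"
   by (intro min.mono order_refl mult_right_mono mult_left_mono) simp_all
 qed
 finally have t2: "min 1 (\<Sum>x\<in>#?M. ennreal C * (f x + e)) \<le>
  (ennreal C + 1) * (SUM y:R - F. min 1 (?m y * f y)) + min 1 (ennreal C * (SUM y:R. ?m y) * e)" .
 have S: "(\<Sum>x\<in>#?E. hits Q (- R) {} (Suc (N - snd x)) (fst x)) = ?S"
  unfolding A_start_def using sum_mset_sum_replicate[OF fin(1), of "%x. hits Q (- R) {} (Suc (N - snd x)) (fst x)" "%y. nat (ze y)" "%y. (y, 0)"]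
  by (simp only: fst_conv snd_conv diff_zero)
 have bb: "?b y = ?b' y" if "y : R" for y using that by (intro ext) (simp add: static_def B_start_def B_kill_def)
 have "expect Q N c' g ?b 0 ?E <= expect Q N c' g ?b' 0 ?E + ?S"
  using expect_exit[where g = g and N = N and b = ?b and b' = ?b' and R = R and Q = Q and c = c' and v = 0 and M = ?E,
   OF g(2) admissible_static admissible_static bb] by (simp only: S)
 moreover have "expect Q N c' g ?b 0 ?E <= expect Q N c' g ?b' 0 ?E + 1"
  by (rule order_trans[OF expect_le_1[OF g(2)]]) simp
 ultimately have "expect Q N c' g ?b 0 ?E <= expect Q N c' g ?b' 0 ?E + min 1 ?S" by (simp only: min_def split: if_split) blast
 also have "... <= kill_expect Q N c' g R ze + (SUM x:F. min 1 (?m x * hits Q (- R) {} (Suc N) x))"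
 proof (rule add_mono[OF _ min_1_sum[OF fin(1)]])
  show "expect Q N c' g ?b' 0 ?E <= kill_expect Q N c' g R ze"
   unfolding A by (rule expect_mono[OF c' g(3)]) (simp_all add: multiset.rel_refl no_later_def)
 qed
 finally have t3: "expect Q N c' g ?b 0 ?E <= kill_expect Q N c' g R ze + (SUM x:F. min 1 (?m x * hits Q (- R) {} (Suc N) x))" .
 show ?thesis
  by (rule order_trans[OF t1], rule add_mono[OF add_mono[OF t3 mult_left_mono[OF add_right_mono[OF t2]]] order_refl]) simp
qed

lemma Pi_pmf_marginal:
 assumes "finite R" "x : R"
 shows "(\<integral>\<^sup>+ze. f (ze x) \<partial>Pi_pmf R d p) = (\<integral>\<^sup>+z. f z \<partial>p x)"
proof -
 have "map_pmf (%ze. ze x) (Pi_pmf R d p) = p x" using assms by (simp add: Pi_pmf_component)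
 hence "(\<integral>\<^sup>+z. f z \<partial>p x) = (\<integral>\<^sup>+z. f z \<partial>map_pmf (%ze. ze x) (Pi_pmf R d p))" by simp
 thus ?thesis by (simp only: nn_integral_map_pmf)
qed

section \<open>Approximation of the infinite system by killed finite systems\<close>

context sampled_dlas
begin

text \<open>A path visits finitely many sites up to \<open>T'\<close>, so the event
  \<open>E x m\<close> of leaving \<open>Rs m\<close> has small probability for large
  \<open>m\<close>. The event refers to the points of all grids at once, which makes the bound
  uniform in \<open>k\<close>.\<close>

lemma exits_negligible:
 assumes F: "finite F" "F <= V" and ep: "0 < ep"
 shows "EX R. finite R & F <= R & R <= V & (ALL k. (SUM x:F. arrivals start_law (hits (Q k) (- R) {} (Suc (Suc (n k)))) x) <= ennreal ep)"
proof -
 obtain Rs where Rs: "!!m. finite (Rs m)" "!!m. Rs m <= V" "!!m. Rs m <= Rs (Suc m)" "(\<Union>m. Rs m) = V"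
   "!!m. F <= Rs m" "!!A. finite A ==> A <= V ==> EX m. A <= Rs m"
  by (rule countable_exhaustion[OF countable_verts F]) blast
 define E where "E x m = {om : space M. EX k. EX i:{..Suc (n k)}. S (x, 1) om (real i * dt k) ~: Rs m}" for x m
 have lab: "(x, 1) : labels V" if "x : F" for x using F that by (auto simp: labels_def)
 have path: "path_element (S (x, 1)) : measurable M (path_space V)" if "x : F" for x
  using indep_paths lab[OF that] unfolding indep_vars_def2 by blast
 have coord: "(%om. S (x, 1) om t) : measurable M (count_space V)" if "x : F" "0 <= t" for x t
 proof -
  have "(%om. path_element (S (x, 1)) om t) : measurable M (count_space V)"
   using measurable_compose[OF path[OF that(1), unfolded path_space_def] measurable_component_singleton[of t "{0..}"]] that by simp
  thus ?thesis using that(2) by (simp add: path_element_def)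
 qed
 have one: "{om : space M. S (x, 1) om t ~: Rs m} : sets M" if "x : F" "0 <= t" for x t m
 proof -
  have "(%om. S (x, 1) om t) -` (V - Rs m) Int space M : sets M" by (rule measurable_sets[OF coord[OF that]]) simp
  also have "(%om. S (x, 1) om t) -` (V - Rs m) Int space M = {om : space M. S (x, 1) om t ~: Rs m}"
   using measurable_space[OF coord[OF that]] by auto
  finally show ?thesis .
 qed
 have Esets: "E x m : sets M" if "x : F" for x m
  unfolding E_def by (intro sets.sets_Collect_countable_Ex sets.sets_Collect_finite_Ex one that)
   (simp_all add: dt less_imp_le)
 have hit: "hits (Q k) (- Rs m) {} (Suc (Suc (n k))) x <= emeasure M (E x m)" if x: "x : F" for k m x
 proof -
  let ?D = "chain (Q k) (Suc (n k)) x" and ?f = "%om. samples (dt k) (Suc (n k)) (S (x, 1) om)"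
  let ?I = "indicator {l. set l Int - Rs m ~= {}} :: 'v list => ennreal"
  have ev: "{om : space M. ?f om = l} : sets M" for l
  proof -
   have "path_element (S (x, 1)) -` {s : space (path_space V). samples (dt k) (Suc (n k)) s = l} Int space M : sets M"
    by (rule measurable_sets[OF path[OF x] samples_in_path_space]) (simp add: dt less_imp_le)
   also have "path_element (S (x, 1)) -` {s : space (path_space V). samples (dt k) (Suc (n k)) s = l} Int space M = {om : space M. ?f om = l}"
    using path_in_space[OF lab[OF x]] by (auto simp: samples_path_element dt less_imp_le)
   finally show ?thesis .
  qed
  have "(\<integral>\<^sup>+om. ?I (?f om) * indicator (space M) om \<partial>M) = 1 * (\<integral>\<^sup>+l. ?I l \<partial>?D)"
  proof (rule nn_integral_discrete[where C = "lists V"])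
   show "countable (lists V)" using countable_verts by (rule countable_lists)
   show "?f om : lists V" if "om : space M" for om
    using measurable_space[OF coord[OF x] that] dt[of k] by (auto simp: samples_def less_imp_le simp del: upt_Suc)
   show "set_pmf ?D <= lists V" using set_pmf_chain[of V "Q k" x] Q x F by blast
   show "{om : space M. ?f om = l} : sets M" for l by (rule ev)
   show "emeasure M {om : space M. ?f om = l} = 1 * ennreal (pmf ?D l)" for l
    using law[of "{(x, 1)}" k "Suc (n k)" "%_. l"] lab[OF x] by simp
  qed
  hence int: "(\<integral>\<^sup>+l. ?I l \<partial>?D) = (\<integral>\<^sup>+om. ?I (?f om) * indicator (space M) om \<partial>M)"
   by (simp only: mult_1)
  have "hits (Q k) (- Rs m) {} (Suc (Suc (n k))) x = emeasure ?D {l. set l Int - Rs m ~= {}}" by (rule hits_chain(1))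
  also have "... = (\<integral>\<^sup>+l. ?I l \<partial>?D)" by (rule nn_integral_indicator[symmetric]) (simp del: chain.simps)
  also have "... = (\<integral>\<^sup>+om. ?I (?f om) * indicator (space M) om \<partial>M)" by (rule int)
  also have "... <= (\<integral>\<^sup>+om. indicator (E x m) om \<partial>M)"
  proof (rule nn_integral_mono)
   fix om assume w: "om : space M"
   show "?I (?f om) * indicator (space M) om <= indicator (E x m) om"
   proof (cases "set (?f om) Int - Rs m = {}")
    case False
    then obtain i where "i < Suc (Suc (n k))" "S (x, 1) om (real i * dt k) ~: Rs m" by (auto simp: samples_def simp del: upt_Suc)
    hence "om : E x m" using w unfolding E_def by (auto intro!: exI[of _ k] bexI[of _ i])
    thus ?thesis by (simp add: indicator_def)
   qed (simp add: indicator_def)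
  qed
  also have "... = emeasure M (E x m)" using Esets[OF x] by simp
  finally show ?thesis .
 qed
 have lim: "(%m. emeasure M (E x m)) ~~> 0" if x: "x : F" for x
 proof -
  have "AE om in M. \<not> (ALL m. om : E x m)"
   using valid_instructions
  proof eventually_elim
   case (elim om)
   have cad: "cadlag_path V (S (x, 1) om)" using elim lab[OF x] unfolding instructions_def by blast
   have "S (x, 1) om ` {0..T'} <= V" using cad by (auto simp: cadlag_path_def)
   then obtain m where m: "S (x, 1) om ` {0..T'} <= Rs m" using Rs(6)[OF cadlag_finite_range[OF cad]] by blast
   have "real i * dt k : {0..T'}" if "i <= Suc (n k)" for i k
   proof -
    have "real i * dt k <= real (Suc (n k)) * dt k" using that dt[of k] by (intro mult_right_mono) auto
    hence "real i * dt k <= T'" using n[of k] by (rule order_trans)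
    thus ?thesis using dt[of k] by simp
   qed
   hence "om ~: E x m" using m unfolding E_def by blast
   thus ?case by blast
  qed
  hence "emeasure M {om : space M. ALL m. om : E x m} = 0" by (rule emeasure_eq_0_AE)
  moreover have "{om : space M. ALL m. om : E x m} = (\<Inter>m. E x m)" by (auto simp: E_def)
  moreover have "(%m. emeasure M (E x m)) ~~> emeasure M (\<Inter>m. E x m)"
  proof (rule Lim_emeasure_decseq)
   show "range (E x) <= sets M" using Esets[OF x] by blast
   show "decseq (E x)" using Rs(3) unfolding decseq_Suc_iff E_def by blast
  qed simp
  ultimately show ?thesis by simp
 qed
 have "(%m. \<integral>\<^sup>+z. min 1 (of_nat (nat z) * emeasure M (E x m)) \<partial>start_law x) ~~> (\<integral>\<^sup>+z. 0 \<partial>start_law x)" if x: "x : F" for x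
 proof (rule nn_integral_dominated_convergence[where w = "%_. 1"])
  have "(%m. min 1 (of_nat (nat z) * emeasure M (E x m))) ~~> min 1 (of_nat (nat z) * 0)" for z
   by (intro tendsto_min tendsto_const ennreal_tendsto_cmult lim x) (simp add: of_nat_less_top)
  thus "AE z in start_law x. (%m. min 1 (of_nat (nat z) * emeasure M (E x m))) ~~> 0" by simp
 qed auto
 hence "(%m. SUM x:F. \<integral>\<^sup>+z. min 1 (of_nat (nat z) * emeasure M (E x m)) \<partial>start_law x) ~~> (SUM x:F. 0)"
  by (intro tendsto_sum) simp
 hence "\<forall>\<^sub>F m in sequentially. (SUM x:F. \<integral>\<^sup>+z. min 1 (of_nat (nat z) * emeasure M (E x m)) \<partial>start_law x) < ennreal ep"
  using ep by (intro order_tendstoD(2)) auto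
 then obtain m where m: "(SUM x:F. \<integral>\<^sup>+z. min 1 (of_nat (nat z) * emeasure M (E x m)) \<partial>start_law x) < ennreal ep"
  unfolding eventually_sequentially by blast
 have "(SUM x:F. arrivals start_law (hits (Q k) (- Rs m) {} (Suc (Suc (n k)))) x) <= ennreal ep" for k
 proof -
  have "(SUM x:F. arrivals start_law (hits (Q k) (- Rs m) {} (Suc (Suc (n k)))) x) \<le>
    (SUM x:F. \<integral>\<^sup>+z. min 1 (of_nat (nat z) * emeasure M (E x m)) \<partial>start_law x)"
   unfolding arrivals_def
   by (intro sum_mono nn_integral_mono min.mono order_refl mult_left_mono hit) simp_all
  with m show ?thesis by simp
 qed
 thus ?thesis by (intro exI[of _ "Rs m"] conjI allI Rs(1,2,5))
qed

lemma final_measurable: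
 assumes H: "finite H" "H <= V" and T: "0 <= T" "!!k. T <= real (Suc (n k)) * dt k"
  and g: "continuous_on UNIV g" "!!v. 0 <= g v" "!!v. g v <= B"
 shows "EX u. u : borel_measurable M & (AE om in M. u om = ennreal (g (final H T om)))"
proof -
 obtain Rs :: "nat => 'v set" where Rs: "(ALL m. finite (Rs m)) & (ALL m. Rs m <= V) & (ALL m. Rs m <= Rs (Suc m)) & (\<Union>m. Rs m) = V &
   (ALL A. finite A --> A <= V --> (EX m. A <= Rs m))"
  using countable_finite_exhaustion[OF countable_verts] by (elim exE) (rule that)
 have Rs': "finite (Rs m)" "Rs m <= V" "Rs m <= Rs (Suc m)" "(\<Union>m. Rs m) = V" for m
  using Rs by simp_all
 show ?thesis by (rule exhaustion_limit(1)[OF Rs' H T g])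
qed

lemma final_tight:
 assumes H: "finite H" "H <= V" and T: "0 <= T" "!!k. T <= real (Suc (n k)) * dt k" and ep: "0 < ep"
 shows "EX A. (\<integral>\<^sup>+om. ennreal (min 1 (max 0 (final H T om - A + 1))) \<partial>M) <= ennreal ep"
proof -
 let ?g = "%A v. min 1 (max 0 (v - A + 1)) :: real"
 have "\<forall>A::nat. EX u. u : borel_measurable M & (AE om in M. u om = ennreal (?g (real A) (final H T om)))"
 proof (intro allI final_measurable[OF H T, where B = 1])
  show "continuous_on UNIV (?g (real A))" for A :: nat by (intro continuous_intros)
 qed simp_all
 from choice[OF this] obtain u where u0: "\<forall>A::nat. u A : borel_measurable M & (AE om in M. u A om = ennreal (?g (real A) (final H T om)))" by blast
 have u: "u A : borel_measurable M" "AE om in M. u A om = ennreal (?g (real A) (final H T om))" for A using u0 by blast+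
 have all: "AE om in M. ALL A. u A om = ennreal (?g (real A) (final H T om))" using u(2) by (simp add: AE_all_countable)
 have "(%A. \<integral>\<^sup>+om. u A om \<partial>M) ~~> (\<integral>\<^sup>+om. 0 \<partial>M)"
 proof (rule nn_integral_dominated_convergence[where w = "%_. 1"])
  show "AE om in M. u A om <= 1" for A using u(2)[of A] by eventually_elim simp
  show "AE om in M. (%A. u A om) ~~> 0" using all
  proof eventually_elim
   case (elim om)
   have "\<forall>\<^sub>F A in sequentially. u A om = 0"
    using eventually_ge_at_top[of "nat \<lceil>final H T om + 1\<rceil>"]
   proof eventually_elim
    fix A assume "nat \<lceil>final H T om + 1\<rceil> <= A"
    hence "final H T om - real A + 1 <= 0" by linarith
    thus "u A om = 0" using elim by (simp add: max_absorb1)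
   qed
   thus ?case by (rule tendsto_eventually)
  qed
 qed (use u(1) in \<open>auto simp: emeasure_space_1\<close>)
 hence "\<forall>\<^sub>F A in sequentially. (\<integral>\<^sup>+om. u A om \<partial>M) < ennreal ep" using ep by (intro order_tendstoD(2)) auto
 then obtain A where "(\<integral>\<^sup>+om. u A om \<partial>M) < ennreal ep" unfolding eventually_sequentially by blast
 hence "(\<integral>\<^sup>+om. ennreal (?g (real A) (final H T om)) \<partial>M) < ennreal ep"
  by (simp only: nn_integral_cong_AE[OF u(2), symmetric])
 thus ?thesis by (blast intro: less_imp_le)
qed

lemma net_lower:
 fixes g :: "real => real"
 assumes H: "finite H" "H <= V" and T: "0 <= T" "!!k. T <= real (Suc (n k)) * dt k"
  and g: "continuous_on UNIV g" "!!v. 0 <= g v" "!!v. g v <= B" and ep: "0 < ep"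
 shows "EX F. finite F & F <= V & (ALL R. finite R --> F <= R --> R <= V --> (\<forall>\<^sub>F k in sequentially.
  (\<integral>\<^sup>+om. ennreal (g (final H T om)) \<partial>M) \<le>
  (\<integral>\<^sup>+ze. start_expect (Q k) (Suc (n k)) (occ_weight H T (dt k)) (%v. ennreal (g v)) R ze \<partial>Pi_pmf R 0 start_law) + ennreal ep))"
proof -
 obtain F where F: "finite F" "F <= V" and lim: "ALL R. finite R --> F <= R --> R <= V --> eventually (%k. (\<integral>\<^sup>+ze. start_expect (Q k) (Suc (n k)) (occ_weight H T (dt k)) (%v. ennreal (g v)) R ze \<partial>Pi_pmf R 0 start_law) <= (\<integral>\<^sup>+om. ennreal (g (final H T om)) \<partial>M) + ennreal ep & (\<integral>\<^sup>+om. ennreal (g (final H T om)) \<partial>M) <= (\<integral>\<^sup>+ze. start_expect (Q k) (Suc (n k)) (occ_weight H T (dt k)) (%v. ennreal (g v)) R ze \<partial>Pi_pmf R 0 start_law) + ennreal ep) sequentially"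
  using net_limit[OF H T g ep] by blast
 show ?thesis
 proof (intro exI[of _ F] conjI F allI impI)
  fix R assume "finite R" "F <= R" "R <= V"
  from lim[rule_format, OF this] show "eventually (%k. (\<integral>\<^sup>+om. ennreal (g (final H T om)) \<partial>M) <= (\<integral>\<^sup>+ze. start_expect (Q k) (Suc (n k)) (occ_weight H T (dt k)) (%v. ennreal (g v)) R ze \<partial>Pi_pmf R 0 start_law) + ennreal ep) sequentially" by (rule eventually_mono) simp
 qed
qed

lemma net_upper:
 fixes g :: "real => real"
 assumes H: "finite H" "H <= V" and T: "0 <= T" "!!k. T <= real (Suc (n k)) * dt k"
  and g: "continuous_on UNIV g" "!!v. 0 <= g v" "!!v. g v <= B" and ep: "0 < ep"
 shows "EX F. finite F & F <= V & (ALL R. finite R --> F <= R --> R <= V --> (\<forall>\<^sub>F k in sequentially.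
  (\<integral>\<^sup>+ze. start_expect (Q k) (Suc (n k)) (occ_weight H T (dt k)) (%v. ennreal (g v)) R ze \<partial>Pi_pmf R 0 start_law) \<le>
  (\<integral>\<^sup>+om. ennreal (g (final H T om)) \<partial>M) + ennreal ep))"
proof -
 obtain F where F: "finite F" "F <= V" and lim: "ALL R. finite R --> F <= R --> R <= V --> eventually (%k. (\<integral>\<^sup>+ze. start_expect (Q k) (Suc (n k)) (occ_weight H T (dt k)) (%v. ennreal (g v)) R ze \<partial>Pi_pmf R 0 start_law) <= (\<integral>\<^sup>+om. ennreal (g (final H T om)) \<partial>M) + ennreal ep & (\<integral>\<^sup>+om. ennreal (g (final H T om)) \<partial>M) <= (\<integral>\<^sup>+ze. start_expect (Q k) (Suc (n k)) (occ_weight H T (dt k)) (%v. ennreal (g v)) R ze \<partial>Pi_pmf R 0 start_law) + ennreal ep) sequentially"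
  using net_limit[OF H T g ep] by blast
 show ?thesis
 proof (intro exI[of _ F] conjI F allI impI)
  fix R assume "finite R" "F <= R" "R <= V"
  from lim[rule_format, OF this] show "eventually (%k. (\<integral>\<^sup>+ze. start_expect (Q k) (Suc (n k)) (occ_weight H T (dt k)) (%v. ennreal (g v)) R ze \<partial>Pi_pmf R 0 start_law) <= (\<integral>\<^sup>+om. ennreal (g (final H T om)) \<partial>M) + ennreal ep) sequentially" by (rule eventually_mono) simp
 qed
qed

text \<open>\<open>truncation_bound\<close> is integrated over the initial configuration, and seven
  errors of size \<open>e\<close> are collected. The order of the choices matters: \<open>A\<close>
  comes from tightness, then \<open>et\<close> yields \<open>J\<close> and \<open>C\<close>, then
  summability of the arrivals for this \<open>J\<close> yields \<open>F\<close>, and finally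
  \<open>R\<close> is taken so large that the tokens of \<open>F\<close> rarely leave it.\<close>

theorem killed_approximation:
 fixes g :: "real => real"
 assumes lb: "level_bounds K H Q (%k. Suc (n k)) (%k. occ_weight H T (dt k)) (%k. occ_weight H T2 (dt k))"
  and H: "finite H" "H <= V" and T: "0 <= T" "!!k. T <= real (Suc (n k)) * dt k"
  and T2: "0 < T2" "!!k. T2 <= real (Suc (n k)) * dt k"
  and g: "continuous_on UNIV g" "!!v. 0 <= g v" "!!v. g v <= 1" "mono g" "!!v d. 0 <= d ==> g (v + d) <= g v + min 1 d"
  and ep: "0 < ep"
 shows "EX R. finite R & R <= V & (\<integral>\<^sup>+om. ennreal (g (final H T om)) \<partial>M) \<le>
  (\<integral>\<^sup>+ze. limsup (%k. kill_expect (Q k) (Suc (n k)) (occ_weight H T (dt k)) (%v. ennreal (g v)) R ze) \<partial>Pi_pmf R 0 start_law) + ennreal ep"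
proof -
 let ?N = "%k. Suc (n k)" and ?c = "%k. occ_weight H T (dt k)" and ?c2 = "%k. occ_weight H T2 (dt k)"
 define r where "r = 1 / T2"
 have r: "0 < r" using T2 by (simp add: r_def)
 have bw: "bounded_weights (?N k) (?c2 k) (cell_weight T2 (dt k)) r" for k
  unfolding r_def by (rule occupation_bounded_weights[OF dt T2(1)])
 have c2: "0 <= ?c2 k y j" for k y j using cell_weight_props(1)[OF dt] by (simp add: occ_weight_def)
 have c: "0 <= ?c k y j" "i <= j ==> ?c k y j <= ?c k y i" for k y i j
  using cell_weight_props(1,3)[OF dt] by (simp_all add: occ_weight_def)
 define e where "e = ep / 7"
 have e: "0 < e" using ep by (simp add: e_def)
 obtain A where A: "(\<integral>\<^sup>+om. ennreal (min 1 (max 0 (final H T2 om - A + 1))) \<partial>M) <= ennreal e"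
  using final_tight[OF H less_imp_le[OF T2(1)] T2(2) e] by blast
 let ?ps = "%v. min 1 (max 0 (v - A + 1)) :: real"
 define a where "a = exp (r * A)"
 have a: "0 < a" by (simp add: a_def)
 \<comment> \<open>Chosen so that \<open>a * (2 * et / r) = e\<close>.\<close>
 define et where "et = e * r / (2 * a)"
 have et: "0 < et" using e r a by (simp add: et_def)
 obtain J C ka err where ka0: "0 < ka" and C: "0 <= C" and err: "err ~~> 0"
  and up: "!!k y b. admissible (?N k) b ==> solo (Q k) (%y j. ennreal (?c k y j)) b (?N k) 0 y \<le>
    ennreal C * (hits K H {} (Suc J) y + err k) + ennreal et * solo (Q k) (%y j. ennreal (?c2 k y j)) b (?N k) 0 y"
  and low: "\<forall>\<^sub>F k in sequentially. ALL Z x. ennreal ka * hits K H Z (Suc J) x \<le>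
    solo (Q k) (%y j. ennreal (?c2 k y j)) (static (?N k) (%y. if y : Z then \<infinity> else 0)) (?N k) 0 x"
  using lb[unfolded level_bounds_def, rule_format, OF et] by blast
 let ?h = "hits K H {} (Suc J)"
 \<comment> \<open>Lowered to achieve \<open>ka' * r \<le> 2\<close>, where
   \<open>r = 1 / T2\<close>.\<close>
 define ka' where "ka' = min ka (2 * T2)"
 have ka': "0 < ka'" "ka' * r <= 2" "ka' <= ka" using ka0 T2 by (simp_all add: ka'_def r_def field_simps)
 \<comment> \<open>\<open>max 0 v\<close> makes the function bounded on all reals; occupation values
   are nonnegative, where it agrees with \<open>exp (- r * v)\<close>.\<close>
 let ?gx = "%v. exp (- (r * max 0 v)) :: real"
 define X where "X = (\<integral>\<^sup>+om. ennreal (?gx (final H T2 om)) \<partial>M)"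
 have gx: "continuous_on UNIV ?gx" "!!v. 0 <= ?gx v" "!!v. ?gx v <= 1"
  using r by (auto intro!: continuous_intros)
 have "X ~= 0"
 proof
  assume X0: "X = 0"
  obtain u where u: "u : borel_measurable M" "AE om in M. u om = ennreal (?gx (final H T2 om))"
   using final_measurable[OF H less_imp_le[OF T2(1)] T2(2) gx] by blast
  have "(\<integral>\<^sup>+om. u om \<partial>M) = 0" using X0 nn_integral_cong_AE[OF u(2)] by (simp only: X_def)
  hence "AE om in M. u om = 0" using u(1) by (simp add: nn_integral_0_iff_AE)
  with u(2) have "AE om in M. False" by eventually_elim simp
  thus False by simp
 qed
 moreover have "X <= 1"
 proof -
  have "X <= (\<integral>\<^sup>+om. 1 \<partial>M)" unfolding X_def by (rule nn_integral_mono) (simp only: ennreal_le_1 gx(3))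
  thus ?thesis by (simp add: emeasure_space_1)
 qed
 ultimately obtain x0 where x0: "X = ennreal x0" "0 < x0"
  by (cases X) (auto simp: top_unique)
 \<comment> \<open>The limit \<open>x0\<close> is positive because the occupation is a real number;
   finite systems within \<theta> of the limit stay above
   \<open>x0 - \<theta> = \<theta>\<close>.\<close>
 define \<theta> where "\<theta> = x0 / 2"
 have \<theta>: "0 < \<theta>" using x0 by (simp add: \<theta>_def)
 obtain F1 where F1: "finite F1" "F1 <= V" "ALL R. finite R --> F1 <= R --> R <= V --> (\<forall>\<^sub>F k in sequentially.
   X <= (\<integral>\<^sup>+ze. start_expect (Q k) (?N k) (?c2 k) (%v. ennreal (?gx v)) R ze \<partial>Pi_pmf R 0 start_law) + ennreal \<theta>)"
  using net_lower[OF H less_imp_le[OF T2(1)] T2(2) gx \<theta>] unfolding X_def[symmetric] by blast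
 have gx_eq: "start_expect (Q k) (?N k) (?c2 k) (%v. ennreal (?gx v)) R ze = start_expect (Q k) (?N k) (?c2 k) (%v. ennreal (exp (- r * v))) R ze" for k R ze
 proof (rule expect_cong_support)
  fix z assume "z : set_pmf (run (Q k) (?N k) (?c2 k) (static (?N k) (B_start R ze)) 0 (A_start R ze))"
  from run_increasing[OF admissible_static c2 this] show "ennreal (?gx (snd z)) = ennreal (exp (- r * snd z))" by (simp add: max_absorb2)
 qed
 have pos: "\<forall>\<^sub>F k in sequentially. ennreal \<theta> \<le>
   (\<integral>\<^sup>+ze. start_expect (Q k) (?N k) (?c2 k) (%v. ennreal (exp (- r * v))) R ze \<partial>Pi_pmf R 0 start_law)"
  if "finite R" "F1 <= R" "R <= V" for R
  using F1(3)[rule_format, OF that]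
 proof eventually_elim
  case (elim k)
  have "ennreal \<theta> + ennreal \<theta> = X" using \<theta> ennreal_plus[of \<theta> \<theta>] x0(2) unfolding x0(1) by (simp add: \<theta>_def)
  with elim have "ennreal \<theta> + ennreal \<theta> <= ennreal \<theta> + (\<integral>\<^sup>+ze. start_expect (Q k) (?N k) (?c2 k) (%v. ennreal (?gx v)) R ze \<partial>Pi_pmf R 0 start_law)"
   by (simp add: add.commute)
  hence "ennreal \<theta> <= (\<integral>\<^sup>+ze. start_expect (Q k) (?N k) (?c2 k) (%v. ennreal (?gx v)) R ze \<partial>Pi_pmf R 0 start_law)"
   by (simp add: ennreal_add_left_cancel_le)
  thus ?case by (simp only: gx_eq)
 qed
 have low': "\<forall>\<^sub>F k in sequentially. ALL Z x. ennreal ka' * hits K H Z (Suc J) x \<le>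
   solo (Q k) (%y j. ennreal (?c2 k y j)) (static (?N k) (%y. if y : Z then \<infinity> else 0)) (?N k) 0 x"
  using low
 proof eventually_elim
  case (elim k)
  show ?case
  proof (intro allI)
   fix Z x
   have "ennreal ka' * hits K H Z (Suc J) x <= ennreal ka * hits K H Z (Suc J) x"
    by (intro mult_right_mono ennreal_leI ka'(3)) simp
   thus "ennreal ka' * hits K H Z (Suc J) x \<le>
     solo (Q k) (%y j. ennreal (?c2 k y j)) (static (?N k) (%y. if y : Z then \<infinity> else 0)) (?N k) 0 x"
    using elim[rule_format, of Z x] by (rule order_trans)
  qed
 qed
 obtain C1 where C1: "!!X. finite X ==> X <= V - F1 ==> (SUM x:X. arrivals start_law ?h x) <= ennreal C1"
  using arrivals_summable[where N = ?N and c = ?c2 and Q = Q and p = start_law and V = V, OF bw ka'(1,2) \<theta> F1(1,2) low' pos] by blast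
 define e2 where "e2 = e / ((C + 1) * a)"
 have e2: "0 < e2" using e C a by (simp add: e2_def)
 obtain F2 where F2: "finite F2" "F1 <= F2" "F2 <= V" "!!X. finite X ==> X <= V - F2 ==> (SUM x:X. arrivals start_law ?h x) <= ennreal e2"
  using arrivals_tail[where f = "arrivals start_law ?h", OF C1 F1(1,2) e2] by blast
 define E where "E = (\<integral>\<^sup>+om. ennreal (g (final H T om)) \<partial>M)"
 obtain F3 where F3: "finite F3" "F3 <= V" "ALL R. finite R --> F3 <= R --> R <= V --> (\<forall>\<^sub>F k in sequentially.
   E <= (\<integral>\<^sup>+ze. start_expect (Q k) (?N k) (?c k) (%v. ennreal (g v)) R ze \<partial>Pi_pmf R 0 start_law) + ennreal e)"
  using net_lower[OF H T g(1-3) e] unfolding E_def[symmetric] by blast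
 have psc: "continuous_on UNIV ?ps" by (intro continuous_intros)
 have psb: "!!v. 0 <= ?ps v" "!!v. ?ps v <= 1" by simp_all
 obtain F4 where F4: "finite F4" "F4 <= V" "ALL R. finite R --> F4 <= R --> R <= V --> (\<forall>\<^sub>F k in sequentially.
   (\<integral>\<^sup>+ze. start_expect (Q k) (?N k) (?c2 k) (%v. ennreal (?ps v)) R ze \<partial>Pi_pmf R 0 start_law) \<le>
   (\<integral>\<^sup>+om. ennreal (?ps (final H T2 om)) \<partial>M) + ennreal e)"
  using net_upper[OF H less_imp_le[OF T2(1)] T2(2) psc psb e] by blast
 define F where "F = F2 Un F3 Un F4"
 have F: "finite F" "F <= V" using F2 F3 F4 by (auto simp: F_def)
 obtain R where R: "finite R" "F <= R" "R <= V"
   "!!k. (SUM x:F. arrivals start_law (hits (Q k) (- R) {} (Suc (?N k))) x) <= ennreal e"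
  using exits_negligible[OF F e] by blast
 let ?P = "Pi_pmf R 0 start_law"
 define W where "W k ze = kill_expect (Q k) (?N k) (?c k) (%v. ennreal (g v)) R ze" for k ze
 define L where "L k ze = start_expect (Q k) (?N k) (?c k) (%v. ennreal (g v)) R ze" for k ze
 define L2 where "L2 k ze = start_expect (Q k) (?N k) (?c2 k) (%v. ennreal (?ps v)) R ze" for k ze
 define rh where "rh k ze = min 1 (ennreal C * (SUM y:R. of_nat (nat (ze y))) * err k)" for k ze
 define X1 where "X1 k ze = (SUM x:F. min 1 (of_nat (nat (ze x)) * hits (Q k) (- R) {} (Suc (?N k)) x))" for k ze
 define Y where "Y ze = (SUM y:R - F. min 1 (of_nat (nat (ze y)) * ?h y))" for ze
 have bound: "L k ze <= W k ze + X1 k ze + ennreal a * ((ennreal C + 1) * Y ze + rh k ze + ennreal (2 * et / r)) + L2 k ze" for k ze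
  unfolding L_def W_def X1_def a_def Y_def rh_def L2_def
 proof (rule truncation_bound[OF bw c less_imp_le[OF et] up _ _ _ _ R(1,2)])
  show "ennreal (g (v + d)) <= ennreal (g v) + ennreal (min 1 d)" if "0 <= d" for v d
   using ennreal_leI[OF g(5)[OF that, of v]] g(2)[of v] that by (simp add: ennreal_plus)
  show "mono (%v. ennreal (g v))" using g(4) by (auto simp: mono_def intro!: ennreal_leI)
 qed (use g(3) in \<open>simp_all add: ennreal_le_1 ennreal_ge_1\<close>)
 have rh0: "(%k. \<integral>\<^sup>+ze. rh k ze \<partial>?P) ~~> (\<integral>\<^sup>+ze. 0 \<partial>?P)"
 proof (rule nn_integral_dominated_convergence[where w = "%_. 1"])
  have "(%k. rh k ze) ~~> min 1 (ennreal C * (SUM y:R. of_nat (nat (ze y))) * 0)" for ze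
   unfolding rh_def by (intro tendsto_min tendsto_const ennreal_tendsto_cmult err)
    (simp add: ennreal_mult_less_top of_nat_less_top of_nat_sum[symmetric] del: of_nat_sum)
  thus "AE ze in ?P. (%k. rh k ze) ~~> 0" by simp
 qed (auto simp: rh_def)
 have "\<forall>\<^sub>F k in sequentially. (\<integral>\<^sup>+ze. rh k ze \<partial>?P) < ennreal (e / a)"
  using rh0 e a by (intro order_tendstoD(2)) auto
 moreover have "\<forall>\<^sub>F k in sequentially. E <= (\<integral>\<^sup>+ze. L k ze \<partial>?P) + ennreal e"
  unfolding L_def using R F_def by (intro F3(3)[rule_format]) auto
 moreover have "\<forall>\<^sub>F k in sequentially. (\<integral>\<^sup>+ze. L2 k ze \<partial>?P) <= (\<integral>\<^sup>+om. ennreal (?ps (final H T2 om)) \<partial>M) + ennreal e"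
  unfolding L2_def using R F_def by (intro F4(3)[rule_format]) auto
 ultimately have "\<forall>\<^sub>F k in sequentially. E - ennreal ep <= (\<integral>\<^sup>+ze. W k ze \<partial>?P)"
 proof eventually_elim
  case (elim k)
  have margR: "(\<integral>\<^sup>+ze. min 1 (of_nat (nat (ze x)) * f x) \<partial>?P) = arrivals start_law f x" if "x : R" for x f
   unfolding arrivals_def by (rule Pi_pmf_marginal[OF R(1) that])
  have iX: "(\<integral>\<^sup>+ze. X1 k ze \<partial>?P) <= ennreal e"
  proof -
   have "(\<integral>\<^sup>+ze. X1 k ze \<partial>?P) = (SUM x:F. \<integral>\<^sup>+ze. min 1 (of_nat (nat (ze x)) * hits (Q k) (- R) {} (Suc (?N k)) x) \<partial>?P)"
    unfolding X1_def by (rule nn_integral_sum) (simp del: hits.simps)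
   also have "... = (SUM x:F. arrivals start_law (hits (Q k) (- R) {} (Suc (?N k))) x)"
    by (intro sum.cong refl margR) (use R(2) in blast)
   finally show ?thesis using R(4)[of k] by (simp only:)
  qed
  have iY: "(\<integral>\<^sup>+ze. Y ze \<partial>?P) <= ennreal e2"
  proof -
   have "(\<integral>\<^sup>+ze. Y ze \<partial>?P) = (SUM x:R - F. \<integral>\<^sup>+ze. min 1 (of_nat (nat (ze x)) * ?h x) \<partial>?P)"
    unfolding Y_def by (rule nn_integral_sum) (simp del: hits.simps)
   also have "... = (SUM x:R - F. arrivals start_law ?h x)" by (intro sum.cong refl margR) blast
   also have "... <= ennreal e2" by (rule F2(4)) (use R F_def in auto)
   finally show ?thesis .
  qed
  have ae2: "ennreal a * ((ennreal C + 1) * ennreal e2) = ennreal e"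
  proof -
   have "ennreal C + 1 = ennreal (C + 1)" using C by simp
   hence "ennreal a * ((ennreal C + 1) * ennreal e2) = ennreal (a * ((C + 1) * e2))"
    using a C e2 by (simp add: ennreal_mult del: ennreal_plus)
   also have "a * ((C + 1) * e2) = e" using a C by (simp add: e2_def)
   finally show ?thesis .
  qed
  have ae3: "ennreal a * ennreal (e / a) = ennreal e" using a e by (simp add: ennreal_mult[symmetric])
  have ae4: "ennreal a * ennreal (2 * et / r) = ennreal e" using a e r et by (simp add: ennreal_mult[symmetric] et_def)
  have "(\<integral>\<^sup>+ze. L k ze \<partial>?P) <= (\<integral>\<^sup>+ze. W k ze + X1 k ze + ennreal a * ((ennreal C + 1) * Y ze + rh k ze + ennreal (2 * et / r)) + L2 k ze \<partial>?P)"
   by (intro nn_integral_mono bound)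
  also have "... = (\<integral>\<^sup>+ze. W k ze \<partial>?P) + (\<integral>\<^sup>+ze. X1 k ze \<partial>?P) + ennreal a * ((ennreal C + 1) * (\<integral>\<^sup>+ze. Y ze \<partial>?P) + (\<integral>\<^sup>+ze. rh k ze \<partial>?P) + ennreal (2 * et / r)) + (\<integral>\<^sup>+ze. L2 k ze \<partial>?P)"
   by (simp add: nn_integral_add nn_integral_cmult measure_pmf.emeasure_space_1)
  also have "... <= (\<integral>\<^sup>+ze. W k ze \<partial>?P) + ennreal e + ennreal a * ((ennreal C + 1) * ennreal e2 + ennreal (e / a) + ennreal (2 * et / r)) + (ennreal e + ennreal e)"
   by (intro add_mono mult_left_mono order_refl iX iY less_imp_le[OF elim(1)] order_trans[OF elim(3)] A) simp_all
  also have "... = (\<integral>\<^sup>+ze. W k ze \<partial>?P) + ennreal e + (ennreal e + ennreal e + ennreal e) + (ennreal e + ennreal e)"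
   by (simp only: distrib_left[of "ennreal a"] ae2 ae3 ae4)
  finally have "E <= (\<integral>\<^sup>+ze. W k ze \<partial>?P) + ennreal e + (ennreal e + ennreal e + ennreal e) + (ennreal e + ennreal e) + ennreal e"
   by (intro order_trans[OF elim(2)] add_right_mono)
  also have "... = (\<integral>\<^sup>+ze. W k ze \<partial>?P) + (ennreal e + (ennreal e + ennreal e + ennreal e) + (ennreal e + ennreal e) + ennreal e)"
   by (simp only: add.assoc)
  also have "ennreal e + (ennreal e + ennreal e + ennreal e) + (ennreal e + ennreal e) + ennreal e = ennreal (e + (e + e + e) + (e + e) + e)"
   using e by (simp only: ennreal_plus[symmetric] less_imp_le add_nonneg_nonneg)
  also have "e + (e + e + e) + (e + e) + e = ep" by (simp add: e_def)
  finally show ?case by (simp add: ennreal_minus_le_iff add.commute)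
 qed
 hence "E - ennreal ep <= limsup (%k. \<integral>\<^sup>+ze. W k ze \<partial>?P)" by (intro le_Limsup) simp_all
 also have "... <= (\<integral>\<^sup>+ze. limsup (%k. W k ze) \<partial>?P)"
 proof (rule nn_integral_limsup[where w = "%_. 1"])
  show "AE ze in ?P. W k ze <= 1" for k unfolding W_def using g(3) by (intro AE_I2 expect_le_1) (simp add: ennreal_le_1)
 qed auto
 finally have "E <= (\<integral>\<^sup>+ze. limsup (%k. W k ze) \<partial>?P) + ennreal ep" by (simp add: ennreal_minus_le_iff add.commute)
 thus ?thesis unfolding E_def W_def using R by blast
qed

text \<open>Passing from the killed system on \<open>R\<close> to the finite system on a larger
  \<open>R'\<close> removes the killing sites and adds tokens, both of which only increase the
  value. For large \<open>R'\<close> the finite system is close to the infinite one.\<close>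

theorem killed_upper_bound:
 fixes g :: "real => real"
 assumes H: "finite H" "H <= V" and T: "0 <= T" "!!k. T <= real (Suc (n k)) * dt k"
  and g: "continuous_on UNIV g" "!!v. 0 <= g v" "!!v. g v <= B" "mono g" and R: "finite R" "R <= V"
 shows "(\<integral>\<^sup>+ze. limsup (%k. kill_expect (Q k) (Suc (n k)) (occ_weight H T (dt k)) (%v. ennreal (g v)) R ze) \<partial>Pi_pmf R 0 start_law)
  <= (\<integral>\<^sup>+om. ennreal (g (final H T om)) \<partial>M)"
proof (rule ennreal_le_epsilon)
 fix e :: real assume e: "0 < e"
 let ?N = "%k. Suc (n k)" and ?c = "%k. occ_weight H T (dt k)" and ?E = "\<integral>\<^sup>+om. ennreal (g (final H T om)) \<partial>M"
 obtain F where F: "finite F" "F <= V" "ALL R. finite R --> F <= R --> R <= V --> (\<forall>\<^sub>F k in sequentially.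
   (\<integral>\<^sup>+ze. start_expect (Q k) (?N k) (?c k) (%v. ennreal (g v)) R ze \<partial>Pi_pmf R 0 start_law) <= ?E + ennreal e)"
  using net_upper[OF H T g(1-3) e] by blast
 define R' where "R' = R Un F"
 have R': "finite R'" "R' <= V" "R <= R'" "F <= R'" using R F by (auto simp: R'_def)
 let ?P = "Pi_pmf R' 0 start_law"
 define W where "W k ze = kill_expect (Q k) (?N k) (?c k) (%v. ennreal (g v)) R ze" for k ze
 define L where "L k ze = start_expect (Q k) (?N k) (?c k) (%v. ennreal (g v)) R' ze" for k ze
 let ?rh = "%ze x. if x : R then ze x else 0"
 have WL: "W k (?rh ze) <= L k ze" for k ze
 proof -
  have A: "A_start R (?rh ze) = A_start R ze" unfolding A_start_def by (rule sum.cong) simp_all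
  show ?thesis
   unfolding W_def L_def A_start_split[OF R'(1,3)] A
  proof (rule expect_mono)
   show "0 <= ?c k y j" "i <= j ==> ?c k y j <= ?c k y i" for y i j
    using cell_weight_props(1,3)[OF dt] by (simp_all add: occ_weight_def)
   show "mono (%v. ennreal (g v))" using g(4) by (auto simp: mono_def intro!: ennreal_leI)
   show "static (?N k) (B_start R' ze) y j <= static (?N k) (B_kill R (?rh ze)) y j" for y j
    using R'(3) by (auto simp: static_def B_start_def B_kill_def)
  qed (simp_all add: multiset.rel_refl no_later_def)
 qed
 obtain La where La: "ALL ze:set_pmf ?P. (%k. L k ze) ~~> La ze"
  using occupation_law_limit(1)[OF R'(1,2) H(1) T g(1-3)] unfolding L_def by blast
 have LB: "L k ze <= ennreal B" for k ze
 proof -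
  have "L k ze <= (\<integral>\<^sup>+z. ennreal B \<partial>run (Q k) (?N k) (?c k) (static (?N k) (B_start R' ze)) 0 (A_start R' ze))"
   unfolding L_def expect_def by (intro nn_integral_mono ennreal_leI g(3))
  thus ?thesis by (simp add: measure_pmf.emeasure_space_1)
 qed
 have lim: "(%k. \<integral>\<^sup>+ze. L k ze \<partial>?P) ~~> (\<integral>\<^sup>+ze. La ze \<partial>?P)"
  by (rule nn_integral_dominated_convergence[where w = "%_. ennreal B"])
   (use LB La in \<open>auto simp: AE_measure_pmf_iff ennreal_mult_less_top measure_pmf.emeasure_space_1\<close>)
 have "(\<integral>\<^sup>+ze. limsup (%k. W k ze) \<partial>Pi_pmf R 0 start_law) = (\<integral>\<^sup>+ze. limsup (%k. W k (?rh ze)) \<partial>?P)"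
  by (subst Pi_pmf_subset[OF R'(1,3)]) (simp only: nn_integral_map_pmf)
 also have "... <= (\<integral>\<^sup>+ze. La ze \<partial>?P)"
 proof (rule nn_integral_mono_AE, unfold AE_measure_pmf_iff, rule ballI)
  fix ze assume z: "ze : set_pmf ?P"
  have "limsup (%k. W k (?rh ze)) <= limsup (%k. L k ze)" by (intro Limsup_mono always_eventually allI WL)
  also have "... = La ze" using La z by (intro lim_imp_Limsup) auto
  finally show "limsup (%k. W k (?rh ze)) <= La ze" .
 qed
 also have "... <= ?E + ennreal e"
  by (rule tendsto_upperbound[OF lim[unfolded L_def] F(3)[rule_format, OF R'(1,4,2)]]) simp
 finally show "(\<integral>\<^sup>+ze. limsup (%k. kill_expect (Q k) (?N k) (?c k) (%v. ennreal (g v)) R ze) \<partial>Pi_pmf R 0 start_law) <= ?E + ennreal e"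
  unfolding W_def .
qed

end

subsection \<open>Comparing the killed systems\<close>

text \<open>Linear interpolation between integers. By \<open>line\<close> each of its pieces lies
  below the graph when extended; these supporting lines have nonnegative slopes, which gives
  convexity and monotonicity.\<close>

lemma convex_extension:
 fixes f :: "int => real"
 assumes mono: "!!z. f z <= f (z + 1)" and conv: "!!z. 2 * f (z + 1) <= f (z + 2) + f z"
 shows "\<exists>ph. mono ph & convex_on UNIV ph & (ALL z. ph (real_of_int z) = f z)"
proof -
 define d where "d z = f (z + 1) - f z" for z
 define ph where "ph v = f \<lfloor>v\<rfloor> + (v - of_int \<lfloor>v\<rfloor>) * d \<lfloor>v\<rfloor>" for v :: real
 have d0: "0 <= d z" for z using mono[of z] by (simp add: d_def)
 have fs: "f (z + 1) = f z + d z" for z by (simp add: d_def)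
 have d1: "d z <= d (z + 1)" for z
 proof -
  have e: "z + 1 + 1 = z + 2" by simp
  show ?thesis unfolding d_def e using conv[of z] by linarith
 qed
 have dm: "d z <= d w" if "z <= w" for z w
  using that
 proof (induction w rule: int_ge_induct)
  case (step i) thus ?case using d1[of i] by linarith
 qed simp
 have sup: "f z + of_int (w - z) * d z <= f w" for z w
 proof (cases "z <= w")
  case True
  thus ?thesis
  proof (induction w rule: int_ge_induct)
   case (step i)
   have "of_int (i + 1 - z) * d z = of_int (i - z) * d z + d z" by (simp add: algebra_simps)
   thus ?case using step.IH dm[OF step.hyps] fs[of i] by linarith
  qed simp
 next
  case False
  hence "w <= z" by simp
  thus ?thesis
  proof (induction w rule: int_le_induct)
   case (step i)
   have "of_int (i - 1 - z) * d z = of_int (i - z) * d z - d z" by (simp add: algebra_simps)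
   moreover have "d (i - 1) <= d z" using step.hyps by (intro dm) simp
   moreover have "f i = f (i - 1) + d (i - 1)" using fs[of "i - 1"] by simp
   ultimately show ?case using step.IH by linarith
  qed simp
 qed
 have line: "f z + (v - of_int z) * d z <= ph v" for z v
 proof -
  define i where "i = \<lfloor>v\<rfloor>"
  have i: "of_int i <= v" "v <= of_int i + 1" unfolding i_def by linarith+
  show ?thesis
  proof (cases "z <= i")
   case True
   have "(v - of_int i) * d z <= (v - of_int i) * d i" using i(1) dm[OF True] by (intro mult_left_mono) auto
   thus ?thesis using sup[of z i] unfolding ph_def i_def[symmetric] by (simp add: algebra_simps)
  next
   case False
   hence "(v - of_int i - 1) * d z <= (v - of_int i - 1) * d i" using i(2) dm[of i z] by (intro mult_left_mono_neg) auto
   thus ?thesis using sup[of z "i + 1"] fs[of i] unfolding ph_def i_def[symmetric] by (simp add: algebra_simps)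
  qed
 qed
 have "mono ph"
 proof (rule monoI)
  fix x y :: real assume "x <= y"
  hence "0 <= (y - x) * d \<lfloor>x\<rfloor>" using d0 by simp
  thus "ph x <= ph y" using line[of "\<lfloor>x\<rfloor>" y] unfolding ph_def[of x] by (simp add: algebra_simps)
 qed
 moreover have "convex_on UNIV ph"
 proof (rule convex_onI)
  fix t x y :: real assume t: "0 < t" "t < 1"
  let ?w = "(1 - t) *\<^sub>R x + t *\<^sub>R y" let ?z = "\<lfloor>?w\<rfloor>"
  have "ph ?w = (1 - t) * (f ?z + (x - of_int ?z) * d ?z) + t * (f ?z + (y - of_int ?z) * d ?z)"
   unfolding ph_def by (simp add: algebra_simps)
  also have "... <= (1 - t) * ph x + t * ph y" using t by (intro add_mono mult_left_mono line) auto
  finally show "ph ?w <= (1 - t) * ph x + t * ph y" .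
 qed simp
 moreover have "ALL z. ph (real_of_int z) = f z" by (simp add: ph_def)
 ultimately show ?thesis by blast
qed

text \<open>The interpolation agrees with the nonnegative \<open>F\<close> at integers, so its
  extended expectations exist and are nonnegative integrals.\<close>

lemma icx_le_discrete:
 fixes F :: "int => ennreal"
 assumes icx: "icx_le M (%om. real_of_int (X om)) M' (%om. real_of_int (Y om))"
  and F: "!!z. F z < top" "!!z. F z <= F (z + 1)" "!!z. 2 * F (z + 1) <= F (z + 2) + F z"
 shows "(\<integral>\<^sup>+om. F (X om) \<partial>M) <= (\<integral>\<^sup>+om. F (Y om) \<partial>M')"
proof -
 define f where "f z = enn2real (F z)" for z
 have f: "F z = ennreal (f z)" "0 <= f z" for z using F(1)[of z] by (simp_all add: f_def)
 have "f z <= f (z + 1)" for z using F(2)[of z] f(2) by (simp add: f(1))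
 moreover have "2 * f (z + 1) <= f (z + 2) + f z" for z
 proof -
  have "ennreal (f (z + 1) + f (z + 1)) <= ennreal (f (z + 2) + f z)"
   using F(3)[of z] f(2) by (simp only: f(1) mult_2 ennreal_plus)
  thus ?thesis using f(2)[of z] f(2)[of "z + 2"] by (simp only: ennreal_le_iff add_nonneg_nonneg mult_2)
 qed
 ultimately obtain ph where ph: "mono ph" "convex_on UNIV ph" "!!z. ph (real_of_int z) = f z"
  using convex_extension[of f] by blast
 have neg: "ennreal (- ph (real_of_int z)) = 0" for z using f(2)[of z] by (simp add: ph(3) ennreal_neg)
 have "expectation_exists N (%om. ph (real_of_int (Z om)))" for N :: "'c measure" and Z
  unfolding expectation_exists_def by (simp add: neg)
 moreover have "expectation_exists N (%om. ph (real_of_int (Z om)))" for N :: "'d measure" and Z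
  unfolding expectation_exists_def by (simp add: neg)
 ultimately have "ext_expectation M (%om. ph (real_of_int (X om))) <= ext_expectation M' (%om. ph (real_of_int (Y om)))"
  using icx ph(1,2) unfolding icx_le_def by (simp add: expectation_exists_def neg)
 moreover have "ennreal (- f z) = 0" for z using f(2)[of z] by (simp add: ennreal_neg)
 ultimately show ?thesis
  unfolding ext_expectation_def by (simp add: ph(3) f(1)[symmetric] zero_ennreal.rep_eq less_eq_ennreal.rep_eq)
qed

text \<open>The coordinate laws are exchanged one at a time while the other coordinates are held
  fixed, which is why the hypothesis refers to every \<open>ze\<close>.\<close>

lemma Pi_pmf_coordinatewise_mono:
 assumes "finite R"
  and "!!x ze. x : R ==> (\<integral>\<^sup>+z. F (ze(x := z)) \<partial>measure_pmf (p x)) <= (\<integral>\<^sup>+z. F (ze(x := z)) \<partial>measure_pmf (p' x))"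
 shows "(\<integral>\<^sup>+ze. F ze \<partial>Pi_pmf R d p) <= (\<integral>\<^sup>+ze. F ze \<partial>Pi_pmf R d p')"
 using assms
proof (induction R arbitrary: F rule: finite_induct)
 case (insert x R)
 let ?P = "Pi_pmf R d p" and ?P' = "Pi_pmf R d p'"
 have swap: "(\<integral>\<^sup>+y. \<integral>\<^sup>+f. H y f \<partial>measure_pmf B \<partial>measure_pmf A) = (\<integral>\<^sup>+f. \<integral>\<^sup>+y. H y f \<partial>measure_pmf A \<partial>measure_pmf B)" for H A B
 proof -
  have "(\<integral>\<^sup>+y. \<integral>\<^sup>+f. H y f \<partial>measure_pmf B \<partial>measure_pmf A) = (\<integral>\<^sup>+w. H (fst w) (snd w) \<partial>pair_pmf A B)"
   by (simp add: nn_integral_pair_pmf')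
  also have "... = (\<integral>\<^sup>+w. H (snd w) (fst w) \<partial>pair_pmf B A)"
   by (subst pair_commute_pmf) (simp add: nn_integral_map_pmf case_prod_unfold)
  also have "... = (\<integral>\<^sup>+f. \<integral>\<^sup>+y. H y f \<partial>measure_pmf A \<partial>measure_pmf B)" by (simp add: nn_integral_pair_pmf')
  finally show ?thesis .
 qed
 have "(\<integral>\<^sup>+ze. F ze \<partial>Pi_pmf (insert x R) d p) = (\<integral>\<^sup>+y. \<integral>\<^sup>+f. F (f(x := y)) \<partial>?P \<partial>p x)"
  using insert.hyps by (simp add: Pi_pmf_insert nn_integral_map_pmf nn_integral_pair_pmf')
 also have "... <= (\<integral>\<^sup>+y. \<integral>\<^sup>+f. F (f(x := y)) \<partial>?P' \<partial>p x)"
 proof (rule nn_integral_mono, rule insert.IH)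
  fix y z ze assume z: "z : R"
  hence ne: "z ~= x" using insert.hyps by blast
  show "(\<integral>\<^sup>+w. F ((ze(z := w))(x := y)) \<partial>measure_pmf (p z)) <= (\<integral>\<^sup>+w. F ((ze(z := w))(x := y)) \<partial>measure_pmf (p' z))"
   unfolding fun_upd_twist[OF ne] by (rule insert.prems) (use z in simp)
 qed
 also have "... = (\<integral>\<^sup>+f. \<integral>\<^sup>+y. F (f(x := y)) \<partial>p x \<partial>?P')" by (rule swap)
 also have "... <= (\<integral>\<^sup>+f. \<integral>\<^sup>+y. F (f(x := y)) \<partial>p' x \<partial>?P')" by (intro nn_integral_mono insert.prems) simp
 also have "... = (\<integral>\<^sup>+y. \<integral>\<^sup>+f. F (f(x := y)) \<partial>?P' \<partial>p' x)" by (rule swap[symmetric])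
 also have "... = (\<integral>\<^sup>+ze. F ze \<partial>Pi_pmf (insert x R) d p')"
  using insert.hyps by (simp add: Pi_pmf_insert nn_integral_map_pmf nn_integral_pair_pmf')
 finally show ?case .
qed simp

text \<open>Adding \<open>m\<close> particles of each type at \<open>x\<close> changes nothing, which turns the negative values of the
 coordinate at \<open>x\<close> into nonnegative numbers of tokens.\<close>

lemma kill_expect_coordinate:
 assumes "finite R" "x : R" and z: "0 <= z + int m"
 shows "kill_expect Q N c g R (ze(x := z)) = expect Q N c g (static N ((B_kill R ze)(x := enat m))) 0
  (replicate_mset (nat (z + int m)) (x, 0) + A_start (R - {x}) ze)"
proof -
 let ?a = "(B_kill R ze)(x := enat m)"
 define q where "q = m - nat (- z)"
 have q: "nat (z + int m) = q + nat z" "m - q = nat (- z)" "q <= m" using z by (simp_all add: q_def)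
 have "expect Q N c g (static N ?a) 0 (replicate_mset (nat (z + int m)) (x, 0) + A_start (R - {x}) ze) =
   expect Q N c g (static N ?a) 0 (replicate_mset q (x, 0) + (replicate_mset (nat z) (x, 0) + A_start (R - {x}) ze))"
 proof -
  have "replicate_mset (q + nat z) (x, 0::nat) = replicate_mset q (x, 0) + replicate_mset (nat z) (x, 0)" by (induct q) simp_all
  thus ?thesis unfolding q(1) by (simp only: add.assoc)
 qed
 also have "... = expect Q N c g (static N (?a(x := ?a x - enat q))) 0 (replicate_mset (nat z) (x, 0) + A_start (R - {x}) ze)"
  using q(3) by (intro expect_cancel_replicate) simp
 also have "?a(x := ?a x - enat q) = B_kill R (ze(x := z))" using assms(2) q(2) by (auto simp: B_kill_def fun_eq_iff)
 also have "replicate_mset (nat z) (x, 0) + A_start (R - {x}) ze = A_start R (ze(x := z))"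
  unfolding A_start_def sum.remove[OF assms(1,2)] by (intro arg_cong2[where f = "(+)"] sum.cong) auto
 finally show ?thesis by (rule sym)
qed

lemma kill_expect_convex:
 fixes c :: "'v => nat => real"
 assumes c: "!!y j. 0 <= c y j" "!!y i j. i <= j ==> c y j <= c y i" and g: "mono g"
  and conv: "!!v d d'. 0 <= d ==> 0 <= d' ==> g (v + d) + g (v + d') <= g (v + d + d') + g v"
  and R: "finite R" "x : R"
 shows "kill_expect Q N c g R (ze(x := z)) <= kill_expect Q N c g R (ze(x := z + 1))"
  and "2 * kill_expect Q N c g R (ze(x := z + 1)) <= kill_expect Q N c g R (ze(x := z + 2)) + kill_expect Q N c g R (ze(x := z))"
proof -
 \<comment> \<open>With \<open>m\<close> pairs added at \<open>x\<close>, the values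
   \<open>z\<close>, \<open>z + 1\<close> and \<open>z + 2\<close> become numbers of tokens in one
   common environment.\<close>
 define m where "m = nat (- z)"
 define j where "j = nat (z + int m)"
 have z: "0 <= z + int m" by (simp add: m_def)
 have n: "nat (z + int m) = j" "nat (z + 1 + int m) = Suc j" "nat (z + 2 + int m) = Suc (Suc j)" using z by (simp_all add: j_def)
 let ?b = "static N ((B_kill R ze)(x := enat m))" and ?M = "replicate_mset j (x, 0) + A_start (R - {x}) ze"
 have e: "kill_expect Q N c g R (ze(x := z)) = expect Q N c g ?b 0 ?M"
   "kill_expect Q N c g R (ze(x := z + 1)) = expect Q N c g ?b 0 (add_mset (x, 0) ?M)"
   "kill_expect Q N c g R (ze(x := z + 2)) = expect Q N c g ?b 0 (add_mset (x, 0) (add_mset (x, 0) ?M))"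
  using kill_expect_coordinate[OF R z, of Q N c g ze] kill_expect_coordinate[OF R, of "z + 1" m Q N c g ze]
   kill_expect_coordinate[OF R, of "z + 2" m Q N c g ze] z by (simp_all only: n) (simp_all add: n)
 have "expect Q N c g ?b 0 ?M <= expect Q N c g ?b 0 (?M + {#(x, 0)#})"
  by (rule expect_mono[OF c g]) (simp_all add: multiset.rel_refl no_later_def)
 thus "kill_expect Q N c g R (ze(x := z)) <= kill_expect Q N c g R (ze(x := z + 1))" unfolding e by simp
 show "2 * kill_expect Q N c g R (ze(x := z + 1)) <= kill_expect Q N c g R (ze(x := z + 2)) + kill_expect Q N c g R (ze(x := z))"
  unfolding e by (rule expect_convex[OF c g conv admissible_static])
qed

text \<open>Subadditivity of the limsup preserves midpoint convexity although convergence in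
  \<open>k\<close> is not known; a liminf would not do.\<close>

lemma limsup_midpoint:
 fixes u a b :: "nat => ennreal"
 assumes "!!k. 2 * u k <= a k + b k"
 shows "2 * limsup u <= limsup a + limsup b"
proof -
 have lim: "(%n. SUP k\<in>{n..}. f k) ~~> limsup f" for f :: "nat => ennreal"
  unfolding limsup_INF_SUP by (rule LIMSEQ_INF) (auto simp: decseq_def intro!: SUP_subset_mono)
 have "2 * (SUP k\<in>{n..}. u k) <= (SUP k\<in>{n..}. a k) + (SUP k\<in>{n..}. b k)" for n
  unfolding SUP_mult_left_ennreal
  by (intro SUP_least order_trans[OF assms] add_mono SUP_upper)
 thus ?thesis
  by (intro LIMSEQ_le[OF ennreal_tendsto_cmult[OF _ lim] tendsto_add[OF lim lim]]) auto
qed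

text \<open>Both \<open>v + d\<close> and \<open>v + d'\<close> are convex combinations of
  \<open>v\<close> and \<open>v + d + d'\<close>, with complementary weights.\<close>

lemma convex_increment:
 fixes ps :: "real => real"
 assumes conv: "convex_on UNIV ps" and d: "0 <= d" "0 <= d'"
 shows "ps (v + d) + ps (v + d') <= ps (v + d + d') + ps v"
proof (cases "d + d' = 0")
 case True
 hence "d = 0" "d' = 0" using d by linarith+
 thus ?thesis by simp
next
 case False
 define s where "s = d + d'"
 have s: "0 < s" using d False by (simp add: s_def)
 define t where "t = d / s"
 have t: "0 <= t" "t <= 1" "t * s = d" using d s by (simp_all add: t_def s_def)
 have "ps ((1 - t) *\<^sub>R v + t *\<^sub>R (v + s)) <= (1 - t) * ps v + t * ps (v + s)" by (rule convex_onD[OF conv t(1,2)]) simp_all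
 moreover have "ps ((1 - (1 - t)) *\<^sub>R v + (1 - t) *\<^sub>R (v + s)) <= (1 - (1 - t)) * ps v + (1 - t) * ps (v + s)"
  by (rule convex_onD[OF conv]) (use t in simp_all)
 moreover have "(1 - t) *\<^sub>R v + t *\<^sub>R (v + s) = v + d" "(1 - (1 - t)) *\<^sub>R v + (1 - t) *\<^sub>R (v + s) = v + d'"
  using t(3) by (simp_all add: algebra_simps s_def)
 ultimately show ?thesis by (simp add: s_def algebra_simps)
qed

lemma (in sampled_dlas) nn_integral_start_law:
 assumes "x : V"
 shows "(\<integral>\<^sup>+z. F z \<partial>start_law x) = (\<integral>\<^sup>+om. F (\<xi>0 x om) \<partial>M)"
proof -
 have "(\<integral>\<^sup>+om. F (\<xi>0 x om) * indicator (space M) om \<partial>M) = 1 * (\<integral>\<^sup>+z. F z \<partial>start_law x)"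
 proof (rule nn_integral_discrete[where C = UNIV])
  have "\<xi>0 x -` {z} Int space M : sets M" for z by (rule measurable_sets[OF \<xi>0_measurable[OF assms]]) simp
  moreover have "\<xi>0 x -` {z} Int space M = {om : space M. \<xi>0 x om = z}" for z by auto
  ultimately show "{om : space M. \<xi>0 x om = z} : sets M" for z by simp
  show "emeasure M {om : space M. \<xi>0 x om = z} = 1 * ennreal (pmf (start_law x) z)" for z
   by (simp add: pmf_start_law[OF assms] emeasure_eq_measure)
 qed auto
 moreover have "(\<integral>\<^sup>+om. F (\<xi>0 x om) * indicator (space M) om \<partial>M) = (\<integral>\<^sup>+om. F (\<xi>0 x om) \<partial>M)"
  by (rule nn_integral_cong) simp
 ultimately show ?thesis by simp
qed

text \<open>Scaled simple functions below \<open>f\<close> lie below the scaled \<open>f\<close>,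
  whether or not \<open>f\<close> is measurable.\<close>

lemma nn_integral_cmult_le: "ennreal s * (\<integral>\<^sup>+om. f om \<partial>M) <= (\<integral>\<^sup>+om. ennreal s * f om \<partial>M)" if "0 < s"
proof -
 have "ennreal s * (\<integral>\<^sup>+om. f om \<partial>M) = (SUP g \<in> {g. simple_function M g & g <= f}. ennreal s * integral\<^sup>S M g)"
  unfolding nn_integral_def by (simp add: SUP_mult_left_ennreal)
 also have "... <= (\<integral>\<^sup>+om. ennreal s * f om \<partial>M)"
 proof (rule SUP_least)
  fix g assume "g : {g. simple_function M g & g <= f}"
  hence g: "simple_function M g" "!!om. g om <= f om" by (auto simp: le_fun_def)
  have "ennreal s * integral\<^sup>S M g = (\<integral>\<^sup>+om. ennreal s * g om \<partial>M)"
   using g(1) by (simp add: nn_integral_eq_simple_integral[symmetric] nn_integral_cmult borel_measurable_simple_function)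
  also have "... <= (\<integral>\<^sup>+om. ennreal s * f om \<partial>M)" by (intro nn_integral_mono mult_left_mono g(2)) simp
  finally show "ennreal s * integral\<^sup>S M g <= (\<integral>\<^sup>+om. ennreal s * f om \<partial>M)" .
 qed
 finally show ?thesis .
qed

text \<open>Truncation requires a bounded Lipschitz function, but capping destroys convexity. So the
  cap at \<open>a\<close> is used only to pass from the first system to a killed one and is then
  dropped; the coordinatewise comparison is done for the uncapped function. For the killed second
  system caps at \<open>m\<close> are inserted again and removed by monotone convergence.\<close>

theorem capped_comparison:
 fixes ps :: "real => real"
 assumes A: "sampled_dlas M G \<xi>0 S h \<xi> Q dt n T'" and B: "sampled_dlas M' G \<xi>0' S' h' \<xi>' Q dt n T'"
  and lb: "level_bounds K H Q (%k. Suc (n k)) (%k. occ_weight H T (dt k)) (%k. occ_weight H T2 (dt k))"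
  and H: "finite H" "H <= verts G" and T: "0 <= T" "!!k. T <= real (Suc (n k)) * dt k"
  and T2: "0 < T2" "!!k. T2 <= real (Suc (n k)) * dt k"
  and icx: "ALL x:verts G. icx_le M (%om. real_of_int (\<xi>0 x om)) M' (%om. real_of_int (\<xi>0' x om))"
  and ps: "mono ps" "convex_on UNIV ps" "!!v. 0 <= ps v"
 shows "(\<integral>\<^sup>+om. ennreal (ps (min (enn2real (occupation_time H (\<xi> om) T)) a)) \<partial>M) \<le>
  (\<integral>\<^sup>+om. ennreal (ps (enn2real (occupation_time H (\<xi>' om) T))) \<partial>M')"
proof -
 interpret A: sampled_dlas M G \<xi>0 S h \<xi> Q dt n T' by (rule A)
 interpret B: sampled_dlas M' G \<xi>0' S' h' \<xi>' Q dt n T' by (rule B)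
 let ?N = "%k. Suc (n k)" and ?c = "%k. occ_weight H T (dt k)"
 \<comment> \<open>Division by \<open>s\<close> bounds the capped function by \<open>1\<close>; by
   convexity the slopes of \<open>ps\<close> to the left of \<open>a\<close> are at most its
   increment over \<open>[a, a + 1]\<close>, so the quotient also has Lipschitz constant
   \<open>1\<close> there.\<close>
 define s where "s = max 1 (max (ps a) (ps (a + 1) - ps a))"
 have s: "0 < s" "ps a <= s" "ps (a + 1) - ps a <= s" by (simp_all add: s_def)
 define f where "f v = ps v / s" for v
 have f: "mono f" "!!v. 0 <= f v" using ps(1,3) s(1) by (auto simp: f_def mono_def divide_right_mono)
 have fconv: "f (v + d) + f (v + d') <= f (v + d + d') + f v" if "0 <= d" "0 <= d'" for v d d'
  using divide_right_mono[OF convex_increment[OF ps(2) that, of v] less_imp_le[OF s(1)]] by (simp add: f_def add_divide_distrib)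
 have fcont: "continuous_on UNIV f" unfolding f_def
  by (intro continuous_intros convex_on_continuous[OF open_UNIV ps(2)]) (use s in simp)
 have capc: "continuous_on UNIV (%v. f (min v b))" for b
  by (rule continuous_on_compose2[OF fcont]) (auto intro!: continuous_intros)
 have capm: "mono (%v. f (min v b))" for b using f(1) by (auto simp: mono_def intro!: min.mono)
 have cap1: "f (min v a) <= 1" for v
 proof -
  have "ps (min v a) <= s" using monoD[OF ps(1), of "min v a" a] s(2) by simp
  thus ?thesis using s(1) by (simp add: f_def)
 qed
 have slope: "ps y - ps x <= s * (y - x)" if xy: "x < y" "y <= a" for x y
 proof -
  define l where "l = a + 1 - x"
  have l: "0 < l" "y - x <= l - 1" using xy by (simp_all add: l_def)
  have conv: "l * ps (x + r) <= (l - r) * ps x + r * ps (a + 1)" if r: "0 <= r" "r <= l" for r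
  proof -
   have "ps ((1 - r / l) *\<^sub>R x + (r / l) *\<^sub>R (a + 1)) <= (1 - r / l) * ps x + (r / l) * ps (a + 1)"
    by (rule convex_onD[OF ps(2)]) (use r l in simp_all)
   moreover have "(1 - r / l) *\<^sub>R x + (r / l) *\<^sub>R (a + 1) = x + r"
   proof -
    have a1: "a + 1 = x + l" by (simp add: l_def)
    have "(1 - r / l) * x + (r / l) * (x + l) = x + r" using l(1) by (simp add: field_simps)
    thus ?thesis by (simp only: a1 real_scaleR_def)
   qed
   ultimately have "l * ps (x + r) <= l * ((1 - r / l) * ps x + (r / l) * ps (a + 1))" using l by simp
   also have "... = (l - r) * ps x + r * ps (a + 1)" using l by (simp add: field_simps)
   finally show ?thesis .
  qed
  have "ps (a + 1) - ps x <= l * (ps (a + 1) - ps a)"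
  proof -
   have "x + (l - 1) = a" by (simp add: l_def)
   thus ?thesis using conv[of "l - 1"] l xy by (simp add: algebra_simps)
  qed
  also have "... <= l * s" using s(3) l by (intro mult_left_mono) auto
  finally have "(y - x) * (ps (a + 1) - ps x) <= (y - x) * (l * s)" using xy by (intro mult_left_mono) auto
  moreover have "l * (ps y - ps x) <= (y - x) * (ps (a + 1) - ps x)"
   using conv[of "y - x"] l xy by (simp add: algebra_simps)
  ultimately have "l * (ps y - ps x) <= l * (s * (y - x))" by (simp add: mult.commute mult.left_commute)
  thus ?thesis using l by simp
 qed
 have lip: "f (min (v + d) a) <= f (min v a) + min 1 d" if d: "0 <= d" for v d
 proof -
  have "f (min (v + d) a) <= f (min v a) + d"
  proof (cases "min v a < min (v + d) a")
   case True
   have "ps (min (v + d) a) - ps (min v a) <= s * (min (v + d) a - min v a)" by (rule slope[OF True]) simp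
   also have "... <= s * d" using s(1) d by (intro mult_left_mono) auto
   finally show ?thesis using s(1) by (simp add: f_def field_simps)
  next
   case False
   hence "min (v + d) a = min v a" using d by linarith
   thus ?thesis using d by simp
  qed
  moreover have "f (min (v + d) a) <= f (min v a) + 1" using cap1[of "v + d"] f(2)[of "min v a"] by linarith
  ultimately show ?thesis by linarith
 qed
 have c: "0 <= ?c k y j" "i <= j ==> ?c k y j <= ?c k y i" for k y i j
  using cell_weight_props(1,3)[OF A.dt] by (simp_all add: occ_weight_def)
 have main: "(\<integral>\<^sup>+om. ennreal (f (min (A.final H T om) a)) \<partial>M) <= (\<integral>\<^sup>+om. ennreal (f (B.final H T om)) \<partial>M')"
 proof (rule ennreal_le_epsilon)
  fix e :: real assume e: "0 < e"
  obtain R where R: "finite R" "R <= A.V" and left: "(\<integral>\<^sup>+om. ennreal (f (min (A.final H T om) a)) \<partial>M) \<le>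
    (\<integral>\<^sup>+ze. limsup (%k. kill_expect (Q k) (?N k) (?c k) (%v. ennreal (f (min v a))) R ze) \<partial>Pi_pmf R 0 A.start_law) + ennreal e"
   using A.killed_approximation[OF lb H T T2 capc f(2) cap1 capm lip e] by blast
  define U where "U ze = limsup (%k. kill_expect (Q k) (?N k) (?c k) (%v. ennreal (f v)) R ze)" for ze
  define Um where "Um m ze = limsup (%k. kill_expect (Q k) (?N k) (?c k) (%v. ennreal (f (min v (real m)))) R ze)" for m :: nat and ze
  have mono_g: "kill_expect (Q k) (?N k) (?c k) g R ze <= kill_expect (Q k) (?N k) (?c k) g' R ze" if "!!v. g v <= g' v" for k ze and g g' :: "real => ennreal"
   unfolding expect_def by (intro nn_integral_mono that)
  have le: "snd z <= real (size (A_start R ze)) * T"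
   if "z : set_pmf (run (Q k) (?N k) (?c k) (static (?N k) (B_kill R ze)) 0 (A_start R ze))" for z k ze
  proof -
   have "snd z <= 0 + real (size (A_start R ze)) * (\<Sum>j<?N k. cell_weight T (dt k) j)"
    by (rule run_bound_0[OF admissible_static _ _ A_start_0 that])
     (use cell_weight_props(1)[OF A.dt] in \<open>simp_all add: occ_weight_def\<close>)
   also have "... <= 0 + real (size (A_start R ze)) * T"
    by (intro add_left_mono mult_left_mono cell_weight_props(6)[OF A.dt T(1)]) simp
   finally show ?thesis by simp
  qed
  have U_fin: "U ze < top" for ze
  proof -
   let ?m = "real (size (A_start R ze)) * T"
   have "kill_expect (Q k) (?N k) (?c k) (%v. ennreal (f v)) R ze <= ennreal (f ?m)" for k
   proof -
    have "kill_expect (Q k) (?N k) (?c k) (%v. ennreal (f v)) R ze \<le>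
      (\<integral>\<^sup>+z. ennreal (f ?m) \<partial>run (Q k) (?N k) (?c k) (static (?N k) (B_kill R ze)) 0 (A_start R ze))"
     unfolding expect_def by (intro nn_integral_mono_AE) (auto simp: AE_measure_pmf_iff intro!: ennreal_leI monoD[OF f(1)] le)
    thus ?thesis by (simp add: measure_pmf.emeasure_space_1)
   qed
   hence "U ze <= ennreal (f ?m)" unfolding U_def by (intro Limsup_bounded) (simp add: eventually_sequentially)
   thus ?thesis by (rule le_less_trans) simp
  qed
  have fm: "mono (%v. ennreal (f v))" using f(1) by (auto simp: mono_def intro!: ennreal_leI)
  have fc: "ennreal (f (v + d)) + ennreal (f (v + d')) <= ennreal (f (v + d + d')) + ennreal (f v)" if "0 <= d" "0 <= d'" for v d d'
   using ennreal_leI[OF fconv[OF that, of v]] f(2) by (simp add: ennreal_plus)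
  have "(\<integral>\<^sup>+ze. limsup (%k. kill_expect (Q k) (?N k) (?c k) (%v. ennreal (f (min v a))) R ze) \<partial>Pi_pmf R 0 A.start_law) <= (\<integral>\<^sup>+ze. U ze \<partial>Pi_pmf R 0 A.start_law)"
   unfolding U_def by (intro nn_integral_mono Limsup_mono always_eventually allI mono_g ennreal_leI monoD[OF f(1)]) simp
  also have "... <= (\<integral>\<^sup>+ze. U ze \<partial>Pi_pmf R 0 B.start_law)"
  proof (rule Pi_pmf_coordinatewise_mono[OF R(1)])
   fix x ze assume x: "x : R"
   hence xV: "x : A.V" using R(2) by blast
   have "(\<integral>\<^sup>+om. U (ze(x := \<xi>0 x om)) \<partial>M) <= (\<integral>\<^sup>+om. U (ze(x := \<xi>0' x om)) \<partial>M')"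
   proof (rule icx_le_discrete[where F = "%z. U (ze(x := z))", OF icx[rule_format, OF xV] U_fin])
    show "U (ze(x := z)) <= U (ze(x := z + 1))" for z
     unfolding U_def by (intro Limsup_mono always_eventually allI kill_expect_convex(1)[OF c fm fc R(1) x])
    show "2 * U (ze(x := z + 1)) <= U (ze(x := z + 2)) + U (ze(x := z))" for z
     unfolding U_def by (intro limsup_midpoint kill_expect_convex(2)[OF c fm fc R(1) x])
   qed
   thus "(\<integral>\<^sup>+z. U (ze(x := z)) \<partial>A.start_law x) <= (\<integral>\<^sup>+z. U (ze(x := z)) \<partial>B.start_law x)"
    by (simp only: A.nn_integral_start_law[OF xV] B.nn_integral_start_law[OF xV])
  qed
  also have "... <= (\<integral>\<^sup>+ze. (SUP m. Um m ze) \<partial>Pi_pmf R 0 B.start_law)"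
  proof (rule nn_integral_mono)
   fix ze
   \<comment> \<open>For a fixed configuration the killed value is at most the number of tokens
     times \<open>T\<close>, so a cap above this has no effect.\<close>
   define m where "m = nat \<lceil>real (size (A_start R ze)) * T\<rceil>"
   have m: "real (size (A_start R ze)) * T <= real m" unfolding m_def by linarith
   have "kill_expect (Q k) (?N k) (?c k) (%v. ennreal (f v)) R ze = kill_expect (Q k) (?N k) (?c k) (%v. ennreal (f (min v (real m)))) R ze" for k
   proof (rule expect_cong_support)
    fix z assume "z : set_pmf (run (Q k) (?N k) (?c k) (static (?N k) (B_kill R ze)) 0 (A_start R ze))"
    from order_trans[OF le[OF this] m] show "ennreal (f (snd z)) = ennreal (f (min (snd z) (real m)))" by (simp add: min_absorb1)
   qed
   hence eq: "U ze = Um m ze" by (simp only: U_def Um_def)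
   have "Um m ze <= (SUP i. Um i ze)" by (rule SUP_upper) simp
   thus "U ze <= (SUP m. Um m ze)" by (simp only: eq)
  qed
  also have "... = (SUP m. \<integral>\<^sup>+ze. Um m ze \<partial>Pi_pmf R 0 B.start_law)"
  proof (rule nn_integral_monotone_convergence_SUP)
   show "incseq Um"
    unfolding Um_def by (intro incseq_SucI le_funI Limsup_mono always_eventually allI mono_g ennreal_leI monoD[OF f(1)]) auto
  qed simp
  also have "... <= (\<integral>\<^sup>+om. ennreal (f (B.final H T om)) \<partial>M')"
  proof (rule SUP_least)
   fix m
   have "(\<integral>\<^sup>+ze. Um m ze \<partial>Pi_pmf R 0 B.start_law) <= (\<integral>\<^sup>+om. ennreal (f (min (B.final H T om) (real m))) \<partial>M')"
    unfolding Um_def by (rule B.killed_upper_bound[OF H T capc f(2) _ capm R, where B = "f (real m)"]) (auto intro: monoD[OF f(1)])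
   also have "... <= (\<integral>\<^sup>+om. ennreal (f (B.final H T om)) \<partial>M')" by (intro nn_integral_mono ennreal_leI monoD[OF f(1)]) simp
   finally show "(\<integral>\<^sup>+ze. Um m ze \<partial>Pi_pmf R 0 B.start_law) <= (\<integral>\<^sup>+om. ennreal (f (B.final H T om)) \<partial>M')" .
  qed
  finally show "(\<integral>\<^sup>+om. ennreal (f (min (A.final H T om) a)) \<partial>M) <= (\<integral>\<^sup>+om. ennreal (f (B.final H T om)) \<partial>M') + ennreal e"
   by (intro order_trans[OF left] add_right_mono)
 qed
 have obtain_u: "EX u. u : borel_measurable M & (AE om in M. u om = ennreal (f (min (A.final H T om) a)))"
  by (rule A.final_measurable[OF H T capc f(2) cap1])
 have sc: "ennreal (ps v) = ennreal s * ennreal (f v)" for v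
  using s(1) f(2)[of v] by (simp add: f_def ennreal_mult[symmetric])
 obtain u where u: "u : borel_measurable M" "AE om in M. u om = ennreal (f (min (A.final H T om) a))" using obtain_u by blast
 have "(\<integral>\<^sup>+om. ennreal (ps (min (A.final H T om) a)) \<partial>M) = (\<integral>\<^sup>+om. ennreal s * u om \<partial>M)"
  by (rule nn_integral_cong_AE) (use u(2) in eventually_elim, simp add: sc)
 also have "... = ennreal s * (\<integral>\<^sup>+om. u om \<partial>M)" by (rule nn_integral_cmult[OF u(1)])
 also have "... = ennreal s * (\<integral>\<^sup>+om. ennreal (f (min (A.final H T om) a)) \<partial>M)" by (simp only: nn_integral_cong_AE[OF u(2)])
 also have "... <= ennreal s * (\<integral>\<^sup>+om. ennreal (f (B.final H T om)) \<partial>M')" by (rule mult_left_mono[OF main]) simp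
 also have "... <= (\<integral>\<^sup>+om. ennreal s * ennreal (f (B.final H T om)) \<partial>M')"
  by (rule nn_integral_cmult_le[OF s(1)])
 also have "... = (\<integral>\<^sup>+om. ennreal (ps (B.final H T om)) \<partial>M')" by (simp only: sc)
 finally show ?thesis .
qed

subsection \<open>Exhausting the observed set\<close>

lemma cadlag_times_measurable:
 fixes s :: "'v particle => real => 'v"
 assumes "cadlag_path V (s p)"
 shows "{t : {0..T}. s p t = x} : sets borel"
proof -
 have "well_sampled_limit (%k. (1 / 2) ^ k) T s {p}"
  by (rule well_sampled_limit_cadlag[where V = V]) (use assms in \<open>simp_all add: LIMSEQ_realpow_zero\<close>)
 then obtain k where "well_sampled s {p} T ((1 / 2) ^ k)"
  unfolding well_sampled_limit_def eventually_sequentially by blast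
 thus ?thesis by (rule well_sampled_measurable) simp
qed

lemma finite_system_bound:
 assumes R: "finite R" "R <= V" and H: "finite H" and T: "0 <= T" and inst: "instructions V s h"
 shows "occupation_time H (finite_dlas V (%y. if y : R then ze y else 0) s h) T \<le>
  ennreal T * (SUM x:R. ennreal (real_of_int (max (ze x) 0)))"
proof -
 let ?P = "initial_particles V (%y. if y : R then ze y else 0)"
 have P: "finite ?P" by (rule initial_particles_finite[OF R])
 have lab: "?P <= labels V" by (auto simp: initial_particles_def labels_def)
 have cad: "cadlag_path V (s p)" if "p : ?P" for p using inst lab that unfolding instructions_def by blast
 have rc: "\<forall>\<^sub>F r in at_right t. s p r = s p t" if "p : ?P" "0 <= t" for p t
  using cad[OF that(1)] that(2) unfolding cadlag_path_def by blast
 have me: "{t : {0..T}. s p t = x} : sets borel" if "p : ?P" for p x by (rule cadlag_times_measurable[where s = s and p = p, OF cad[OF that]])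
 obtain ta where occ: "occupation_time H (finite_dlas V (%y. if y : R then ze y else 0) s h) T =
   (\<integral>\<^sup>+t\<in>{0..T}. ennreal (real (card {p : alive ?P ta t. type_A p & s p t : H})) \<partial>lborel)"
  by (rule finite_dlas_occupation[OF P rc me H])
 let ?m = "SUM x:R. nat (ze x)"
 have ca: "card {p : ?P. type_A p} = ?m" unfolding initial_A_particles[OF R(2)] using R(1) by simp
 have fP: "finite {p : ?P. type_A p}" using P by (rule finite_subset[rotated]) blast
 have "card {p : alive ?P ta t. type_A p & s p t : H} <= card {p : ?P. type_A p}" for t
  by (rule card_mono[OF fP]) (unfold alive_def, blast)
 hence "card {p : alive ?P ta t. type_A p & s p t : H} <= ?m" for t unfolding ca .
 hence "occupation_time H (finite_dlas V (%y. if y : R then ze y else 0) s h) T <= (\<integral>\<^sup>+t\<in>{0..T}. ennreal (real ?m) \<partial>lborel)"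
  unfolding occ by (intro nn_integral_mono mult_right_mono ennreal_leI of_nat_mono) simp_all
 also have "... = ennreal (real ?m) * ennreal T" using T by (simp add: nn_integral_cmult_indicator)
 also have "ennreal (real ?m) = (SUM x:R. ennreal (real_of_int (max (ze x) 0)))"
 proof -
  have "real ?m = (SUM x:R. real_of_int (max (ze x) 0))" unfolding of_nat_sum by (rule sum.cong) (auto simp: max_def)
  thus ?thesis by (simp add: sum_ennreal)
 qed
 finally show ?thesis by (simp only: mult.commute)
qed

lemma occupation_time_SUP:
 "occupation_time H x T = (SUP F\<in>{F. finite F & F <= H}. occupation_time F x T)"
proof -
 have fin: "occupation_time F x T = (SUM y:F. \<integral>\<^sup>+t\<in>{0..T}. ennreal (if 0 < x t y then real_of_int (x t y) else 0) \<partial>lborel)" if "finite F" for F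
  unfolding occupation_time_def by (rule infsum_finite[OF that])
 show ?thesis
  unfolding occupation_time_def[of H] by (subst nonneg_infsum_complete) (auto intro!: SUP_cong simp: fin)
qed

lemma occupation_time_subset: "H' <= H ==> occupation_time H' x T <= occupation_time H x T"
 unfolding occupation_time_SUP[of H'] occupation_time_SUP[of H] by (rule SUP_subset_mono) auto

locale exhausted_dlas = sampled_dlas M G \<xi>0 S h \<xi> Q dt n T'
 for M :: "'w measure" and G :: "('v, 'e) pre_digraph" and \<xi>0 S h \<xi> Q dt n T' +
 fixes Rs :: "nat => 'v set" and H :: "'v set" and T :: real
 assumes Rs: "!!m. finite (Rs m)" "!!m. Rs m <= verts G" "!!m. Rs m <= Rs (Suc m)" "(\<Union>m. Rs m) = verts G"
   "!!A. finite A ==> A <= verts G ==> EX m. A <= Rs m"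
  and H: "H <= verts G" and T: "0 <= T" "!!k. T <= real (Suc (n k)) * dt k"
  and fin: "AE om in M. finite H \<or> total_A (verts G) (%x. \<xi>0 x om) < \<infinity>"
begin

abbreviation "Hs m \<equiv> H Int Rs m"

lemma Hs: "finite (Hs m)" "Hs m <= V" using Rs(1) H by auto

lemma occupation_Hs: "occupation_time H x T = (SUP m. occupation_time (Hs m) x T)"
proof (rule antisym)
 show "occupation_time H x T <= (SUP m. occupation_time (Hs m) x T)"
  unfolding occupation_time_SUP[of H]
 proof (rule SUP_least)
  fix F assume "F : {F. finite F & F <= H}"
  then obtain m where "F <= Hs m" using Rs(5)[of F] H by blast
  thus "occupation_time F x T <= (SUP m. occupation_time (Hs m) x T)"
   by (rule order_trans[OF occupation_time_subset]) (rule SUP_upper, simp)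
 qed
 show "(SUP m. occupation_time (Hs m) x T) <= occupation_time H x T"
  by (intro SUP_least occupation_time_subset) blast
qed

text \<open>If \<open>H\<close> is finite, its occupation is that of a finite system. Otherwise the
  occupation of each \<open>Hs k\<close> is at most \<open>T\<close> times the total number of
  A-particles, a bound that does not depend on \<open>k\<close>.\<close>

lemma occupation_finite: "AE om in M. occupation_time H (\<xi> om) T < \<infinity>"
proof -
 have ex: "AE om in M. \<forall>\<^sub>F m in sequentially. occupation (Hs k) T (Rs m) om = final (Hs k) T om &
   occupation_time (Hs k) (\<xi> om) T = occupation_time (Hs k) (finite_dlas V (%y. if y : Rs m then \<xi>0 y om else 0) (%p. S p om) (%p. h p om)) T" for k
  by (rule exhaustion_limit(3)[OF Rs(1-4) Hs T, where g = "%_. 0" and B = 0]) simp_all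
 have "AE om in M. ALL k. \<forall>\<^sub>F m in sequentially. occupation (Hs k) T (Rs m) om = final (Hs k) T om &
   occupation_time (Hs k) (\<xi> om) T = occupation_time (Hs k) (finite_dlas V (%y. if y : Rs m then \<xi>0 y om else 0) (%p. S p om) (%p. h p om)) T"
  unfolding AE_all_countable by (intro allI ex)
 with valid_instructions fin show ?thesis
 proof eventually_elim
  case (elim om)
  let ?a = "%x. ennreal (real_of_int (max (\<xi>0 x om) 0))"
  have b: "EX m. occupation_time (Hs k) (\<xi> om) T <= ennreal T * (SUM x:Rs m. ?a x)" for k
  proof -
   obtain m where m: "occupation_time (Hs k) (\<xi> om) T = occupation_time (Hs k) (finite_dlas V (%y. if y : Rs m then \<xi>0 y om else 0) (%p. S p om) (%p. h p om)) T"
    using elim(3) unfolding eventually_sequentially by blast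
   show ?thesis unfolding m by (rule exI, rule finite_system_bound[OF Rs(1,2) Hs(1) T(1) elim(1)])
  qed
  from elim(2) show ?case
  proof
   assume "finite H"
   then obtain k where "H <= Rs k" using Rs(5) H by blast
   hence "Hs k = H" by blast
   with b[of k] obtain m where m: "occupation_time H (\<xi> om) T <= ennreal T * (SUM x:Rs m. ?a x)" by metis
   also have "... < top" by (simp add: ennreal_mult_less_top sum_ennreal)
   finally show ?thesis by simp
  next
   assume tot: "total_A V (%x. \<xi>0 x om) < \<infinity>"
   have "(SUM x:Rs m. ?a x) <= total_A V (%x. \<xi>0 x om)" for m
    unfolding total_A_def by (subst nonneg_infsum_complete) (auto intro!: SUP_upper Rs)
   hence "occupation_time (Hs k) (\<xi> om) T <= ennreal T * total_A V (%x. \<xi>0 x om)" for k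
    using b[of k] by (blast intro: order_trans mult_left_mono zero_le)
   hence "occupation_time H (\<xi> om) T <= ennreal T * total_A V (%x. \<xi>0 x om)"
    unfolding occupation_Hs by (rule SUP_least)
   also have "... < top" using tot by (simp add: ennreal_mult_less_top)
   finally show ?thesis by simp
  qed
 qed
qed

lemma final_Hs: "AE om in M. (ALL m. final (Hs m) T om <= final H T om) & (%m. final (Hs m) T om) ~~> final H T om"
 using occupation_finite
proof eventually_elim
 case (elim om)
 have "incseq (%m. occupation_time (Hs m) (\<xi> om) T)" using Rs(3) by (intro incseq_SucI occupation_time_subset) blast
 hence "(%m. occupation_time (Hs m) (\<xi> om) T) ~~> occupation_time H (\<xi> om) T"
  unfolding occupation_Hs[of "\<xi> om"] by (rule LIMSEQ_SUP)
 also have "occupation_time H (\<xi> om) T = ennreal (final H T om)" using elim by simp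
 finally have "(%m. final (Hs m) T om) ~~> final H T om" by (rule tendsto_enn2real) simp
 moreover have "final (Hs m) T om <= final H T om" for m
  using elim by (intro enn2real_mono occupation_time_subset) auto
 ultimately show ?case by blast
qed

text \<open>\<open>final_measurable\<close> treats bounded continuous functions of the occupation;
  \<open>exp (- v)\<close> is one from which \<open>v\<close> can be recovered.\<close>

lemma final_Hs_measurable: "EX f. f : borel_measurable M & (AE om in M. f om = final (Hs m) T om)"
proof -
 have c: "continuous_on UNIV (%v. exp (- max 0 v) :: real)" by (intro continuous_intros)
 have e: "0 <= exp (- max 0 v)" "exp (- max 0 v) <= 1" for v :: real by simp_all
 obtain u where u: "u : borel_measurable M" "AE om in M. u om = ennreal (exp (- max 0 (final (Hs m) T om)))"
  using final_measurable[OF Hs T c e] by blast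
 have "(%om. - ln (enn2real (u om))) : borel_measurable M" using u(1) by measurable
 moreover have "AE om in M. - ln (enn2real (u om)) = final (Hs m) T om" using u(2) by eventually_elim simp
 ultimately show ?thesis by blast
qed

lemma final_measurable_H: "EX f. f : borel_measurable M & (AE om in M. f om = final H T om) & (ALL om. 0 <= f om)"
proof -
 obtain f where f: "!!m. f m : borel_measurable M" "!!m. AE om in M. f m om = final (Hs m) T om"
  using final_Hs_measurable by metis
 have all: "AE om in M. ALL m. f m om = final (Hs m) T om" using f(2) by (simp only: AE_all_countable) blast
 have "(%om. max 0 (lim (%m. f m om))) : borel_measurable M"
  by (intro borel_measurable_max borel_measurable_const borel_measurable_lim_metric f(1))
 moreover have "AE om in M. max 0 (lim (%m. f m om)) = final H T om"
  using all final_Hs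
 proof eventually_elim
  case (elim om)
  have "(%m. f m om) ~~> final H T om" using elim by simp
  hence "lim (%m. f m om) = final H T om" by (rule limI)
  thus ?case by simp
 qed
 ultimately show ?thesis by (intro exI[of _ "%om. max 0 (lim (%m. f m om))"]) simp
qed

text \<open>The occupation is nonnegative and \<open>ph\<close> increases, so \<open>ph\<close>
  stays above \<open>ph 0\<close> and its negative part is bounded. This reduces the comparison to
  the nonnegative convex function \<open>max 0 (ph v - ph 0)\<close>.\<close>

lemma ext_expectation_final:
 fixes ph :: "real => real"
 assumes ph: "mono ph" "convex_on UNIV ph"
 shows "ext_expectation M (%om. ph (final H T om)) = enn2ereal (\<integral>\<^sup>+om. ennreal (max 0 (ph (final H T om) - ph 0)) \<partial>M) + ereal (ph 0)"
proof -
 obtain f where f: "f : borel_measurable M" "AE om in M. f om = final H T om" "!!om. 0 <= f om"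
  using final_measurable_H by blast
 have cong: "(\<integral>\<^sup>+om. F (final H T om) \<partial>M) = (\<integral>\<^sup>+om. F (f om) \<partial>M)" for F
  by (rule nn_integral_cong_AE) (use f(2) in eventually_elim, simp)
 have "ph : borel_measurable borel"
  by (intro borel_measurable_continuous_onI convex_on_continuous[OF open_UNIV ph(2)])
 hence m[measurable]: "(%om. ph (f om)) : borel_measurable M" by (rule measurable_compose[OF f(1)])
 define c where "c = max 0 (- ph 0)"
 define d where "d = max 0 (ph 0)"
 define P where "P = (\<integral>\<^sup>+om. ennreal (ph (f om)) \<partial>M)"
 define N where "N = (\<integral>\<^sup>+om. ennreal (- ph (f om)) \<partial>M)"
 define I where "I = (\<integral>\<^sup>+om. ennreal (max 0 (ph (f om) - ph 0)) \<partial>M)"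
 have le: "ph 0 <= ph (f om)" for om by (rule monoD[OF ph(1) f(3)])
 have cd: "0 <= c" "0 <= d" "ph 0 = d - c" by (auto simp: c_def d_def)
 have pt: "ennreal (ph (f om)) + ennreal c = ennreal (max 0 (ph (f om) - ph 0)) + ennreal d + ennreal (- ph (f om))" for om
 proof -
  define a where "a = ph (f om)"
  have "max 0 a + c = max 0 (a - ph 0) + d + max 0 (- a)" using le[of om] unfolding a_def[symmetric] by (simp add: c_def d_def max_def)
  hence "ennreal (max 0 a + c) = ennreal (max 0 (a - ph 0) + d + max 0 (- a))" by (simp only:)
  hence "ennreal (max 0 a) + ennreal c = ennreal (max 0 (a - ph 0)) + ennreal d + ennreal (max 0 (- a))"
   using cd(1,2) by (simp only: ennreal_plus max.cobounded1 add_nonneg_nonneg)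
  thus ?thesis unfolding a_def[symmetric] by simp
 qed
 have "P + ennreal c = (\<integral>\<^sup>+om. ennreal (ph (f om)) + ennreal c \<partial>M)"
  unfolding P_def by (subst nn_integral_add) (simp_all add: emeasure_space_1)
 also have "... = I + ennreal d + N"
  unfolding pt I_def N_def by (subst nn_integral_add; simp)+ (simp add: emeasure_space_1)
 finally have eq: "P + ennreal c = I + ennreal d + N" .
 have "N <= (\<integral>\<^sup>+om. ennreal c \<partial>M)" unfolding N_def by (intro nn_integral_mono ennreal_leI) (use le in \<open>auto simp: c_def le_max_iff_disj\<close>)
 also have "... = ennreal c" by (simp add: emeasure_space_1)
 finally obtain nn where nn: "N = ennreal nn" "0 <= nn" by (cases N) (auto simp: top_unique)
 have "enn2ereal P - enn2ereal N = enn2ereal I + ereal (ph 0)"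
 proof (cases I)
  case (real i)
  with eq nn cd have e: "P + ennreal c = ennreal (i + d + nn)" by simp
  then obtain q where q: "P = ennreal q" "0 <= q" by (cases P) auto
  hence "q + c = i + d + nn" using e real cd nn by (simp add: ennreal_plus[symmetric] del: ennreal_plus)
  thus ?thesis using q real nn cd by (simp add: enn2ereal_ennreal)
 next
  case top
  hence "P = top" using eq by (cases P) auto
  thus ?thesis using top nn by (simp add: enn2ereal_ennreal)
 qed
 thus ?thesis
  unfolding ext_expectation_def cong[of "%v. ennreal (ph v)"] cong[of "%v. ennreal (- ph v)"] cong[of "%v. ennreal (max 0 (ph v - ph 0))"]
  by (simp only: P_def N_def I_def)
qed

end

text \<open>In the first system the occupation of \<open>Hs m\<close>, capped at \<open>m\<close>,
  recovers the full one by Fatou's lemma. In the second system the occupation of a part of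
  \<open>H\<close> is at most that of \<open>H\<close>.\<close>

theorem exhausted_comparison:
 assumes A: "exhausted_dlas M G \<xi>0 S h \<xi> Q dt n T' Rs H T" and B: "exhausted_dlas M' G \<xi>0' S' h' \<xi>' Q dt n T' Rs H T"
  and lb: "ALL H. level_bounds K H Q (%k. Suc (n k)) (%k. occ_weight H T (dt k)) (%k. occ_weight H T2 (dt k))"
  and T2: "0 < T2" "!!k. T2 <= real (Suc (n k)) * dt k"
  and icx: "ALL x:verts G. icx_le M (%om. real_of_int (\<xi>0 x om)) M' (%om. real_of_int (\<xi>0' x om))"
 shows "icx_le M (%om. enn2real (occupation_time H (\<xi> om) T)) M' (%om. enn2real (occupation_time H (\<xi>' om) T))"
 unfolding icx_le_def
proof (intro allI impI)
 interpret A: exhausted_dlas M G \<xi>0 S h \<xi> Q dt n T' Rs H T by (rule A)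
 interpret B: exhausted_dlas M' G \<xi>0' S' h' \<xi>' Q dt n T' Rs H T by (rule B)
 fix ph :: "real => real" assume ph: "mono ph" "convex_on UNIV ph"
 define ps where "ps v = max 0 (ph v - ph 0)" for v
 have psm: "mono ps"
 proof (rule monoI)
  fix x y :: real assume "x <= y"
  hence "ph x - ph 0 <= ph y - ph 0" using monoD[OF ph(1)] by simp
  thus "ps x <= ps y" unfolding ps_def by (rule max.mono[OF order_refl])
 qed
 have ps0: "0 <= ps v" for v by (simp add: ps_def)
 have psc: "convex_on UNIV ps"
 proof (rule convex_onI)
  fix t x y :: real assume t: "0 < t" "t < 1"
  have "ph ((1 - t) *\<^sub>R x + t *\<^sub>R y) - ph 0 <= (1 - t) * (ph x - ph 0) + t * (ph y - ph 0)"
   using convex_onD[OF ph(2), of t x y] t by (simp add: algebra_simps)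
  also have "... <= (1 - t) * ps x + t * ps y" using t by (intro add_mono mult_left_mono) (auto simp: ps_def)
  finally have up: "ph ((1 - t) *\<^sub>R x + t *\<^sub>R y) - ph 0 <= (1 - t) * ps x + t * ps y" .
  have "0 <= (1 - t) * ps x + t * ps y" using t ps0 by simp
  thus "ps ((1 - t) *\<^sub>R x + t *\<^sub>R y) <= (1 - t) * ps x + t * ps y"
   unfolding ps_def[of "(1 - t) *\<^sub>R x + t *\<^sub>R y"] using up by (rule max.boundedI)
 qed simp
 have cont: "continuous_on UNIV ps" by (rule convex_on_continuous[OF open_UNIV psc])
 hence psb: "ps : borel_measurable borel" by (rule borel_measurable_continuous_onI)
 obtain f where f: "!!m. f m : borel_measurable M" "!!m. AE om in M. f m om = A.final (A.Hs m) T om"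
  using A.final_Hs_measurable by metis
 have all: "AE om in M. ALL m. f m om = A.final (A.Hs m) T om" using f(2) by (simp only: AE_all_countable) blast
 have "(\<integral>\<^sup>+om. ennreal (ps (A.final H T om)) \<partial>M) = (\<integral>\<^sup>+om. liminf (%m. ennreal (ps (min (f m om) (real m)))) \<partial>M)"
 proof (rule nn_integral_cong_AE)
  show "AE om in M. ennreal (ps (A.final H T om)) = liminf (%m. ennreal (ps (min (f m om) (real m))))"
   using all A.final_Hs
  proof eventually_elim
   case (elim om)
   let ?v = "A.final H T om"
   have lim: "(%m. f m om) ~~> ?v" using elim by simp
   have "\<forall>\<^sub>F m in sequentially. min (f m om) (real m) = f m om"
    using eventually_ge_at_top[of "nat \<lceil>?v\<rceil>"]
   proof eventually_elim
    case (elim m)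
    hence "?v <= real m" by linarith
    moreover have "f m om <= ?v" using \<open>ALL m. f m om = A.final (A.Hs m) T om\<close> \<open>(ALL m. A.final (A.Hs m) T om <= ?v) & _\<close> by simp
    ultimately show ?case by simp
   qed
   hence "(%m. min (f m om) (real m)) ~~> ?v"
    using lim by (subst tendsto_cong)
   hence "(%m. ps (min (f m om) (real m))) ~~> ps ?v"
    by (rule continuous_on_tendsto_compose[OF cont]) simp_all
   hence "(%m. ennreal (ps (min (f m om) (real m)))) ~~> ennreal (ps ?v)" by (rule tendsto_ennrealI)
   thus ?case by (intro lim_imp_Liminf[symmetric]) auto
  qed
 qed
 also have "... <= liminf (%m. \<integral>\<^sup>+om. ennreal (ps (min (f m om) (real m))) \<partial>M)"
 proof (rule nn_integral_liminf)
  show "(%om. ennreal (ps (min (f m om) (real m)))) : borel_measurable M" for m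
   by (intro measurable_compose[OF _ measurable_ennreal] measurable_compose[OF _ psb] borel_measurable_min f(1) borel_measurable_const)
 qed
 also have "... <= (\<integral>\<^sup>+om. ennreal (ps (B.final H T om)) \<partial>M')"
 proof -
  have "(\<integral>\<^sup>+om. ennreal (ps (min (f m om) (real m))) \<partial>M) <= (\<integral>\<^sup>+om. ennreal (ps (B.final H T om)) \<partial>M')" for m
  proof -
   have "(\<integral>\<^sup>+om. ennreal (ps (min (f m om) (real m))) \<partial>M) = (\<integral>\<^sup>+om. ennreal (ps (min (A.final (A.Hs m) T om) (real m))) \<partial>M)"
    by (rule nn_integral_cong_AE) (use f(2)[of m] in eventually_elim, simp)
   also have "... <= (\<integral>\<^sup>+om. ennreal (ps (B.final (A.Hs m) T om)) \<partial>M')"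
    by (rule capped_comparison[OF A.sampled_dlas_axioms B.sampled_dlas_axioms lb[rule_format] A.Hs A.T T2 icx psm psc ps0])
   also have "... <= (\<integral>\<^sup>+om. ennreal (ps (B.final H T om)) \<partial>M')"
    by (rule nn_integral_mono_AE) (use B.final_Hs in eventually_elim, intro ennreal_leI monoD[OF psm], blast)
   finally show ?thesis .
  qed
  hence "liminf (%m. \<integral>\<^sup>+om. ennreal (ps (min (f m om) (real m))) \<partial>M) <= liminf (%m::nat. \<integral>\<^sup>+om. ennreal (ps (B.final H T om)) \<partial>M')"
   by (intro Liminf_mono always_eventually allI)
  thus ?thesis by (simp add: Liminf_const)
 qed
 finally have "enn2ereal (\<integral>\<^sup>+om. ennreal (ps (A.final H T om)) \<partial>M) <= enn2ereal (\<integral>\<^sup>+om. ennreal (ps (B.final H T om)) \<partial>M')"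
  by (simp only: less_eq_ennreal.rep_eq)
 thus "ext_expectation M (%om. ph (A.final H T om)) <= ext_expectation M' (%om. ph (B.final H T om))"
  unfolding A.ext_expectation_final[OF ph] B.ext_expectation_final[OF ph] ps_def by (rule add_right_mono)
qed

subsection \<open>Sampling two systems with the same path law\<close>

context regular_dlas
begin

lemma path_element_measurable: "p : labels (verts G) ==> path_element (S p) : measurable M (path_space (verts G))"
 using indep_paths unfolding indep_vars_def2 by blast

lemma paths_element_measurable: "paths_element (verts G) S : measurable M (paths_space (verts G))"
proof -
 have "(%om. \<lambda>p\<in>labels (verts G). path_element (S p) om) : measurable M (PiM (labels (verts G)) (%_. path_space (verts G)))"
  by (rule measurable_restrict) (rule path_element_measurable)
 thus ?thesis by (simp only: paths_element_def[abs_def] paths_space_def)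
qed

lemma sampled_cadlag:
 assumes dt: "!!k. 0 < dt k" "dt ~~> 0" and P: "finite P" "P <= labels (verts G)"
 shows "AE om in M. well_sampled_limit dt T' (%p. S p om) P"
 using valid_instructions
proof eventually_elim
 case (elim om)
 hence "ALL p:P. cadlag_path (verts G) (S p om)" using P(2) unfolding instructions_def by blast
 thus ?case by (rule well_sampled_limit_cadlag[OF P(1) _ dt])
qed

text \<open>The hypothesis concerns each fixed time separately. It holds at all rational times
  simultaneously, and right-continuity of the paths extends it to all times.\<close>

lemma sampled_unit:
 assumes const: "!!p t. p : labels (verts G) ==> 0 <= t ==> AE om in M. S p om t = S p om (real (nat \<lfloor>t\<rfloor>))"
  and P: "finite P" "P <= labels (verts G)"
 shows "AE om in M. well_sampled_limit (%_. 1) T' (%p. S p om) P"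
proof -
 have "AE om in M. \<forall>q::rat. 0 <= q --> S p om (of_rat q) = S p om (real (nat \<lfloor>of_rat q :: real\<rfloor>))" if "p : P" for p
 proof (unfold AE_all_countable, rule allI)
  fix q :: rat
  show "AE om in M. 0 <= q --> S p om (of_rat q) = S p om (real (nat \<lfloor>of_rat q :: real\<rfloor>))"
  proof (cases "0 <= q")
   case True
   hence "0 <= (of_rat q :: real)" by simp
   from const[OF subsetD[OF P(2) that] this] show ?thesis by eventually_elim blast
  qed simp
 qed
 hence "AE om in M. ALL p:P. \<forall>q::rat. 0 <= q --> S p om (of_rat q) = S p om (real (nat \<lfloor>of_rat q :: real\<rfloor>))"
  by (intro AE_finite_allI P(1))
 with valid_instructions show ?thesis
 proof eventually_elim
  case (elim om)
  show ?case
  proof (rule well_sampled_limit_unit)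
   fix p i t assume p: "p : P" and t: "real i <= t" "t < real (Suc i)"
   have "cadlag_path (verts G) (S p om)" using elim(1) P(2) p unfolding instructions_def by blast
   hence "\<forall>\<^sub>F r in at_right t. S p om r = S p om t" using t unfolding cadlag_path_def by auto
   then obtain b where b: "t < b" "\<forall>y>t. y < b --> S p om y = S p om t" unfolding eventually_at_right_field by blast
   obtain q where q: "t < of_rat q" "of_rat q < min b (real (Suc i))" using of_rat_dense[of t "min b (real (Suc i))"] b(1) t(2) by auto
   have q0: "0 <= q" using q(1) t(1) by (metis of_nat_0_le_iff order_trans less_imp_le zero_le_of_rat_iff)
   have "\<lfloor>of_rat q :: real\<rfloor> = int i" using q t by (intro floor_unique) auto
   hence "S p om (of_rat q) = S p om (real i)" using elim(2)[rule_format, OF p q0] by simp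
   moreover have "S p om (of_rat q) = S p om t" using b(2) q by simp
   ultimately show "S p om t = S p om (real i)" by simp
  qed
 qed
qed

end

lemma paths_event_transfer:
 assumes A: "regular_dlas M G \<xi>0 S h \<xi>" and B: "regular_dlas M' G \<xi>0' S' h' \<xi>'"
  and eq: "distr M (paths_space (verts G)) (paths_element (verts G) S) = distr M' (paths_space (verts G)) (paths_element (verts G) S')"
  and X: "X : sets (paths_space (verts G))"
 shows "emeasure M {om : space M. paths_element (verts G) S om : X} = emeasure M' {om : space M'. paths_element (verts G) S' om : X}"
proof -
 have "emeasure (distr M (paths_space (verts G)) (paths_element (verts G) S)) X = emeasure (distr M' (paths_space (verts G)) (paths_element (verts G) S')) X"
  by (simp only: eq)
 thus ?thesis
  by (simp add: emeasure_distr[OF regular_dlas.paths_element_measurable[OF A] X] emeasure_distr[OF regular_dlas.paths_element_measurable[OF B] X]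
    vimage_def Int_def conj_commute)
qed

lemma coordinate_measurable:
 assumes "p : labels V" "0 <= t"
 shows "(%s. s p t) : measurable (paths_space V) (count_space V)"
proof -
 have "(%s. s p) : measurable (paths_space V) (path_space V)"
  unfolding paths_space_def by (rule measurable_component_singleton[OF assms(1)])
 moreover have "(%s. s t) : measurable (path_space V) (count_space V)"
  unfolding path_space_def by (rule measurable_component_singleton) (use assms in simp)
 ultimately show ?thesis by (rule measurable_compose)
qed

lemma paths_element_apply: "p : labels V ==> 0 <= t ==> paths_element V S om p t = S p om t"
 by (simp add: paths_element_def path_element_def)

lemma (in regular_dlas) constancy_event:
 assumes p: "p : labels (verts G)" and t: "0 <= t" "0 <= u"
 defines "X \<equiv> {s : space (paths_space (verts G)). s p t ~= s p u}"
 shows "X : sets (paths_space (verts G))"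
  and "(AE om in M. S p om t = S p om u) \<longleftrightarrow> emeasure M {om : space M. paths_element (verts G) S om : X} = 0"
proof -
 let ?V = "verts G" and ?P = "paths_space (verts G)"
 have m: "(%s. s p t) : measurable ?P (count_space ?V)" "(%s. s p u) : measurable ?P (count_space ?V)"
  by (rule coordinate_measurable[OF p t(1)], rule coordinate_measurable[OF p t(2)])
 have "(UN v:?V. ((%s. s p t) -` {v} Int space ?P) Int ((%s. s p u) -` {v} Int space ?P)) : sets ?P"
  by (intro sets.countable_UN'' countable_verts sets.Int measurable_sets[OF m(1)] measurable_sets[OF m(2)]) simp_all
 hence "space ?P - (UN v:?V. ((%s. s p t) -` {v} Int space ?P) Int ((%s. s p u) -` {v} Int space ?P)) : sets ?P" by (rule sets.compl_sets)
 also have "space ?P - (UN v:?V. ((%s. s p t) -` {v} Int space ?P) Int ((%s. s p u) -` {v} Int space ?P)) = X"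
  using measurable_space[OF m(1)] measurable_space[OF m(2)] unfolding X_def by auto
 finally show X: "X : sets ?P" .
 have sp: "paths_element ?V S om : space ?P" if "om : space M" for om by (rule measurable_space[OF paths_element_measurable that])
 have ev: "{om : space M. \<not> S p om t = S p om u} = {om : space M. paths_element ?V S om : X}"
  using sp by (auto simp: X_def paths_element_apply[OF p t(1)] paths_element_apply[OF p t(2)])
 have "paths_element ?V S -` X Int space M : sets M" by (rule measurable_sets[OF paths_element_measurable X])
 hence "{om : space M. paths_element ?V S om : X} : sets M" by (simp add: vimage_def Int_def conj_commute)
 from AE_iff_measurable[OF this ev]
 show "(AE om in M. S p om t = S p om u) \<longleftrightarrow> emeasure M {om : space M. paths_element ?V S om : X} = 0" .
qed

lemma (in regular_dlas) samples_event:
 fixes m :: nat and pa :: "'v particle => 'v list"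
 assumes dt: "0 < dt" and A: "finite A" "A <= labels (verts G)"
 defines "X \<equiv> {s : space (paths_space (verts G)). ALL p:A. samples dt m (s p) = pa p}"
 shows "X : sets (paths_space (verts G))"
  and "{om : space M. paths_element (verts G) S om : X} = {om : space M. ALL p:A. samples dt m (S p om) = pa p}"
proof -
 let ?P = "paths_space (verts G)"
 have one: "{s : space ?P. samples dt m (s p) = pa p} : sets ?P" if p: "p : A" for p
 proof -
  have m: "(%s. s p) : measurable ?P (path_space (verts G))"
   unfolding paths_space_def by (rule measurable_component_singleton) (use A p in blast)
  have "(%s. s p) -` {s : space (path_space (verts G)). samples dt m s = pa p} Int space ?P : sets ?P"
   by (rule measurable_sets[OF m samples_in_path_space]) (use dt in simp)
  also have "(%s. s p) -` {s : space (path_space (verts G)). samples dt m s = pa p} Int space ?P = {s : space ?P. samples dt m (s p) = pa p}"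
   using measurable_space[OF m] by auto
  finally show ?thesis .
 qed
 show "X : sets ?P" unfolding X_def by (intro sets.sets_Collect_finite_All A one)
 have sp: "paths_element (verts G) S om : space ?P" if "om : space M" for om by (rule measurable_space[OF paths_element_measurable that])
 have el: "samples dt m (paths_element (verts G) S om p) = samples dt m (S p om)" if "p : A" for p om
 proof -
  have "paths_element (verts G) S om p = path_element (S p) om" using A that by (auto simp: paths_element_def)
  thus ?thesis using dt by (simp add: samples_path_element)
 qed
 show "{om : space M. paths_element (verts G) S om : X} = {om : space M. ALL p:A. samples dt m (S p om) = pa p}"
  unfolding X_def by (intro Collect_cong conj_cong refl) (simp add: sp el cong: ball_cong)
qed

text \<open>The two instances of \<open>A_walks\<close> may provide different kernels, or even
  different clauses. Kernel and time scale are taken from the first system; the sampling law and the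
  constancy between integers are events of the path space, so equality of the path laws carries them
  to the second.\<close>

theorem common_sampling:
 assumes A: "regular_dlas M G \<xi>0 S h \<xi>" and B: "regular_dlas M' G \<xi>0' S' h' \<xi>'"
  and eq: "distr M (paths_space (verts G)) (paths_element (verts G) S) = distr M' (paths_space (verts G)) (paths_element (verts G) S')"
 shows "EX Q dt n T' K T2. sampled_dlas M G \<xi>0 S h \<xi> Q dt n T' & sampled_dlas M' G \<xi>0' S' h' \<xi>' Q dt n T' &
  (ALL H. level_bounds K H Q (%k. Suc (n k)) (%k. occ_weight H T (dt k)) (%k. occ_weight H T2 (dt k))) &
  (ALL k. T <= real (Suc (n k)) * dt k) & 0 < T2 & (ALL k. T2 <= real (Suc (n k)) * dt k)"
proof -
 interpret A: regular_dlas M G \<xi>0 S h \<xi> by (rule A)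
 interpret B: regular_dlas M' G \<xi>0' S' h' \<xi>' by (rule B)
 let ?V = "verts G"
 obtain K where K: "ALL x:?V. set_pmf (K x) <= ?V"
  and walks: "(ALL x:?V. \<forall>j>0. continuous_time_walk M ?V K x (S (x, j))) \<or> (ALL x:?V. \<forall>j>0. discrete_time_walk M ?V K x (S (x, j)))"
  using A.A_walks by blast
 have law': "emeasure M' {om : space M'. ALL p:D. samples dt m (S' p om) = pa p} = emeasure M {om : space M. ALL p:D. samples dt m (S p om) = pa p}"
  if D: "0 < dt" "finite D" "D <= {p : labels ?V. type_A p}" for dt m D pa
 proof -
  have sub: "D <= labels ?V" using D by blast
  show ?thesis
   using paths_event_transfer[OF A B eq A.samples_event(1)[OF D(1,2) sub, where m = m and pa = pa]]
   unfolding A.samples_event(2)[OF D(1,2) sub] B.samples_event(2)[OF D(1,2) sub] by (rule sym)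
 qed
 from walks show ?thesis
 proof
  assume cont: "ALL x:?V. \<forall>j>0. continuous_time_walk M ?V K x (S (x, j))"
  define m where "m = nat \<lceil>T\<rceil>"
  have m: "T <= real m" unfolding m_def by linarith
  define dt where "dt k = (1 / 2 :: real) ^ k" for k :: nat
  \<comment> \<open>The grid has \<open>Suc (n k)\<close> cells, which is \<open>2 * m + 2\<close>
    units of time divided into cells of length \<open>dt k\<close>.\<close>
  define n where "n k = (2 * m + 2) * 2 ^ k - 1" for k :: nat
  have dt: "0 < dt k" for k by (simp add: dt_def)
  have dt0: "dt ~~> 0" unfolding dt_def by (rule LIMSEQ_realpow_zero) simp_all
  have Sn: "Suc (n k) = (2 * m + 2) * 2 ^ k" for k by (simp add: n_def)
  have N: "real (Suc (n k)) * dt k = real (2 * m + 2)" for k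
   unfolding Sn dt_def by (simp add: power_one_over field_simps)
  define Q where "Q k = poisson_kernel K (dt k)" for k
  have Q: "set_pmf (Q k x) <= ?V" if "x : ?V" for k x unfolding Q_def by (rule set_pmf_poisson_kernel[OF K that])
  have law: "emeasure M {om : space M. ALL p:D. samples (dt k) i (S p om) = pa p} = (PROD p:D. ennreal (pmf (chain (Q k) i (fst p)) (pa p)))"
   if D: "finite D" "D <= {p : labels ?V. type_A p}" for k i D pa
  proof (rule A.joint_samples_law[OF A.indep_paths D(1)])
   fix p l assume p: "p : D" and meas: "{om : space M. samples (dt k) i (S p om) = l} : sets M"
   have x: "fst p : ?V" "0 < snd p" using D p by (auto simp: labels_def)
   have w: "continuous_time_walk M ?V K (fst p) (S p)" using cont[rule_format, OF x] by simp
   show "emeasure M {om : space M. samples (dt k) i (S p om) = l} = ennreal (pmf (chain (Q k) i (fst p)) l)"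
    unfolding Q_def by (rule A.continuous_walk_law[OF w A.countable_verts K x(1) dt meas])
  qed (use D dt[of k] in auto)
  have "sampled_dlas M G \<xi>0 S h \<xi> Q dt n (real (2 * m + 2))"
   by (intro sampled_dlas.intro A sampled_dlas_axioms.intro dt Q law A.sampled_cadlag[OF dt dt0]) (simp_all only: N order_refl)
  moreover have "sampled_dlas M' G \<xi>0' S' h' \<xi>' Q dt n (real (2 * m + 2))"
   by (intro sampled_dlas.intro B sampled_dlas_axioms.intro dt Q trans[OF law'[OF dt] law] B.sampled_cadlag[OF dt dt0]) (simp_all only: N order_refl)
  moreover have "level_bounds K H Q (%k. Suc (n k)) (%k. occ_weight H T (dt k)) (%k. occ_weight H (real (2 * m + 2)) (dt k))" for H
   unfolding Sn Q_def dt_def by (rule level_bounds_continuous[OF m])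
  moreover have "T <= real (2 * m + 2)" using m by simp
  ultimately show ?thesis
   by (intro exI[of _ Q] exI[of _ dt] exI[of _ n] exI[of _ "real (2 * m + 2)"] exI[of _ K]) (simp only: N order_refl, simp)
 next
  assume disc: "ALL x:?V. \<forall>j>0. discrete_time_walk M ?V K x (S (x, j))"
  define n where "n = nat \<lceil>T\<rceil>"
  have m: "T <= real (Suc n)" unfolding n_def by linarith
  have law: "emeasure M {om : space M. ALL p:D. samples 1 i (S p om) = pa p} = (PROD p:D. ennreal (pmf (chain K i (fst p)) (pa p)))"
   if D: "finite D" "D <= {p : labels ?V. type_A p}" for i D pa
  proof (rule A.joint_samples_law[OF A.indep_paths D(1)])
   fix p l assume p: "p : D" and meas: "{om : space M. samples 1 i (S p om) = l} : sets M"
   have x: "fst p : ?V" "0 < snd p" using D p by (auto simp: labels_def)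
   have w: "discrete_time_walk M ?V K (fst p) (S p)" using disc[rule_format, OF x] by simp
   show "emeasure M {om : space M. samples 1 i (S p om) = l} = ennreal (pmf (chain K i (fst p)) l)"
    by (rule A.discrete_walk_law[OF w A.countable_verts K x(1) meas])
  qed (use D in auto)
  have constA: "AE om in M. S p om t = S p om (real (nat \<lfloor>t\<rfloor>))" if p: "p : labels ?V" and t: "0 <= t" for p t
  proof (cases "0 < snd p")
   case True
   have "discrete_time_walk M ?V K (fst p) (S p)" using disc p True by (cases p) (simp add: labels_def)
   then obtain Y where "AE om in M. ALL n t. real n <= t & t < real (Suc n) --> S p om t = Y n om"
    unfolding discrete_time_walk_def by blast
   thus ?thesis
   proof eventually_elim
    case (elim om)
    have b: "real (nat \<lfloor>t\<rfloor>) <= t & t < real (Suc (nat \<lfloor>t\<rfloor>))" using t by linarith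
    have c: "real (nat \<lfloor>t\<rfloor>) <= real (nat \<lfloor>t\<rfloor>) & real (nat \<lfloor>t\<rfloor>) < real (Suc (nat \<lfloor>t\<rfloor>))" by simp
    show ?case using elim[rule_format, OF b] elim[rule_format, OF c] by simp
   qed
  next
   case False
   hence "AE om in M. ALL t>=0. S p om t = fst p" using A.B_stationary p by (cases p) (auto simp: labels_def)
   thus ?thesis by eventually_elim (use t in simp)
  qed
  have constB: "AE om in M'. S' p om t = S' p om (real (nat \<lfloor>t\<rfloor>))" if p: "p : labels ?V" and t: "0 <= t" for p t
   using constA[OF p t] paths_event_transfer[OF A B eq A.constancy_event(1)[OF p t of_nat_0_le_iff]]
   unfolding A.constancy_event(2)[OF p t of_nat_0_le_iff] B.constancy_event(2)[OF p t of_nat_0_le_iff] by metis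
  have "sampled_dlas M G \<xi>0 S h \<xi> (%_. K) (%_. 1) (%_. n) (real (Suc n))"
   by (intro sampled_dlas.intro A sampled_dlas_axioms.intro law A.sampled_unit constA K[rule_format]) simp_all
  moreover have "sampled_dlas M' G \<xi>0' S' h' \<xi>' (%_. K) (%_. 1) (%_. n) (real (Suc n))"
   by (intro sampled_dlas.intro B sampled_dlas_axioms.intro trans[OF law'[OF zero_less_one] law] B.sampled_unit constB K[rule_format]) simp_all
  moreover have "level_bounds K H (%_. K) (%k. Suc n) (%k. occ_weight H T 1) (%k. occ_weight H (real (Suc n)) 1)" for H
   by (rule level_bounds_discrete[OF m])
  ultimately show ?thesis using m
   by (intro exI[of _ "%_. K"] exI[of _ "%_. 1"] exI[of _ "%_. n"] exI[of _ "real (Suc n)"] exI[of _ K]) (simp del: of_nat_Suc)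
 qed
qed

theorem theorem1p3:
  fixes G :: "('v, 'e) pre_digraph" and H :: "'v set"
    and M :: "'w measure" and M' :: "'u measure"
    and \<xi>0 :: "'v \<Rightarrow> 'w \<Rightarrow> int" and \<xi>0' :: "'v \<Rightarrow> 'u \<Rightarrow> int"
    and S :: "'v particle \<Rightarrow> 'w \<Rightarrow> real \<Rightarrow> 'v" and S' :: "'v particle \<Rightarrow> 'u \<Rightarrow> real \<Rightarrow> 'v"
    and h :: "'v particle \<Rightarrow> 'w \<Rightarrow> real" and h' :: "'v particle \<Rightarrow> 'u \<Rightarrow> real"
    and \<xi> :: "'w \<Rightarrow> real \<Rightarrow> 'v \<Rightarrow> int" and \<xi>' :: "'u \<Rightarrow> real \<Rightarrow> 'v \<Rightarrow> int"
  assumes "locally_finite_graph G" and "H \<subseteq> verts G"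
    and "regular_dlas M G \<xi>0 S h \<xi>" and "regular_dlas M' G \<xi>0' S' h' \<xi>'"
    and "distr M (paths_space (verts G)) (paths_element (verts G) S)
       = distr M' (paths_space (verts G)) (paths_element (verts G) S')"
    and "distr M (bravery_space (verts G)) (bravery_element (verts G) h)
       = distr M' (bravery_space (verts G)) (bravery_element (verts G) h')"
    and "AE \<omega> in M. finite H \<or> total_A (verts G) (\<lambda>x. \<xi>0 x \<omega>) < \<infinity>"
    and "AE \<omega> in M'. finite H \<or> total_A (verts G) (\<lambda>x. \<xi>0' x \<omega>) < \<infinity>"
    and "\<forall>x\<in>verts G. icx_le M (\<lambda>\<omega>. real_of_int (\<xi>0 x \<omega>)) M' (\<lambda>\<omega>. real_of_int (\<xi>0' x \<omega>))"
  shows "\<forall>T\<ge>0. icx_le M (\<lambda>\<omega>. enn2real (occupation_time H (\<xi> \<omega>) T))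
                      M' (\<lambda>\<omega>. enn2real (occupation_time H (\<xi>' \<omega>) T))"
proof (intro allI impI)
  fix T :: real assume T: "0 \<le> T"
  have cnt: "countable (verts G)" using assms(1) by (rule locally_finite_graph.countable_verts)
  obtain Rs :: "nat \<Rightarrow> 'v set" where Rs0: "(\<forall>m. finite (Rs m)) \<and> (\<forall>m. Rs m \<subseteq> verts G) \<and> (\<forall>m. Rs m \<subseteq> Rs (Suc m)) \<and>
      (\<Union>m. Rs m) = verts G \<and> (\<forall>A. finite A \<longrightarrow> A \<subseteq> verts G \<longrightarrow> (\<exists>m. A \<subseteq> Rs m))"
    using countable_finite_exhaustion[OF cnt] by (elim exE) (rule that)
  then have Rs: "finite (Rs m)" "Rs m \<subseteq> verts G" "Rs m \<subseteq> Rs (Suc m)" "(\<Union>m. Rs m) = verts G" for m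
    by simp_all
  have Rs_cover: "\<exists>m. A \<subseteq> Rs m" if "finite A" "A \<subseteq> verts G" for A using Rs0 that by simp
  obtain Q \<delta> n T' K T2 where A: "sampled_dlas M G \<xi>0 S h \<xi> Q \<delta> n T'" and B: "sampled_dlas M' G \<xi>0' S' h' \<xi>' Q \<delta> n T'"
    and lb: "\<forall>H. level_bounds K H Q (\<lambda>k. Suc (n k)) (\<lambda>k. occ_weight H T (\<delta> k)) (\<lambda>k. occ_weight H T2 (\<delta> k))"
    and Tn: "\<forall>k. T \<le> real (Suc (n k)) * \<delta> k" and T2: "0 < T2" "\<forall>k. T2 \<le> real (Suc (n k)) * \<delta> k"
    using common_sampling[OF assms(3,4,5), of T] by (elim exE conjE) (rule that)
  have "exhausted_dlas M G \<xi>0 S h \<xi> Q \<delta> n T' Rs H T"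
    by (intro exhausted_dlas.intro A exhausted_dlas_axioms.intro Rs Rs_cover assms(2) T Tn[rule_format] assms(7))
  moreover have "exhausted_dlas M' G \<xi>0' S' h' \<xi>' Q \<delta> n T' Rs H T"
    by (intro exhausted_dlas.intro B exhausted_dlas_axioms.intro Rs Rs_cover assms(2) T Tn[rule_format] assms(8))
  ultimately show "icx_le M (\<lambda>\<omega>. enn2real (occupation_time H (\<xi> \<omega>) T)) M' (\<lambda>\<omega>. enn2real (occupation_time H (\<xi>' \<omega>) T))"
    by (rule exhausted_comparison[OF _ _ lb T2(1) T2(2)[rule_format] assms(9)])
qed

end
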